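(* Let $\ell\ge0$ be an integer, $M=mI$ with $m\ge2$, and let $\{\mathbf a^{(k)},\ k\ge1\}$ be a sequence of masks supported in $\{0,\dots,N\}^s$ with $a_*^{(k)}(1)=m^s$ for all $k$. Let $\{\delta_k,\ k\ge1\}$ be the sum rule defects (for the given $\ell$). Assume that the symbols of $\{S_{\mathbf a^{(k)}},\ k\ge1\}$ satisfy approximate sum rules of order $\ell+1$ and that $$\rho_{\mathcal A}:=\rho\bigl(\mathcal T_{\mathcal A}|_{V_\ell}\bigr)<m^{-\ell},$$ where $\mathcal A$ is the set of limit points of $\{\mathbf a^{(k)},\ k\ge1\}$. Then the non-stationary scheme $\{S_{\mathbf a^{(k)}},\ k\ge1\}$ is $C^\ell$-convergent and the Hölder exponent $\alpha$ of its limit functions satisfies $$\alpha\ \ge\ \min\Bigl\{-\log_m\rho_{\mathcal A},\ -\limsup_{k\to\infty}\frac{\log_m\delta_k}{k}\Bigr\}.$$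
   Context: Masks, operators. A mask is a real sequence $\mathbf a=\{\mathrm a(\alpha)\}_{\alpha\in\mathbb Z^s}$ supported in $\{0,\dots,N\}^s$ ($N$ fixed). Its symbol is $a_*(z)=\sum_\alpha \mathrm a(\alpha)z^\alpha$, $z\in(\mathbb C\setminus\{0\})^s$. The subdivision operator is $(S_{\mathbf a}\boldsymbol c)(\alpha)=\sum_{\beta\in\mathbb Z^s}\mathrm a(\alpha-M\beta)c(\beta)$. $E=\{0,\dots,m-1\}^s$, $\Xi=\{e^{-i\frac{2\pi}{m}\varepsilon}:\varepsilon\in E\}$ (componentwise exponential), $1=(1,\dots,1)$, $D^\eta$ is the partial derivative of multi-index $\eta\in\mathbb N_0^s$. Convention $\log_m 0=-\infty$. Sum rules. $a_*$ satisfies sum rules of order $\ell+1$ if $a_*(1)=m^s$ and $D^\eta a_*(\epsilon)=0$ for all $|\eta|\le\ell$, $\epsilon\in\Xi\setminus\{1\}$. Put $\mu_k=|a_*^{(k)}(1)-m^s|$ and (sum rule defects) $\delta_k=\max_{|\eta|\le\ell}\max_{\epsilon\in\Xi\setminus\{1\}}|m^{-k|\eta|}D^\eta a_*^{(k)}(\epsilon)|$. The sequence $\{a_*^{(k)}\}$ satisfies approximate sum rules of order $\ell+1$ if $\sum_k\mu_k<\infty$ and $\sum_k m^{k\ell}\delta_k<\infty$. Limit points, transition matrices. $\mathcal A$ is the set of masks $\mathbf a$ that are limits of some subsequence $\{\mathbf a^{(k_n)}\}$. Let $K=\mathbb Z^s\cap\{\sum_{r\ge1}m^{-r}g_r:\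 g_r\in\{-m,\dots,N+1\}^s\}$ and, for $\varepsilon\in E$, $T_{\varepsilon,\mathbf a}=[\mathrm a(\varepsilon+M\alpha-\beta)]_{\alpha,\beta\in K}$. $V_\ell\subset\mathbb R^{|K|}$ is the space of vectors orthogonal to $[p(\alpha)]_{\alpha\in K}$ for all polynomials $p$ of total degree $\le\ell$; it is invariant under all $T_{\varepsilon,\mathbf a}$ whenever $a_*$ satisfies sum rules of order $\ell+1$, which under approximate sum rules of order $\ell+1$ holds for all $\mathbf a\in\mathcal A$. $\mathcal T_{\mathcal A}|_{V_\ell}=\{T_{\varepsilon,\mathbf a}|_{V_\ell}:\varepsilon\in E,\mathbf a\in\mathcal A\}$. The joint spectral radius of a compact set $\mathcal M$ of square matrices is $\rho(\mathcal M)=\lim_{n\to\infty}\max_{M_1,\dots,M_n\in\mathcal M}\|M_1\cdots M_n\|^{1/n}$. $C^\ell$-convergence. A test function is a compactly supported, sufficiently smooth, stable function $f$ satisfying Strang–Fix conditions of order $\ell+1$: $\hat f(0)=1$, $D^\mu\hat f(\alpha)=0$ for $\alpha\in\mathbb Z^s\setminus\{0\}$, $|\mu|<\ell+1$, where $\hat f(\omega)=\int f(x)e^{-2\pi i x\cdot\omega}dx$. Stable: there are $0<C_1\le C_2<\infty$ with $C_1\|\boldsymbol c\|_{\ell_\infty}\le\|\sum_\alpha c(\alpha)f(\cdot-\alpha)\|_\infty\le C_2\|\boldsymbol c\|_{\ell_\infty}$ for all $\boldsymbol c\in\ell_\infty(\mathbb Z^s)$. The scheme is $C^\ell$-convergent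 if for every $\boldsymbol c\in\ell_\infty(\mathbb Z^s)$ there is $g_{\boldsymbol c}\in C^\ell(\mathbb R^s)$ such that for any test function $f\in C^\ell(\mathbb R^s)$, $\lim_{k\to\infty}\|g_{\boldsymbol c}-\sum_{\alpha}(S_{\mathbf a^{(k)}}\cdots S_{\mathbf a^{(1)}}\boldsymbol c)(\alpha)f(M^k\cdot-\alpha)\|_{C^\ell}=0$. Hölder exponent. The Hölder exponent of the limit functions of a $C^0$-convergent scheme is $\alpha=n+\zeta$, where $n$ is the largest integer with all $g_{\boldsymbol c}\in C^n(\mathbb R^s)$ and $\zeta$ is the supremum of $\nu\in[0,1]$ such that for every limit function $g_{\boldsymbol c}$ there is a constant $C$ with $\max_{|\mu|=n}|D^\mu g_{\boldsymbol c}(x)-D^\mu g_{\boldsymbol c}(y)|\le C|x-y|^\nu$ for all $x,y$.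
   Formalization: The masks are additionally assumed to be uniformly bounded in k; without this the claim fails, e.g. when the masks with odd k are unbounded and only those with even k have a limit point. *)

theory Defs
  imports "HOL-Analysis.Analysis"
begin

text \<open>The dimension is the cardinality of the finite index type \<open>'s\<close>; points, lattice
  points and multi-indices are \<open>real ^ 's\<close>, \<open>int ^ 's\<close> and \<open>nat ^ 's\<close>.\<close>

definition mabs :: "nat ^ 's \<Rightarrow> nat" where
  "mabs \<eta> = (\<Sum>i\<in>UNIV. \<eta> $ i)"

definition partial :: "'s \<Rightarrow> (real ^ 's \<Rightarrow> 'b::real_normed_vector) \<Rightarrow> real ^ 's \<Rightarrow> 'b" where
  "partial i f x = vector_derivative (\<lambda>t. f (x + axis i t)) (at 0)"

definition cpartial :: "'s \<Rightarrow> (complex ^ 's \<Rightarrow> complex) \<Rightarrow> complex ^ 's \<Rightarrow> complex" where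
  "cpartial i f z = deriv (\<lambda>t. f (z + axis i t)) 0"

text \<open>A multi-index does not fix the order of differentiation and \<open>'s\<close> carries no order, so the
  coordinates are taken in an arbitrary fixed order. The operators below are only
  applied to functions all of whose partial derivatives of the relevant order are
  continuous, where the order is immaterial.\<close>

definition coords :: "'s::finite list" where
  "coords = (SOME xs. distinct xs \<and> set xs = UNIV)"

definition mderiv :: "nat ^ 's::finite \<Rightarrow> (real ^ 's \<Rightarrow> 'b::real_normed_vector) \<Rightarrow> real ^ 's \<Rightarrow> 'b" where
  "mderiv \<eta> f = foldr (\<lambda>i. partial i ^^ (\<eta> $ i)) coords f"

definition cmderiv :: "nat ^ 's::finite \<Rightarrow> (complex ^ 's \<Rightarrow> complex) \<Rightarrow> complex ^ 's \<Rightarrow> complex" where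
  "cmderiv \<eta> f = foldr (\<lambda>i. cpartial i ^^ (\<eta> $ i)) coords f"

primrec Cdiff :: "nat \<Rightarrow> (real ^ 's::finite \<Rightarrow> real) \<Rightarrow> bool" where
  "Cdiff 0 f \<longleftrightarrow> continuous_on UNIV f"
| "Cdiff (Suc n) f \<longleftrightarrow> continuous_on UNIV f \<and>
     (\<forall>i. (\<forall>x. (\<lambda>t. f (x + axis i t)) differentiable at 0) \<and> Cdiff n (partial i f))"

text \<open>Norms are extended reals, so that unbounded functions have norm \<open>\<infinity>\<close>.\<close>

definition supnorm :: "('a \<Rightarrow> real) \<Rightarrow> ereal" where
  "supnorm f = (SUP x. ereal \<bar>f x\<bar>)"

definition Cnorm :: "nat \<Rightarrow> (real ^ 's::finite \<Rightarrow> real) \<Rightarrow> ereal" where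
  "Cnorm l f = (SUP \<mu>\<in>{\<mu>. mabs \<mu> \<le> l}. supnorm (mderiv \<mu> f))"

definition is_mask :: "nat \<Rightarrow> (int ^ 's \<Rightarrow> real) \<Rightarrow> bool" where
  "is_mask N a \<longleftrightarrow> (\<forall>\<alpha>. a \<alpha> \<noteq> 0 \<longrightarrow> (\<forall>i. \<alpha> $ i \<in> {0..int N}))"

definition symbol :: "(int ^ 's::finite \<Rightarrow> real) \<Rightarrow> complex ^ 's \<Rightarrow> complex" where
  "symbol a z = (\<Sum>\<^sub>\<infinity>\<alpha>. of_real (a \<alpha>) * (\<Prod>i\<in>UNIV. z $ i powi (\<alpha> $ i)))"

definition subdiv :: "nat \<Rightarrow> (int ^ 's::finite \<Rightarrow> real) \<Rightarrow> (int ^ 's \<Rightarrow> real) \<Rightarrow> int ^ 's \<Rightarrow> real" where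
  "subdiv m a c \<alpha> = (\<Sum>\<^sub>\<infinity>\<beta>. a (\<alpha> - int m *s \<beta>) * c \<beta>)"

definition digits :: "nat \<Rightarrow> (int ^ 's) set" where
  "digits m = {\<epsilon>. \<forall>i. \<epsilon> $ i \<in> {0..<int m}}"

definition Xi :: "nat \<Rightarrow> (complex ^ 's::finite) set" where
  "Xi m = (\<lambda>\<epsilon>. \<chi> i. exp (- \<i> * (2 * of_real pi / of_nat m) * of_int (\<epsilon> $ i))) ` digits m"

definition mu :: "nat \<Rightarrow> (nat \<Rightarrow> int ^ 's::finite \<Rightarrow> real) \<Rightarrow> nat \<Rightarrow> real" where
  "mu m a k = cmod (symbol (a k) 1 - of_nat m ^ CARD('s))"

definition delta :: "nat \<Rightarrow> nat \<Rightarrow> (nat \<Rightarrow> int ^ 's::finite \<Rightarrow> real) \<Rightarrow> nat \<Rightarrow> real" where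
  "delta l m a k =
     Max {cmod (cmderiv \<eta> (symbol (a k)) \<epsilon> / of_nat m ^ (k * mabs \<eta>)) | \<eta> \<epsilon>.
            mabs \<eta> \<le> l \<and> \<epsilon> \<in> Xi m - {1}}"

text \<open>Mask sequences are indexed by \<open>k \<ge> 1\<close>; the value at \<open>0\<close> is never used.
  The order of the sum rules is \<open>l + 1\<close>.\<close>

definition approx_sum_rules :: "nat \<Rightarrow> nat \<Rightarrow> (nat \<Rightarrow> int ^ 's::finite \<Rightarrow> real) \<Rightarrow> bool" where
  "approx_sum_rules l m a \<longleftrightarrow>
     mu m a summable_on {1..} \<and> (\<lambda>k. real m ^ (k * l) * delta l m a k) summable_on {1..}"

text \<open>For masks with a common finite support, convergence is pointwise convergence.\<close>

definition limit_masks :: "(nat \<Rightarrow> int ^ 's \<Rightarrow> real) \<Rightarrow> (int ^ 's \<Rightarrow> real) set" where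
  "limit_masks a = {b. \<exists>r. strict_mono r \<and> (\<forall>\<alpha>. (\<lambda>n. a (r n) \<alpha>) \<longlonglongrightarrow> b \<alpha>)}"

definition Kset :: "nat \<Rightarrow> nat \<Rightarrow> (int ^ 's) set" where
  "Kset m N = {\<kappa>. \<exists>g :: nat \<Rightarrow> int ^ 's.
     (\<forall>r i. g r $ i \<in> {- int m..int N + 1}) \<and>
     (\<forall>i. (\<lambda>r. of_int (g (Suc r) $ i) / real m ^ Suc r) sums real_of_int (\<kappa> $ i))}"

text \<open>Vectors indexed by the set \<open>K = Kset m N\<close> are functions on the lattice that vanish
  outside \<open>K\<close>; matrices indexed by \<open>K\<close> are given by their action on such vectors.\<close>

definition trans_op ::
    "nat \<Rightarrow> nat \<Rightarrow> int ^ 's \<Rightarrow> (int ^ 's \<Rightarrow> real) \<Rightarrow> (int ^ 's \<Rightarrow> real) \<Rightarrow> int ^ 's \<Rightarrow> real" where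
  "trans_op m N \<epsilon> a v = (\<lambda>\<alpha>. if \<alpha> \<in> Kset m N
     then \<Sum>\<beta>\<in>Kset m N. a (\<epsilon> + int m *s \<alpha> - \<beta>) * v \<beta> else 0)"

definition poly_fun :: "nat \<Rightarrow> (nat ^ 's::finite \<Rightarrow> real) \<Rightarrow> int ^ 's \<Rightarrow> real" where
  "poly_fun l c \<alpha> = (\<Sum>\<eta>\<in>{\<eta>. mabs \<eta> \<le> l}. c \<eta> * (\<Prod>i\<in>UNIV. of_int (\<alpha> $ i) ^ (\<eta> $ i)))"

definition Vspace :: "nat \<Rightarrow> nat \<Rightarrow> nat \<Rightarrow> (int ^ 's::finite \<Rightarrow> real) set" where
  "Vspace l m N = {v. (\<forall>\<alpha>. \<alpha> \<notin> Kset m N \<longrightarrow> v \<alpha> = 0) \<and>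
     (\<forall>c. (\<Sum>\<alpha>\<in>Kset m N. poly_fun l c \<alpha> * v \<alpha>) = 0)}"

definition trans_ops ::
    "nat \<Rightarrow> nat \<Rightarrow> (int ^ 's \<Rightarrow> real) set \<Rightarrow> ((int ^ 's \<Rightarrow> real) \<Rightarrow> int ^ 's \<Rightarrow> real) set" where
  "trans_ops m N A = {trans_op m N \<epsilon> b | \<epsilon> b. \<epsilon> \<in> digits m \<and> b \<in> A}"

definition opnorm_on :: "('v \<Rightarrow> real) \<Rightarrow> 'v set \<Rightarrow> ('v \<Rightarrow> 'v) \<Rightarrow> real" where
  "opnorm_on nrm V T = (SUP v\<in>{v\<in>V. nrm v \<le> 1}. nrm (T v))"

text \<open>The joint spectral radius of the restrictions to \<open>V\<close> of the operators in \<open>\<M>\<close>.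
  On a finite-dimensional \<open>V\<close> it does not depend on the norm.\<close>

definition joint_spectral_radius :: "('v \<Rightarrow> real) \<Rightarrow> 'v set \<Rightarrow> ('v \<Rightarrow> 'v) set \<Rightarrow> real" where
  "joint_spectral_radius nrm V \<M> =
     lim (\<lambda>n. root n (SUP Ms\<in>{Ms. length Ms = n \<and> set Ms \<subseteq> \<M>}. opnorm_on nrm V (foldr (\<circ>) Ms id)))"

definition rhoA :: "nat \<Rightarrow> nat \<Rightarrow> nat \<Rightarrow> (nat \<Rightarrow> int ^ 's::finite \<Rightarrow> real) \<Rightarrow> real" where
  "rhoA l m N a = joint_spectral_radius (\<lambda>v. L2_set v (Kset m N)) (Vspace l m N)
     (trans_ops m N (limit_masks a))"

definition rvec :: "int ^ 's \<Rightarrow> real ^ 's" where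
  "rvec \<alpha> = (\<chi> i. of_int (\<alpha> $ i))"

definition fourier :: "(real ^ 's::finite \<Rightarrow> real) \<Rightarrow> real ^ 's \<Rightarrow> complex" where
  "fourier f \<omega> = (LINT x|lborel. of_real (f x) * exp (- 2 * of_real pi * \<i> * of_real (x \<bullet> \<omega>)))"

definition strang_fix :: "nat \<Rightarrow> (real ^ 's::finite \<Rightarrow> real) \<Rightarrow> bool" where
  "strang_fix n f \<longleftrightarrow> fourier f 0 = 1 \<and>
     (\<forall>\<alpha> \<mu>. \<alpha> \<noteq> 0 \<longrightarrow> mabs \<mu> < n \<longrightarrow> mderiv \<mu> (fourier f) (rvec \<alpha>) = 0)"

definition stable :: "(real ^ 's::finite \<Rightarrow> real) \<Rightarrow> bool" where
  "stable f \<longleftrightarrow> (\<exists>C1 C2 :: real. 0 < C1 \<and> C1 \<le> C2 \<and>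
     (\<forall>c :: int ^ 's \<Rightarrow> real. bounded (range c) \<longrightarrow>
        ereal C1 * supnorm c \<le> supnorm (\<lambda>x. \<Sum>\<^sub>\<infinity>\<alpha>. c \<alpha> * f (x - rvec \<alpha>)) \<and>
        supnorm (\<lambda>x. \<Sum>\<^sub>\<infinity>\<alpha>. c \<alpha> * f (x - rvec \<alpha>)) \<le> ereal C2 * supnorm c))"

definition test_function :: "nat \<Rightarrow> (real ^ 's::finite \<Rightarrow> real) \<Rightarrow> bool" where
  "test_function l f \<longleftrightarrow>
     compact (closure {x. f x \<noteq> 0}) \<and> Cdiff l f \<and> stable f \<and> strang_fix (l + 1) f"

primrec subdiv_iter ::
    "nat \<Rightarrow> (nat \<Rightarrow> int ^ 's::finite \<Rightarrow> real) \<Rightarrow> nat \<Rightarrow> (int ^ 's \<Rightarrow> real) \<Rightarrow> int ^ 's \<Rightarrow> real" where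
  "subdiv_iter m a 0 c = c"
| "subdiv_iter m a (Suc k) c = subdiv m (a (Suc k)) (subdiv_iter m a k c)"

definition is_limit_function ::
    "nat \<Rightarrow> nat \<Rightarrow> (nat \<Rightarrow> int ^ 's::finite \<Rightarrow> real) \<Rightarrow> (int ^ 's \<Rightarrow> real) \<Rightarrow> (real ^ 's \<Rightarrow> real) \<Rightarrow> bool" where
  "is_limit_function l m a c g \<longleftrightarrow> Cdiff l g \<and>
     (\<forall>f. test_function l f \<longrightarrow>
        (\<lambda>k. Cnorm l (\<lambda>x. g x -
           (\<Sum>\<^sub>\<infinity>\<alpha>. subdiv_iter m a k c \<alpha> * f (real m ^ k *\<^sub>R x - rvec \<alpha>)))) \<longlonglongrightarrow> 0)"

definition C_convergent :: "nat \<Rightarrow> nat \<Rightarrow> (nat \<Rightarrow> int ^ 's::finite \<Rightarrow> real) \<Rightarrow> bool" where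
  "C_convergent l m a \<longleftrightarrow> (\<forall>c. bounded (range c) \<longrightarrow> (\<exists>g. is_limit_function l m a c g))"

definition limit_functions ::
    "nat \<Rightarrow> nat \<Rightarrow> (nat \<Rightarrow> int ^ 's::finite \<Rightarrow> real) \<Rightarrow> (real ^ 's \<Rightarrow> real) set" where
  "limit_functions l m a = {g. \<exists>c. bounded (range c) \<and> is_limit_function l m a c g}"

definition holder_exponent :: "(real ^ 's::finite \<Rightarrow> real) set \<Rightarrow> ereal" where
  "holder_exponent G =
     (if \<forall>n. \<forall>g\<in>G. Cdiff n g then \<infinity>
      else let n = (GREATEST n. \<forall>g\<in>G. Cdiff n g);
               \<zeta> = Sup {\<nu>\<in>{0..1}. \<forall>g\<in>G. \<exists>C. \<forall>x y \<mu>. mabs \<mu> = n \<longrightarrow>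
                         \<bar>mderiv \<mu> g x - mderiv \<mu> g y\<bar> \<le> C * norm (x - y) powr \<nu>}
           in ereal (real n + \<zeta>))"

definition elog :: "nat \<Rightarrow> real \<Rightarrow> ereal" where
  "elog m x = (if x = 0 then -\<infinity> else ereal (log (real m) x))"

end

theory Submission
  imports Defs
begin

text \<open>
  Evaluated on a lattice \<open>x + \<int>\<^sup>s\<close>, the cascade iterates are products of transition operators
  applied to the samples of the initial function. An approximate sum rule turns, by a discrete
  Fourier transform over the cosets of \<open>m\<int>\<^sup>s\<close>, into the statement that a transition operator
  multiplies the moments of order \<open>|\<eta>|\<close> by \<open>m\<close> to the power \<open>-|\<eta>|\<close>, up to moments of lower order
  and an error controlled by \<open>\<delta>\<^sub>k\<close>. On the joint kernel \<open>V\<^sub>\<ell>\<close> of the moments, an adapted norm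
  contracts at any rate \<open>r\<close> above \<open>\<rho>\<^sub>\<A>\<close> for all late masks, by compactness. As \<open>m\<^sup>\<ell> r < 1\<close> and
  \<open>\<sigma>\<^sub>k = m\<^sup>k\<^sup>\<ell> \<delta>\<^sub>k\<close> is summable, the scalar recursion \<open>E\<^sub>k\<^sub>+\<^sub>1 = m\<^sup>\<ell> r E\<^sub>k + \<sigma>\<^sub>k\<^sub>+\<^sub>1\<close>
  has a summable solution that bounds the derivatives of order \<open>\<ell>\<close> of differences of iterates.
  The Strang-Fix conditions enter through Poisson summation: they fix the moments of the samples
  of a test function up to terms that \<open>\<ell>\<close> differentiations remove.

  The same recursion gives the Hoelder exponent \<open>\<nu>\<close> of the derivatives of order \<open>\<ell>\<close>, comparing
  two points at distance about \<open>m\<^sup>-\<^sup>k\<close>, when \<open>\<ell> + \<nu>\<close> is below the asserted minimum. This minimum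
  cannot exceed \<open>\<ell> + 1\<close>, since the basic limit function would otherwise vanish, whereas the
  normalization of the masks forbids that.
\<close>

section \<open>Iterated partial derivatives\<close>

text \<open>The masks satisfy the sum rules only approximately, so \<open>V\<close> is not invariant
  under the transition operators of \<open>a k\<close>; only the limit masks preserve it. Two
  quantities are therefore propagated together: the projection \<open>P w\<close> onto
  \<open>V\<close>, measured in the adapted norm, and the moments of \<open>w\<close> up to order
  \<open>l\<close>. Each feeds the other, and the estimate closes because both couplings are
  summable along the levels. A moment present at level \<open>k\<close> is amplified to
  \<open>m ^ (k * l)\<close> times its size by \<open>l\<close> differentiations, which is why
  \<open>\<sigma>\<close> and not \<open>delta\<close> drives the recursion. In a product the newest
  mask acts before the older ones, so the finitely many masks far from the limit set act last and
  cost a constant.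

  An explicit test function is constructed because convergence speaks about all test functions:
  without one, limit functions would be undetermined. All of them are combinations of integer shifts
  of one function \<open>\<phi>\<close>.

  The cap \<open>l + 1\<close> serves twice: it keeps the exponents tested at order \<open>l\<close>
  in [0, 1], and it settles the case where all limit functions are smoother than order
  \<open>l\<close>.\<close>

definition has_partial ::
    "'s::finite \<Rightarrow> (real ^ 's \<Rightarrow> 'b::real_normed_vector) \<Rightarrow> (real ^ 's \<Rightarrow> 'b) \<Rightarrow> bool" where
  "has_partial i f f' \<longleftrightarrow> (\<forall>x. ((\<lambda>t. f (x + axis i t)) has_vector_derivative f' x) (at 0))"

lemma axis_add: "axis i (a + b :: real) = axis i a + axis i b"
  by (simp add: vec_eq_iff axis_def)

lemma axis_scale: "c *\<^sub>R axis i (t :: real) = axis i (c * t)"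
  by (simp add: vec_eq_iff axis_def)

lemma axis_zero_real [simp]: "axis i (0 :: real) = 0"
  by (simp add: vec_eq_iff axis_def)

lemma has_partial_partial: "has_partial i f f' \<Longrightarrow> partial i f = f'"
  unfolding has_partial_def partial_def by (auto intro!: ext vector_derivative_at)

text \<open>The definition differentiates at 0 only. Moving the base point along the axis gives the
  derivative on the whole coordinate line, where the mean value theorem and term-by-term
  differentiation are applied.\<close>

lemma has_partial_at:
  assumes "has_partial i f f'"
  shows "((\<lambda>t. f (x + axis i t)) has_vector_derivative f' (x + axis i t0)) (at t0)"
proof -
  have "((\<lambda>t. f ((x + axis i t0) + axis i t)) has_vector_derivative f' (x + axis i t0)) (at (t0 - t0))"
    using assms by (simp add: has_partial_def)
  moreover have "((\<lambda>t. t - t0) has_vector_derivative 1) (at t0)"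
    by (auto intro!: derivative_eq_intros)
  ultimately have "((\<lambda>t. f ((x + axis i t0) + axis i t)) \<circ> (\<lambda>t. t - t0) has_vector_derivative
      1 *\<^sub>R f' (x + axis i t0)) (at t0)"
    by (rule vector_diff_chain_at[rotated])
  moreover have "(\<lambda>t. f ((x + axis i t0) + axis i t)) \<circ> (\<lambda>t. t - t0) = (\<lambda>t. f (x + axis i t))"
    by (auto simp: add.assoc axis_add[symmetric])
  ultimately show ?thesis by simp
qed

lemma has_partial_const: "has_partial i (\<lambda>x. c) (\<lambda>x. 0)"
  by (simp add: has_partial_def)

lemma has_partial_add:
  "has_partial i f f' \<Longrightarrow> has_partial i g g' \<Longrightarrow> has_partial i (\<lambda>x. f x + g x) (\<lambda>x. f' x + g' x)"
  by (auto simp: has_partial_def intro!: has_vector_derivative_add)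

lemma has_partial_mult:
  fixes f g :: "real ^ 's::finite \<Rightarrow> 'b::real_normed_algebra"
  assumes "has_partial i f f'" "has_partial i g g'"
  shows "has_partial i (\<lambda>x. f x * g x) (\<lambda>x. f x * g' x + f' x * g x)"
  unfolding has_partial_def
proof
  fix x
  show "((\<lambda>t. f (x + axis i t) * g (x + axis i t)) has_vector_derivative f x * g' x + f' x * g x) (at 0)"
    using has_vector_derivative_mult[of "\<lambda>t. f (x + axis i t)" "f' x" 0 UNIV "\<lambda>t. g (x + axis i t)" "g' x"] assms
    by (simp add: has_partial_def)
qed

lemma has_partial_cmult:
  fixes f :: "real ^ 's::finite \<Rightarrow> 'b::real_normed_algebra"
  assumes "has_partial i f f'" 
  shows "has_partial i (\<lambda>x. c * f x) (\<lambda>x. c * f' x)"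
  using has_partial_mult[OF has_partial_const[of i c] assms] by simp

lemma has_partial_sum:
  "(\<And>a. a \<in> A \<Longrightarrow> has_partial i (f a) (f' a)) \<Longrightarrow>
    has_partial i (\<lambda>x. \<Sum>a\<in>A. f a x) (\<lambda>x. \<Sum>a\<in>A. f' a x)"
  by (induction A rule: infinite_finite_induct) (auto simp: has_partial_const has_partial_add)

lemma has_partial_affine:
  assumes "has_partial i f f'"
  shows "has_partial i (\<lambda>x. f (c *\<^sub>R x + b)) (\<lambda>x. c *\<^sub>R f' (c *\<^sub>R x + b))"
  unfolding has_partial_def
proof
  fix x
  have "((\<lambda>t. f ((c *\<^sub>R x + b) + axis i t)) has_vector_derivative f' (c *\<^sub>R x + b)) (at (c * 0))"
    using assms by (simp add: has_partial_def)
  moreover have "((\<lambda>t. c * t) has_vector_derivative c) (at 0)"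
    by (auto intro!: derivative_eq_intros)
  ultimately have "((\<lambda>t. f ((c *\<^sub>R x + b) + axis i t)) \<circ> (\<lambda>t. c * t) has_vector_derivative
      c *\<^sub>R f' (c *\<^sub>R x + b)) (at 0)"
    by (rule vector_diff_chain_at[rotated])
  moreover have "(\<lambda>t. f ((c *\<^sub>R x + b) + axis i t)) \<circ> (\<lambda>t. c * t) = (\<lambda>t. f (c *\<^sub>R (x + axis i t) + b))"
    by (auto simp: scaleR_add_right axis_scale algebra_simps)
  ultimately show "((\<lambda>t. f (c *\<^sub>R (x + axis i t) + b)) has_vector_derivative c *\<^sub>R f' (c *\<^sub>R x + b)) (at 0)"
    by simp
qed

lemma has_partial_bound:
  fixes f :: "real ^ 's::finite \<Rightarrow> real"
  assumes "has_partial i f f'" and B: "\<And>x. \<bar>f' x\<bar> \<le> B"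
  shows "\<bar>f (x + axis i t) - f x\<bar> \<le> B * \<bar>t\<bar>"
proof -
  have "norm (f (x + axis i t) - f (x + axis i 0)) \<le> B * norm (t - 0)"
  proof (rule field_differentiable_bound[where S = UNIV])
    show "((\<lambda>t. f (x + axis i t)) has_field_derivative f' (x + axis i u)) (at u within UNIV)" for u
      using has_partial_at[OF assms(1)] by (simp add: has_real_derivative_iff_has_vector_derivative)
  qed (use B in auto)
  then show ?thesis by simp
qed

section \<open>Functions with continuous partial derivatives up to a given order\<close>

lemma Cdiff_Suc_iff:
  "Cdiff (Suc n) f \<longleftrightarrow>
    continuous_on UNIV f \<and> (\<forall>i. has_partial i f (partial i f) \<and> Cdiff n (partial i f))"
  by (auto simp: has_partial_def partial_def vector_derivative_works)

lemma Cdiff_SucI: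
  assumes "continuous_on UNIV f" "\<And>i. has_partial i f (f' i)" "\<And>i. Cdiff n (f' i)"
  shows "Cdiff (Suc n) f"
  using assms has_partial_partial[OF assms(2)] by (simp add: Cdiff_Suc_iff del: Cdiff.simps)

lemma Cdiff_SucD:
  assumes "Cdiff (Suc n) f"
  shows "continuous_on UNIV f" "has_partial i f (partial i f)" "Cdiff n (partial i f)"
  using assms by (auto simp: Cdiff_Suc_iff simp del: Cdiff.simps)

lemma Cdiff_continuous: "Cdiff n f \<Longrightarrow> continuous_on UNIV f"
  by (cases n) auto

lemma Cdiff_Suc_imp: "Cdiff (Suc n) f \<Longrightarrow> Cdiff n f"
proof (induction n arbitrary: f)
  case (Suc n)
  show ?case
    by (rule Cdiff_SucI[OF Cdiff_SucD(1,2)[OF Suc.prems] Suc.IH[OF Cdiff_SucD(3)[OF Suc.prems]]])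
qed auto

lemma Cdiff_mono: "Cdiff n f \<Longrightarrow> k \<le> n \<Longrightarrow> Cdiff k f"
  by (induction n) (auto simp: le_Suc_eq simp del: Cdiff.simps(2) dest: Cdiff_Suc_imp)

lemma Cdiff_const: "Cdiff n (\<lambda>x. c)"
proof (induction n arbitrary: c)
  case (Suc n)
  show ?case
    by (rule Cdiff_SucI[OF _ has_partial_const Suc.IH]) simp
qed auto

lemma Cdiff_add: "Cdiff n f \<Longrightarrow> Cdiff n g \<Longrightarrow> Cdiff n (\<lambda>x. f x + g x)"
proof (induction n arbitrary: f g)
  case 0 then show ?case by (auto intro!: continuous_intros)
next
  case (Suc n)
  show ?case
    by (rule Cdiff_SucI[OF continuous_on_add has_partial_add Suc.IH];
        rule Cdiff_SucD[OF Suc.prems(1)] Cdiff_SucD[OF Suc.prems(2)])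
qed

lemma Cdiff_mult: "Cdiff n f \<Longrightarrow> Cdiff n g \<Longrightarrow> Cdiff n (\<lambda>x. f x * g x)"
proof (induction n arbitrary: f g)
  case 0 then show ?case by (auto intro!: continuous_intros)
next
  case (Suc n)
  note f = Cdiff_SucD[OF Suc.prems(1)] Cdiff_Suc_imp[OF Suc.prems(1)]
  note g = Cdiff_SucD[OF Suc.prems(2)] Cdiff_Suc_imp[OF Suc.prems(2)]
  show ?case
    by (rule Cdiff_SucI[OF continuous_on_mult has_partial_mult]; (rule Cdiff_add Suc.IH)?)
       (rule f g Suc.IH)+
qed

lemma Cdiff_cmult: "Cdiff n f \<Longrightarrow> Cdiff n (\<lambda>x. c * f x)"
  by (rule Cdiff_mult[OF Cdiff_const])

lemma Cdiff_sum: "(\<And>a. a \<in> A \<Longrightarrow> Cdiff n (f a)) \<Longrightarrow> Cdiff n (\<lambda>x. \<Sum>a\<in>A. f a x)"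
  by (induction A rule: infinite_finite_induct) (auto simp: Cdiff_const Cdiff_add)

lemma Cdiff_prod: "(\<And>a. a \<in> A \<Longrightarrow> Cdiff n (f a)) \<Longrightarrow> Cdiff n (\<lambda>x. \<Prod>a\<in>A. f a x)"
  by (induction A rule: infinite_finite_induct) (auto simp: Cdiff_const Cdiff_mult)

lemma Cdiff_affine: "Cdiff n f \<Longrightarrow> Cdiff n (\<lambda>x. f (c *\<^sub>R x + b))"
proof (induction n arbitrary: f)
  case 0 then show ?case
    by (auto intro!: continuous_intros continuous_on_compose2[of UNIV f])
next
  case (Suc n)
  note f = Cdiff_SucD[OF Suc.prems]
  have c: "continuous_on UNIV (\<lambda>x. f (c *\<^sub>R x + b))"
    by (auto intro!: continuous_intros continuous_on_compose2[OF f(1)])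
  have "Cdiff n (\<lambda>x. c * partial i f (c *\<^sub>R x + b))" for i
    by (rule Cdiff_cmult[OF Suc.IH[OF f(3)]])
  then show ?case
    using Cdiff_SucI[OF c has_partial_affine[OF f(2)], of n] by simp
qed

text \<open>Derivatives along words of coordinates. Estimates are stated uniformly over all words of
  a given length, hence independently of the order of differentiation; \<open>mderiv_Dl\<close>
  returns to multi-indices.\<close>

definition Dl :: "'s::finite list \<Rightarrow> (real ^ 's \<Rightarrow> 'b::real_normed_vector) \<Rightarrow> real ^ 's \<Rightarrow> 'b" where
  "Dl is f = foldr partial is f"

lemma Dl_Nil [simp]: "Dl [] f = f" by (simp add: Dl_def)
lemma Dl_Cons: "Dl (i # is) f = partial i (Dl is f)" by (simp add: Dl_def)
lemma Dl_snoc: "Dl (is @ [i]) f = Dl is (partial i f)" by (simp add: Dl_def)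

lemma Cdiff_Dl: "Cdiff n f \<Longrightarrow> length is + k \<le> n \<Longrightarrow> Cdiff k (Dl is f)"
proof (induction "is" arbitrary: f n rule: rev_induct)
  case Nil then show ?case using Cdiff_mono by auto
next
  case (snoc i xs)
  then obtain n' where n: "n = Suc n'" by (cases n) auto
  show ?case unfolding Dl_snoc
    by (rule snoc.IH[OF Cdiff_SucD(3)[OF snoc.prems(1)[unfolded n]]]) (use snoc.prems n in auto)
qed

lemma Dl_has_partial: "Cdiff n f \<Longrightarrow> length is < n \<Longrightarrow> has_partial i (Dl is f) (Dl (i # is) f)"
  using Cdiff_Dl[of n f "is" 1] Cdiff_SucD(2)[of 0 "Dl is f" i] by (simp add: Dl_Cons)

lemma Cdiff_iff_Dl:
  "Cdiff n f \<longleftrightarrow> (\<forall>is. length is \<le> n \<longrightarrow> continuous_on UNIV (Dl is f)) \<and>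
     (\<forall>is i. length is < n \<longrightarrow> has_partial i (Dl is f) (Dl (i # is) f))"
proof
  assume "Cdiff n f"
  then show "(\<forall>is. length is \<le> n \<longrightarrow> continuous_on UNIV (Dl is f)) \<and>
     (\<forall>is i. length is < n \<longrightarrow> has_partial i (Dl is f) (Dl (i # is) f))"
    using Cdiff_Dl[of n f _ 0] by (auto simp: Dl_has_partial)
next
  assume "(\<forall>is. length is \<le> n \<longrightarrow> continuous_on UNIV (Dl is f)) \<and>
     (\<forall>is i. length is < n \<longrightarrow> has_partial i (Dl is f) (Dl (i # is) f))"
  then show "Cdiff n f"
  proof (induction n arbitrary: f)
    case 0 then show ?case by (auto dest: spec[of _ "[]"])
  next
    case (Suc n)
    show ?case
    proof (rule Cdiff_SucI)
      show "continuous_on UNIV f" using Suc.prems by (auto dest: spec[of _ "[]"])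
      show "has_partial i f (partial i f)" for i 
        using conjunct2[OF Suc.prems, rule_format, of "[]" i] by (simp add: Dl_Cons)
      show "Cdiff n (partial i f)" for i
        using conjunct1[OF Suc.prems, rule_format, of "_ @ [i]"]
              conjunct2[OF Suc.prems, rule_format, of "_ @ [i]"]
        by (intro Suc.IH) (simp add: Dl_snoc flip: append_Cons)
    qed
  qed
qed

text \<open>A family indexed by words and closed under one further partial derivative must be the
  family of derivatives of its member at the empty word. The rules for sums, affine substitutions,
  sums of shifts and uniform limits all arise by exhibiting such a family.\<close>

lemma Cdiff_DlI:
  assumes c: "\<And>is. length is \<le> n \<Longrightarrow> continuous_on UNIV (F is)" and
     d: "\<And>is i. length is < n \<Longrightarrow> has_partial i (F is) (F (i # is))"
  shows "Cdiff n (F [])" and "length is \<le> n \<Longrightarrow> Dl is (F []) = F is"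
proof -
  have *: "length is \<le> n \<Longrightarrow> Dl is (F []) = F is" for "is"
    by (induction "is") (auto simp: Dl_Cons has_partial_partial[OF d])
  then show "length is \<le> n \<Longrightarrow> Dl is (F []) = F is" .
  show "Cdiff n (F [])"
    unfolding Cdiff_iff_Dl
  proof (intro conjI allI impI)
    show "continuous_on UNIV (Dl is (F []))" if "length is \<le> n" for "is" using * c that by simp
    show "has_partial i (Dl is (F [])) (Dl (i # is) (F []))" if "length is < n" for "is" i
      using *[of "is"] *[of "i # is"] d[of "is" i] that by simp
  qed
qed

lemma Dl_add: "Cdiff n f \<Longrightarrow> Cdiff n g \<Longrightarrow> length is \<le> n \<Longrightarrow> Dl is (\<lambda>x. f x + g x) = (\<lambda>x. Dl is f x + Dl is g x)"
  by (rule Cdiff_DlI(2)[where F = "\<lambda>is x. Dl is f x + Dl is g x", simplified])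
     (auto intro!: continuous_intros has_partial_add Dl_has_partial simp: Cdiff_iff_Dl)

lemma Dl_cmult:
  fixes f :: "real ^ 's::finite \<Rightarrow> real"
  shows "Cdiff n f \<Longrightarrow> length is \<le> n \<Longrightarrow> Dl is (\<lambda>x. c * f x) = (\<lambda>x. c * Dl is f x)"
  by (rule Cdiff_DlI(2)[where F = "\<lambda>is x. c * Dl is f x", simplified])
     (auto intro!: continuous_intros has_partial_cmult Dl_has_partial simp: Cdiff_iff_Dl)

lemma Cdiff_diff: "Cdiff n f \<Longrightarrow> Cdiff n g \<Longrightarrow> Cdiff n (\<lambda>x. f x - g x)"
  using Cdiff_add[OF _ Cdiff_cmult[of n g "-1"]] by simp

lemma Dl_diff:
  assumes "Cdiff n f" "Cdiff n g" "length is \<le> n"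
  shows "Dl is (\<lambda>x. f x - g x) = (\<lambda>x. Dl is f x - Dl is g x)"
  using Dl_add[OF assms(1) Cdiff_cmult[OF assms(2), of "-1"] assms(3)] Dl_cmult[OF assms(2,3), of "-1"] by simp

lemma Dl_sum:
  fixes f :: "'a \<Rightarrow> real ^ 's::finite \<Rightarrow> real"
  assumes "\<And>a. a \<in> A \<Longrightarrow> Cdiff n (f a)" "length is \<le> n"
  shows "Dl is (\<lambda>x. \<Sum>a\<in>A. f a x) = (\<lambda>x. \<Sum>a\<in>A. Dl is (f a) x)"
  by (rule Cdiff_DlI(2)[where F = "\<lambda>is x. \<Sum>a\<in>A. Dl is (f a) x", simplified])
     (use assms in \<open>auto intro!: continuous_intros has_partial_sum Dl_has_partial simp: Cdiff_iff_Dl\<close>)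

lemma Dl_affine:
  fixes f :: "real ^ 's::finite \<Rightarrow> real"
  assumes "Cdiff n f" "length is \<le> n"
  shows "Dl is (\<lambda>x. f (c *\<^sub>R x + b)) = (\<lambda>x. c ^ length is * Dl is f (c *\<^sub>R x + b))"
proof -
  have C: "continuous_on UNIV (Dl js f)" if "length js \<le> n" for js
    using assms(1) that by (simp add: Cdiff_iff_Dl)
  have "has_partial i (\<lambda>x. c ^ length js * Dl js f (c *\<^sub>R x + b))
      (\<lambda>x. c * c ^ length js * Dl (i # js) f (c *\<^sub>R x + b))" if "length js < n" for js i
    using has_partial_cmult[OF has_partial_affine[OF Dl_has_partial[OF assms(1) that, of i]], where c = "c ^ length js"]
    by (simp add: mult_ac)
  then show ?thesis
    by (intro Cdiff_DlI(2)[where F = "\<lambda>is x. c ^ length is * Dl is f (c *\<^sub>R x + b)", simplified])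
       (auto intro!: continuous_intros continuous_on_compose2[OF C] assms)
qed

text \<open>The word repeats each coordinate as often as the multi-index says. The last clause is
  for Fourier transforms, where differentiating along a word produces the product of its
  coordinates.\<close>

lemma mderiv_Dl:
  fixes \<mu> :: "nat ^ 's::finite" and f :: "real ^ 's \<Rightarrow> 'b::real_normed_vector"
  shows "\<exists>is. mderiv \<mu> f = Dl is f \<and> length is = mabs \<mu> \<and>
    (\<forall>x :: real ^ 's. (\<Prod>j\<leftarrow>is. x $ j) = (\<Prod>i\<in>UNIV. x $ i ^ (\<mu> $ i)))"
proof -
  have ex: "\<exists>xs :: 's list. distinct xs \<and> set xs = UNIV"
    using finite_distinct_list[OF finite, of "UNIV :: 's set"] by blast
  have c: "distinct (coords :: 's list)" "set (coords :: 's list) = UNIV"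
    using someI_ex[OF ex] by (auto simp: coords_def)
  have "foldr (\<lambda>i. partial i ^^ (\<mu> $ i)) xs f = Dl (concat (map (\<lambda>i. replicate (\<mu> $ i) i) xs)) f" for xs
  proof (induction xs)
    case (Cons x xs)
    have "(partial x ^^ n) g = foldr partial (replicate n x) g" for n g
      by (induction n) auto
    then show ?case using Cons by (simp add: Dl_def)
  qed simp
  moreover have "length (concat (map (\<lambda>i. replicate (\<mu> $ i) i) (coords :: 's list))) = mabs \<mu>"
    by (simp add: mabs_def length_concat comp_def c(2)[symmetric] sum.distinct_set_conv_list[OF c(1)])
  moreover have "(\<Prod>j\<leftarrow>concat (map (\<lambda>i. replicate (\<mu> $ i) i) coords). x $ j) = (\<Prod>i\<in>UNIV. x $ i ^ (\<mu> $ i))"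
    for x :: "real ^ 's"
  proof -
    have r: "prod_list (replicate n y) = y ^ n" for n and y :: real by (induction n) auto
    have "prod_list (map (\<lambda>j. x $ j) (concat (map (\<lambda>i. replicate (\<mu> $ i) i) xs))) = (\<Prod>i\<leftarrow>xs. x $ i ^ (\<mu> $ i))" for xs
      by (induction xs) (auto simp: r map_replicate_const)
    then show ?thesis by (simp add: c(2)[symmetric] prod.distinct_set_conv_list[OF c(1)])
  qed
  ultimately show ?thesis by (auto simp: mderiv_def)
qed

text \<open>On a single coordinate line this is the one-variable theorem on differentiating a
  sequence; its limit is identified with \<open>g\<close> by uniqueness of pointwise limits.\<close>

lemma has_partial_uniform_limit:
  fixes g g' :: "real ^ 's::finite \<Rightarrow> real"
  assumes d: "\<And>k. has_partial i (h k) (h' k)" and u: "uniform_limit UNIV h' g' sequentially"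
    and p: "\<And>x. (\<lambda>k. h k x) \<longlonglongrightarrow> g x"
  shows "has_partial i g g'"
  unfolding has_partial_def
proof
  fix x
  have "\<exists>G. \<forall>t\<in>UNIV. (\<lambda>n. h n (x + axis i t)) \<longlonglongrightarrow> G t \<and> (G has_derivative (\<lambda>u. u * g' (x + axis i t))) (at t within UNIV)"
  proof (rule has_derivative_sequence)
    show "((\<lambda>t. h n (x + axis i t)) has_derivative (\<lambda>u. u * h' n (x + axis i t))) (at t within UNIV)" for n t
      using has_partial_at[OF d] by (simp add: has_vector_derivative_def)
    show "\<forall>\<^sub>F n in sequentially. \<forall>t\<in>UNIV. \<forall>u. norm (u * h' n (x + axis i t) - u * g' (x + axis i t)) \<le> e * norm u"
      if "e > 0" for e :: real
    proof -
      have "\<forall>\<^sub>F n in sequentially. \<forall>x\<in>UNIV. dist (h' n x) (g' x) < e"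
        using u that by (simp add: uniform_limit_iff)
      then show ?thesis
      proof (eventually_elim, intro ballI allI)
        fix n and t u :: real assume "\<forall>x\<in>UNIV. dist (h' n x) (g' x) < e"
        then have "\<bar>h' n (x + axis i t) - g' (x + axis i t)\<bar> \<le> e" by (auto simp: dist_real_def intro: less_imp_le)
        then show "norm (u * h' n (x + axis i t) - u * g' (x + axis i t)) \<le> e * norm u"
          by (simp add: right_diff_distrib[symmetric] abs_mult mult.commute[of e] mult_left_mono)
      qed
    qed
    show "(\<lambda>n. h n (x + axis i 0)) \<longlonglongrightarrow> g (x + axis i 0)" by (rule p)
  qed auto
  then obtain G where G: "\<And>t. (\<lambda>n. h n (x + axis i t)) \<longlonglongrightarrow> G t"
    "\<And>t. (G has_derivative (\<lambda>u. u * g' (x + axis i t))) (at t)" by auto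
  have "G = (\<lambda>t. g (x + axis i t))" using LIMSEQ_unique[OF G(1) p] by auto
  then show "((\<lambda>t. g (x + axis i t)) has_vector_derivative g' x) (at 0)"
    using G(2)[of 0] by (simp add: has_vector_derivative_def)
qed

text \<open>A short step along any axis keeps the same coordinate outside the cube, so every further
  derivative is that of a function vanishing near the point.\<close>

lemma Dl_outside_support:
  fixes f :: "real ^ 's::finite \<Rightarrow> real"
  assumes supp: "\<And>x. f x \<noteq> 0 \<Longrightarrow> \<forall>i. \<bar>x $ i\<bar> \<le> R" and "\<exists>i. \<bar>x $ i\<bar> > R"
  shows "Dl is f x = 0"
  using assms(2)
proof (induction "is" arbitrary: x)
  case Nil then show ?case using supp[of x] by (auto simp: not_le[symmetric])
next
  case (Cons j js)
  obtain i where i: "\<bar>x $ i\<bar> > R" using Cons by auto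
  have "Dl js f (x + axis j t) = 0" if "t \<in> ball 0 (\<bar>x $ i\<bar> - R)" for t
  proof (rule Cons.IH)
    have "\<bar>(x + axis j t) $ i\<bar> \<ge> \<bar>x $ i\<bar> - \<bar>t\<bar>" by (auto simp: axis_def)
    then show "\<exists>i. \<bar>(x + axis j t) $ i\<bar> > R" using that by (intro exI[of _ i]) auto
  qed
  then have "((\<lambda>t. Dl js f (x + axis j t)) has_vector_derivative 0) (at 0)"
    using has_vector_derivative_transform_within_open[of "\<lambda>t. 0" 0 0 "ball 0 (\<bar>x $ i\<bar> - R)"
      "\<lambda>t. Dl js f (x + axis j t)"] i by simp
  then show ?case unfolding Dl_Cons partial_def by (rule vector_derivative_at)
qed

text \<open>A step of length \<open>2 * R + 2\<close> along one axis leaves the support, so by the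
  mean value theorem each order of differentiation that is undone costs this factor. It reduces all
  later estimates to derivatives of top order.\<close>

lemma compact_support_Dl_bound:
  fixes f :: "real ^ 's::finite \<Rightarrow> real"
  assumes C: "Cdiff n f" and R: "R \<ge> 0" and supp: "\<And>x. f x \<noteq> 0 \<Longrightarrow> \<forall>i. \<bar>x $ i\<bar> \<le> R"
    and top: "\<And>is x. length is = n \<Longrightarrow> \<bar>Dl is f x\<bar> \<le> B" and len: "length is \<le> n" and B: "B \<ge> 0"
  shows "\<bar>Dl is f x\<bar> \<le> B * (2 * R + 2) ^ n"
proof -
  have van: "Dl is f x = 0" if "\<exists>i. \<bar>x $ i\<bar> > R" for x "is"
    by (rule Dl_outside_support[OF supp that])
  have "\<forall>is x. length is = n - k \<longrightarrow> \<bar>Dl is f x\<bar> \<le> B * (2 * R + 2) ^ k" if "k \<le> n" for k using that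
  proof (induction k)
    case 0 then show ?case using top by simp
  next
    case (Suc k)
    show ?case
    proof (intro allI impI)
      fix js :: "'s list" and x assume js: "length js = n - Suc k"
      \<comment> \<open>Any coordinate serves as the direction in which the support is left; the
        index type is inhabited.\<close>
      define i :: 's where "i = undefined"
      have "has_partial i (Dl js f) (Dl (i # js) f)" using Dl_has_partial[OF C] js Suc by simp
      then have *: "\<bar>Dl js f (x + axis i (2 * R + 2)) - Dl js f x\<bar> \<le> B * (2 * R + 2) ^ k * \<bar>2 * R + 2\<bar>"
        by (rule has_partial_bound) (use Suc js in auto)
      show "\<bar>Dl js f x\<bar> \<le> B * (2 * R + 2) ^ Suc k"
      proof (cases "\<exists>i. \<bar>x $ i\<bar> > R")
        case True then show ?thesis using van[OF True, of js] B R by simp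
      next
        case False
        then have "\<bar>x $ i\<bar> \<le> R" by (auto simp: not_less)
        then have "\<bar>(x + axis i (2 * R + 2)) $ i\<bar> > R" using R by (auto simp: axis_def)
        then have "\<exists>j. \<bar>(x + axis i (2 * R + 2)) $ j\<bar> > R" by blast
        from van[OF this, of js] have "Dl js f (x + axis i (2 * R + 2)) = 0" by simp
        then show ?thesis using * R by (simp add: mult_ac)
      qed
    qed
  qed
  from this[of "n - length is"] len have "\<bar>Dl is f x\<bar> \<le> B * (2 * R + 2) ^ (n - length is)" by simp
  also have "\<dots> \<le> B * (2 * R + 2) ^ n" using B R by (intro mult_left_mono power_increasing) auto
  finally show ?thesis .
qed

section \<open>Joint spectral radius\<close>

text \<open>Fekete's lemma in multiplicative form; \<open>root 0 x = 0\<close> makes the value at \<open>n = 0\<close> irrelevant.\<close>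

lemma submultiplicative_root_convergent:
  fixes a :: "nat \<Rightarrow> real"
  assumes nn: "\<And>n. a n \<ge> 0" and sub: "\<And>m n. a (m + n) \<le> a m * a n"
  shows "\<exists>L\<ge>0. (\<lambda>n. root n (a n)) \<longlonglongrightarrow> L"
    and "\<And>r. r > lim (\<lambda>n. root n (a n)) \<Longrightarrow> \<exists>C>0. \<forall>n. a n \<le> C * r ^ n"
proof -
  define L where "L = (INF n\<in>{1..}. root n (a n))"
  have bdd: "bdd_below ((\<lambda>n. root n (a n)) ` {1..})"
    by (rule bdd_belowI[of _ 0]) (auto simp: nn)
  have L0: "L \<ge> 0" unfolding L_def by (rule cINF_greatest) (auto simp: nn)
  have Lle: "L \<le> root n (a n)" if "n \<ge> 1" for n
    unfolding L_def by (rule cINF_lower[OF bdd]) (use that in auto)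
  have growth: "\<exists>C>0. \<forall>n. a n \<le> C * r ^ n" if rL: "r > L" for r
  proof -
    \<comment> \<open>The infimum \<open>L\<close> is below \<open>r\<close>, so one block length
      \<open>q\<close> already satisfies the bound; every \<open>n\<close> is then cut into blocks
      of length \<open>q\<close> and a remainder.\<close>
    obtain q where q: "q \<ge> 1" "root q (a q) < r"
      using iffD1[OF cINF_less_iff[OF _ bdd, of r]] rL unfolding L_def by auto
    have r0: "r > 0" using rL L0 by simp
    have aq: "a q \<le> r ^ q"
    proof -
      have "a q = root q (a q) ^ q" using q nn by (simp add: real_root_pow_pos2)
      also have "\<dots> \<le> r ^ q" using q nn by (intro power_mono) auto
      finally show ?thesis .
    qed
    have mult: "a (u * q + v) \<le> r ^ (u * q) * a v" for u v
    proof (induction u)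
      case (Suc u)
      have "a (Suc u * q + v) \<le> a q * a (u * q + v)"
        using sub[of q "u * q + v"] by (simp add: algebra_simps)
      also have "\<dots> \<le> r ^ q * (r ^ (u * q) * a v)"
        using aq Suc nn r0 by (intro mult_mono) auto
      finally show ?case by (simp add: power_add mult_ac)
    qed simp
    \<comment> \<open>Absorbs the finitely many remainders \<open>n mod q\<close>; the summand 1
      makes it positive.\<close>
    define C where "C = 1 + (\<Sum>v<q. a v / r ^ v)"
    have "a n \<le> C * r ^ n" for n
    proof -
      define v where "v = n mod q"
      have n: "n = (n div q) * q + v" by (simp add: v_def)
      have "a v / r ^ v \<le> (\<Sum>v<q. a v / r ^ v)"
        by (rule member_le_sum) (use q nn r0 in \<open>auto simp: v_def\<close>)
      then have "a v \<le> C * r ^ v" using r0 zero_le_power[of r v] by (simp add: C_def field_simps del: zero_le_power)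
      have "a n \<le> r ^ ((n div q) * q) * a v" using mult[of "n div q" v] n by simp
      also have "\<dots> \<le> r ^ ((n div q) * q) * (C * r ^ v)"
        using \<open>a v \<le> C * r ^ v\<close> r0 by (intro mult_left_mono) auto
      also have "\<dots> = C * r ^ ((n div q) * q + v)" by (simp add: power_add)
      also have "\<dots> = C * r ^ n" using n by simp
      finally show ?thesis .
    qed
    moreover have "C > 0" unfolding C_def using nn r0 by (intro add_pos_nonneg sum_nonneg) auto
    ultimately show ?thesis by blast
  qed
  have lim: "(\<lambda>n. root n (a n)) \<longlonglongrightarrow> L"
  proof (rule order_tendstoI)
    fix x assume "x < L"
    then show "\<forall>\<^sub>F n in sequentially. x < root n (a n)"
      using Lle by (auto intro!: eventually_sequentiallyI[of 1] intro: less_le_trans)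
  next
    fix x assume x: "L < x"
    define r where "r = (L + x) / 2"
    have r: "L < r" "r < x" "r > 0" using x L0 by (auto simp: r_def)
    obtain C where C: "C > 0" "\<And>n. a n \<le> C * r ^ n" using growth[OF r(1)] by blast
    have "(\<lambda>n. root n C * r) \<longlonglongrightarrow> 1 * r"
      by (intro tendsto_intros LIMSEQ_root_const C)
    then have "\<forall>\<^sub>F n in sequentially. root n C * r < x"
      using r by (intro order_tendstoD(2)) auto
    moreover have "\<forall>\<^sub>F n in sequentially. n \<ge> (1::nat)" by (rule eventually_ge_at_top)
    ultimately show "\<forall>\<^sub>F n in sequentially. root n (a n) < x"
    proof eventually_elim
      case (elim n)
      have "root n (a n) \<le> root n (C * r ^ n)" using C elim by simp
      also have "\<dots> = root n C * r" using elim r by (simp add: real_root_mult real_root_power_cancel)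
      finally show ?case using elim by simp
    qed
  qed
  show "\<exists>L\<ge>0. (\<lambda>n. root n (a n)) \<longlonglongrightarrow> L" using lim L0 by blast
  show "\<exists>C>0. \<forall>n. a n \<le> C * r ^ n" if "r > lim (\<lambda>n. root n (a n))" for r
    using that growth limI[OF lim] by simp
qed

text \<open>\<open>nrm\<close> is a seminorm on all functions on the index type, because the
  intended norm reads only the entries in a finite set of indices. The common bound \<open>B\<close>
  makes the suprema below finite.\<close>

locale bounded_operators =
  fixes nrm :: "('i \<Rightarrow> real) \<Rightarrow> real" and V :: "('i \<Rightarrow> real) set"
    and \<M> :: "(('i \<Rightarrow> real) \<Rightarrow> 'i \<Rightarrow> real) set" and B :: real
  assumes nonempty: "\<M> \<noteq> {}"
    and zero_mem: "(\<lambda>_. 0) \<in> V"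
    and scale_mem: "v \<in> V \<Longrightarrow> (\<lambda>i. c * v i) \<in> V"
    and add_mem: "u \<in> V \<Longrightarrow> v \<in> V \<Longrightarrow> (\<lambda>i. u i + v i) \<in> V"
    and nrm_nonneg: "nrm v \<ge> 0"
    and nrm_scale: "nrm (\<lambda>i. c * v i) = \<bar>c\<bar> * nrm v"
    and nrm_add: "nrm (\<lambda>i. u i + v i) \<le> nrm u + nrm v"
    and M_mem: "T \<in> \<M> \<Longrightarrow> v \<in> V \<Longrightarrow> T v \<in> V"
    and M_scale: "T \<in> \<M> \<Longrightarrow> T (\<lambda>i. c * v i) = (\<lambda>i. c * T v i)"
    and M_add: "T \<in> \<M> \<Longrightarrow> T (\<lambda>i. u i + v i) = (\<lambda>i. T u i + T v i)"
    and M_bound: "T \<in> \<M> \<Longrightarrow> v \<in> V \<Longrightarrow> nrm (T v) \<le> B * nrm v"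
    and B_nonneg: "B \<ge> 0"
begin

definition comp :: "(('i \<Rightarrow> real) \<Rightarrow> 'i \<Rightarrow> real) list \<Rightarrow> ('i \<Rightarrow> real) \<Rightarrow> 'i \<Rightarrow> real" where
  "comp Ms = foldr (\<circ>) Ms id"

lemma comp_Nil [simp]: "comp [] v = v" by (simp add: comp_def)
lemma comp_Cons [simp]: "comp (T # Ms) v = T (comp Ms v)" by (simp add: comp_def)

lemma comp_mem: "set Ms \<subseteq> \<M> \<Longrightarrow> v \<in> V \<Longrightarrow> comp Ms v \<in> V"
  by (induction Ms) (auto simp: M_mem)

lemma comp_scale: "set Ms \<subseteq> \<M> \<Longrightarrow> comp Ms (\<lambda>i. c * v i) = (\<lambda>i. c * comp Ms v i)"
  by (induction Ms) (auto simp: M_scale)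

lemma comp_add: "set Ms \<subseteq> \<M> \<Longrightarrow> comp Ms (\<lambda>i. u i + v i) = (\<lambda>i. comp Ms u i + comp Ms v i)"
  by (induction Ms) (auto simp: M_add)

lemma comp_append: "comp (Ms @ Ns) v = comp Ms (comp Ns v)"
  by (induction Ms) auto

lemma comp_bound: "set Ms \<subseteq> \<M> \<Longrightarrow> v \<in> V \<Longrightarrow> nrm (comp Ms v) \<le> B ^ length Ms * nrm v"
proof (induction Ms)
  case (Cons T Ms)
  have "nrm (T (comp Ms v)) \<le> B * nrm (comp Ms v)"
    using Cons.prems by (intro M_bound comp_mem) auto
  also have "\<dots> \<le> B * (B ^ length Ms * nrm v)"
    using Cons B_nonneg by (intro mult_left_mono) auto
  finally show ?case by (simp add: mult_ac)
qed simp

lemma opnorm_bdd: "set Ms \<subseteq> \<M> \<Longrightarrow> bdd_above ((\<lambda>v. nrm (comp Ms v)) ` {v\<in>V. nrm v \<le> 1})"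
  using comp_bound[of Ms] B_nonneg
  by (intro bdd_aboveI2[where M = "B ^ length Ms"]) (auto intro!: order_trans[OF comp_bound] mult_left_le)

lemma nrm_zero: "nrm (\<lambda>_. 0) = 0"
  using nrm_scale[of 0 "\<lambda>_. 0"] by simp

lemma ball_nonempty: "{v\<in>V. nrm v \<le> 1} \<noteq> {}"
  using zero_mem nrm_zero by auto

text \<open>By homogeneity it suffices to look at the unit ball; a vector of seminorm 0 cannot be
  normalized and is covered by the a priori bound \<open>comp_bound\<close>.\<close>

lemma opnorm_bound:
  assumes "set Ms \<subseteq> \<M>" "v \<in> V"
  shows "nrm (comp Ms v) \<le> opnorm_on nrm V (comp Ms) * nrm v"
proof (cases "nrm v = 0")
  case True
  then show ?thesis using comp_bound[OF assms] by simp
next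
  case False
  then have p: "nrm v > 0" using nrm_nonneg[of v] by simp
  have "nrm (comp Ms (\<lambda>i. inverse (nrm v) * v i)) \<le> opnorm_on nrm V (comp Ms)"
    unfolding opnorm_on_def
    by (rule cSUP_upper[OF _ opnorm_bdd]) (use assms p in \<open>auto simp: scale_mem nrm_scale\<close>)
  then show ?thesis using p unfolding comp_scale[OF assms(1)] nrm_scale by (simp add: field_simps)
qed

lemma opnorm_le:
  assumes "\<And>v. v \<in> V \<Longrightarrow> nrm (T v) \<le> c * nrm v" "c \<ge> 0"
  shows "opnorm_on nrm V T \<le> c"
  unfolding opnorm_on_def
  by (rule cSUP_least[OF ball_nonempty]) (use assms in \<open>force intro: order_trans[OF _ mult_left_le]\<close>)

lemma opnorm_nonneg: "set Ms \<subseteq> \<M> \<Longrightarrow> opnorm_on nrm V (comp Ms) \<ge> 0"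
  unfolding opnorm_on_def
  by (rule cSUP_upper2[OF opnorm_bdd, of _ "\<lambda>_. 0"]) (auto simp: zero_mem nrm_zero nrm_nonneg)

definition growth :: "nat \<Rightarrow> real" where
  "growth n = (SUP Ms\<in>{Ms. length Ms = n \<and> set Ms \<subseteq> \<M>}. opnorm_on nrm V (comp Ms))"

lemma jsr_growth: "joint_spectral_radius nrm V \<M> = lim (\<lambda>n. root n (growth n))"
  by (simp add: joint_spectral_radius_def growth_def comp_def)

lemma words_nonempty: "{Ms. length Ms = n \<and> set Ms \<subseteq> \<M>} \<noteq> {}"
proof -
  obtain T where "T \<in> \<M>" using nonempty by auto
  then have "replicate n T \<in> {Ms. length Ms = n \<and> set Ms \<subseteq> \<M>}" by auto
  then show ?thesis by blast
qed

lemma growth_bdd: "bdd_above ((\<lambda>Ms. opnorm_on nrm V (comp Ms)) ` {Ms. length Ms = n \<and> set Ms \<subseteq> \<M>})"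
  using comp_bound B_nonneg
  by (intro bdd_aboveI2[where M = "B ^ n"]) (auto intro!: opnorm_le)

lemma growth_upper: "set Ms \<subseteq> \<M> \<Longrightarrow> opnorm_on nrm V (comp Ms) \<le> growth (length Ms)"
  unfolding growth_def by (rule cSUP_upper[OF _ growth_bdd]) auto

lemma growth_nonneg: "growth n \<ge> 0"
proof -
  obtain Ms where "length Ms = n" "set Ms \<subseteq> \<M>" using words_nonempty[of n] by blast
  then show ?thesis using growth_upper[of Ms] opnorm_nonneg[of Ms] by auto
qed

lemma growth_submult: "growth (m + n) \<le> growth m * growth n"
  unfolding growth_def[of "m + n"]
proof (rule cSUP_least[OF words_nonempty])
  fix Ms assume "Ms \<in> {Ms. length Ms = m + n \<and> set Ms \<subseteq> \<M>}"
  then have Ms: "length Ms = m + n" "set Ms \<subseteq> \<M>" by auto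
  have s: "set (take m Ms) \<subseteq> \<M>" "set (drop m Ms) \<subseteq> \<M>"
    using Ms set_take_subset[of m Ms] set_drop_subset[of m Ms] by auto
  have l: "length (take m Ms) = m" "length (drop m Ms) = n" using Ms by auto
  have "nrm (comp Ms v) \<le> growth m * growth n * nrm v" if v: "v \<in> V" for v
  proof -
    have "comp Ms v = comp (take m Ms) (comp (drop m Ms) v)"
      using comp_append[of "take m Ms" "drop m Ms" v] by simp
    then have "nrm (comp Ms v) \<le> opnorm_on nrm V (comp (take m Ms)) * nrm (comp (drop m Ms) v)"
      using opnorm_bound[OF s(1) comp_mem[OF s(2) v]] by simp
    also have "\<dots> \<le> growth m * (opnorm_on nrm V (comp (drop m Ms)) * nrm v)"
      using growth_upper[OF s(1)] opnorm_bound[OF s(2) v] growth_nonneg nrm_nonneg l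
      by (intro mult_mono) auto
    also have "\<dots> \<le> growth m * (growth n * nrm v)"
      using growth_upper[OF s(2)] growth_nonneg nrm_nonneg l
      by (intro mult_left_mono mult_right_mono) auto
    finally show ?thesis by (simp add: mult_ac)
  qed
  then show "opnorm_on nrm V (comp Ms) \<le> growth m * growth n"
    using growth_nonneg by (intro opnorm_le) auto
qed

lemma jsr_nonneg: "joint_spectral_radius nrm V \<M> \<ge> 0"
proof -
  obtain L where "L \<ge> 0" "(\<lambda>n. root n (growth n)) \<longlonglongrightarrow> L"
    using submultiplicative_root_convergent(1)[OF growth_nonneg growth_submult] by blast
  then show ?thesis by (simp add: jsr_growth limI)
qed

text \<open>The Rota-Strang norm: the supremum of \<open>nrm (M v) / r ^ n\<close> over all products
  \<open>M\<close> of \<open>n\<close> operators. It is finite because products grow no faster than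
  \<open>C * r ^ n\<close> for \<open>r\<close> above the joint spectral radius, and the empty
  product gives the comparison from below.\<close>

lemma adapted_norm:
  assumes r: "joint_spectral_radius nrm V \<M> < r"
  shows "\<exists>an C. (\<forall>v\<in>V. nrm v \<le> an v \<and> an v \<le> C * nrm v) \<and> C \<ge> 0 \<and>
    (\<forall>u\<in>V. \<forall>v\<in>V. an (\<lambda>i. u i + v i) \<le> an u + an v) \<and>
    (\<forall>T\<in>\<M>. \<forall>v\<in>V. an (T v) \<le> r * an v)"
proof -
  have r0: "r > 0" using r jsr_nonneg by linarith
  obtain C where C: "C > 0" "\<And>n. growth n \<le> C * r ^ n"
    using submultiplicative_root_convergent(2)[OF growth_nonneg growth_submult r[unfolded jsr_growth]] by blast
  define an where "an v = (SUP Ms\<in>{Ms. set Ms \<subseteq> \<M>}. nrm (comp Ms v) / r ^ length Ms)" for v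
  have ne: "{Ms. set Ms \<subseteq> \<M>} \<noteq> {}" using words_nonempty[of 0] by blast
  have each: "nrm (comp Ms v) / r ^ length Ms \<le> C * nrm v" if "set Ms \<subseteq> \<M>" "v \<in> V" for Ms v
  proof -
    have "nrm (comp Ms v) \<le> growth (length Ms) * nrm v"
      using opnorm_bound[OF that] growth_upper[OF that(1)] nrm_nonneg[of v]
      by (meson mult_right_mono order_trans)
    also have "\<dots> \<le> C * r ^ length Ms * nrm v"
      using C nrm_nonneg by (intro mult_right_mono) auto
    finally show ?thesis using r0 by (simp add: field_simps)
  qed
  have bdd: "bdd_above ((\<lambda>Ms. nrm (comp Ms v) / r ^ length Ms) ` {Ms. set Ms \<subseteq> \<M>})" if "v \<in> V" for v
    using each that by (intro bdd_aboveI2[where M = "C * nrm v"]) auto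
  have up: "nrm (comp Ms v) / r ^ length Ms \<le> an v" if "set Ms \<subseteq> \<M>" "v \<in> V" for Ms v
    unfolding an_def by (rule cSUP_upper[OF _ bdd]) (use that in auto)
  have 1: "nrm v \<le> an v" "an v \<le> C * nrm v" if "v \<in> V" for v
    using up[of "[]" v] that each cSUP_least[OF ne, of "\<lambda>Ms. nrm (comp Ms v) / r ^ length Ms" "C * nrm v"]
    by (auto simp: an_def)
  have 2: "an (\<lambda>i. u i + v i) \<le> an u + an v" if uv: "u \<in> V" "v \<in> V" for u v
    unfolding an_def[of "\<lambda>i. u i + v i"]
  proof (rule cSUP_least[OF ne])
    fix Ms assume "Ms \<in> {Ms. set Ms \<subseteq> \<M>}"
    then have Ms: "set Ms \<subseteq> \<M>" by auto
    have "nrm (comp Ms (\<lambda>i. u i + v i)) / r ^ length Ms \<le> (nrm (comp Ms u) + nrm (comp Ms v)) / r ^ length Ms"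
      using r0 by (simp add: comp_add[OF Ms] nrm_add divide_right_mono)
    also have "\<dots> \<le> an u + an v"
      using up[OF Ms uv(1)] up[OF Ms uv(2)] by (simp add: add_divide_distrib)
    finally show "nrm (comp Ms (\<lambda>i. u i + v i)) / r ^ length Ms \<le> an u + an v" .
  qed
  have 3: "an (T v) \<le> r * an v" if T: "T \<in> \<M>" "v \<in> V" for T v
    unfolding an_def[of "T v"]
  proof (rule cSUP_least[OF ne])
    fix Ms assume "Ms \<in> {Ms. set Ms \<subseteq> \<M>}"
    \<comment> \<open>A word tested on \<open>T v\<close> is a word with one more letter tested on
      \<open>v\<close>; the missing power of \<open>r\<close> is the contraction factor.\<close>
    then have "set (Ms @ [T]) \<subseteq> \<M>" using T by auto
    from up[OF this T(2)] show "nrm (comp Ms (T v)) / r ^ length Ms \<le> r * an v"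
      using r0 by (simp add: comp_append field_simps)
  qed
  show ?thesis using 1 2 3 C by (intro exI[of _ an] exI[of _ C]) auto
qed

end

section \<open>Sum rule defects and moments\<close>

lemma vec_set_image: "{\<beta> :: 'a ^ 's::finite. \<forall>i. \<beta> $ i \<in> S i} = vec_lambda ` (PiE UNIV S)"
proof -
  have "\<beta> \<in> vec_lambda ` (PiE UNIV S)" if "\<forall>i. \<beta> $ i \<in> S i" for \<beta> :: "'a ^ 's"
    using that by (intro image_eqI[of _ _ "vec_nth \<beta>"]) auto
  then show ?thesis by auto
qed

lemma inj_vec_lambda: "inj_on vec_lambda A"
  by (auto simp: inj_on_def vec_lambda_inject)

lemma finite_vec_set: "(\<And>i. finite (S i)) \<Longrightarrow> finite {\<beta> :: 'a ^ 's::finite. \<forall>i. \<beta> $ i \<in> S i}"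
  unfolding vec_set_image by (intro finite_imageI finite_PiE) auto

lemma card_vec_set: "card {\<beta> :: 'a ^ 's::finite. \<forall>i. \<beta> $ i \<in> S i} = (\<Prod>i\<in>UNIV. card (S i))"
  unfolding vec_set_image by (simp add: card_image[OF inj_vec_lambda] card_PiE)

lemma sum_vec_set_prod:
  fixes g :: "'s::finite \<Rightarrow> 'a \<Rightarrow> 'b::comm_ring_1"
  assumes "\<And>i. finite (S i)"
  shows "(\<Sum>\<beta>\<in>{\<beta>. \<forall>i. \<beta> $ i \<in> S i}. \<Prod>i\<in>UNIV. g i (\<beta> $ i)) = (\<Prod>i\<in>UNIV. \<Sum>b\<in>S i. g i b)"
  unfolding vec_set_image
  by (simp add: sum.reindex[OF inj_vec_lambda] prod_sum_PiE[OF finite assms])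

lemma infsum_finite_support:
  assumes "finite S" "\<And>x. x \<notin> S \<Longrightarrow> f x = 0"
  shows "infsum f UNIV = sum f S"
proof -
  have "infsum f UNIV = infsum f S" by (rule infsum_cong_neutral) (use assms in auto)
  then show ?thesis using assms by simp
qed

definition mbox :: "nat \<Rightarrow> (int ^ 's::finite) set" where
  "mbox N = {\<gamma>. \<forall>i. \<gamma> $ i \<in> {0..int N}}"

lemma finite_mbox [simp]: "finite (mbox N)"
  unfolding mbox_def by (rule finite_vec_set) simp

lemma finite_digits [simp]: "finite (digits m :: (int ^ 's::finite) set)"
  unfolding digits_def by (rule finite_vec_set) simp

lemma card_digits: "card (digits m :: (int ^ 's::finite) set) = m ^ CARD('s)"
  unfolding digits_def by (subst card_vec_set) simp

lemma is_mask_outside: "is_mask N a \<Longrightarrow> \<gamma> \<notin> mbox N \<Longrightarrow> a \<gamma> = 0"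
  by (auto simp: is_mask_def mbox_def)

lemma finite_mabs: "finite {\<eta> :: nat ^ 's::finite. mabs \<eta> \<le> n}"
proof (rule finite_subset)
  show "finite {\<eta> :: nat ^ 's. \<forall>i. \<eta> $ i \<in> {..n}}" by (rule finite_vec_set) simp
  show "{\<eta> :: nat ^ 's. mabs \<eta> \<le> n} \<subseteq> {\<eta>. \<forall>i. \<eta> $ i \<in> {..n}}"
    unfolding mabs_def using member_le_sum[of _ "UNIV :: 's set" "\<lambda>i. _ $ i"] by (auto intro: order_trans)
qed

lemma finite_mabs_less: "finite {\<eta> :: nat ^ 's::finite. mabs \<eta> < n}"
  by (rule finite_subset[OF _ finite_mabs[of n]]) auto

section \<open>Derivatives of symbols through falling factorials\<close>

definition ffall :: "nat ^ 's::finite \<Rightarrow> real ^ 's \<Rightarrow> real" where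
  "ffall \<kappa> x = (\<Prod>i\<in>UNIV. \<Prod>j<\<kappa> $ i. (x $ i - real j))"

text \<open>The derivative of order \<kappa> of the symbol in closed form. The truncated subtraction
  in the exponent is harmless: where it truncates, the falling factorial contains the factor
  0.\<close>

definition symd :: "nat \<Rightarrow> (int ^ 's::finite \<Rightarrow> real) \<Rightarrow> nat ^ 's \<Rightarrow> complex ^ 's \<Rightarrow> complex" where
  "symd N a \<kappa> z = (\<Sum>\<gamma>\<in>mbox N. of_real (a \<gamma>) *
     (\<Prod>i\<in>UNIV. (\<Prod>j<\<kappa> $ i. (of_int (\<gamma> $ i) - of_nat j)) * z $ i ^ (nat (\<gamma> $ i) - \<kappa> $ i)))"

lemma symbol_symd:
  assumes "is_mask N a"
  shows "symbol a = symd N a 0"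
proof
  fix z
  have "symbol a z = (\<Sum>\<gamma>\<in>mbox N. of_real (a \<gamma>) * (\<Prod>i\<in>UNIV. z $ i powi (\<gamma> $ i)))"
    unfolding symbol_def
    by (rule infsum_finite_support) (auto simp: is_mask_outside[OF assms])
  also have "\<dots> = symd N a 0 z"
    unfolding symd_def by (rule sum.cong) (auto simp: mbox_def power_int_def intro!: prod.cong)
  finally show "symbol a z = symd N a 0 z" .
qed

lemma cpartial_symd:
  fixes a :: "int ^ 's::finite \<Rightarrow> real"
  shows "cpartial i (symd N a \<kappa>) = symd N a (\<kappa> + axis i 1)"
proof
  fix z :: "complex ^ 's"
  define f where "f \<kappa> \<gamma> j w = (\<Prod>u<\<kappa> $ j. (of_int (\<gamma> $ j) - of_nat u)) * w ^ (nat (\<gamma> $ j) - \<kappa> $ j)"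
    for \<kappa> :: "nat ^ 's" and \<gamma> :: "int ^ 's" and j and w :: complex
  have der: "(f \<kappa> \<gamma> i has_field_derivative f (\<kappa> + axis i 1) \<gamma> i w) (at w)" if "\<gamma> \<in> mbox N" for \<gamma> w
  proof -
    define n where "n = nat (\<gamma> $ i)"
    have n: "(of_int (\<gamma> $ i) :: complex) = of_nat n" using that by (simp add: n_def mbox_def)
    show ?thesis
    proof (cases "\<kappa> $ i \<le> n")
      case True
      then show ?thesis
        unfolding f_def n n_def[symmetric]
        by (auto intro!: derivative_eq_intros simp: of_nat_diff axis_def mult_ac)
    next
      case False
      then have "(\<Prod>u<\<kappa> $ i. (of_nat n - of_nat u :: complex)) = 0" by (intro prod_zero) auto
      then have "f \<kappa> \<gamma> i = (\<lambda>w. 0)" "f (\<kappa> + axis i 1) \<gamma> i = (\<lambda>w. 0)"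
        unfolding f_def n by (auto simp: axis_def)
      then show ?thesis by simp
    qed
  qed
  have split: "(\<Prod>j\<in>UNIV. f \<kappa> \<gamma> j (w $ j)) = f \<kappa> \<gamma> i (w $ i) * (\<Prod>j\<in>UNIV - {i}. f \<kappa> \<gamma> j (w $ j))" for \<kappa> \<gamma> w
    by (rule prod.remove) auto
  have "((\<lambda>t. \<Sum>\<gamma>\<in>mbox N. of_real (a \<gamma>) * (f \<kappa> \<gamma> i (z $ i + t) * (\<Prod>j\<in>UNIV - {i}. f \<kappa> \<gamma> j (z $ j))))
     has_field_derivative (\<Sum>\<gamma>\<in>mbox N. of_real (a \<gamma>) * (f (\<kappa> + axis i 1) \<gamma> i (z $ i) *
         (\<Prod>j\<in>UNIV - {i}. f \<kappa> \<gamma> j (z $ j))))) (at 0)"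
  proof (rule DERIV_sum)
    fix \<gamma> :: "int ^ 's" assume g: "\<gamma> \<in> mbox N"
    have "((\<lambda>t. f \<kappa> \<gamma> i (z $ i + t)) has_field_derivative f (\<kappa> + axis i 1) \<gamma> i (z $ i)) (at 0)"
      using DERIV_shift[of "f \<kappa> \<gamma> i" _ 0 "z $ i"] der[OF g, of "z $ i"] by (simp add: add.commute)
    then show "((\<lambda>t. of_real (a \<gamma>) * (f \<kappa> \<gamma> i (z $ i + t) * (\<Prod>j\<in>UNIV - {i}. f \<kappa> \<gamma> j (z $ j))))
     has_field_derivative (of_real (a \<gamma>) * (f (\<kappa> + axis i 1) \<gamma> i (z $ i) *
         (\<Prod>j\<in>UNIV - {i}. f \<kappa> \<gamma> j (z $ j))))) (at 0)"
      by (auto intro!: derivative_eq_intros)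
  qed
  moreover have "(\<lambda>t. \<Sum>\<gamma>\<in>mbox N. of_real (a \<gamma>) * (f \<kappa> \<gamma> i (z $ i + t) * (\<Prod>j\<in>UNIV - {i}. f \<kappa> \<gamma> j (z $ j))))
      = (\<lambda>t. symd N a \<kappa> (z + axis i t))"
    unfolding symd_def f_def[symmetric] split
    by (auto simp: axis_def intro!: ext sum.cong prod.cong)
  moreover have "(\<Sum>\<gamma>\<in>mbox N. of_real (a \<gamma>) * (f (\<kappa> + axis i 1) \<gamma> i (z $ i) *
         (\<Prod>j\<in>UNIV - {i}. f \<kappa> \<gamma> j (z $ j)))) = symd N a (\<kappa> + axis i 1) z"
    unfolding symd_def f_def[symmetric] split
    by (auto simp: axis_def f_def intro!: sum.cong prod.cong)
  ultimately show "cpartial i (symd N a \<kappa>) z = symd N a (\<kappa> + axis i 1) z"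
    unfolding cpartial_def by (simp add: DERIV_imp_deriv)
qed

lemma cmderiv_symd:
  fixes a :: "int ^ 's::finite \<Rightarrow> real"
  shows "cmderiv \<eta> (symd N a 0) = symd N a \<eta>"
proof -
  have ex: "\<exists>xs :: 's list. distinct xs \<and> set xs = UNIV"
    using finite_distinct_list[OF finite, of "UNIV :: 's set"] by blast
  have c: "distinct (coords :: 's list)" "set (coords :: 's list) = UNIV"
    using someI_ex[OF ex] by (auto simp: coords_def)
  have pw: "(cpartial i ^^ n) (symd N a \<kappa>) = symd N a (\<kappa> + axis i n)" for i n and \<kappa> :: "nat ^ 's"
  proof (induction n)
    case 0
    have "\<kappa> + axis i 0 = \<kappa>" by (simp add: vec_eq_iff axis_def)
    then show ?case by (simp only: funpow_0)
  next
    case (Suc n)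
    have "\<kappa> + axis i n + axis i 1 = \<kappa> + axis i (Suc n)" by (simp add: vec_eq_iff axis_def)
    then show ?case using Suc by (simp add: cpartial_symd)
  qed
  have "distinct xs \<Longrightarrow> foldr (\<lambda>i. cpartial i ^^ (\<eta> $ i)) xs (symd N a 0) =
      symd N a (\<chi> i. if i \<in> set xs then \<eta> $ i else 0)" for xs
  proof (induction xs)
    case Nil
    have "(\<chi> i. 0) = (0 :: nat ^ 's)" by (simp add: vec_eq_iff)
    then show ?case by simp
  next
    case (Cons x xs)
    have "(\<chi> i. if i \<in> set xs then \<eta> $ i else 0) + axis x (\<eta> $ x) = (\<chi> i. if i \<in> set (x # xs) then \<eta> $ i else 0)"
      using Cons.prems by (auto simp: vec_eq_iff axis_def)
    then show ?case using Cons by (simp add: pw)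
  qed
  from this[OF c(1)] show ?thesis by (simp add: cmderiv_def c(2))
qed

section \<open>Characters modulo \<open>m\<close> and the sum rule defects\<close>

definition ch :: "nat \<Rightarrow> int ^ 's::finite \<Rightarrow> int ^ 's \<Rightarrow> complex" where
  "ch m e \<gamma> = (\<Prod>i\<in>UNIV. cis (- (2 * pi / real m) * of_int (e $ i) * of_int (\<gamma> $ i)))"

lemma ch_diff: "ch m e (\<gamma> - \<gamma>') = ch m e \<gamma> * ch m e (- \<gamma>')"
  unfolding ch_def prod.distrib[symmetric] cis_mult
  by (intro prod.cong refl arg_cong[of _ _ cis]) (simp add: algebra_simps diff_divide_distrib)

lemma norm_ch: "cmod (ch m e \<gamma>) = 1"
  by (simp add: ch_def prod_norm[symmetric])

lemma ch_zero: "ch m 0 \<gamma> = 1" by (simp add: ch_def)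

lemma cis_eq_1_iff: "cis x = 1 \<longleftrightarrow> (\<exists>n::int. x = 2 * pi * of_int n)"
  using complex_eq_iff[of "cis x" 1] sin_cos_eq_iff[of x 0] 
  by (auto simp: algebra_simps)

lemma cis_root_eq_1_iff:
  assumes m: "m \<ge> 1"
  shows "cis (- (2 * pi / real m) * of_int n) = 1 \<longleftrightarrow> int m dvd n"
proof
  assume "cis (- (2 * pi / real m) * of_int n) = 1"
  then obtain j :: int where "- (2 * pi / real m) * of_int n = 2 * pi * of_int j"
    unfolding cis_eq_1_iff by blast
  then have "2 * pi * of_int n = 2 * pi * (of_int (- j) * real m)" using m by (simp add: field_simps)
  then have "real_of_int n = of_int (- j * int m)" by (subst (asm) mult_cancel_left) auto
  then have "n = - j * int m" by (simp only: of_int_eq_iff)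
  then show "int m dvd n" by simp
next
  assume "int m dvd n"
  then obtain j where "n = int m * j" by (auto elim: dvdE)
  then have "- (2 * pi / real m) * of_int n = 2 * pi * of_int (- j)" using m by simp
  then show "cis (- (2 * pi / real m) * of_int n) = 1" unfolding cis_eq_1_iff by blast
qed

lemma cis_root_sum:
  assumes m: "m \<ge> 1"
  shows "(\<Sum>e\<in>{0..<int m}. cis (- (2 * pi / real m) * of_int e * of_int n)) = (if int m dvd n then of_nat m else 0)"
proof -
  define w where "w = cis (- (2 * pi / real m) * of_int n)"
  have "(\<Sum>e\<in>{0..<int m}. cis (- (2 * pi / real m) * of_int e * of_int n)) = (\<Sum>e<m. w ^ e)"
    by (rule sum.reindex_bij_witness[of _ int nat])
       (auto simp: w_def Complex.DeMoivre mult_ac)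
  also have "\<dots> = (if int m dvd n then of_nat m else 0)"
  proof (cases "w = 1")
    case True
    then show ?thesis using cis_root_eq_1_iff[OF m, of n] by (simp add: w_def)
  next
    case False
    have "w ^ m = cis (2 * pi * of_int (- n))" using m by (simp add: w_def Complex.DeMoivre)
    then have "w ^ m = 1" using cis_eq_1_iff[of "2 * pi * of_int (- n)"] by metis
    then show ?thesis using False cis_root_eq_1_iff[OF m, of n] by (simp add: geometric_sum w_def)
  qed
  finally show ?thesis .
qed

text \<open>Orthogonality of characters: the sum over digit vectors factors into geometric sums over
  roots of unity, one for each coordinate.\<close>

lemma ch_sum:
  assumes m: "m \<ge> 1"
  shows "(\<Sum>e\<in>digits m. ch m e (\<gamma> :: int ^ 's::finite)) =
    (if \<forall>i. int m dvd \<gamma> $ i then of_nat m ^ CARD('s) else 0)"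
proof -
  have "(\<Sum>e\<in>digits m. ch m e \<gamma>) =
    (\<Prod>i\<in>UNIV. \<Sum>n\<in>{0..<int m}. cis (- (2 * pi / real m) * of_int n * of_int (\<gamma> $ i)))"
    unfolding digits_def ch_def by (rule sum_vec_set_prod) simp
  also have "\<dots> = (if \<forall>i. int m dvd \<gamma> $ i then of_nat m ^ CARD('s) else 0)"
    unfolding cis_root_sum[OF m] by (auto simp: intro!: prod_zero)
  finally show ?thesis .
qed

lemma delta_bound:
  fixes a :: "nat \<Rightarrow> int ^ 's::finite \<Rightarrow> real"
  assumes m: "m \<ge> 2"
  shows "delta l m a k \<ge> 0"
    and "mabs \<eta> \<le> l \<Longrightarrow> \<epsilon> \<in> Xi m - {1} \<Longrightarrow>
      cmod (cmderiv \<eta> (symbol (a k)) \<epsilon>) \<le> real m ^ (k * mabs \<eta>) * delta l m a k"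
proof -
  let ?h = "\<lambda>(\<eta>, \<epsilon>). cmod (cmderiv \<eta> (symbol (a k)) \<epsilon> / of_nat m ^ (k * mabs \<eta>))"
  let ?S = "{cmod (cmderiv \<eta> (symbol (a k)) \<epsilon> / of_nat m ^ (k * mabs \<eta>)) | \<eta> \<epsilon>.
            mabs \<eta> \<le> l \<and> \<epsilon> \<in> Xi m - {1}}"
  have S: "?S = ?h ` ({\<eta>. mabs \<eta> \<le> l} \<times> (Xi m - {1}))" by auto
  have fin: "finite ?S" unfolding S
    by (intro finite_imageI finite_cartesian_product finite_mabs finite_Diff) (simp add: Xi_def)
  have *: "cmod (cmderiv \<eta> (symbol (a k)) \<epsilon> / of_nat m ^ (k * mabs \<eta>)) \<le> delta l m a k"
    if "mabs \<eta> \<le> l" "\<epsilon> \<in> Xi m - {1}" for \<eta> \<epsilon>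
    unfolding delta_def by (rule Max_ge[OF fin]) (use that in auto)
  then show "mabs \<eta> \<le> l \<Longrightarrow> \<epsilon> \<in> Xi m - {1} \<Longrightarrow>
      cmod (cmderiv \<eta> (symbol (a k)) \<epsilon>) \<le> real m ^ (k * mabs \<eta>) * delta l m a k"
    using m by (simp add: norm_divide norm_power divide_le_eq mult.commute)
  \<comment> \<open>The digit vector of ones gives a point of \<open>Xi m\<close> other than 1,
    since \<open>m \<ge> 2\<close>. The maximum is thus taken over a nonempty set of norms.\<close>
  obtain e :: "int ^ 's" where e: "e \<in> digits m" "\<forall>i. e $ i = 1"
    using m by (intro that[of 1]) (auto simp: digits_def)
  define \<epsilon> :: "complex ^ 's" where "\<epsilon> = (\<chi> i. exp (- \<i> * (2 * of_real pi / of_nat m) * of_int (e $ i)))"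
  have "\<epsilon> \<noteq> 1"
  proof
    assume "\<epsilon> = 1"
    then have "exp (- \<i> * (2 * of_real pi / of_nat m)) = 1" using e by (auto simp: \<epsilon>_def vec_eq_iff)
    then have "cis (- (2 * pi / real m) * of_int 1) = 1" by (simp add: cis_conv_exp mult_ac)
    then have "int m dvd 1" using cis_root_eq_1_iff[of m 1] m by simp
    then show False using m by (simp add: zdvd_not_zless)
  qed
  moreover have "\<epsilon> \<in> Xi m" unfolding Xi_def \<epsilon>_def by (rule imageI[OF e(1)])
  moreover have "mabs (0 :: nat ^ 's) \<le> l" by (simp add: mabs_def)
  ultimately show "delta l m a k \<ge> 0" using *[of 0 \<epsilon>] norm_ge_zero order_trans by blast
qed

text \<open>Fourier inversion modulo \<open>m\<close> writes the coset sum as an average of twisted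
  moments \<open>P e\<close>. The trivial character contributes the full moment; each other one is,
  up to a unimodular factor, a derivative of the symbol at a point of \<open>Xi m - {1}\<close>.
  Falling factorials make this correspondence exact, and averaging over \<open>m ^ CARD('s)\<close>
  frequencies leaves no dimension factor in the error.\<close>

lemma coset_moment:
  fixes a :: "nat \<Rightarrow> int ^ 's::finite \<Rightarrow> real"
  assumes m: "m \<ge> 2" and mask: "is_mask N (a k)" and \<kappa>: "mabs \<kappa> \<le> l"
  shows "\<bar>(\<Sum>\<gamma>\<in>{\<gamma>\<in>mbox N. \<forall>i. int m dvd (\<gamma> - \<gamma>0) $ i}. a k \<gamma> * ffall \<kappa> (rvec \<gamma>)) -
     (\<Sum>\<gamma>\<in>mbox N. a k \<gamma> * ffall \<kappa> (rvec \<gamma>)) / real m ^ CARD('s)\<bar> \<le> real m ^ (k * mabs \<kappa>) * delta l m a k"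
proof -
  define M where "M = (\<Sum>\<gamma>\<in>{\<gamma>\<in>mbox N. \<forall>i. int m dvd (\<gamma> - \<gamma>0) $ i}. a k \<gamma> * ffall \<kappa> (rvec \<gamma>))"
  define A where "A = (\<Sum>\<gamma>\<in>mbox N. a k \<gamma> * ffall \<kappa> (rvec \<gamma>))"
  define P where "P e = (\<Sum>\<gamma>\<in>mbox N. complex_of_real (a k \<gamma> * ffall \<kappa> (rvec \<gamma>)) * ch m e \<gamma>)" for e
  define D where "D = real m ^ (k * mabs \<kappa>) * delta l m a k"
  have P0: "P 0 = of_real A" by (simp add: P_def A_def ch_zero)
  have bound: "cmod (P e) \<le> D" if e: "e \<in> digits m" "e \<noteq> 0" for e
  proof -
    define \<epsilon> :: "complex ^ 's" where "\<epsilon> = (\<chi> i. exp (- \<i> * (2 * of_real pi / of_nat m) * of_int (e $ i)))"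
    have eps: "\<epsilon> $ i = cis (- (2 * pi / real m) * of_int (e $ i))" for i
      by (simp add: \<epsilon>_def cis_conv_exp mult_ac)
    have "\<epsilon> \<noteq> 1"
    proof
      assume eq1: "\<epsilon> = 1"
      obtain i where i: "e $ i \<noteq> 0" using e by (auto simp: vec_eq_iff)
      then have ei: "0 < e $ i" "e $ i < int m" using e by (auto simp: digits_def order_less_le)
      have "cis (- (2 * pi / real m) * of_int (e $ i)) = 1" using eq1 eps[of i] by simp
      then have "int m dvd e $ i" using cis_root_eq_1_iff[of m "e $ i"] m by simp
      then show False using ei zdvd_not_zless by blast
    qed
    moreover have "\<epsilon> \<in> Xi m" unfolding Xi_def \<epsilon>_def by (rule imageI[OF e(1)])
    ultimately have "cmod (cmderiv \<kappa> (symbol (a k)) \<epsilon>) \<le> D"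
      unfolding D_def using delta_bound(2)[OF m \<kappa>] by blast
    then have "cmod (symd N (a k) \<kappa> \<epsilon>) \<le> D" by (simp add: symbol_symd[OF mask] cmderiv_symd)
    \<comment> \<open>Differentiation lowers the exponents by \<kappa>. Multiplying by the monomial
      of exponent \<kappa> restores them and turns the powers of \<epsilon> into the
      character.\<close>
    moreover have "P e = (\<Prod>i\<in>UNIV. \<epsilon> $ i ^ (\<kappa> $ i)) * symd N (a k) \<kappa> \<epsilon>"
      unfolding P_def symd_def sum_distrib_left
    proof (rule sum.cong[OF refl])
      fix \<gamma> :: "int ^ 's" assume g: "\<gamma> \<in> mbox N"
      have "complex_of_real (\<Prod>j<\<kappa> $ i. (of_int (\<gamma> $ i) - real j)) * cis (- (2 * pi / real m) * of_int (e $ i) * of_int (\<gamma> $ i))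
         = \<epsilon> $ i ^ (\<kappa> $ i) * ((\<Prod>j<\<kappa> $ i. (of_int (\<gamma> $ i) - of_nat j)) * \<epsilon> $ i ^ (nat (\<gamma> $ i) - \<kappa> $ i))" for i
      proof -
        define n where "n = nat (\<gamma> $ i)"
        have n: "\<gamma> $ i = int n" using g by (simp add: n_def mbox_def)
        show ?thesis
        proof (cases "\<kappa> $ i \<le> n")
          case True
          have "cis (- (2 * pi / real m) * of_int (e $ i) * of_int (\<gamma> $ i)) = \<epsilon> $ i ^ n"
            unfolding eps n by (simp add: Complex.DeMoivre mult_ac)
          also have "\<dots> = \<epsilon> $ i ^ (\<kappa> $ i) * \<epsilon> $ i ^ (n - \<kappa> $ i)" using True by (simp add: power_add[symmetric])
          finally show ?thesis by (simp add: n)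
        next
          case False
          then have z: "(\<Prod>j<\<kappa> $ i. (of_nat n - of_nat j :: complex)) = 0" "(\<Prod>j<\<kappa> $ i. (real n - real j)) = 0"
            by (auto intro!: prod_zero)
          show ?thesis unfolding n of_int_of_nat_eq z by simp
        qed
      qed
      note factor = this
      have "complex_of_real (ffall \<kappa> (rvec \<gamma>)) * ch m e \<gamma> =
         (\<Prod>i\<in>UNIV. \<epsilon> $ i ^ (\<kappa> $ i)) * (\<Prod>i\<in>UNIV. (\<Prod>j<\<kappa> $ i. (of_int (\<gamma> $ i) - of_nat j)) * \<epsilon> $ i ^ (nat (\<gamma> $ i) - \<kappa> $ i))"
        unfolding ffall_def ch_def rvec_def prod.distrib[symmetric] 
          of_real_prod[of "\<lambda>i. \<Prod>j<\<kappa> $ i. _ i j" UNIV] vec_lambda_beta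
        by (rule prod.cong[OF refl factor])
      then show "complex_of_real (a k \<gamma> * ffall \<kappa> (rvec \<gamma>)) * ch m e \<gamma> =
         (\<Prod>i\<in>UNIV. \<epsilon> $ i ^ (\<kappa> $ i)) * (complex_of_real (a k \<gamma>) *
           (\<Prod>i\<in>UNIV. (\<Prod>j<\<kappa> $ i. (of_int (\<gamma> $ i) - of_nat j)) * \<epsilon> $ i ^ (nat (\<gamma> $ i) - \<kappa> $ i)))"
        by (simp add: mult_ac)
    qed
    moreover have "cmod (\<Prod>i\<in>UNIV. \<epsilon> $ i ^ (\<kappa> $ i)) = 1" by (simp add: prod_norm[symmetric] norm_power eps)
    ultimately show ?thesis by (simp add: norm_mult)
  qed
  have z: "0 \<in> digits m" using m by (simp add: digits_def)
  \<comment> \<open>Orthogonality applied to \<open>\<gamma> - \<gamma>0\<close> selects the coset;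
    exchanging the sums isolates the twisted moments.\<close>
  have "of_nat m ^ CARD('s) * of_real M = (\<Sum>e\<in>digits m. ch m e (- \<gamma>0) * P e)"
  proof -
    have "of_nat m ^ CARD('s) * complex_of_real M =
        (\<Sum>\<gamma>\<in>mbox N. of_real (a k \<gamma> * ffall \<kappa> (rvec \<gamma>)) * (\<Sum>e\<in>digits m. ch m e (\<gamma> - \<gamma>0)))"
      using m unfolding M_def sum.inter_filter[OF finite_mbox] of_real_sum sum_distrib_left[of "of_nat m ^ CARD('s)"]
      by (intro sum.cong refl) (simp add: ch_sum del: of_real_mult)
    also have "\<dots> = (\<Sum>e\<in>digits m. \<Sum>\<gamma>\<in>mbox N. of_real (a k \<gamma> * ffall \<kappa> (rvec \<gamma>)) * ch m e (\<gamma> - \<gamma>0))"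
      unfolding sum_distrib_left by (rule sum.swap)
    also have "\<dots> = (\<Sum>e\<in>digits m. ch m e (- \<gamma>0) * P e)"
      unfolding P_def sum_distrib_left
      by (intro sum.cong refl) (simp only: ch_diff[of m _ _ \<gamma>0] mult_ac)
    finally show ?thesis .
  qed
  also have "\<dots> = of_real A + (\<Sum>e\<in>digits m - {0}. ch m e (- \<gamma>0) * P e)"
    by (subst sum.remove[OF _ z]) (auto simp: P0 ch_zero)
  finally have eq: "of_nat m ^ CARD('s) * complex_of_real M - of_real A = (\<Sum>e\<in>digits m - {0}. ch m e (- \<gamma>0) * P e)"
    by simp
  have D0: "D \<ge> 0" using delta_bound(1)[OF m, of l a k] by (simp add: D_def)
  have "cmod (of_real (real m ^ CARD('s) * M - A)) = cmod (\<Sum>e\<in>digits m - {0}. ch m e (- \<gamma>0) * P e)"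
    unfolding eq[symmetric] by simp
  also have "\<dots> \<le> (\<Sum>e\<in>digits m - {0 :: int ^ 's}. D)"
  proof (rule order_trans[OF norm_sum sum_mono])
    show "cmod (ch m e (- \<gamma>0) * P e) \<le> D" if "e \<in> digits m - {0}" for e
      using bound[of e] that by (simp add: norm_mult norm_ch)
  qed
  also have "\<dots> \<le> (\<Sum>e\<in>(digits m :: (int ^ 's) set). D)" by (rule sum_mono2[OF finite_digits]) (use D0 in simp_all)
  also have "\<dots> = real m ^ CARD('s) * D" by (simp add: card_digits)
  finally have *: "\<bar>real m ^ CARD('s) * M - A\<bar> \<le> real m ^ CARD('s) * D" by (simp only: norm_of_real)
  have "M - A / real m ^ CARD('s) = (real m ^ CARD('s) * M - A) / real m ^ CARD('s)"
    using m by (simp add: diff_divide_distrib)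
  then have "\<bar>M - A / real m ^ CARD('s)\<bar> = \<bar>real m ^ CARD('s) * M - A\<bar> / real m ^ CARD('s)"
    by (simp add: abs_divide)
  also have "\<dots> \<le> D" using * m by (simp add: divide_le_eq mult.commute)
  finally show ?thesis unfolding M_def A_def D_def .
qed

section \<open>Monomials and the expansion of shifted monomials\<close>

definition rmono :: "nat ^ 's::finite \<Rightarrow> real ^ 's \<Rightarrow> real" where
  "rmono \<eta> x = (\<Prod>i\<in>UNIV. x $ i ^ (\<eta> $ i))"

lemma rvec_simps:
  "rvec (\<alpha> + \<beta>) = rvec \<alpha> + rvec \<beta>" "rvec (\<alpha> - \<beta>) = rvec \<alpha> - rvec \<beta>" "rvec (- \<alpha>) = - rvec \<alpha>"
  "rvec (int n *s \<alpha>) = real n *\<^sub>R rvec \<alpha>" "rvec 0 = 0" "rvec \<alpha> $ i = of_int (\<alpha> $ i)"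
  by (auto simp: rvec_def vec_eq_iff)

lemma mabs_add: "mabs (\<eta> + \<kappa>) = mabs \<eta> + mabs \<kappa>"
  by (simp add: mabs_def sum.distrib)

lemma mabs_axis [simp]: "mabs (axis i n) = n"
  by (simp add: mabs_def axis_def)

lemma mabs_zero [simp]: "mabs 0 = 0"
  by (simp add: mabs_def)

lemma mabs_eq_0 [simp]: "mabs \<eta> = 0 \<longleftrightarrow> \<eta> = 0"
  by (auto simp: mabs_def vec_eq_iff)

lemma mabs_SucE:
  assumes "mabs \<eta> = Suc n"
  obtains \<eta>' i where "\<eta> = \<eta>' + axis i 1" "mabs \<eta>' = n"
proof -
  obtain i where i: "\<eta> $ i > 0"
    using assms by (metis mabs_eq_0 nat.distinct(1) neq0_conv vec_eq_iff zero_index)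
  have e: "\<eta> = (\<chi> j. \<eta> $ j - axis i 1 $ j) + axis i 1"
    using i by (auto simp: vec_eq_iff axis_def)
  have "mabs (\<chi> j. \<eta> $ j - axis i 1 $ j) = n"
    using arg_cong[OF e, of mabs] assms unfolding mabs_add by simp
  then show ?thesis using that e by blast
qed

lemma rmono_zero [simp]: "rmono 0 x = 1"
  by (simp add: rmono_def)

lemma rmono_add: "rmono (\<eta> + \<kappa>) x = rmono \<eta> x * rmono \<kappa> x"
  by (simp add: rmono_def power_add prod.distrib)

lemma rmono_axis: "rmono (axis i 1) x = x $ i"
proof -
  have "rmono (axis i 1) x = (\<Prod>j\<in>UNIV. if j = i then x $ i else 1)"
    unfolding rmono_def by (intro prod.cong) (auto simp: axis_def)
  then show ?thesis by simp
qed

lemma rmono_Suc: "rmono (\<eta> + axis i 1) x = x $ i * rmono \<eta> x"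
  unfolding rmono_add rmono_axis by simp

lemma rmono_scale: "rmono \<eta> (c *\<^sub>R x) = c ^ mabs \<eta> * rmono \<eta> x"
  by (simp add: rmono_def mabs_def power_mult_distrib prod.distrib power_sum)

lemma ffall_zero: "ffall 0 x = 1"
  by (simp add: ffall_def)

lemma ffall_Suc: "x $ i * ffall \<kappa> x = ffall (\<kappa> + axis i 1) x + real (\<kappa> $ i) * ffall \<kappa> x"
proof -
  have s: "ffall \<kappa> x = (\<Prod>j<\<kappa> $ i. (x $ i - real j)) * (\<Prod>i\<in>UNIV - {i}. \<Prod>j<\<kappa> $ i. (x $ i - real j))" for \<kappa>
    unfolding ffall_def by (rule prod.remove) auto
  have "(\<Prod>u\<in>UNIV - {i}. \<Prod>j<(\<kappa> + axis i 1) $ u. (x $ u - real j)) = (\<Prod>u\<in>UNIV - {i}. \<Prod>j<\<kappa> $ u. (x $ u - real j))"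
    by (intro prod.cong) (auto simp: axis_def)
  then show ?thesis unfolding s by (simp add: axis_def algebra_simps)
qed

text \<open>Mixed functions \<open>g\<^sub>\<kappa>(x) y\<^sup>\<eta>\<close> of joint degree at most \<open>n\<close> and of degree
  strictly below \<open>n\<close> in \<open>y\<close>. They contain what is left of \<open>(x + y - e)\<^sup>\<eta>\<close> after its top
  term \<open>y\<^sup>\<eta>\<close> is removed; \<open>g\<close> is either a falling factorial or a monomial.\<close>

inductive lowmix :: "(nat ^ 's::finite \<Rightarrow> real ^ 's \<Rightarrow> real) \<Rightarrow> nat \<Rightarrow> (real ^ 's \<Rightarrow> real ^ 's \<Rightarrow> real) \<Rightarrow> bool"
  for g n where
  zero: "lowmix g n (\<lambda>x y. 0)"
| basis: "mabs \<kappa> + mabs \<eta> \<le> n \<Longrightarrow> mabs \<eta> < n \<Longrightarrow> lowmix g n (\<lambda>x y. g \<kappa> x * rmono \<eta> y)"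
| add: "lowmix g n F \<Longrightarrow> lowmix g n G \<Longrightarrow> lowmix g n (\<lambda>x y. F x y + G x y)"
| scale: "lowmix g n F \<Longrightarrow> lowmix g n (\<lambda>x y. c * F x y)"

lemma lowmix_Suc: "lowmix g n F \<Longrightarrow> lowmix g (Suc n) F"
  by (induction rule: lowmix.induct) (auto intro: lowmix.intros)

lemma lowmix_mult_y: "lowmix g n F \<Longrightarrow> lowmix g (Suc n) (\<lambda>x y. y $ i * F x y)"
proof (induction rule: lowmix.induct)
  case (basis \<kappa> \<eta>)
  have "lowmix g (Suc n) (\<lambda>x y. g \<kappa> x * rmono (\<eta> + axis i 1) y)"
    by (rule lowmix.basis) (use basis in \<open>auto simp: mabs_add\<close>)
  then show ?case by (simp only: rmono_Suc mult.left_commute)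
next
  case (add F G)
  then show ?case using lowmix.add[OF add.IH] by (simp add: distrib_left)
next
  case (scale F c)
  then show ?case using lowmix.scale[OF scale.IH, of c] by (simp add: mult_ac)
qed (simp add: lowmix.zero)

text \<open>The hypothesis is the multiplication rule of the family \<open>g\<close>:
  \<open>c \<kappa> i\<close> is \<open>\<kappa> $ i\<close> for falling factorials and 0 for
  monomials.\<close>

lemma lowmix_mult_x:
  assumes g: "\<And>\<kappa> i x. x $ i * g \<kappa> x = g (\<kappa> + axis i 1) x + c \<kappa> i * g \<kappa> x"
  shows "lowmix g n F \<Longrightarrow> lowmix g (Suc n) (\<lambda>x y. x $ i * F x y)"
proof (induction rule: lowmix.induct)
  case (basis \<kappa> \<eta>)
  have 1: "lowmix g (Suc n) (\<lambda>x y. g (\<kappa> + axis i 1) x * rmono \<eta> y)"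
    by (rule lowmix.basis) (use basis in \<open>auto simp: mabs_add\<close>)
  have 2: "lowmix g (Suc n) (\<lambda>x y. g \<kappa> x * rmono \<eta> y)"
    by (rule lowmix.basis) (use basis in auto)
  have "lowmix g (Suc n) (\<lambda>x y. g (\<kappa> + axis i 1) x * rmono \<eta> y + c \<kappa> i * (g \<kappa> x * rmono \<eta> y))"
    by (rule lowmix.add[OF 1 lowmix.scale[OF 2]])
  also have "(\<lambda>x y. g (\<kappa> + axis i 1) x * rmono \<eta> y + c \<kappa> i * (g \<kappa> x * rmono \<eta> y)) = (\<lambda>x y. x $ i * (g \<kappa> x * rmono \<eta> y))"
    by (simp only: mult.assoc[symmetric] g distrib_right)
  finally show ?case .
next
  case (add F G)
  then show ?case using lowmix.add[OF add.IH] by (simp add: distrib_left)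
next
  case (scale F c)
  then show ?case using lowmix.scale[OF scale.IH, of c] by (simp add: mult_ac)
qed (simp add: lowmix.zero)

text \<open>Induction on the degree. The additional factor is \<open>x $ i + y $ i - e $ i\<close>,
  and only its part \<open>y $ i\<close> acting on the previous top term reproduces a top term,
  which is subtracted.\<close>

lemma lowmix_expand:
  assumes g0: "\<And>x. g 0 x = 1" and g: "\<And>\<kappa> i x. x $ i * g \<kappa> x = g (\<kappa> + axis i 1) x + c \<kappa> i * g \<kappa> x"
  shows "lowmix g (mabs \<eta>) (\<lambda>x y. rmono \<eta> (x + y - e) - rmono \<eta> y)"
proof (induction "mabs \<eta>" arbitrary: \<eta>)
  case 0
  then have "\<eta> = 0" by simp
  then show ?case by (simp add: lowmix.zero)
next
  case (Suc n)
  obtain \<eta>' i where \<eta>: "\<eta> = \<eta>' + axis i 1" "mabs \<eta>' = n" using mabs_SucE[OF Suc.hyps(2)[symmetric]] .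
  define r where "r x y = rmono \<eta>' (x + y - e) - rmono \<eta>' y" for x y
  have r: "lowmix g n r" using Suc.hyps(1)[of \<eta>'] \<eta> by (simp add: r_def[abs_def])
  have n0: "n \<ge> 0" by simp
  have p: "lowmix g (Suc n) (\<lambda>x y. g (axis i 1) x * rmono \<eta>' y)"
    and q: "lowmix g (Suc n) (\<lambda>x y. g 0 x * rmono \<eta>' y)"
    using \<eta> by (auto intro!: lowmix.basis)
  \<comment> \<open>In degree one the multiplication rule expresses the coordinate itself through
    the family.\<close>
  have gp: "g (axis i 1) x = x $ i - c 0 i" for x
    using g[of x i 0] g0 by simp
  have "lowmix g (Suc n) (\<lambda>x y. (x $ i * r x y + (y $ i * r x y + (- e $ i) * r x y)) +
      (g (axis i 1) x * rmono \<eta>' y + (c 0 i - e $ i) * (g 0 x * rmono \<eta>' y)))"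
    by (intro lowmix.add lowmix.scale lowmix_mult_y lowmix_mult_x[OF g] lowmix_Suc r p q)
  also have "(\<lambda>x y. (x $ i * r x y + (y $ i * r x y + (- e $ i) * r x y)) +
      (g (axis i 1) x * rmono \<eta>' y + (c 0 i - e $ i) * (g 0 x * rmono \<eta>' y))) =
      (\<lambda>x y. rmono \<eta> (x + y - e) - rmono \<eta> y)"
    unfolding \<eta>(1) rmono_Suc g0 r_def
    by (intro ext) (simp only: gp vector_add_component vector_minus_component, simp add: algebra_simps)
  finally show ?case using Suc.hyps(2) by simp
qed

section \<open>Transition operators, moments and invariant boxes\<close>

definition tr :: "nat \<Rightarrow> nat \<Rightarrow> (int ^ 's::finite \<Rightarrow> real) \<Rightarrow> int ^ 's \<Rightarrow> (int ^ 's \<Rightarrow> real) \<Rightarrow> int ^ 's \<Rightarrow> real" where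
  "tr m N a \<epsilon> w = (\<lambda>\<alpha>. \<Sum>\<gamma>\<in>mbox N. a \<gamma> * w (\<epsilon> + int m *s \<alpha> - \<gamma>))"

definition mom :: "nat ^ 's::finite \<Rightarrow> (int ^ 's \<Rightarrow> real) \<Rightarrow> real" where
  "mom \<eta> w = (\<Sum>\<^sub>\<infinity>\<beta>. rmono \<eta> (rvec \<beta>) * w \<beta>)"

text \<open>Componentwise the interval from \<open>-1\<close> to \<open>N / (m - 1)\<close>, widened
  by \<open>d / (m - 1)\<close> on both sides and multiplied by \<open>m - 1\<close> to stay in the
  integers. Slack 0 is the interval invariant under
  \<open>\<beta> \<mapsto> (\<beta> + \<gamma> - \<epsilon>) / m\<close>; slack 1 is the index set
  \<open>Kset m N\<close>.\<close>

definition lbox :: "nat \<Rightarrow> nat \<Rightarrow> nat \<Rightarrow> (int ^ 's::finite) set" where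
  "lbox m N d = {\<beta>. \<forall>i. - (int m - 1) - int d \<le> (int m - 1) * \<beta> $ i \<and> (int m - 1) * \<beta> $ i \<le> int N + int d}"

definition supp :: "nat \<Rightarrow> nat \<Rightarrow> nat \<Rightarrow> (int ^ 's::finite \<Rightarrow> real) \<Rightarrow> bool" where
  "supp m N d w \<longleftrightarrow> (\<forall>\<beta>. \<beta> \<notin> lbox m N d \<longrightarrow> w \<beta> = 0)"

lemma finite_lbox [simp]:
  assumes "m \<ge> 2"
  shows "finite (lbox m N d)"
proof (rule finite_subset)
  show "finite {\<beta> :: int ^ 's. \<forall>i. \<beta> $ i \<in> {- (int m + int d) .. int N + int d}}"
    by (rule finite_vec_set) simp
  have "\<beta> $ i \<in> {- (int m + int d) .. int N + int d}" if "\<beta> \<in> lbox m N d" for \<beta> :: "int ^ 's" and i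
  proof -
    have b: "- (int m - 1) - int d \<le> (int m - 1) * \<beta> $ i" "(int m - 1) * \<beta> $ i \<le> int N + int d"
      using that by (auto simp: lbox_def)
    have m1: "int m - 1 \<ge> 1" using assms by simp
    have "\<beta> $ i \<le> int N + int d"
    proof (cases "\<beta> $ i \<le> 0")
      case False
      then have "1 * \<beta> $ i \<le> (int m - 1) * \<beta> $ i" using m1 by (intro mult_right_mono) auto
      then show ?thesis using b by simp
    qed simp
    moreover have "- (\<beta> $ i) \<le> int m + int d"
    proof (cases "\<beta> $ i \<ge> 0")
      case False
      then have "1 * (- \<beta> $ i) \<le> (int m - 1) * (- \<beta> $ i)" using m1 by (intro mult_right_mono) auto
      then show ?thesis using b by simp
    qed simp
    ultimately show ?thesis by simp
  qed
  then show "lbox m N d \<subseteq> {\<beta> :: int ^ 's. \<forall>i. \<beta> $ i \<in> {- (int m + int d) .. int N + int d}}" by blast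
qed

lemma lbox_mono: "d \<le> d' \<Longrightarrow> lbox m N d \<subseteq> lbox m N d'"
  unfolding lbox_def by (auto intro: order_trans) (smt (verit) of_nat_le_iff)+

lemma supp_mono: "supp m N d w \<Longrightarrow> d \<le> d' \<Longrightarrow> supp m N d' w"
  using lbox_mono unfolding supp_def by blast

text \<open>The maps \<open>\<beta> \<mapsto> (\<beta> + \<gamma> - \<epsilon>) / m\<close> contract
  towards the box with slack 0, so the slack is divided by \<open>m\<close>; integrality allows
  rounding down.\<close>

lemma lbox_step:
  assumes m: "m \<ge> 2" and b: "\<beta> \<in> lbox m N d" and g: "\<gamma> \<in> mbox N" and e: "\<epsilon> \<in> digits m"
    and eq: "\<epsilon> + int m *s \<alpha> = \<beta> + \<gamma>"
  shows "\<alpha> \<in> lbox m N (d div m)"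
  unfolding lbox_def mem_Collect_eq
proof
  fix i
  let ?X = "(int m - 1) * \<alpha> $ i"
  have m1: "int m - 1 \<ge> 1" using m by simp
  have le: "X \<le> int (d div m)" if "X * int m \<le> int d" for X
    using zdiv_mono1[OF that, of "int m"] m by (simp add: zdiv_int)
  have "\<epsilon> $ i + int m * \<alpha> $ i = \<beta> $ i + \<gamma> $ i" using arg_cong[OF eq, of "\<lambda>v. v $ i"] by simp
  then have eqi: "int m * \<alpha> $ i = \<beta> $ i + \<gamma> $ i - \<epsilon> $ i" by simp
  have "?X * int m = (int m - 1) * (int m * \<alpha> $ i)" by simp
  then have X: "?X * int m = (int m - 1) * \<beta> $ i + (int m - 1) * \<gamma> $ i - (int m - 1) * \<epsilon> $ i"
    by (simp only: eqi distrib_left right_diff_distrib)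
  have bb: "- (int m - 1) - int d \<le> (int m - 1) * \<beta> $ i" "(int m - 1) * \<beta> $ i \<le> int N + int d"
    using b by (auto simp: lbox_def)
  have gg: "0 \<le> (int m - 1) * \<gamma> $ i" "(int m - 1) * \<gamma> $ i \<le> (int m - 1) * int N"
    using g m1 by (auto simp: mbox_def intro!: mult_left_mono mult_nonneg_nonneg)
  have ee: "0 \<le> (int m - 1) * \<epsilon> $ i" "(int m - 1) * \<epsilon> $ i \<le> (int m - 1) * (int m - 1)"
    using e m1 by (auto simp: digits_def intro!: mult_left_mono mult_nonneg_nonneg)
  have "(?X - int N) * int m \<le> int d"
    using X bb gg ee by (simp add: algebra_simps)
  moreover have "(- (int m - 1) - ?X) * int m \<le> int d"
    using X bb gg ee by (simp add: algebra_simps)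
  ultimately show "- (int m - 1) - int (d div m) \<le> ?X \<and> ?X \<le> int N + int (d div m)"
    using le[of "?X - int N"] le[of "- (int m - 1) - ?X"] by linarith
qed

lemma supp_tr:
  fixes w :: "int ^ 's::finite \<Rightarrow> real"
  assumes m: "m \<ge> 2" and e: "\<epsilon> \<in> digits m" and w: "supp m N d w"
  shows "supp m N (d div m) (tr m N a \<epsilon> w)"
  unfolding supp_def
proof (intro allI impI)
  fix \<alpha> :: "int ^ 's" assume "\<alpha> \<notin> lbox m N (d div m)"
  then have "\<epsilon> + int m *s \<alpha> - \<gamma> \<notin> lbox m N d" if "\<gamma> \<in> mbox N" for \<gamma>
    using lbox_step[OF m _ that e] by auto
  then show "tr m N a \<epsilon> w \<alpha> = 0"
    using w by (auto simp: tr_def supp_def intro!: sum.neutral)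
qed

lemma mom_sum:
  assumes "m \<ge> 2" "supp m N d w"
  shows "mom \<eta> w = (\<Sum>\<beta>\<in>lbox m N d. rmono \<eta> (rvec \<beta>) * w \<beta>)"
  unfolding mom_def by (rule infsum_finite_support) (use assms in \<open>auto simp: supp_def\<close>)

lemma tr_bound:
  fixes w :: "int ^ 's::finite \<Rightarrow> real"
  assumes "\<And>\<gamma>. \<bar>a \<gamma>\<bar> \<le> B" "\<And>\<beta>. \<bar>w \<beta>\<bar> \<le> H"
  shows "\<bar>tr m N a \<epsilon> w \<alpha>\<bar> \<le> real (card (mbox N :: (int ^ 's) set)) * B * H"
    (is "_ \<le> real (card ?A) * B * H")
proof -
  have "\<bar>tr m N a \<epsilon> w \<alpha>\<bar> \<le> (\<Sum>\<gamma>\<in>?A. \<bar>a \<gamma> * w (\<epsilon> + int m *s \<alpha> - \<gamma>)\<bar>)"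
    unfolding tr_def by (rule sum_abs)
  also have "\<dots> \<le> (\<Sum>\<gamma>\<in>?A. B * H)"
    using assms order_trans[OF abs_ge_zero assms(1)] unfolding abs_mult by (intro sum_mono mult_mono) auto
  finally show ?thesis by simp
qed

text \<open>The sum of the nonnegative constants dominates each of them, and enlarging a constant is
  harmless where \<open>g\<close> is nonnegative.\<close>

lemma finite_uniform_const:
  assumes "finite A" "\<And>x. x \<in> A \<Longrightarrow> \<exists>C\<ge>0::real. \<forall>y. Q x y \<longrightarrow> f x y \<le> C * g x y"
    and g: "\<And>x y. x \<in> A \<Longrightarrow> Q x y \<Longrightarrow> g x y \<ge> 0"
  shows "\<exists>C\<ge>0. \<forall>x\<in>A. \<forall>y. Q x y \<longrightarrow> f x y \<le> C * g x y"
proof -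
  from assms(2) have "\<forall>x\<in>A. \<exists>C. C\<ge>0 \<and> (\<forall>y. Q x y \<longrightarrow> f x y \<le> C * g x y)" by blast
  from bchoice[OF this] obtain C where C: "\<forall>x\<in>A. C x \<ge> 0 \<and> (\<forall>y. Q x y \<longrightarrow> f x y \<le> C x * g x y)"
    by blast
  have "f x y \<le> sum C A * g x y" if "x \<in> A" "Q x y" for x y
  proof -
    have "C x \<le> sum C A" using C that assms(1) by (intro member_le_sum) auto
    then show ?thesis using C that g[OF that] by (meson mult_right_mono order_trans)
  qed
  moreover have "sum C A \<ge> 0" using C by (intro sum_nonneg) auto
  ultimately show ?thesis by blast
qed

section \<open>Moments under one transition step\<close>

locale subdivision_scheme =
  fixes a :: "nat \<Rightarrow> int ^ 's::finite \<Rightarrow> real" and l m N :: nat and B :: real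
  assumes m2: "m \<ge> 2"
    and mask: "k \<ge> 1 \<Longrightarrow> is_mask N (a k)"
    and symbol1: "k \<ge> 1 \<Longrightarrow> symbol (a k) 1 = of_nat m ^ CARD('s)"
    and bnd: "k \<ge> 1 \<Longrightarrow> \<bar>a k \<alpha>\<bar> \<le> B"
begin

abbreviation \<delta> :: "nat \<Rightarrow> real" where "\<delta> \<equiv> delta l m a"

lemma B_nonneg: "B \<ge> 0" using bnd[of 1 0] by simp

lemma delta_nonneg [simp]: "\<delta> k \<ge> 0" by (rule delta_bound(1)[OF m2])

lemma sum_mask: "k \<ge> 1 \<Longrightarrow> (\<Sum>\<gamma>\<in>mbox N. a k \<gamma>) = real m ^ CARD('s)"
proof -
  assume k: "k \<ge> 1"
  have "complex_of_real (\<Sum>\<gamma>\<in>mbox N. a k \<gamma>) = symbol (a k) 1"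
    by (simp add: symbol_symd[OF mask[OF k]] symd_def)
  also have "\<dots> = complex_of_real (real m ^ CARD('s))" by (simp add: symbol1[OF k])
  finally show ?thesis by (simp only: of_real_eq_iff)
qed

definition coset :: "int ^ 's \<Rightarrow> (int ^ 's) set" where
  "coset \<gamma>0 = {\<gamma>\<in>mbox N. \<forall>i. int m dvd (\<gamma> - \<gamma>0) $ i}"

definition avg :: "nat \<Rightarrow> nat ^ 's \<Rightarrow> real" where
  "avg k \<kappa> = (\<Sum>\<gamma>\<in>mbox N. a k \<gamma> * ffall \<kappa> (rvec \<gamma>)) / real m ^ CARD('s)"

text \<open>What the moments of \<open>tr m N (a k) \<epsilon> w\<close> become when written through
  \<open>w\<close>: \<gamma> runs over the coset for which
  \<open>(\<beta> + \<gamma> - \<epsilon>) / m\<close> is a lattice point, and \<open>G\<close> is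
  the polynomial weight.\<close>

definition cform :: "nat \<Rightarrow> nat \<Rightarrow> int ^ 's \<Rightarrow> (int ^ 's \<Rightarrow> real) \<Rightarrow> (real ^ 's \<Rightarrow> real ^ 's \<Rightarrow> real) \<Rightarrow> real" where
  "cform d k \<epsilon> w G = (\<Sum>\<beta>\<in>lbox m N d. \<Sum>\<gamma>\<in>coset (\<epsilon> - \<beta>). G (rvec \<gamma>) (rvec \<beta>) * a k \<gamma> * w \<beta>)"

text \<open>The substitution \<open>m\<alpha> = \<beta> + \<gamma> - \<epsilon>\<close>; by
  homogeneity the monomial at \<alpha> absorbs the power of \<open>m\<close>.\<close>

lemma mom_tr:
  assumes k: "k \<ge> 1" and e: "\<epsilon> \<in> digits m" and w: "supp m N d w"
  shows "real m ^ mabs \<eta> * mom \<eta> (tr m N (a k) \<epsilon> w) =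
     cform d k \<epsilon> w (\<lambda>x y. rmono \<eta> (x + y - rvec \<epsilon>))"
proof -
  let ?S = "lbox m N d :: (int ^ 's) set"
  have fin: "finite ?S" using m2 by simp
  have sub: "supp m N d (tr m N (a k) \<epsilon> w)"
    by (rule supp_mono[OF supp_tr[OF m2 e w]]) (simp add: div_le_dividend)
  have "real m ^ mabs \<eta> * mom \<eta> (tr m N (a k) \<epsilon> w) =
      (\<Sum>\<alpha>\<in>?S. \<Sum>\<gamma>\<in>mbox N. real m ^ mabs \<eta> * rmono \<eta> (rvec \<alpha>) * a k \<gamma> * w (\<epsilon> + int m *s \<alpha> - \<gamma>))"
    unfolding mom_sum[OF m2 sub] by (simp add: tr_def sum_distrib_left mult_ac)
  \<comment> \<open>An indicator of \<open>\<beta> = \<epsilon> + m\<alpha> - \<gamma>\<close> makes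
    \<beta> a free summation index, so that the sum over \<alpha> can be moved innermost, where at
    most one term survives.\<close>
  also have "\<dots> = (\<Sum>\<alpha>\<in>?S. \<Sum>\<gamma>\<in>mbox N. \<Sum>\<beta>\<in>?S. if \<beta> = \<epsilon> + int m *s \<alpha> - \<gamma>
      then real m ^ mabs \<eta> * rmono \<eta> (rvec \<alpha>) * a k \<gamma> * w \<beta> else 0)"
    using w fin by (intro sum.cong refl) (auto simp: supp_def)
  also have "\<dots> = (\<Sum>\<alpha>\<in>?S. \<Sum>\<beta>\<in>?S. \<Sum>\<gamma>\<in>mbox N. if \<beta> = \<epsilon> + int m *s \<alpha> - \<gamma>
      then real m ^ mabs \<eta> * rmono \<eta> (rvec \<alpha>) * a k \<gamma> * w \<beta> else 0)"
    by (intro sum.cong refl sum.swap)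
  also have "\<dots> = (\<Sum>\<beta>\<in>?S. \<Sum>\<alpha>\<in>?S. \<Sum>\<gamma>\<in>mbox N. if \<beta> = \<epsilon> + int m *s \<alpha> - \<gamma>
      then real m ^ mabs \<eta> * rmono \<eta> (rvec \<alpha>) * a k \<gamma> * w \<beta> else 0)"
    by (rule sum.swap)
  also have "\<dots> = (\<Sum>\<beta>\<in>?S. \<Sum>\<gamma>\<in>mbox N. \<Sum>\<alpha>\<in>?S. if \<beta> = \<epsilon> + int m *s \<alpha> - \<gamma>
      then real m ^ mabs \<eta> * rmono \<eta> (rvec \<alpha>) * a k \<gamma> * w \<beta> else 0)"
    by (intro sum.cong refl sum.swap)
  also have "\<dots> = (\<Sum>\<beta>\<in>?S. \<Sum>\<gamma>\<in>mbox N. if \<forall>i. int m dvd (\<gamma> - (\<epsilon> - \<beta>)) $ i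
      then rmono \<eta> (rvec \<gamma> + rvec \<beta> - rvec \<epsilon>) * a k \<gamma> * w \<beta> else 0)"
  proof (intro sum.cong refl)
    fix \<beta> \<gamma> :: "int ^ 's" assume b: "\<beta> \<in> ?S" and g: "\<gamma> \<in> mbox N"
    show "(\<Sum>\<alpha>\<in>?S. if \<beta> = \<epsilon> + int m *s \<alpha> - \<gamma> then real m ^ mabs \<eta> * rmono \<eta> (rvec \<alpha>) * a k \<gamma> * w \<beta> else 0) =
      (if \<forall>i. int m dvd (\<gamma> - (\<epsilon> - \<beta>)) $ i then rmono \<eta> (rvec \<gamma> + rvec \<beta> - rvec \<epsilon>) * a k \<gamma> * w \<beta> else 0)"
    proof (cases "\<forall>i. int m dvd (\<gamma> - (\<epsilon> - \<beta>)) $ i")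
      case True
      define \<alpha>0 where "\<alpha>0 = (\<chi> i. (\<gamma> - (\<epsilon> - \<beta>)) $ i div int m)"
      have a0: "int m *s \<alpha>0 = \<gamma> - (\<epsilon> - \<beta>)" using True by (auto simp: \<alpha>0_def vec_eq_iff)
      then have eq: "\<epsilon> + int m *s \<alpha>0 = \<beta> + \<gamma>" by simp
      have inS: "\<alpha>0 \<in> ?S" using lbox_step[OF m2 b g e eq] lbox_mono[of "d div m" d] by (auto simp: div_le_dividend)
      have "\<beta> = \<epsilon> + int m *s \<alpha> - \<gamma> \<longleftrightarrow> \<alpha> = \<alpha>0" for \<alpha>
      proof
        assume "\<beta> = \<epsilon> + int m *s \<alpha> - \<gamma>"
        then have "int m *s \<alpha> = int m *s \<alpha>0" unfolding a0 by simp
        then show "\<alpha> = \<alpha>0" using m2 by (simp add: vec_eq_iff)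
      qed (use eq in \<open>simp add: algebra_simps\<close>)
      moreover have "rvec \<gamma> + rvec \<beta> - rvec \<epsilon> = real m *\<^sub>R rvec \<alpha>0"
        using arg_cong[OF a0, of rvec] by (simp add: rvec_simps)
      ultimately show ?thesis using True inS fin by (simp add: rmono_scale)
    next
      case False
      have *: "\<beta> \<noteq> \<epsilon> + int m *s \<alpha> - \<gamma>" for \<alpha>
      proof
        assume "\<beta> = \<epsilon> + int m *s \<alpha> - \<gamma>"
        then have "\<gamma> - (\<epsilon> - \<beta>) = int m *s \<alpha>" by simp
        then show False using False by simp
      qed
      show ?thesis unfolding if_not_P[OF False] by (simp add: *)
    qed
  qed
  also have "\<dots> = cform d k \<epsilon> w (\<lambda>x y. rmono \<eta> (x + y - rvec \<epsilon>))"
    unfolding cform_def coset_def by (simp add: sum.inter_filter)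
  finally show ?thesis .
qed

text \<open>Each inner sum over a coset is replaced by its mean \<open>avg k \<kappa>\<close> over
  all cosets, which pulls out of the sum over \<beta>; the replacement error is
  \<open>coset_moment\<close>.\<close>

lemma cform_basis:
  assumes k: "k \<ge> 1" and w: "supp m N d w" and H: "\<And>\<beta>. \<bar>w \<beta>\<bar> \<le> H" and \<kappa>: "mabs \<kappa> \<le> l"
  shows "\<bar>cform d k \<epsilon> w (\<lambda>x y. ffall \<kappa> x * rmono \<eta> y) - avg k \<kappa> * mom \<eta> w\<bar> \<le>
     (\<Sum>\<beta>\<in>(lbox m N d :: (int ^ 's) set). \<bar>rmono \<eta> (rvec \<beta>)\<bar>) * (real m ^ (k * mabs \<kappa>) * \<delta> k * H)"
proof -
  define M where "M \<beta> = (\<Sum>\<gamma>\<in>coset (\<epsilon> - \<beta>). a k \<gamma> * ffall \<kappa> (rvec \<gamma>))" for \<beta>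
  have M: "\<bar>M \<beta> - avg k \<kappa>\<bar> \<le> real m ^ (k * mabs \<kappa>) * \<delta> k" for \<beta>
    unfolding M_def avg_def coset_def by (rule coset_moment[where a = a and k = k, OF m2 mask[OF k] \<kappa>])
  have "cform d k \<epsilon> w (\<lambda>x y. ffall \<kappa> x * rmono \<eta> y) = (\<Sum>\<beta>\<in>lbox m N d. rmono \<eta> (rvec \<beta>) * w \<beta> * M \<beta>)"
    unfolding cform_def M_def sum_distrib_left by (intro sum.cong refl) (simp add: mult_ac)
  then have "cform d k \<epsilon> w (\<lambda>x y. ffall \<kappa> x * rmono \<eta> y) - avg k \<kappa> * mom \<eta> w =
     (\<Sum>\<beta>\<in>lbox m N d. rmono \<eta> (rvec \<beta>) * w \<beta> * (M \<beta> - avg k \<kappa>))"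
    unfolding mom_sum[OF m2 w] sum_distrib_left by (simp add: right_diff_distrib sum_subtractf mult_ac)
  also have "\<bar>\<dots>\<bar> \<le> (\<Sum>\<beta>\<in>(lbox m N d :: (int ^ 's) set). \<bar>rmono \<eta> (rvec \<beta>)\<bar> * H * (real m ^ (k * mabs \<kappa>) * \<delta> k))"
    using M H order_trans[OF abs_ge_zero H]
    by (intro order_trans[OF sum_abs] sum_mono) (auto simp: abs_mult intro!: mult_mono)
  also have "\<dots> = (\<Sum>\<beta>\<in>(lbox m N d :: (int ^ 's) set). \<bar>rmono \<eta> (rvec \<beta>)\<bar>) * (real m ^ (k * mabs \<kappa>) * \<delta> k * H)"
    unfolding sum_distrib_right by (simp only: mult_ac)
  finally show ?thesis .
qed

lemma avg_zero: "k \<ge> 1 \<Longrightarrow> avg k 0 = 1"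
  using m2 by (simp add: avg_def ffall_zero sum_mask)

lemma avg_bound: "k \<ge> 1 \<Longrightarrow> \<bar>avg k \<kappa>\<bar> \<le> (\<Sum>\<gamma>\<in>(mbox N :: (int ^ 's) set). B * \<bar>ffall \<kappa> (rvec \<gamma>)\<bar>)"
proof -
  assume k: "k \<ge> 1"
  have "\<bar>avg k \<kappa>\<bar> \<le> \<bar>\<Sum>\<gamma>\<in>mbox N. a k \<gamma> * ffall \<kappa> (rvec \<gamma>)\<bar>"
    unfolding avg_def abs_divide using m2 by (simp add: divide_le_eq mult_le_cancel_left1)
  also have "\<dots> \<le> (\<Sum>\<gamma>\<in>(mbox N :: (int ^ 's) set). B * \<bar>ffall \<kappa> (rvec \<gamma>)\<bar>)"
    by (intro order_trans[OF sum_abs] sum_mono) (auto simp: abs_mult intro!: mult_right_mono bnd k)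
  finally show ?thesis .
qed

definition lowmom :: "nat \<Rightarrow> (int ^ 's \<Rightarrow> real) \<Rightarrow> real" where
  "lowmom n w = (\<Sum>\<eta>\<in>{\<eta>. mabs \<eta> < n}. \<bar>mom \<eta> w\<bar>)"

lemma lowmom_nonneg: "lowmom n w \<ge> 0" by (auto simp: lowmom_def intro: sum_nonneg)

text \<open>Degree below \<open>n\<close> in \<open>y\<close> leaves only moments of order below
  \<open>n\<close>; joint degree at most \<open>n\<close> bounds the order of the derivatives of the
  symbol by \<open>n\<close>, hence the power of \<open>m\<close> in front of the defect.\<close>

lemma cform_lowmix:
  assumes "lowmix ffall n G" and n: "n \<le> l"
  shows "\<exists>C\<ge>0. \<forall>k\<ge>1. \<forall>\<epsilon> w H. supp m N d w \<longrightarrow> (\<forall>\<beta>. \<bar>w \<beta>\<bar> \<le> H) \<longrightarrow>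
     \<bar>cform d k \<epsilon> w G\<bar> \<le> C * (lowmom n w + real m ^ (k * n) * \<delta> k * H)"
  using assms(1)
proof (induction rule: lowmix.induct)
  case zero
  then show ?case by (intro exI[of _ 0]) (simp add: cform_def)
next
  case (basis \<kappa> \<eta>)
  define C1 where "C1 = (\<Sum>\<gamma>\<in>(mbox N :: (int ^ 's) set). B * \<bar>ffall \<kappa> (rvec \<gamma>)\<bar>)"
  define C2 where "C2 = (\<Sum>\<beta>\<in>(lbox m N d :: (int ^ 's) set). \<bar>rmono \<eta> (rvec \<beta>)\<bar>)"
  have C: "C1 \<ge> 0" "C2 \<ge> 0" unfolding C1_def C2_def using B_nonneg by (auto intro!: sum_nonneg)
  have "\<bar>cform d k \<epsilon> w (\<lambda>x y. ffall \<kappa> x * rmono \<eta> y)\<bar> \<le> (C1 + C2) * (lowmom n w + real m ^ (k * n) * \<delta> k * H)"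
    if k: "k \<ge> 1" and w: "supp m N d w" and H: "\<forall>\<beta>. \<bar>w \<beta>\<bar> \<le> H" for k \<epsilon> w H
  proof -
    have H0: "H \<ge> 0" using H order_trans[OF abs_ge_zero] by blast
    have "real m ^ (k * mabs \<kappa>) \<le> real m ^ (k * n)"
      using basis m2 by (intro power_increasing) auto
    then have p: "real m ^ (k * mabs \<kappa>) * \<delta> k * H \<le> real m ^ (k * n) * \<delta> k * H"
      using H0 by (intro mult_right_mono) auto
    have q: "\<bar>mom \<eta> w\<bar> \<le> lowmom n w"
      unfolding lowmom_def by (rule member_le_sum) (use basis in \<open>auto intro: finite_mabs_less\<close>)
    have "\<bar>cform d k \<epsilon> w (\<lambda>x y. ffall \<kappa> x * rmono \<eta> y)\<bar> \<le> \<bar>avg k \<kappa> * mom \<eta> w\<bar> + C2 * (real m ^ (k * mabs \<kappa>) * \<delta> k * H)"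
      using cform_basis[OF k w, of H \<kappa> \<epsilon> \<eta>] H basis n unfolding C2_def[symmetric] by fastforce
    also have "\<dots> \<le> C1 * lowmom n w + C2 * (real m ^ (k * n) * \<delta> k * H)"
      unfolding abs_mult C1_def
      by (intro add_mono[OF mult_mono[OF avg_bound[OF k] q] mult_left_mono[OF p C(2)]] C(1)[unfolded C1_def]) simp
    also have "\<dots> \<le> (C1 + C2) * (lowmom n w + real m ^ (k * n) * \<delta> k * H)"
    proof -
      have "0 \<le> C1 * (real m ^ (k * n) * \<delta> k * H) + C2 * lowmom n w"
        using C H0 lowmom_nonneg by simp
      then show ?thesis by (simp add: algebra_simps)
    qed
    finally show ?thesis .
  qed
  then show ?case using C by (intro exI[of _ "C1 + C2"]) auto
next
  case (add F G)
  from add.IH(1) obtain C1 where C1: "C1 \<ge> 0"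
   "\<forall>k\<ge>1. \<forall>\<epsilon> w H. supp m N d w \<longrightarrow> (\<forall>\<beta>. \<bar>w \<beta>\<bar> \<le> H) \<longrightarrow>
     \<bar>cform d k \<epsilon> w F\<bar> \<le> C1 * (lowmom n w + real m ^ (k * n) * \<delta> k * H)" by (elim exE conjE)
  from add.IH(2) obtain C2 where C2: "C2 \<ge> 0"
   "\<forall>k\<ge>1. \<forall>\<epsilon> w H. supp m N d w \<longrightarrow> (\<forall>\<beta>. \<bar>w \<beta>\<bar> \<le> H) \<longrightarrow>
     \<bar>cform d k \<epsilon> w G\<bar> \<le> C2 * (lowmom n w + real m ^ (k * n) * \<delta> k * H)" by (elim exE conjE)
  have eq: "cform d k \<epsilon> w (\<lambda>x y. F x y + G x y) = cform d k \<epsilon> w F + cform d k \<epsilon> w G" for k \<epsilon> w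
    by (simp add: cform_def sum.distrib distrib_right)
  have "\<bar>cform d k \<epsilon> w (\<lambda>x y. F x y + G x y)\<bar> \<le> (C1 + C2) * (lowmom n w + real m ^ (k * n) * \<delta> k * H)"
    if "k \<ge> 1" "supp m N d w" "\<forall>\<beta>. \<bar>w \<beta>\<bar> \<le> H" for k \<epsilon> w H
    unfolding eq distrib_right
    by (rule order_trans[OF abs_triangle_ineq add_mono[OF C1(2)[rule_format] C2(2)[rule_format]]]) (use that in auto)
  then show ?case using C1(1) C2(1) by (intro exI[of _ "C1 + C2"]) auto
next
  case (scale F c)
  from scale.IH obtain C1 where C1: "C1 \<ge> 0"
   "\<forall>k\<ge>1. \<forall>\<epsilon> w H. supp m N d w \<longrightarrow> (\<forall>\<beta>. \<bar>w \<beta>\<bar> \<le> H) \<longrightarrow>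
     \<bar>cform d k \<epsilon> w F\<bar> \<le> C1 * (lowmom n w + real m ^ (k * n) * \<delta> k * H)" by (elim exE conjE)
  have eq: "cform d k \<epsilon> w (\<lambda>x y. c * F x y) = c * cform d k \<epsilon> w F" for k \<epsilon> w
    by (simp add: cform_def sum_distrib_left mult_ac)
  have "\<bar>cform d k \<epsilon> w (\<lambda>x y. c * F x y)\<bar> \<le> (\<bar>c\<bar> * C1) * (lowmom n w + real m ^ (k * n) * \<delta> k * H)"
    if "k \<ge> 1" "supp m N d w" "\<forall>\<beta>. \<bar>w \<beta>\<bar> \<le> H" for k \<epsilon> w H
    using mult_left_mono[OF C1(2)[rule_format, OF that(1,2), of H \<epsilon>], of "\<bar>c\<bar>"] that(3)
    by (simp add: eq abs_mult mult.assoc)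
  then show ?case using C1(1) by (intro exI[of _ "\<bar>c\<bar> * C1"]) auto
qed

text \<open>The top term of the shifted monomial carries the weight \<open>avg k 0 = 1\<close>, by
  the normalization of the symbols, and isolates \<open>mom \<eta> w\<close>. Everything else is of
  type \<open>lowmix\<close>.\<close>

lemma moment_step:
  "\<exists>C\<ge>0. \<forall>k\<ge>1. \<forall>\<epsilon>\<in>digits m. \<forall>w H \<eta>. supp m N d w \<longrightarrow> (\<forall>\<beta>. \<bar>w \<beta>\<bar> \<le> H) \<longrightarrow> mabs \<eta> \<le> l \<longrightarrow>
     \<bar>real m ^ mabs \<eta> * mom \<eta> (tr m N (a k) \<epsilon> w) - mom \<eta> w\<bar>
       \<le> C * (lowmom (mabs \<eta>) w + real m ^ (k * mabs \<eta>) * \<delta> k * H)"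
proof -
  let ?A = "(digits m :: (int ^ 's) set) \<times> {\<eta> :: nat ^ 's. mabs \<eta> \<le> l}"
  let ?Q = "\<lambda>(x :: (int ^ 's) \<times> (nat ^ 's)) (k, w, H). k \<ge> 1 \<and> supp m N d w \<and> (\<forall>\<beta>. \<bar>w \<beta>\<bar> \<le> H)"
  let ?f = "\<lambda>(\<epsilon> :: int ^ 's, \<eta> :: nat ^ 's) (k, w, H). \<bar>real m ^ mabs \<eta> * mom \<eta> (tr m N (a k) \<epsilon> w) - mom \<eta> w\<bar>"
  let ?g = "\<lambda>(\<epsilon> :: int ^ 's, \<eta> :: nat ^ 's) (k, w, H). lowmom (mabs \<eta>) w + real m ^ (k * mabs \<eta>) * \<delta> k * H"
  have "\<exists>C\<ge>0. \<forall>x\<in>?A. \<forall>y. ?Q x y \<longrightarrow> ?f x y \<le> C * ?g x y"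
  proof (rule finite_uniform_const)
    show "finite ?A" by (intro finite_cartesian_product finite_digits finite_mabs)
    show "?g x y \<ge> 0" if "x \<in> ?A" "?Q x y" for x y
      using that lowmom_nonneg order_trans[OF abs_ge_zero] by (auto intro!: add_nonneg_nonneg mult_nonneg_nonneg split: prod.splits)
    fix x assume "x \<in> ?A"
    then obtain \<epsilon> :: "int ^ 's" and \<eta> :: "nat ^ 's" where x: "x = (\<epsilon>, \<eta>)" and e: "\<epsilon> \<in> digits m" and \<eta>: "mabs \<eta> \<le> l" by auto
    define G where "G u v = rmono \<eta> (u + v - rvec \<epsilon>) - rmono \<eta> v" for u v
    have "lowmix ffall (mabs \<eta>) G"
      unfolding G_def[abs_def] by (rule lowmix_expand[OF ffall_zero ffall_Suc])
    from cform_lowmix[OF this \<eta>, of d] obtain C1 where C1: "C1 \<ge> 0"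
      "\<forall>k\<ge>1. \<forall>\<epsilon> w H. supp m N d w \<longrightarrow> (\<forall>\<beta>. \<bar>w \<beta>\<bar> \<le> H) \<longrightarrow>
        \<bar>cform d k \<epsilon> w G\<bar> \<le> C1 * (lowmom (mabs \<eta>) w + real m ^ (k * mabs \<eta>) * \<delta> k * H)" by (elim exE conjE)
    define C2 where "C2 = (\<Sum>\<beta>\<in>(lbox m N d :: (int ^ 's) set). \<bar>rmono \<eta> (rvec \<beta>)\<bar>)"
    have C2: "C2 \<ge> 0" unfolding C2_def by (auto intro!: sum_nonneg)
    have "?f (\<epsilon>, \<eta>) (k, w, H) \<le> (C1 + C2) * ?g (\<epsilon>, \<eta>) (k, w, H)"
      if "k \<ge> 1" "supp m N d w" "\<forall>\<beta>. \<bar>w \<beta>\<bar> \<le> H" for k w H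
    proof -
      have H0: "H \<ge> 0" using that order_trans[OF abs_ge_zero] by blast
      have "cform d k \<epsilon> w (\<lambda>x y. rmono \<eta> (x + y - rvec \<epsilon>)) = cform d k \<epsilon> w G + cform d k \<epsilon> w (\<lambda>x y. ffall 0 x * rmono \<eta> y)"
        by (simp add: cform_def sum.distrib[symmetric] G_def ffall_zero algebra_simps)
      then have eq: "real m ^ mabs \<eta> * mom \<eta> (tr m N (a k) \<epsilon> w) - mom \<eta> w =
          cform d k \<epsilon> w G + (cform d k \<epsilon> w (\<lambda>x y. ffall 0 x * rmono \<eta> y) - avg k 0 * mom \<eta> w)"
        using mom_tr[OF that(1) e that(2), of \<eta>] avg_zero[OF that(1)] by simp
      have "\<bar>cform d k \<epsilon> w (\<lambda>x y. ffall 0 x * rmono \<eta> y) - avg k 0 * mom \<eta> w\<bar> \<le> C2 * (\<delta> k * H)"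
        using cform_basis[OF that(1,2), of H 0 \<epsilon> \<eta>] that(3) by (simp add: C2_def)
      also have "\<dots> \<le> C2 * (lowmom (mabs \<eta>) w + real m ^ (k * mabs \<eta>) * \<delta> k * H)"
      proof (intro mult_left_mono C2)
        have "1 * (\<delta> k * H) \<le> real m ^ (k * mabs \<eta>) * (\<delta> k * H)"
          using m2 H0 by (intro mult_right_mono one_le_power) auto
        then show "\<delta> k * H \<le> lowmom (mabs \<eta>) w + real m ^ (k * mabs \<eta>) * \<delta> k * H"
          using lowmom_nonneg[of "mabs \<eta>" w] by (simp add: mult.assoc)
      qed
      finally have 2: "\<bar>cform d k \<epsilon> w (\<lambda>x y. ffall 0 x * rmono \<eta> y) - avg k 0 * mom \<eta> w\<bar>
        \<le> C2 * (lowmom (mabs \<eta>) w + real m ^ (k * mabs \<eta>) * \<delta> k * H)" .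
      have "\<bar>cform d k \<epsilon> w G\<bar> \<le> C1 * (lowmom (mabs \<eta>) w + real m ^ (k * mabs \<eta>) * \<delta> k * H)"
        by (rule C1(2)[rule_format]) (use that in auto)
      with 2 show ?thesis unfolding prod.case eq distrib_right by linarith
    qed
    then show "\<exists>C\<ge>0. \<forall>y. ?Q x y \<longrightarrow> ?f x y \<le> C * ?g x y"
      using C1 C2 unfolding x by (intro exI[of _ "C1 + C2"]) auto
  qed
  then show ?thesis by fastforce
qed

end

section \<open>Contraction of products of transition operators\<close>

text \<open>Elimination as in the Gram-Schmidt process, for functionals that may be dependent on
  \<open>X\<close>: one that vanishes on the common kernel of its predecessors gets the zero vector,
  any other one is normalized on that kernel.\<close>

lemma functional_projection:
  fixes \<phi> :: "'c \<Rightarrow> ('i \<Rightarrow> real) \<Rightarrow> real" and X :: "('i \<Rightarrow> real) set"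
  assumes fin: "finite I"
    and X: "\<And>u v c. u \<in> X \<Longrightarrow> v \<in> X \<Longrightarrow> (\<lambda>i. u i - c * v i) \<in> X" and zero: "(\<lambda>_. 0) \<in> X"
    and lin: "\<And>j u v c. u \<in> X \<Longrightarrow> v \<in> X \<Longrightarrow> \<phi> j (\<lambda>i. u i - c * v i) = \<phi> j u - c * \<phi> j v"
  shows "\<exists>U. (\<forall>j\<in>I. U j \<in> X) \<and> (\<forall>w\<in>X. (\<lambda>i. w i - (\<Sum>j\<in>I. \<phi> j w * U j i)) \<in> X \<and>
     (\<forall>j\<in>I. \<phi> j (\<lambda>i. w i - (\<Sum>j\<in>I. \<phi> j w * U j i)) = 0))"
  using fin
proof (induction I)
  case empty
  then show ?case by simp
next
  case (insert p I)
  then obtain U where U: "\<And>j. j \<in> I \<Longrightarrow> U j \<in> X"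
    "\<And>w. w \<in> X \<Longrightarrow> (\<lambda>i. w i - (\<Sum>j\<in>I. \<phi> j w * U j i)) \<in> X"
    "\<And>w j. w \<in> X \<Longrightarrow> j \<in> I \<Longrightarrow> \<phi> j (\<lambda>i. w i - (\<Sum>j\<in>I. \<phi> j w * U j i)) = 0" by blast
  define P where "P w = (\<lambda>i. w i - (\<Sum>j\<in>I. \<phi> j w * U j i))" for w
  have P: "\<And>w. w \<in> X \<Longrightarrow> P w \<in> X" "\<And>w j. w \<in> X \<Longrightarrow> j \<in> I \<Longrightarrow> \<phi> j (P w) = 0"
    using U(2,3) by (auto simp: P_def)
  have phi0: "\<phi> j (\<lambda>_. 0) = 0" for j using lin[OF zero zero, of j 1] by simp
  show ?case
  proof (cases "\<forall>w\<in>X. \<phi> p (P w) = 0")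
    case True
    define U' where "U' = U(p := (\<lambda>_. 0))"
    have eq: "(\<lambda>i. w i - (\<Sum>j\<in>insert p I. \<phi> j w * U' j i)) = P w" for w
    proof -
      have "(\<Sum>j\<in>I. \<phi> j w * U' j i) = (\<Sum>j\<in>I. \<phi> j w * U j i)" for i
        using insert.hyps by (intro sum.cong) (auto simp: U'_def)
      then show ?thesis using insert.hyps by (simp add: P_def U'_def)
    qed
    show ?thesis
      by (rule exI[of _ U'], unfold eq) (use U(1) zero P True in \<open>auto simp: U'_def\<close>)
  next
    case False
    then obtain z0 where z0: "z0 \<in> X" "\<phi> p (P z0) \<noteq> 0" by blast
    \<comment> \<open>Scales so that \<open>\<phi> p z = 1\<close>, with \<open>z\<close> in the
      kernel of the earlier functionals. The sign appears because linear combinations are written as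
      differences.\<close>
    define c where "c = - inverse (\<phi> p (P z0))"
    define z where "z = (\<lambda>i. 0 - c * P z0 i)"
    have zX: "z \<in> X" unfolding z_def by (rule X[OF zero P(1)[OF z0(1)]])
    have zphi: "\<phi> j z = - c * \<phi> j (P z0)" for j
      unfolding z_def using lin[OF zero P(1)[OF z0(1)], of j c] by (simp add: phi0)
    have zp: "\<phi> p z = 1" "\<And>j. j \<in> I \<Longrightarrow> \<phi> j z = 0"
      using z0 P(2) by (auto simp: zphi c_def)
    \<comment> \<open>The earlier vectors are corrected by multiples of \<open>z\<close> so that the
      new functional vanishes on them.\<close>
    define U' where "U' j = (if j = p then z else (\<lambda>i. U j i - \<phi> p (U j) * z i))" for j
    have lins: "J \<subseteq> I \<Longrightarrow> finite J \<Longrightarrow> (\<lambda>i. w i - (\<Sum>j\<in>J. d j * U j i)) \<in> X \<and>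
        \<phi> q (\<lambda>i. w i - (\<Sum>j\<in>J. d j * U j i)) = \<phi> q w - (\<Sum>j\<in>J. d j * \<phi> q (U j))"
      if "w \<in> X" for w J d q using that
    proof (induction J rule: infinite_finite_induct)
      case (insert x F)
      then have IH: "(\<lambda>i. w i - (\<Sum>j\<in>F. d j * U j i)) \<in> X"
        "\<phi> q (\<lambda>i. w i - (\<Sum>j\<in>F. d j * U j i)) = \<phi> q w - (\<Sum>j\<in>F. d j * \<phi> q (U j))" by auto
      have "U x \<in> X" using insert U(1) by auto
      from X[OF IH(1) this, of "d x"] lin[OF IH(1) this, of q "d x"] IH(2) insert.hyps
      show ?case by (simp add: algebra_simps)
    qed auto
    have eq: "(\<lambda>i. w i - (\<Sum>j\<in>insert p I. \<phi> j w * U' j i)) = (\<lambda>i. P w i - \<phi> p (P w) * z i)" if w: "w \<in> X" for w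
    proof
      fix i
      have 1: "(\<Sum>j\<in>I. \<phi> j w * U' j i) = (\<Sum>j\<in>I. \<phi> j w * U j i - \<phi> j w * \<phi> p (U j) * z i)"
        using insert.hyps by (intro sum.cong) (auto simp: U'_def algebra_simps)
      have 2: "\<phi> p (P w) = \<phi> p w - (\<Sum>j\<in>I. \<phi> j w * \<phi> p (U j))"
        unfolding P_def using lins[OF w order_refl insert.hyps(1), of "\<lambda>j. \<phi> j w" p] by simp
      have "U' p = z" by (simp add: U'_def)
      then have "(\<Sum>j\<in>insert p I. \<phi> j w * U' j i) =
          \<phi> p w * z i + (\<Sum>j\<in>I. \<phi> j w * U j i) - (\<Sum>j\<in>I. \<phi> j w * \<phi> p (U j)) * z i"
        using insert.hyps by (simp add: 1 sum_subtractf sum_distrib_right)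
      then show "w i - (\<Sum>j\<in>insert p I. \<phi> j w * U' j i) = P w i - \<phi> p (P w) * z i"
        by (simp add: P_def 2[unfolded P_def] left_diff_distrib)
    qed
    show ?thesis
    proof (intro exI[of _ U'] conjI ballI)
      show "U' j \<in> X" if "j \<in> insert p I" for j
        using that zX X[OF U(1) zX] by (auto simp: U'_def)
      show "(\<lambda>i. w i - (\<Sum>j\<in>insert p I. \<phi> j w * U' j i)) \<in> X" if "w \<in> X" for w
        unfolding eq[OF that] by (rule X[OF P(1)[OF that] zX])
      show "\<phi> j (\<lambda>i. w i - (\<Sum>j\<in>insert p I. \<phi> j w * U' j i)) = 0" if "w \<in> X" "j \<in> insert p I" for w j
        unfolding eq[OF that(1)] lin[OF P(1)[OF that(1)] zX] using that zp P(2) by auto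
    qed
  qed
qed

lemma bounded_coordinates_convergent_subsequence:
  fixes f :: "nat \<Rightarrow> 'i \<Rightarrow> real"
  assumes "finite S" and "\<And>n x. x \<in> S \<Longrightarrow> \<bar>f n x\<bar> \<le> B"
  shows "\<exists>r. strict_mono (r :: nat \<Rightarrow> nat) \<and> (\<forall>x\<in>S. \<exists>L. (\<lambda>n. f (r n) x) \<longlonglongrightarrow> L)"
  using assms
proof (induction S)
  case empty
  then show ?case by (intro exI[of _ id]) (auto simp: strict_mono_def)
next
  case (insert y S)
  then obtain r :: "nat \<Rightarrow> nat" where r: "strict_mono r" "\<And>x. x \<in> S \<Longrightarrow> \<exists>L. (\<lambda>n. f (r n) x) \<longlonglongrightarrow> L"
    by auto
  have "bounded (range (\<lambda>n. f (r n) y))"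
    using insert.prems by (intro boundedI[of _ B]) auto
  then obtain L q where q: "strict_mono (q :: nat \<Rightarrow> nat)" "((\<lambda>n. f (r n) y) \<circ> q) \<longlonglongrightarrow> L"
    using bounded_imp_convergent_subsequence by blast
  have "\<exists>L. (\<lambda>n. f ((r \<circ> q) n) x) \<longlonglongrightarrow> L" if x: "x \<in> insert y S" for x
  proof (cases "x = y")
    case True then show ?thesis using q(2) by (auto simp: o_def)
  next
    case False
    then obtain L' where "(\<lambda>n. f (r n) x) \<longlonglongrightarrow> L'" using r(2)[of x] x by auto
    from LIMSEQ_subseq_LIMSEQ[OF this q(1)] show ?thesis by (auto simp: o_def)
  qed
  then show ?case using strict_mono_o[OF r(1) q(1)] by blast
qed

text \<open>Summing the geometric series turns the bounds on the digits into bounds on the sum; at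
  digits \<open>-m\<close> and \<open>N + 1\<close> these are the ends of the box with slack
  1.\<close>

lemma Kset_lbox:
  assumes m: "m \<ge> 2"
  shows "Kset m N = (lbox m N 1 :: (int ^ 's::finite) set)"
proof -
  have geo: "(\<lambda>r. c / real m ^ Suc r) sums (c / (real m - 1))" for c
  proof -
    have "(\<lambda>r. (c / real m) * (1 / real m) ^ r) sums ((c / real m) * (1 / (1 - 1 / real m)))"
      using m by (intro sums_mult geometric_sums) simp
    moreover have "(c / real m) * (1 / (1 - 1 / real m)) = c / (real m - 1)"
      using m by (simp add: field_simps)
    moreover have "(\<lambda>r. (c / real m) * (1 / real m) ^ r) = (\<lambda>r. c / real m ^ Suc r)"
      by (simp add: power_divide)
    ultimately show ?thesis by (simp only:)
  qed
  have "\<kappa> \<in> lbox m N 1 \<longleftrightarrow> \<kappa> \<in> Kset m N" for \<kappa> :: "int ^ 's"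
  proof
    assume "\<kappa> \<in> lbox m N 1"
    then have b: "- (int m - 1) - 1 \<le> (int m - 1) * \<kappa> $ i" "(int m - 1) * \<kappa> $ i \<le> int N + 1" for i
      by (auto simp: lbox_def)
    show "\<kappa> \<in> Kset m N"
      unfolding Kset_def mem_Collect_eq
    \<comment> \<open>The constant digit sequence \<open>(m - 1) \<kappa>\<close> represents
      \<kappa>, because the powers \<open>1 / m ^ r\<close> with \<open>r \<ge> 1\<close> sum to
      \<open>1 / (m - 1)\<close>.\<close>
    proof (intro exI[of _ "\<lambda>r. (int m - 1) *s \<kappa>"] conjI allI)
      show "((int m - 1) *s \<kappa>) $ i \<in> {- int m..int N + 1}" for i
        using b[of i] by (simp add: algebra_simps)
      show "(\<lambda>r. real_of_int (((int m - 1) *s \<kappa>) $ i) / real m ^ Suc r) sums real_of_int (\<kappa> $ i)" for i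
      proof -
        have "real_of_int ((int m - 1) * \<kappa> $ i) / (real m - 1) = real_of_int (\<kappa> $ i)" using m by simp
        with geo[of "real_of_int ((int m - 1) * \<kappa> $ i)"] show ?thesis
          by (simp only: vector_smult_component)
      qed
    qed
  next
    assume "\<kappa> \<in> Kset m N"
    then obtain g :: "nat \<Rightarrow> int ^ 's" where g: "\<And>r i. g r $ i \<in> {- int m..int N + 1}"
      "\<And>i. (\<lambda>r. of_int (g (Suc r) $ i) / real m ^ Suc r) sums real_of_int (\<kappa> $ i)"
      unfolding Kset_def by blast
    show "\<kappa> \<in> lbox m N 1"
      unfolding lbox_def mem_Collect_eq
    proof
      fix i
      have gi: "- real m \<le> real_of_int (g r $ i)" "real_of_int (g r $ i) \<le> real N + 1" for r
      proof -
        have "real_of_int (- int m) \<le> real_of_int (g r $ i)" "real_of_int (g r $ i) \<le> real_of_int (int N + 1)"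
          unfolding of_int_le_iff using g(1)[of r i] by auto
        then show "- real m \<le> real_of_int (g r $ i)" "real_of_int (g r $ i) \<le> real N + 1" by auto
      qed
      have "real_of_int (\<kappa> $ i) \<le> (real N + 1) / (real m - 1)"
        by (rule sums_le[OF divide_right_mono[OF gi(2)] g(2) geo]) simp
      then have "real_of_int ((int m - 1) * \<kappa> $ i) \<le> real_of_int (int N + 1)"
        using m by (simp add: field_simps)
      moreover have "- real m / (real m - 1) \<le> real_of_int (\<kappa> $ i)"
        by (rule sums_le[OF divide_right_mono[OF gi(1)] geo g(2)]) simp
      then have "real_of_int (- int m) \<le> real_of_int ((int m - 1) * \<kappa> $ i)"
        using m by (simp add: field_simps)
      ultimately show "- (int m - 1) - int 1 \<le> (int m - 1) * \<kappa> $ i \<and> (int m - 1) * \<kappa> $ i \<le> int N + int 1"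
        unfolding of_int_le_iff by simp
    qed
  qed
  then show ?thesis by blast
qed

lemma mom_lincomb:
  assumes "m \<ge> 2" "supp m N d u" "supp m N d v"
  shows "mom \<eta> (\<lambda>i. u i - c * v i) = mom \<eta> u - c * mom \<eta> v"
proof -
  have "supp m N d (\<lambda>i. u i - c * v i)" using assms by (auto simp: supp_def)
  then show ?thesis using assms
    by (simp add: mom_sum right_diff_distrib sum_subtractf sum_distrib_left mult_ac)
qed

lemma Vspace_iff:
  assumes m: "m \<ge> 2"
  shows "v \<in> Vspace l m N \<longleftrightarrow> supp m N 1 v \<and> (\<forall>\<eta>. mabs \<eta> \<le> l \<longrightarrow> mom \<eta> v = 0)"
proof -
  have *: "(\<forall>c. (\<Sum>\<alpha>\<in>lbox m N 1. poly_fun l c \<alpha> * v \<alpha>) = 0) \<longleftrightarrow> (\<forall>\<eta>. mabs \<eta> \<le> l \<longrightarrow> mom \<eta> v = 0)"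
    if s: "supp m N 1 v"
  proof -
    have pf: "(\<Sum>\<alpha>\<in>lbox m N 1. poly_fun l c \<alpha> * v \<alpha>) = (\<Sum>\<eta>\<in>{\<eta>. mabs \<eta> \<le> l}. c \<eta> * mom \<eta> v)" for c
    proof -
      have "(\<Sum>\<alpha>\<in>lbox m N 1. poly_fun l c \<alpha> * v \<alpha>) =
         (\<Sum>\<alpha>\<in>lbox m N 1. \<Sum>\<eta>\<in>{\<eta>. mabs \<eta> \<le> l}. c \<eta> * (rmono \<eta> (rvec \<alpha>) * v \<alpha>))"
        by (simp add: poly_fun_def rmono_def rvec_simps sum_distrib_right mult.assoc)
      also have "\<dots> = (\<Sum>\<eta>\<in>{\<eta>. mabs \<eta> \<le> l}. \<Sum>\<alpha>\<in>lbox m N 1. c \<eta> * (rmono \<eta> (rvec \<alpha>) * v \<alpha>))"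
        by (rule sum.swap)
      finally show ?thesis by (simp add: mom_sum[OF m s] sum_distrib_left)
    qed
    show ?thesis
    proof
      assume L: "\<forall>c. (\<Sum>\<alpha>\<in>lbox m N 1. poly_fun l c \<alpha> * v \<alpha>) = 0"
      show "\<forall>\<eta>. mabs \<eta> \<le> l \<longrightarrow> mom \<eta> v = 0"
      proof (intro allI impI)
        fix \<eta> :: "nat ^ 'a" assume \<eta>: "mabs \<eta> \<le> l"
        have "(\<Sum>\<eta>'\<in>{\<eta>. mabs \<eta> \<le> l}. (if \<eta>' = \<eta> then 1 else 0) * mom \<eta>' v) = 0"
          using L pf by metis
        moreover have "(\<Sum>\<eta>'\<in>{\<eta>. mabs \<eta> \<le> l}. (if \<eta>' = \<eta> then 1 else 0) * mom \<eta>' v) =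
           (\<Sum>\<eta>'\<in>{\<eta>. mabs \<eta> \<le> l}. if \<eta>' = \<eta> then mom \<eta>' v else 0)" by (intro sum.cong) auto
        ultimately show "mom \<eta> v = 0" using \<eta> by (simp add: finite_mabs)
      qed
    qed (unfold pf, simp)
  qed
  show ?thesis unfolding Vspace_def mem_Collect_eq Kset_lbox[OF m] supp_def[symmetric]
    using * by blast
qed

text \<open>The matrix indexed by \<open>Kset m N\<close> agrees with the operator on the whole
  lattice on vectors supported there, because the box with slack 1 is invariant. Estimates are
  carried out for the latter, whose form does not mention the index set.\<close>

lemma trans_op_tr:
  fixes b :: "int ^ 's::finite \<Rightarrow> real"
  assumes m: "m \<ge> 2" and b: "is_mask N b" and e: "\<epsilon> \<in> digits m" and v: "supp m N 1 v"
  shows "trans_op m N \<epsilon> b v = tr m N b \<epsilon> v"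
proof
  fix \<alpha> :: "int ^ 's"
  show "trans_op m N \<epsilon> b v \<alpha> = tr m N b \<epsilon> v \<alpha>"
  proof (cases "\<alpha> \<in> lbox m N 1")
    case True
    define c where "c = \<epsilon> + int m *s \<alpha>"
    have "(\<Sum>\<beta>\<in>lbox m N 1. b (c - \<beta>) * v \<beta>) = (\<Sum>\<gamma>\<in>mbox N. b \<gamma> * v (c - \<gamma>))"
    proof (rule sum.reindex_bij_witness_not_neutral[of "{\<beta>\<in>lbox m N 1. b (c - \<beta>) * v \<beta> = 0}"
            "{\<gamma>\<in>mbox N. b \<gamma> * v (c - \<gamma>) = 0}" _ "\<lambda>\<gamma>. c - \<gamma>" "\<lambda>\<beta>. c - \<beta>"])
      show "finite {\<beta>\<in>lbox m N 1. b (c - \<beta>) * v \<beta> = 0}" using m by simp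
    qed (use is_mask_outside[OF b] v in \<open>auto simp: supp_def\<close>)
    then show ?thesis using True by (simp add: trans_op_def tr_def Kset_lbox[OF m] c_def)
  next
    case False
    have "supp m N 1 (tr m N b \<epsilon> v)"
      by (rule supp_mono[OF supp_tr[OF m e v]]) (use m in simp)
    then show ?thesis using False by (simp add: trans_op_def Kset_lbox[OF m] supp_def)
  qed
qed

section \<open>Limit masks and the adapted norm on \<open>V\<close>\<close>

locale contractive_scheme = subdivision_scheme a l m N B
  for a :: "nat \<Rightarrow> int ^ 's::finite \<Rightarrow> real" and l m N :: nat and B :: real +
  assumes asr: "approx_sum_rules l m a"
    and rho: "rhoA l m N a < 1 / real m ^ l"
begin

definition \<sigma> :: "nat \<Rightarrow> real" where "\<sigma> k = real m ^ (k * l) * \<delta> k"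

lemma sigma_nonneg [simp]: "\<sigma> k \<ge> 0" by (simp add: \<sigma>_def)

lemma sigma_summable: "summable \<sigma>"
proof -
  have "\<sigma> summable_on {1..}" using asr unfolding approx_sum_rules_def \<sigma>_def[abs_def] by simp
  then have "\<sigma> summable_on (insert 0 {1..})" by (simp add: summable_on_insert_iff)
  moreover have "insert 0 {1..} = (UNIV :: nat set)" by auto
  ultimately show ?thesis by (simp add: summable_on_UNIV_nonneg_real_iff)
qed

abbreviation A :: "(int ^ 's \<Rightarrow> real) set" where "A \<equiv> limit_masks a"
abbreviation K :: "(int ^ 's) set" where "K \<equiv> lbox m N 1"
abbreviation V :: "(int ^ 's \<Rightarrow> real) set" where "V \<equiv> Vspace l m N"

lemma finite_lbox' [simp]: "finite (lbox m N d)" by (rule finite_lbox[OF m2])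

lemma finK: "finite K" by simp

lemma eventually_subseq_ge: "strict_mono (r :: nat \<Rightarrow> nat) \<Longrightarrow> \<forall>\<^sub>F n in sequentially. r n \<ge> c"
  using filterlim_subseq[of r] by (auto simp: filterlim_at_top)

lemma limit_mask:
  assumes "b \<in> A"
  shows "is_mask N b" "\<bar>b \<gamma>\<bar> \<le> B"
proof -
  obtain r where r: "strict_mono r" "\<And>\<alpha>. (\<lambda>n. a (r n) \<alpha>) \<longlonglongrightarrow> b \<alpha>"
    using assms by (auto simp: limit_masks_def)
  have ev: "\<forall>\<^sub>F n in sequentially. r n \<ge> 1" by (rule eventually_subseq_ge[OF r(1)])
  show "\<bar>b \<gamma>\<bar> \<le> B"
    by (rule tendsto_upperbound[OF tendsto_rabs[OF r(2)]]) (use ev in \<open>auto elim!: eventually_mono intro: bnd\<close>)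
  have "b \<alpha> = 0" if "\<alpha> \<notin> mbox N" for \<alpha>
  proof -
    have "\<forall>\<^sub>F n in sequentially. a (r n) \<alpha> = 0"
      using ev by (rule eventually_mono) (rule is_mask_outside[OF mask that])
    then have "(\<lambda>n. a (r n) \<alpha>) \<longlonglongrightarrow> 0" by (rule tendsto_eventually)
    then show ?thesis using r(2) LIMSEQ_unique by blast
  qed
  then show "is_mask N b" by (auto simp: is_mask_def mbox_def)
qed

lemma limit_subsequence:
  fixes r :: "nat \<Rightarrow> nat"
  assumes "\<And>n. r n \<ge> 1" "strict_mono r"
  shows "\<exists>q b. strict_mono q \<and> b \<in> A \<and> (\<forall>\<alpha>. (\<lambda>n. a (r (q n)) \<alpha>) \<longlonglongrightarrow> b \<alpha>)"
proof -
  obtain q where q: "strict_mono (q :: nat \<Rightarrow> nat)" "\<And>x. x \<in> mbox N \<Longrightarrow> \<exists>L. (\<lambda>n. a (r (q n)) x) \<longlonglongrightarrow> L"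
    using bounded_coordinates_convergent_subsequence[of "mbox N" "\<lambda>n. a (r n)" B] bnd[OF assms(1)] by auto
  have "\<exists>L. (\<lambda>n. a (r (q n)) x) \<longlonglongrightarrow> L" for x
  proof (cases "x \<in> mbox N")
    case False
    then have "(\<lambda>n. a (r (q n)) x) = (\<lambda>n. 0)" using is_mask_outside[OF mask[OF assms(1)]] by auto
    then show ?thesis by auto
  qed (rule q(2))
  then obtain b where b: "\<And>x. (\<lambda>n. a (r (q n)) x) \<longlonglongrightarrow> b x" by metis
  have "b \<in> A" unfolding limit_masks_def using b strict_mono_o[OF assms(2) q(1)]
    by (auto simp: o_def intro!: exI[of _ "\<lambda>n. r (q n)"])
  then show ?thesis using q(1) b by blast
qed

lemma A_nonempty: "A \<noteq> {}"
  using limit_subsequence[of Suc] by (auto simp: strict_mono_Suc_iff)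

text \<open>Otherwise infinitely many masks stay away from every limit mask, and a convergent
  subsequence of these is a contradiction. Late transition operators are thus small perturbations of
  those of limit masks.\<close>

lemma near_A:
  assumes "e > 0"
  shows "\<exists>k0\<ge>1. \<forall>k\<ge>k0. \<exists>b\<in>A. \<forall>\<gamma>. \<bar>a k \<gamma> - b \<gamma>\<bar> < e"
proof (rule ccontr)
  assume "\<not> ?thesis"
  then have *: "\<And>k0. k0 \<ge> 1 \<Longrightarrow> \<exists>k\<ge>k0. \<forall>b\<in>A. \<exists>\<gamma>. \<bar>a k \<gamma> - b \<gamma>\<bar> \<ge> e" by (meson not_le)
  define P where "P k \<longleftrightarrow> k \<ge> 1 \<and> (\<forall>b\<in>A. \<exists>\<gamma>. \<bar>a k \<gamma> - b \<gamma>\<bar> \<ge> e)" for k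
  have "infinite {k. P k}"
    unfolding infinite_nat_iff_unbounded_le P_def using *[of "max 1 _"] by fastforce
  from infinite_enumerate[OF this] obtain r :: "nat \<Rightarrow> nat" where r: "strict_mono r" "\<And>n. P (r n)" by auto
  then obtain q b where q: "strict_mono q" "b \<in> A" "\<And>\<alpha>. (\<lambda>n. a (r (q n)) \<alpha>) \<longlonglongrightarrow> b \<alpha>"
    using limit_subsequence[of r] by (auto simp: P_def)
  have "\<forall>\<^sub>F n in sequentially. \<forall>\<gamma>\<in>mbox N. \<bar>a (r (q n)) \<gamma> - b \<gamma>\<bar> < e"
    unfolding eventually_ball_finite_distrib[OF finite_mbox]
    using q(3) assms by (auto simp: tendsto_iff dist_real_def)
  then obtain n where n: "\<forall>\<gamma>\<in>mbox N. \<bar>a (r (q n)) \<gamma> - b \<gamma>\<bar> < e"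
    using eventually_happens by force
  have rn: "r (q n) \<ge> 1" using r(2)[of "q n"] by (simp add: P_def)
  have "\<bar>a (r (q n)) \<gamma> - b \<gamma>\<bar> < e" for \<gamma>
    using n is_mask_outside[OF mask[OF rn], of \<gamma>] is_mask_outside[OF limit_mask(1)[OF q(2)], of \<gamma>] assms
    by (cases "\<gamma> \<in> mbox N") auto
  then show False using r(2)[of "q n"] q(2) unfolding P_def by (meson not_le)
qed

text \<open>Along a subsequence converging to \<open>b\<close>, the moments of the image of
  \<open>v\<close> are bounded by a multiple of \<sigma>, which tends to 0. Moments are finite sums
  here, hence continuous in the mask.\<close>

lemma tr_V:
  assumes b: "b \<in> A" and e: "\<epsilon> \<in> digits m" and v: "v \<in> V"
  shows "tr m N b \<epsilon> v \<in> V"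
  unfolding Vspace_iff[OF m2]
proof (intro conjI allI impI)
  have sv: "supp m N 1 v" and mv: "\<And>\<eta>. mabs \<eta> \<le> l \<Longrightarrow> mom \<eta> v = 0"
    using v unfolding Vspace_iff[OF m2] by auto
  have st: "supp m N 1 (tr m N b \<epsilon> v)" for b
    by (rule supp_mono[OF supp_tr[OF m2 e sv]]) (use m2 in simp)
  then show "supp m N 1 (tr m N b \<epsilon> v)" .
  fix \<eta> :: "nat ^ 's" assume \<eta>: "mabs \<eta> \<le> l"
  obtain r where r: "strict_mono r" "\<And>\<alpha>. (\<lambda>n. a (r n) \<alpha>) \<longlonglongrightarrow> b \<alpha>"
    using b by (auto simp: limit_masks_def)
  define H where "H = (\<Sum>\<beta>\<in>K. \<bar>v \<beta>\<bar>)"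
  have H: "\<bar>v \<beta>\<bar> \<le> H" for \<beta>
    using sv member_le_sum[of \<beta> K "\<lambda>\<beta>. \<bar>v \<beta>\<bar>"] unfolding H_def
    by (cases "\<beta> \<in> K") (auto simp: supp_def intro: sum_nonneg)
  obtain C where C: "C \<ge> 0" "\<forall>k\<ge>1. \<forall>\<epsilon>\<in>digits m. \<forall>w H \<eta>. supp m N 1 w \<longrightarrow> (\<forall>\<beta>. \<bar>w \<beta>\<bar> \<le> H) \<longrightarrow> mabs \<eta> \<le> l \<longrightarrow>
     \<bar>real m ^ mabs \<eta> * mom \<eta> (tr m N (a k) \<epsilon> w) - mom \<eta> w\<bar>
       \<le> C * (lowmom (mabs \<eta>) w + real m ^ (k * mabs \<eta>) * \<delta> k * H)"
    using moment_step[of 1] by (elim exE conjE)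
  have H0: "H \<ge> 0" using order_trans[OF abs_ge_zero H] .
  have bound: "\<bar>mom \<eta> (tr m N (a k) \<epsilon> v)\<bar> \<le> C * H * \<sigma> k" if k: "k \<ge> 1" for k
  proof -
    have lz: "lowmom (mabs \<eta>) v = 0" unfolding lowmom_def using mv \<eta> by (intro sum.neutral) auto
    have "1 * \<bar>mom \<eta> (tr m N (a k) \<epsilon> v)\<bar> \<le> real m ^ mabs \<eta> * \<bar>mom \<eta> (tr m N (a k) \<epsilon> v)\<bar>"
      using m2 by (intro mult_right_mono one_le_power) auto
    also have "\<dots> = \<bar>real m ^ mabs \<eta> * mom \<eta> (tr m N (a k) \<epsilon> v) - mom \<eta> v\<bar>"
      using mv[OF \<eta>] by (simp add: abs_mult)
    also have "\<dots> \<le> C * (lowmom (mabs \<eta>) v + real m ^ (k * mabs \<eta>) * \<delta> k * H)"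
      by (rule C(2)[rule_format]) (use k e sv H \<eta> in auto)
    also have "\<dots> \<le> C * (0 + real m ^ (k * l) * \<delta> k * H)"
      using C(1) H0 \<eta> m2 unfolding lz
      by (intro mult_left_mono add_left_mono mult_right_mono power_increasing) auto
    finally show ?thesis by (simp add: \<sigma>_def mult_ac)
  qed
  have "(\<lambda>n. C * H * \<sigma> (r n)) \<longlonglongrightarrow> C * H * 0"
    using LIMSEQ_subseq_LIMSEQ[OF summable_LIMSEQ_zero[OF sigma_summable] r(1)]
    by (intro tendsto_mult_left) (simp add: o_def)
  then have lim0: "(\<lambda>n. C * H * \<sigma> (r n)) \<longlonglongrightarrow> 0" by simp
  have "\<forall>\<^sub>F n in sequentially. norm (mom \<eta> (tr m N (a (r n)) \<epsilon> v)) \<le> C * H * \<sigma> (r n)"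
    using eventually_subseq_ge[OF r(1), of 1]
  proof eventually_elim
    case (elim n)
    then show ?case using bound[of "r n"] by simp
  qed
  from Lim_null_comparison[OF this lim0]
  have "(\<lambda>n. mom \<eta> (tr m N (a (r n)) \<epsilon> v)) \<longlonglongrightarrow> 0" .
  moreover have "(\<lambda>n. mom \<eta> (tr m N (a (r n)) \<epsilon> v)) \<longlonglongrightarrow> mom \<eta> (tr m N b \<epsilon> v)"
    unfolding mom_sum[OF m2 st] unfolding tr_def by (intro tendsto_intros r(2))
  ultimately show "mom \<eta> (tr m N b \<epsilon> v) = 0" using LIMSEQ_unique by blast
qed

abbreviation nrm :: "(int ^ 's \<Rightarrow> real) \<Rightarrow> real" where "nrm v \<equiv> L2_set v K"

lemma abs_le_nrm: "supp m N 1 v \<Longrightarrow> \<bar>v \<beta>\<bar> \<le> nrm v"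
  using member_le_L2_set[OF finK, of \<beta> "\<lambda>\<beta>. \<bar>v \<beta>\<bar>"] L2_set_nonneg[of v K]
  by (cases "\<beta> \<in> K") (auto simp: supp_def L2_set_def)

lemma nrm_le: "(\<And>\<beta>. \<bar>v \<beta>\<bar> \<le> H) \<Longrightarrow> nrm v \<le> real (card K) * H"
  by (rule order_trans[OF L2_set_le_sum_abs]) (auto intro!: sum_bounded_above)

definition b1 :: real where "b1 = real (card (mbox N :: (int ^ 's) set)) * B"

lemma b1_nonneg: "b1 \<ge> 0" using B_nonneg by (simp add: b1_def)

lemma V_supp: "v \<in> V \<Longrightarrow> supp m N 1 v" by (simp add: Vspace_iff[OF m2])

lemma V_lincomb: "u \<in> V \<Longrightarrow> v \<in> V \<Longrightarrow> (\<lambda>i. u i - c * v i) \<in> V"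
  unfolding Vspace_iff[OF m2] by (auto simp: mom_lincomb[OF m2] supp_def[of _ _ _ "\<lambda>i. _ i - _ * _ i"]) (auto simp: supp_def)

lemma V_zero: "(\<lambda>_. 0) \<in> V"
  unfolding Vspace_iff[OF m2] by (auto simp: supp_def mom_def)

sublocale ops: bounded_operators nrm V "trans_ops m N A" "real (card K) * b1"
proof
  show "trans_ops m N A \<noteq> {}"
  proof -
    obtain b where "b \<in> A" using A_nonempty by blast
    moreover have "(0 :: int ^ 's) \<in> digits m" using m2 by (simp add: digits_def)
    ultimately show ?thesis unfolding trans_ops_def by blast
  qed
  show "(\<lambda>_. 0) \<in> V" by (rule V_zero)
  show "(\<lambda>i. c * v i) \<in> V" if "v \<in> V" for v c
    using V_lincomb[OF V_zero that, of "- c"] by simp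
  show "(\<lambda>i. u i + v i) \<in> V" if "u \<in> V" "v \<in> V" for u v
    using V_lincomb[OF that, of "- 1"] by simp
  show "nrm v \<ge> 0" for v by (rule L2_set_nonneg)
  show "nrm (\<lambda>i. c * v i) = \<bar>c\<bar> * nrm v" for c v
    using L2_set_right_distrib[of "\<bar>c\<bar>" v K] by (simp add: L2_set_def power_mult_distrib)
  show "nrm (\<lambda>i. u i + v i) \<le> nrm u + nrm v" for u v by (rule L2_set_triangle_ineq)
  fix T assume "T \<in> trans_ops m N A"
  then obtain \<epsilon> b where T: "T = trans_op m N \<epsilon> b" "\<epsilon> \<in> digits m" "b \<in> A" by (auto simp: trans_ops_def)
  have Tv: "T v = tr m N b \<epsilon> v" if "v \<in> V" for v
    unfolding T(1) by (rule trans_op_tr[OF m2 limit_mask(1)[OF T(3)] T(2) V_supp[OF that]])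
  show "T v \<in> V" if "v \<in> V" for v
    unfolding Tv[OF that] by (rule tr_V[OF T(3,2) that])
  show "T (\<lambda>i. c * v i) = (\<lambda>i. c * T v i)" for c v
    unfolding T(1) trans_op_def by (auto simp: sum_distrib_left mult_ac)
  show "T (\<lambda>i. u i + v i) = (\<lambda>i. T u i + T v i)" for u v
    unfolding T(1) trans_op_def by (auto simp: sum.distrib distrib_left)
  show "nrm (T v) \<le> real (card K) * b1 * nrm v" if "v \<in> V" for v
    unfolding Tv[OF that] mult.assoc b1_def
    by (rule nrm_le) (use tr_bound[of b B v "nrm v"] limit_mask(2)[OF T(3)] abs_le_nrm[OF V_supp[OF that]] in \<open>simp add: mult.assoc\<close>)
next
  show "real (card K) * b1 \<ge> 0" using b1_nonneg by simp
qed

lemma rhoA_eq: "rhoA l m N a = joint_spectral_radius nrm V (trans_ops m N A)"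
  by (simp add: rhoA_def Kset_lbox[OF m2])

lemma rhoA_nonneg: "rhoA l m N a \<ge> 0"
  unfolding rhoA_eq by (rule ops.jsr_nonneg)

lemma adapted:
  assumes "rhoA l m N a < r"
  shows "\<exists>an C. (\<forall>v\<in>V. nrm v \<le> an v \<and> an v \<le> C * nrm v) \<and> C \<ge> 0 \<and>
    (\<forall>u\<in>V. \<forall>v\<in>V. an (\<lambda>i. u i + v i) \<le> an u + an v) \<and>
    (\<forall>b\<in>A. \<forall>\<epsilon>\<in>digits m. \<forall>v\<in>V. an (tr m N b \<epsilon> v) \<le> r * an v)"
proof -
  from ops.adapted_norm[OF assms[unfolded rhoA_eq]] obtain an C where an:
    "\<forall>v\<in>V. nrm v \<le> an v \<and> an v \<le> C * nrm v" "C \<ge> 0"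
    "\<forall>u\<in>V. \<forall>v\<in>V. an (\<lambda>i. u i + v i) \<le> an u + an v"
    "\<forall>T\<in>trans_ops m N A. \<forall>v\<in>V. an (T v) \<le> r * an v" by blast
  have "an (tr m N b \<epsilon> v) \<le> r * an v" if "b \<in> A" "\<epsilon> \<in> digits m" "v \<in> V" for b \<epsilon> v
  proof -
    have "trans_op m N \<epsilon> b \<in> trans_ops m N A" using that by (auto simp: trans_ops_def)
    then have "an (trans_op m N \<epsilon> b v) \<le> r * an v" using an(4) that(3) by blast
    then show ?thesis using trans_op_tr[OF m2 limit_mask(1)[OF that(1)] that(2) V_supp[OF that(3)]] by simp
  qed
  then show ?thesis using an(1-3) by blast
qed

end

text \<open>The operator of the newest mask, index \<open>Suc k\<close>, acts directly on
  \<open>w\<close>; the older ones follow. An induction on \<open>k\<close> therefore peels off late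
  masks, where contraction is available, and ends with the early ones.\<close>

primrec trs :: "nat \<Rightarrow> nat \<Rightarrow> (nat \<Rightarrow> int ^ 's::finite \<Rightarrow> real) \<Rightarrow> (nat \<Rightarrow> int ^ 's) \<Rightarrow> nat \<Rightarrow>
    (int ^ 's \<Rightarrow> real) \<Rightarrow> int ^ 's \<Rightarrow> real" where
  "trs m N a e 0 w = w"
| "trs m N a e (Suc k) w = trs m N a e k (tr m N (a (Suc k)) (e (Suc k)) w)"

lemma prod_one_plus_le_exp:
  fixes t :: "nat \<Rightarrow> real"
  assumes "summable t" "\<And>i. t i \<ge> 0"
  shows "(\<Prod>i<k. 1 + t i) \<le> exp (suminf t)"
proof -
  have "(\<Prod>i<k. 1 + t i) \<le> (\<Prod>i<k. exp (t i))"
    using assms(2) by (intro prod_mono) (auto simp: add_nonneg_nonneg)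
  also have "\<dots> = exp (\<Sum>i<k. t i)" by (simp add: exp_sum)
  also have "\<dots> \<le> exp (suminf t)" using sum_le_suminf[OF assms(1)] assms(2) by simp
  finally show ?thesis .
qed

context subdivision_scheme
begin

lemma b1_step:
  assumes "k \<ge> 1" "\<And>\<beta>. \<bar>w \<beta>\<bar> \<le> H"
  shows "\<bar>tr m N (a k) \<epsilon> w \<alpha>\<bar> \<le> (real (card (mbox N :: (int ^ 's) set)) * B) * H"
  using tr_bound[of "a k" B w H] bnd[OF assms(1)] assms(2) by blast

lemma trs_bound:
  "(\<And>\<beta>. \<bar>w \<beta>\<bar> \<le> H) \<Longrightarrow> \<bar>trs m N a e k w \<alpha>\<bar> \<le> (real (card (mbox N :: (int ^ 's) set)) * B) ^ k * H"
proof (induction k arbitrary: w H)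
  case (Suc k)
  have "\<bar>trs m N a e k (tr m N (a (Suc k)) (e (Suc k)) w) \<alpha>\<bar> \<le>
      (real (card (mbox N :: (int ^ 's) set)) * B) ^ k * ((real (card (mbox N :: (int ^ 's) set)) * B) * H)"
    by (rule Suc.IH) (rule b1_step[OF _ Suc.prems], simp)
  then show ?case by (simp add: mult_ac)
qed simp

end

context contractive_scheme
begin

abbreviation I :: "(nat ^ 's) set" where "I \<equiv> {\<eta>. mabs \<eta> \<le> l}"

lemma finI [simp]: "finite I" by (rule finite_mabs)

lemma projection_exists:
  "\<exists>U. (\<forall>\<eta>\<in>I. supp m N 1 (U \<eta>)) \<and> (\<forall>w. supp m N 1 w \<longrightarrow> (\<lambda>i. w i - (\<Sum>\<eta>\<in>I. mom \<eta> w * U \<eta> i)) \<in> V)"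
proof -
  have "\<exists>U. (\<forall>j\<in>I. U j \<in> {w. supp m N 1 w}) \<and> (\<forall>w\<in>{w. supp m N 1 w}. (\<lambda>i. w i - (\<Sum>j\<in>I. mom j w * U j i)) \<in> {w. supp m N 1 w} \<and>
     (\<forall>j\<in>I. mom j (\<lambda>i. w i - (\<Sum>j\<in>I. mom j w * U j i)) = 0))"
    by (rule functional_projection[OF finI]) (auto simp: supp_def mom_lincomb[OF m2, of N 1])
  then show ?thesis unfolding Vspace_iff[OF m2] by auto
qed

text \<open>Chosen once for the whole scheme, so that \<open>uC\<close> and \<open>pC\<close> depend
  neither on the level nor on the vector.\<close>

definition U :: "nat ^ 's \<Rightarrow> int ^ 's \<Rightarrow> real" where
  "U = (SOME U. (\<forall>\<eta>\<in>I. supp m N 1 (U \<eta>)) \<and> (\<forall>w. supp m N 1 w \<longrightarrow> (\<lambda>i. w i - (\<Sum>\<eta>\<in>I. mom \<eta> w * U \<eta> i)) \<in> V))"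

definition P :: "(int ^ 's \<Rightarrow> real) \<Rightarrow> int ^ 's \<Rightarrow> real" where
  "P w = (\<lambda>i. w i - (\<Sum>\<eta>\<in>I. mom \<eta> w * U \<eta> i))"

lemma U_supp: "\<eta> \<in> I \<Longrightarrow> supp m N 1 (U \<eta>)" and P_V: "supp m N 1 w \<Longrightarrow> P w \<in> V"
  using someI_ex[OF projection_exists] unfolding U_def[symmetric] P_def by auto

definition msum :: "(int ^ 's \<Rightarrow> real) \<Rightarrow> real" where "msum w = (\<Sum>\<eta>\<in>I. \<bar>mom \<eta> w\<bar>)"
definition uC :: real where "uC = (\<Sum>\<eta>\<in>I. \<Sum>\<beta>\<in>K. \<bar>U \<eta> \<beta>\<bar>)"
definition mC :: real where "mC = (\<Sum>\<eta>\<in>I. \<Sum>\<beta>\<in>K. \<bar>rmono \<eta> (rvec \<beta>)\<bar>)"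
definition pC :: real where "pC = real (card K) * (1 + uC * (real (card I) * mC))"

lemma consts_nonneg: "uC \<ge> 0" "mC \<ge> 0" "pC \<ge> 0" "msum w \<ge> 0"
proof -
  show *: "uC \<ge> 0" "mC \<ge> 0" "msum w \<ge> 0" unfolding uC_def mC_def msum_def by (auto intro!: sum_nonneg)
  show "pC \<ge> 0" unfolding pC_def using * by simp
qed

lemma U_bound: "\<eta> \<in> I \<Longrightarrow> \<bar>U \<eta> \<beta>\<bar> \<le> uC"
proof -
  assume \<eta>: "\<eta> \<in> I"
  have 1: "(\<Sum>\<beta>\<in>K. \<bar>U \<eta> \<beta>\<bar>) \<le> uC" unfolding uC_def
    by (rule member_le_sum[OF \<eta>]) (auto intro: sum_nonneg)
  show ?thesis
  proof (cases "\<beta> \<in> K")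
    case True
    have "\<bar>U \<eta> \<beta>\<bar> \<le> (\<Sum>\<beta>\<in>K. \<bar>U \<eta> \<beta>\<bar>)" by (rule member_le_sum[OF True]) auto
    then show ?thesis using 1 by simp
  next
    case False
    then show ?thesis using U_supp[OF \<eta>] consts_nonneg by (simp add: supp_def)
  qed
qed

lemma P_diff: "\<bar>w \<beta> - P w \<beta>\<bar> \<le> uC * msum w"
proof -
  have "\<bar>w \<beta> - P w \<beta>\<bar> = \<bar>\<Sum>\<eta>\<in>I. mom \<eta> w * U \<eta> \<beta>\<bar>" by (simp add: P_def)
  also have "\<dots> \<le> (\<Sum>\<eta>\<in>I. \<bar>mom \<eta> w\<bar> * uC)"
    by (intro order_trans[OF sum_abs] sum_mono) (auto simp: abs_mult intro!: mult_left_mono U_bound)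
  finally show ?thesis by (simp add: msum_def sum_distrib_left mult.commute)
qed

lemma abs_le_P: "supp m N 1 w \<Longrightarrow> \<bar>w \<beta>\<bar> \<le> nrm (P w) + uC * msum w"
  using P_diff[of w \<beta>] abs_le_nrm[OF V_supp[OF P_V], of w \<beta>] by linarith

lemma P_fix: "v \<in> V \<Longrightarrow> P v = v"
  unfolding P_def Vspace_iff[OF m2] by simp

lemma P_lincomb: "supp m N 1 u \<Longrightarrow> supp m N 1 v \<Longrightarrow> P (\<lambda>i. u i - c * v i) = (\<lambda>i. P u i - c * P v i)"
  unfolding P_def
  by (rule ext) (simp add: mom_lincomb[OF m2, of N 1] left_diff_distrib sum_subtractf sum_distrib_left right_diff_distrib mult.assoc)

lemma mom_bound:
  assumes "supp m N 1 w" "\<And>\<beta>. \<bar>w \<beta>\<bar> \<le> H" "\<eta> \<in> I"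
  shows "\<bar>mom \<eta> w\<bar> \<le> mC * H"
proof -
  have H: "H \<ge> 0" using order_trans[OF abs_ge_zero assms(2)] .
  have "\<bar>mom \<eta> w\<bar> \<le> (\<Sum>\<beta>\<in>K. \<bar>rmono \<eta> (rvec \<beta>)\<bar> * H)"
    unfolding mom_sum[OF m2 assms(1)]
    by (intro order_trans[OF sum_abs] sum_mono) (auto simp: abs_mult intro!: mult_left_mono assms(2))
  also have "\<dots> = (\<Sum>\<beta>\<in>K. \<bar>rmono \<eta> (rvec \<beta>)\<bar>) * H" by (simp only: sum_distrib_right)
  also have "\<dots> \<le> mC * H" unfolding mC_def
    by (intro mult_right_mono member_le_sum[OF assms(3)] H) (auto intro: sum_nonneg)
  finally show ?thesis .
qed

lemma nrm_P_bound:
  assumes "supp m N 1 w" "\<And>\<beta>. \<bar>w \<beta>\<bar> \<le> H"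
  shows "nrm (P w) \<le> pC * H"
proof -
  have "msum w \<le> (\<Sum>\<eta>\<in>I. mC * H)" unfolding msum_def
    by (intro sum_mono mom_bound assms) auto
  then have "uC * msum w \<le> uC * (real (card I) * (mC * H))"
    using consts_nonneg by (intro mult_left_mono) auto
  then have "\<bar>P w \<beta>\<bar> \<le> (1 + uC * (real (card I) * mC)) * H" for \<beta>
    using P_diff[of w \<beta>] assms(2)[of \<beta>] by (simp add: algebra_simps)
  from nrm_le[OF this] show ?thesis by (simp add: pC_def mult.assoc)
qed

lemma supp_tr1: "supp m N 1 w \<Longrightarrow> \<epsilon> \<in> digits m \<Longrightarrow> supp m N 1 (tr m N b \<epsilon> w)"
  by (rule supp_mono[OF supp_tr[OF m2]]) (use m2 in auto)

text \<open>With a limit mask \<open>b\<close> close to \<open>a k\<close>, the vector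
  \<open>tr m N b \<epsilon> (P w)\<close> lies in \<open>V\<close> and is contracted by
  \<open>r\<close>. The remaining difference is due to the perturbation of the mask, charged to
  \<open>r' - r\<close>, and to the moments of \<open>w\<close>, charged to
  \<open>msum w\<close>.\<close>

lemma V_step:
  assumes an: "\<forall>v\<in>V. nrm v \<le> an v \<and> an v \<le> C0 * nrm v" "C0 \<ge> 0"
    "\<forall>u\<in>V. \<forall>v\<in>V. an (\<lambda>i. u i + v i) \<le> an u + an v"
    "\<forall>b\<in>A. \<forall>\<epsilon>\<in>digits m. \<forall>v\<in>V. an (tr m N b \<epsilon> v) \<le> r * an v" and r: "r < r'"
  shows "\<exists>C\<ge>0. \<exists>k0\<ge>1. \<forall>k\<ge>k0. \<forall>\<epsilon>\<in>digits m. \<forall>w. supp m N 1 w \<longrightarrow>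
     an (P (tr m N (a k) \<epsilon> w)) \<le> r' * an (P w) + C * msum w"
proof -
  define nb where "nb = real (card (mbox N :: (int ^ 's) set))"
  have nb: "nb \<ge> 0" by (simp add: nb_def)
  \<comment> \<open>Tolerance on the mask under which its perturbation, after passing through
    \<open>P\<close> and the adapted norm, costs at most \<open>r' - r\<close>; the summand 1 keeps
    the denominator positive.\<close>
  define e where "e = (r' - r) / (C0 * pC * nb + 1)"
  have den: "C0 * pC * nb + 1 > 0" using an(2) consts_nonneg nb by (intro add_nonneg_pos mult_nonneg_nonneg) auto
  then have e: "e > 0" using r by (simp add: e_def)
  have ee: "C0 * pC * nb * e \<le> r' - r"
  proof -
    have "C0 * pC * nb * e = (r' - r) * ((C0 * pC * nb) / (C0 * pC * nb + 1))" by (simp add: e_def)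
    also have "\<dots> \<le> (r' - r) * 1" using r den by (intro mult_left_mono) (simp_all add: divide_le_eq)
    finally show ?thesis by simp
  qed
  obtain k0 where k0: "k0 \<ge> 1" "\<And>k. k \<ge> k0 \<Longrightarrow> \<exists>b\<in>A. \<forall>\<gamma>. \<bar>a k \<gamma> - b \<gamma>\<bar> < e"
    using near_A[OF e] by blast
  define C where "C = C0 * pC * (nb * e * uC + nb * B * uC)"
  have C: "C \<ge> 0" unfolding C_def
    using an(2) consts_nonneg nb e B_nonneg by (intro mult_nonneg_nonneg add_nonneg_nonneg) auto
  have "an (P (tr m N (a k) \<epsilon> w)) \<le> r' * an (P w) + C * msum w"
    if k: "k \<ge> k0" and eps: "\<epsilon> \<in> digits m" and w: "supp m N 1 w" for k \<epsilon> w
  proof -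
    obtain b where b: "b \<in> A" "\<And>\<gamma>. \<bar>a k \<gamma> - b \<gamma>\<bar> < e" using k0(2)[OF k] by blast
    note PV = P_V[OF w]
    have anw: "nrm (P w) \<le> an (P w)" using an(1) PV by blast
    have an0: "an (P w) \<ge> 0" using anw L2_set_nonneg order_trans by blast
    define z where "z = tr m N b \<epsilon> (P w)"
    have zV: "z \<in> V" unfolding z_def by (rule tr_V[OF b(1) eps PV])
    define y where "y = (\<lambda>i. tr m N (a k) \<epsilon> w i - 1 * z i)"
    have sy: "supp m N 1 y" using supp_tr1[OF w eps, of "a k"] V_supp[OF zV] by (auto simp: y_def supp_def)
    have Py: "P (tr m N (a k) \<epsilon> w) = (\<lambda>i. z i + P y i)"
      unfolding y_def P_lincomb[OF supp_tr1[OF w eps] V_supp[OF zV]] P_fix[OF zV] by simp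
    define W where "W = an (P w) + uC * msum w"
    have W: "\<bar>w \<beta>\<bar> \<le> W" for \<beta> using abs_le_P[OF w, of \<beta>] anw by (simp add: W_def)
    have W0: "W \<ge> 0" using order_trans[OF abs_ge_zero W] .
    have ybound: "\<bar>y \<alpha>\<bar> \<le> nb * (e * W + B * (uC * msum w))" for \<alpha>
    proof -
      \<comment> \<open>The splitting \<open>a w - b (P w) = (a - b) w + b (w - P w)\<close> with
        \<open>a\<close> standing for the mask \<open>a k\<close>.\<close>
      have "y \<alpha> = (\<Sum>\<gamma>\<in>mbox N. (a k \<gamma> - b \<gamma>) * w (\<epsilon> + int m *s \<alpha> - \<gamma>) +
           b \<gamma> * (w (\<epsilon> + int m *s \<alpha> - \<gamma>) - P w (\<epsilon> + int m *s \<alpha> - \<gamma>)))"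
        unfolding y_def z_def tr_def by (simp add: sum_subtractf[symmetric] algebra_simps)
      also have "\<bar>\<dots>\<bar> \<le> (\<Sum>\<gamma>\<in>(mbox N :: (int ^ 's) set). e * W + B * (uC * msum w))"
      proof (intro order_trans[OF sum_abs] sum_mono)
        fix \<gamma> :: "int ^ 's"
        let ?i = "\<epsilon> + int m *s \<alpha> - \<gamma>"
        have "\<bar>(a k \<gamma> - b \<gamma>) * w ?i\<bar> \<le> e * W"
          unfolding abs_mult using b(2)[of \<gamma>] W[of ?i] e by (intro mult_mono) auto
        moreover have "\<bar>b \<gamma> * (w ?i - P w ?i)\<bar> \<le> B * (uC * msum w)"
          unfolding abs_mult using limit_mask(2)[OF b(1)] P_diff B_nonneg by (intro mult_mono) auto
        ultimately show "\<bar>(a k \<gamma> - b \<gamma>) * w ?i + b \<gamma> * (w ?i - P w ?i)\<bar> \<le> e * W + B * (uC * msum w)"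
          by (rule order_trans[OF abs_triangle_ineq add_mono])
      qed
      finally show ?thesis by (simp add: nb_def)
    qed
    have "an (P y) \<le> C0 * nrm (P y)" using an(1) P_V[OF sy] by blast
    also have "\<dots> \<le> C0 * (pC * (nb * (e * W + B * (uC * msum w))))"
      using an(2) by (intro mult_left_mono nrm_P_bound[OF sy ybound])
    also have "\<dots> = (C0 * pC * nb * e) * an (P w) + C * msum w"
      by (simp add: W_def C_def algebra_simps)
    also have "\<dots> \<le> (r' - r) * an (P w) + C * msum w"
      using ee an0 by (intro add_right_mono mult_right_mono)
    finally have "an (P y) \<le> (r' - r) * an (P w) + C * msum w" .
    moreover have "an z \<le> r * an (P w)" unfolding z_def using an(4) b(1) eps PV by blast
    moreover have "an (P (tr m N (a k) \<epsilon> w)) \<le> an z + an (P y)"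
      unfolding Py using an(3) zV P_V[OF sy] by blast
    ultimately show ?thesis by (simp add: algebra_simps)
  qed
  then show ?thesis using C k0(1) by blast
qed

text \<open>The weights are those for which one step of the cascade increases \<open>Q\<close> only by a
  factor \<open>1 + \<epsilon>\<^sub>k\<close> with \<open>\<Sum>\<epsilon>\<^sub>k < \<infinity>\<close>, up to a defect term: a moment of order
  \<open>|\<eta>|\<close> is divided by \<open>m\<^sup>|\<^sup>\<eta>\<^sup>|\<close> and picks up moments of strictly lower order.\<close>

definition Q :: "nat \<Rightarrow> (int ^ 's \<Rightarrow> real) \<Rightarrow> real" where
  "Q k w = (\<Sum>\<eta>\<in>I. \<bar>mom \<eta> w\<bar> / real m ^ (k * mabs \<eta>))"

lemma Q_nonneg: "Q k w \<ge> 0" unfolding Q_def by (auto intro!: sum_nonneg)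

lemma msum_Q: "msum w \<le> real m ^ (k * l) * Q k w"
  unfolding msum_def Q_def sum_distrib_left
proof (intro sum_mono)
  fix \<eta> :: "nat ^ 's" assume "\<eta> \<in> I"
  then have "real m ^ (k * mabs \<eta>) \<le> real m ^ (k * l)" using m2 by (intro power_increasing) auto
  then have "\<bar>mom \<eta> w\<bar> * real m ^ (k * mabs \<eta>) \<le> \<bar>mom \<eta> w\<bar> * real m ^ (k * l)" by (intro mult_left_mono) auto
  then show "\<bar>mom \<eta> w\<bar> \<le> real m ^ (k * l) * (\<bar>mom \<eta> w\<bar> / real m ^ (k * mabs \<eta>))"
    using m2 by (simp add: field_simps)
qed

text \<open>The size of \<open>w\<close> is split into \<open>H\<close>, which will be the size of
  its part in \<open>V\<close>, and a multiple of its moments. The second share returns into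
  \<open>Q\<close> with the summable factor \<sigma>, so only \<open>H\<close> meets the bare
  defect.\<close>

lemma Q_step:
  "\<exists>C\<ge>0. \<forall>k. \<forall>\<epsilon>\<in>digits m. \<forall>w H. supp m N 1 w \<longrightarrow> (\<forall>\<beta>. \<bar>w \<beta>\<bar> \<le> H + uC * msum w) \<longrightarrow> H \<ge> 0 \<longrightarrow>
     Q k (tr m N (a (Suc k)) \<epsilon> w) \<le> (1 + C / real m ^ Suc k + C * \<sigma> (Suc k)) * Q (Suc k) w + C * \<delta> (Suc k) * H"
proof -
  obtain C1 where C1: "C1 \<ge> 0" "\<forall>k\<ge>1. \<forall>\<epsilon>\<in>digits m. \<forall>w H \<eta>. supp m N 1 w \<longrightarrow> (\<forall>\<beta>. \<bar>w \<beta>\<bar> \<le> H) \<longrightarrow> mabs \<eta> \<le> l \<longrightarrow>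
     \<bar>real m ^ mabs \<eta> * mom \<eta> (tr m N (a k) \<epsilon> w) - mom \<eta> w\<bar>
       \<le> C1 * (lowmom (mabs \<eta>) w + real m ^ (k * mabs \<eta>) * \<delta> k * H)"
    using moment_step[of 1] by (elim exE conjE)
  define n where "n = real (card I)"
  have n: "n \<ge> 0" by (simp add: n_def)
  define C where "C = n * C1 * (1 + uC)"
  have C: "C \<ge> 0" using n C1 consts_nonneg by (simp add: C_def)
  have "Q k (tr m N (a (Suc k)) \<epsilon> w) \<le> (1 + C / real m ^ Suc k + C * \<sigma> (Suc k)) * Q (Suc k) w + C * \<delta> (Suc k) * H"
    if e: "\<epsilon> \<in> digits m" and w: "supp m N 1 w" and H: "\<forall>\<beta>. \<bar>w \<beta>\<bar> \<le> H + uC * msum w" "H \<ge> 0" for k \<epsilon> w H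
  proof -
    define G where "G = H + uC * msum w"
    define q where "q = Q (Suc k) w"
    have q0: "q \<ge> 0" unfolding q_def by (rule Q_nonneg)
    define M where "M = real m ^ Suc k"
    have M: "M > 0" using m2 by (simp add: M_def)
    have each: "\<bar>mom \<eta> (tr m N (a (Suc k)) \<epsilon> w)\<bar> / real m ^ (k * mabs \<eta>) \<le>
       \<bar>mom \<eta> w\<bar> / real m ^ (Suc k * mabs \<eta>) + C1 * (q / M + \<delta> (Suc k) * G)" if \<eta>: "\<eta> \<in> I" for \<eta>
    proof -
      define x where "x = mabs \<eta>"
      define p where "p = real m ^ (Suc k * x)"
      have p: "p > 0" using m2 by (simp add: p_def)
      have low: "lowmom x w / p \<le> q / M"
      proof -
        have "lowmom x w / p = (\<Sum>\<eta>'\<in>{\<eta>'. mabs \<eta>' < x}. \<bar>mom \<eta>' w\<bar> / p)"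
          unfolding lowmom_def by (rule sum_divide_distrib)
        also have "\<dots> \<le> (\<Sum>\<eta>'\<in>{\<eta>'. mabs \<eta>' < x}. \<bar>mom \<eta>' w\<bar> / real m ^ (Suc k * mabs \<eta>') / M)"
        proof (intro sum_mono)
          fix \<eta>' :: "nat ^ 's" assume "\<eta>' \<in> {\<eta>'. mabs \<eta>' < x}"
          \<comment> \<open>A strictly lower order gains a full factor \<open>M = m ^ Suc k\<close>,
            which makes the coupling among the moments summable over the levels.\<close>
          then have "Suc k * Suc (mabs \<eta>') \<le> Suc k * x" by (intro mult_le_mono2) auto
          then have "Suc k * mabs \<eta>' + Suc k \<le> Suc k * x" by (simp only: mult_Suc_right add.commute)
          then have "real m ^ (Suc k * mabs \<eta>') * M \<le> p"
            unfolding M_def p_def power_add[symmetric] using m2 by (intro power_increasing) auto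
          then show "\<bar>mom \<eta>' w\<bar> / p \<le> \<bar>mom \<eta>' w\<bar> / real m ^ (Suc k * mabs \<eta>') / M"
            unfolding divide_divide_eq_left using m2 M p by (intro divide_left_mono mult_pos_pos) auto
        qed
        also have "\<dots> \<le> (\<Sum>\<eta>'\<in>I. \<bar>mom \<eta>' w\<bar> / real m ^ (Suc k * mabs \<eta>') / M)"
          using \<eta> M by (intro sum_mono2) (auto simp: x_def)
        also have "\<dots> = q / M" unfolding q_def Q_def sum_divide_distrib ..
        finally show ?thesis .
      qed
      have "\<bar>real m ^ x * mom \<eta> (tr m N (a (Suc k)) \<epsilon> w) - mom \<eta> w\<bar> \<le> C1 * (lowmom x w + p * \<delta> (Suc k) * G)"
        unfolding x_def p_def by (rule C1(2)[rule_format]) (use e w H \<eta> in \<open>auto simp: G_def\<close>)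
      then have "real m ^ x * \<bar>mom \<eta> (tr m N (a (Suc k)) \<epsilon> w)\<bar> \<le> \<bar>mom \<eta> w\<bar> + C1 * (lowmom x w + p * \<delta> (Suc k) * G)"
        using abs_mult[of "real m ^ x" "mom \<eta> (tr m N (a (Suc k)) \<epsilon> w)"] by simp
      then have "real m ^ x * \<bar>mom \<eta> (tr m N (a (Suc k)) \<epsilon> w)\<bar> / p \<le> (\<bar>mom \<eta> w\<bar> + C1 * (lowmom x w + p * \<delta> (Suc k) * G)) / p"
        using p by (intro divide_right_mono) auto
      moreover have "p = real m ^ x * real m ^ (k * x)" by (simp add: p_def power_add)
      then have "real m ^ x * \<bar>mom \<eta> (tr m N (a (Suc k)) \<epsilon> w)\<bar> / p = \<bar>mom \<eta> (tr m N (a (Suc k)) \<epsilon> w)\<bar> / real m ^ (k * x)"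
        using m2 by simp
      moreover have "(\<bar>mom \<eta> w\<bar> + C1 * (lowmom x w + p * \<delta> (Suc k) * G)) / p = \<bar>mom \<eta> w\<bar> / p + C1 * (lowmom x w / p + \<delta> (Suc k) * G)"
        using p by (simp add: field_simps)
      moreover have "C1 * (lowmom x w / p + \<delta> (Suc k) * G) \<le> C1 * (q / M + \<delta> (Suc k) * G)"
        using low C1(1) by (intro mult_left_mono add_right_mono)
      ultimately show ?thesis unfolding x_def[symmetric] p_def[symmetric] by linarith
    qed
    have "Q k (tr m N (a (Suc k)) \<epsilon> w) \<le> (\<Sum>\<eta>\<in>I. \<bar>mom \<eta> w\<bar> / real m ^ (Suc k * mabs \<eta>) + C1 * (q / M + \<delta> (Suc k) * G))"
      unfolding Q_def by (intro sum_mono each)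
    also have "\<dots> = q + n * C1 * (q / M + \<delta> (Suc k) * G)"
      unfolding sum.distrib q_def[unfolded Q_def, symmetric] by (simp add: n_def)
    also have "\<dots> \<le> q + n * C1 * (q / M + \<delta> (Suc k) * (H + uC * (real m ^ (Suc k * l) * q)))"
      unfolding G_def q_def using n C1 consts_nonneg
      by (intro add_left_mono mult_left_mono mult_nonneg_nonneg msum_Q) auto
    also have "\<dots> = q + n * C1 * (q / M) + n * C1 * uC * \<sigma> (Suc k) * q + n * C1 * \<delta> (Suc k) * H"
      by (simp add: \<sigma>_def algebra_simps)
    also have "\<dots> \<le> q + C * (q / M) + C * \<sigma> (Suc k) * q + C * \<delta> (Suc k) * H"
    proof -
      have "n * C1 \<le> C" "n * C1 * uC \<le> C" using n C1 consts_nonneg(1) by (auto simp: C_def algebra_simps)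
      then show ?thesis using q0 M H(2) by (intro add_mono mult_right_mono order_refl) auto
    qed
    finally show ?thesis unfolding q_def[symmetric] M_def[symmetric] by (simp add: algebra_simps)
  qed
  then show ?thesis using C by blast
qed

text \<open>The decay of the component in \<open>V\<^sub>\<ell>\<close> at the rate \<open>\<theta> = m\<^sup>\<ell> r < 1\<close>, driven by
  the defects \<open>\<sigma>\<^sub>k = m\<^sup>k\<^sup>\<ell> \<delta>\<^sub>k\<close>.\<close>

primrec forced_decay :: "real \<Rightarrow> real \<Rightarrow> nat \<Rightarrow> real" where
  "forced_decay c \<theta> 0 = 1"
| "forced_decay c \<theta> (Suc k) = \<theta> * forced_decay c \<theta> k + c * \<sigma> (Suc k)"

lemma forced_decay_lower: "\<theta> \<ge> 0 \<Longrightarrow> c \<ge> 0 \<Longrightarrow> forced_decay c \<theta> k \<ge> \<theta> ^ k"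
proof (induction k)
  case (Suc k)
  then have "\<theta> * \<theta> ^ k \<le> \<theta> * forced_decay c \<theta> k" by (intro mult_left_mono) auto
  then show ?case using Suc.prems by (simp add: add_increasing2)
qed simp

lemma forced_decay_nonneg: "\<theta> \<ge> 0 \<Longrightarrow> c \<ge> 0 \<Longrightarrow> forced_decay c \<theta> k \<ge> 0"
  by (rule order_trans[OF zero_le_power forced_decay_lower])

lemma forced_decay_scale: "\<theta> \<ge> 0 \<Longrightarrow> c \<ge> 1 \<Longrightarrow> forced_decay c \<theta> k \<le> c * forced_decay 1 \<theta> k"
proof (induction k)
  case (Suc k)
  then have "\<theta> * forced_decay c \<theta> k \<le> \<theta> * (c * forced_decay 1 \<theta> k)" by (intro mult_left_mono) auto
  then show ?case by (simp add: algebra_simps)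
qed simp

text \<open>Summing the recursion bounds a partial sum \<open>S\<close> by
  \<open>1 + \<theta> S\<close> plus a multiple of the sum of \<sigma>, and \<theta> is below
  1.\<close>

lemma forced_decay_summable:
  assumes "0 \<le> \<theta>" "\<theta> < 1" "c \<ge> 0"
  shows "summable (forced_decay c \<theta>)"
proof (rule summableI_nonneg_bounded)
  show nn: "0 \<le> forced_decay c \<theta> n" for n by (rule forced_decay_nonneg[OF assms(1,3)])
  fix n
  let ?S = "\<lambda>n. \<Sum>k<n. forced_decay c \<theta> k"
  have s: "(\<Sum>k<n. \<sigma> (Suc k)) \<le> suminf \<sigma>"
  proof -
    have "(\<Sum>k<n. \<sigma> (Suc k)) \<le> (\<Sum>k<Suc n. \<sigma> k)" by (simp add: sum.lessThan_Suc_shift del: sum.lessThan_Suc)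
    also have "\<dots> \<le> suminf \<sigma>" by (rule sum_le_suminf[OF sigma_summable]) auto
    finally show ?thesis .
  qed
  have "?S (Suc n) = 1 + \<theta> * ?S n + c * (\<Sum>k<n. \<sigma> (Suc k))"
    by (simp add: sum.lessThan_Suc_shift sum.distrib sum_distrib_left del: sum.lessThan_Suc)
  also have "\<dots> \<le> 1 + \<theta> * ?S (Suc n) + c * suminf \<sigma>"
    using assms s nn by (intro add_mono mult_left_mono order_refl) auto
  finally have "(1 - \<theta>) * ?S (Suc n) \<le> 1 + c * suminf \<sigma>" by (simp add: algebra_simps)
  then have "?S (Suc n) \<le> (1 + c * suminf \<sigma>) / (1 - \<theta>)" using assms by (simp add: field_simps)
  then show "?S n \<le> (1 + c * suminf \<sigma>) / (1 - \<theta>)" using nn[of n] by simp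
qed

text \<open>The invariant \<open>claim\<close> has two unknowns: the part in \<open>V\<close> enters
  with weight \<open>forced_decay c \<theta> k\<close>, the moments with weight
  \<open>m ^ (k * l)\<close>. Contraction of \<open>V\<close> and its leakage into the moments
  produce exactly the recursion of the first weight; the return of moments into \<open>V\<close> is
  absorbed by factors \<open>1 + t k\<close> whose product converges.\<close>

lemma contraction_K:
  assumes r: "rhoA l m N a < r" and r1: "real m ^ l * r < 1"
  shows "\<exists>C\<ge>0. \<forall>k e w H \<tau>. (\<forall>j. e j \<in> digits m) \<longrightarrow> supp m N 1 w \<longrightarrow> (\<forall>\<beta>. \<bar>w \<beta>\<bar> \<le> H) \<longrightarrow>
     (\<forall>\<eta>. mabs \<eta> \<le> l \<longrightarrow> \<bar>mom \<eta> w\<bar> \<le> \<tau> * real m ^ (k * mabs \<eta>)) \<longrightarrow>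
     (\<forall>\<alpha>. real m ^ (k * l) * \<bar>trs m N a e k w \<alpha>\<bar> \<le> C * (H * forced_decay 1 (real m ^ l * r) k + real m ^ (k * l) * \<tau>))"
proof -
  define \<theta> where "\<theta> = real m ^ l * r"
  have r0: "r > 0" using r rhoA_nonneg by linarith
  have \<theta>: "0 < \<theta>" "\<theta> < 1" using r0 r1 m2 by (auto simp: \<theta>_def)
  have mid: "rhoA l m N a < (rhoA l m N a + r) / 2" "(rhoA l m N a + r) / 2 < r" using r by auto
  obtain an C0 where an: "\<forall>v\<in>V. nrm v \<le> an v \<and> an v \<le> C0 * nrm v" "C0 \<ge> 0"
    "\<forall>u\<in>V. \<forall>v\<in>V. an (\<lambda>i. u i + v i) \<le> an u + an v"
    "\<forall>b\<in>A. \<forall>\<epsilon>\<in>digits m. \<forall>v\<in>V. an (tr m N b \<epsilon> v) \<le> (rhoA l m N a + r) / 2 * an v"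
    using adapted[OF mid(1)] by (elim exE conjE)
  obtain C1 k0 where C1: "C1 \<ge> 0" "\<forall>k\<ge>k0. \<forall>\<epsilon>\<in>digits m. \<forall>w. supp m N 1 w \<longrightarrow>
     an (P (tr m N (a k) \<epsilon> w)) \<le> r * an (P w) + C1 * msum w"
    using V_step[OF an mid(2)] by (elim exE conjE)
  obtain C2 where C2: "C2 \<ge> 0" "\<forall>k. \<forall>\<epsilon>\<in>digits m. \<forall>w H. supp m N 1 w \<longrightarrow> (\<forall>\<beta>. \<bar>w \<beta>\<bar> \<le> H + uC * msum w) \<longrightarrow> H \<ge> 0 \<longrightarrow>
     Q k (tr m N (a (Suc k)) \<epsilon> w) \<le> (1 + C2 / real m ^ Suc k + C2 * \<sigma> (Suc k)) * Q (Suc k) w + C2 * \<delta> (Suc k) * H"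
    using Q_step by (elim exE conjE)
  \<comment> \<open>At least the leakage constant \<open>C2\<close>, and at least 1 as
    \<open>forced_decay_scale\<close> requires.\<close>
  define c where "c = 1 + C2"
  have c: "c \<ge> 1" using C2 by (simp add: c_def)
  let ?E = "forced_decay c \<theta>"
  have E0: "?E k \<ge> 0" for k using \<theta> c by (intro forced_decay_nonneg) auto
  \<comment> \<open>In this order: coupling of moments with lower ones, the defect acting on the
    moments, and moments entering \<open>V\<close>, where they meet the decaying weight.\<close>
  define t where "t k = C2 / real m ^ Suc k + C2 * \<sigma> (Suc k) + real m ^ l * C1 * ?E k" for k
  have t0: "t k \<ge> 0" for k unfolding t_def using C1 C2 E0 by simp
  have "summable t"
  proof -
    have "summable (\<lambda>k. C2 * (1 / real m) ^ Suc k)"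
      using m2 by (intro summable_mult iffD2[OF summable_Suc_iff] summable_geometric) auto
    then have 1: "summable (\<lambda>k. C2 / real m ^ Suc k)" by (simp add: power_divide)
    have 2: "summable (\<lambda>k. C2 * \<sigma> (Suc k))" by (intro summable_mult iffD2[OF summable_Suc_iff] sigma_summable)
    have 3: "summable (\<lambda>k. real m ^ l * C1 * ?E k)" using \<theta> c by (intro summable_mult forced_decay_summable) auto
    show ?thesis unfolding t_def[abs_def] by (intro summable_add 1 2 3)
  qed
  \<comment> \<open>The early masks offer no contraction. As \<open>g * \<theta>\<close> is at least
    the crude growth per step, a fixed power of \<open>g\<close> pays for keeping the weight
    \<open>\<theta> ^ k\<close> there.\<close>
  define g where "g = real m ^ l * (1 + b1) / \<theta>"
  have ml: "real m ^ l \<ge> 1" using m2 by (intro one_le_power) auto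
  have gnum: "real m ^ l * (1 + b1) \<ge> 1" using ml b1_nonneg mult_mono[of 1 "real m ^ l" 1 "1 + b1"] by simp
  have g1: "g \<ge> 1" unfolding g_def using \<theta> gnum by (simp add: le_divide_eq)
  define D0 where "D0 = (1 + uC) * g ^ k0"
  have D0: "D0 \<ge> 0" unfolding D0_def using consts_nonneg g1 by simp
  define D where "D k = D0 * (\<Prod>i<k. 1 + t i)" for k
  have prod1: "(\<Prod>i<k. 1 + t i) \<ge> 1" for k using t0 by (intro prod_ge_1) auto
  have DD0: "D k \<ge> D0" for k unfolding D_def using D0 prod1 by (simp add: mult_le_cancel_left1)
  have Dexp: "D k \<le> D0 * exp (suminf t)" for k
    unfolding D_def by (intro mult_left_mono prod_one_plus_le_exp[OF \<open>summable t\<close> t0] D0)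
  have anP: "nrm (P w) \<le> an (P w)" "an (P w) \<ge> 0" if "supp m N 1 w" for w :: "int ^ 's \<Rightarrow> real"
  proof -
    show "nrm (P w) \<le> an (P w)" using an(1) P_V[OF that] by blast
    then show "an (P w) \<ge> 0" using L2_set_nonneg order_trans by blast
  qed
  have claim: "\<forall>w e. (\<forall>j. e j \<in> digits m) \<longrightarrow> supp m N 1 w \<longrightarrow>
      (\<forall>\<alpha>. real m ^ (k * l) * \<bar>trs m N a e k w \<alpha>\<bar> \<le> D k * (an (P w) * ?E k + real m ^ (k * l) * Q k w))" for k
  proof (induction k)
    case 0
    show ?case
    proof (intro allI impI)
      fix w :: "int ^ 's \<Rightarrow> real" and e :: "nat \<Rightarrow> int ^ 's" and \<alpha> assume w: "supp m N 1 w"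
      have "\<bar>w \<alpha>\<bar> \<le> an (P w) + uC * Q 0 w"
        using abs_le_P[OF w, of \<alpha>] anP(1)[OF w] mult_left_mono[OF msum_Q[of w 0] consts_nonneg(1)] by simp
      also have "\<dots> \<le> (1 + uC) * (an (P w) + Q 0 w)"
        using consts_nonneg(1) anP(2)[OF w] Q_nonneg[of 0 w] by (simp add: algebra_simps)
      also have "\<dots> \<le> D 0 * (an (P w) + Q 0 w)"
      proof (intro mult_right_mono)
        have "(1 + uC) * 1 \<le> D0" unfolding D0_def using consts_nonneg(1) g1 by (intro mult_left_mono one_le_power) auto
        then show "1 + uC \<le> D 0" using DD0[of 0] by simp
      qed (use anP(2)[OF w] Q_nonneg[of 0 w] in simp)
      finally show "real m ^ (0 * l) * \<bar>trs m N a e 0 w \<alpha>\<bar> \<le> D 0 * (an (P w) * ?E 0 + real m ^ (0 * l) * Q 0 w)" by simp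
    qed
  next
    case (Suc k)
    show ?case
    proof (intro allI impI)
      fix w :: "int ^ 's \<Rightarrow> real" and e :: "nat \<Rightarrow> int ^ 's" and \<alpha> assume e: "\<forall>j. e j \<in> digits m" and w: "supp m N 1 w"
      define x where "x = an (P w)"
      define q where "q = Q (Suc k) w"
      define M where "M = real m ^ (Suc k * l)"
      have x0: "x \<ge> 0" and q0: "q \<ge> 0" and M1: "M \<ge> 1" 
        unfolding x_def q_def M_def using anP(2)[OF w] Q_nonneg m2 by (auto intro!: one_le_power)
      have msq: "msum w \<le> M * q" unfolding M_def q_def by (rule msum_Q)
      have wb: "\<bar>w \<beta>\<bar> \<le> x + uC * msum w" for \<beta>
        using abs_le_P[OF w, of \<beta>] anP(1)[OF w] by (simp add: x_def)
      show "real m ^ (Suc k * l) * \<bar>trs m N a e (Suc k) w \<alpha>\<bar> \<le> D (Suc k) * (an (P w) * ?E (Suc k) + real m ^ (Suc k * l) * Q (Suc k) w)"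
        unfolding x_def[symmetric] q_def[symmetric] M_def[symmetric]
      proof (cases "Suc k \<le> k0")
        case True
        have wb2: "\<bar>w \<beta>\<bar> \<le> x + uC * (M * q)" for \<beta>
          using wb[of \<beta>] mult_left_mono[OF msq consts_nonneg(1)] by linarith
        have "\<bar>trs m N a e (Suc k) w \<alpha>\<bar> \<le> b1 ^ Suc k * (x + uC * (M * q))"
          unfolding b1_def by (rule trs_bound) (rule wb2)
        then have "M * \<bar>trs m N a e (Suc k) w \<alpha>\<bar> \<le> M * (b1 ^ Suc k * (x + uC * (M * q)))"
          using M1 by (intro mult_left_mono) auto
        also have "\<dots> \<le> M * ((1 + b1) ^ Suc k * (x + uC * (M * q)))"
          using M1 b1_nonneg x0 q0 consts_nonneg(1) by (intro mult_left_mono mult_right_mono power_mono) auto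
        also have "\<dots> = g ^ Suc k * (\<theta> ^ Suc k * (x + uC * (M * q)))"
        proof -
          have "g * \<theta> = real m ^ l * (1 + b1)" using \<theta> by (simp add: g_def)
          then have "(g * \<theta>) ^ Suc k = (real m ^ l) ^ Suc k * (1 + b1) ^ Suc k" by (simp only: power_mult_distrib)
          moreover have "(real m ^ l) ^ Suc k = M" unfolding M_def power_mult[symmetric] by (simp only: mult.commute)
          ultimately have "M * (1 + b1) ^ Suc k = g ^ Suc k * \<theta> ^ Suc k" by (simp only: power_mult_distrib)
          then show ?thesis by (simp only: mult.assoc[symmetric])
        qed
        also have "\<dots> \<le> g ^ k0 * ((1 + uC) * (x * ?E (Suc k) + M * q))"
        proof (rule mult_mono[OF power_increasing])
          have "\<theta> ^ Suc k * x \<le> ?E (Suc k) * x" using \<theta> c x0 by (intro mult_right_mono forced_decay_lower) auto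
          moreover have "\<theta> ^ Suc k * (uC * (M * q)) \<le> 1 * (uC * (M * q))"
            using \<theta> q0 M1 consts_nonneg(1) by (intro mult_right_mono power_le_one) auto
          moreover have "0 \<le> uC * (x * ?E (Suc k)) + M * q"
            using consts_nonneg(1) x0 q0 M1 E0[of "Suc k"] by (intro add_nonneg_nonneg mult_nonneg_nonneg) auto
          ultimately show "\<theta> ^ Suc k * (x + uC * (M * q)) \<le> (1 + uC) * (x * ?E (Suc k) + M * q)"
            by (simp add: algebra_simps del: forced_decay.simps power_Suc)
          show "0 \<le> \<theta> ^ Suc k * (x + uC * (M * q))"
            using \<theta> x0 q0 M1 consts_nonneg(1) by (intro mult_nonneg_nonneg add_nonneg_nonneg) auto
        qed (use g1 True in auto)
        also have "\<dots> = D0 * (x * ?E (Suc k) + M * q)" by (simp add: D0_def mult_ac del: forced_decay.simps)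
        also have "\<dots> \<le> D (Suc k) * (x * ?E (Suc k) + M * q)"
          using DD0[of "Suc k"] x0 q0 M1 E0[of "Suc k"] by (intro mult_right_mono add_nonneg_nonneg mult_nonneg_nonneg) auto
        finally show "M * \<bar>trs m N a e (Suc k) w \<alpha>\<bar> \<le> D (Suc k) * (x * ?E (Suc k) + M * q)" .
      next
        case False
        define w' where "w' = tr m N (a (Suc k)) (e (Suc k)) w"
        have e1: "e (Suc k) \<in> digits m" using e by blast
        have w': "supp m N 1 w'" unfolding w'_def by (rule supp_tr1[OF w e1])
        have an': "an (P w') \<le> r * x + C1 * (M * q)"
        proof -
          have "an (P w') \<le> r * x + C1 * msum w"
            unfolding w'_def x_def using C1(2) False e1 w by auto
          also have "\<dots> \<le> r * x + C1 * (M * q)" using msq C1(1) by (intro add_left_mono mult_left_mono)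
          finally show ?thesis .
        qed
        have Q': "Q k w' \<le> (1 + C2 / real m ^ Suc k + C2 * \<sigma> (Suc k)) * q + C2 * \<delta> (Suc k) * x"
          unfolding w'_def q_def using C2(2) e1 w wb x0 by blast
        have Mk: "M = real m ^ l * real m ^ (k * l)" by (simp add: M_def power_add)
        have Dk0: "D k \<ge> 0" using DD0[of k] D0 by linarith
        have "M * \<bar>trs m N a e (Suc k) w \<alpha>\<bar> = real m ^ l * (real m ^ (k * l) * \<bar>trs m N a e k w' \<alpha>\<bar>)"
          by (simp add: Mk w'_def)
        also have "\<dots> \<le> real m ^ l * (D k * (an (P w') * ?E k + real m ^ (k * l) * Q k w'))"
          using Suc.IH e w' by (intro mult_left_mono) auto
        also have "\<dots> = D k * (real m ^ l * an (P w') * ?E k + M * Q k w')"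
          by (simp add: Mk algebra_simps)
        also have "\<dots> \<le> D k * (real m ^ l * (r * x + C1 * (M * q)) * ?E k +
            M * ((1 + C2 / real m ^ Suc k + C2 * \<sigma> (Suc k)) * q + C2 * \<delta> (Suc k) * x))"
          using an' Q' E0[of k] M1 Dk0 by (intro mult_left_mono add_mono mult_right_mono) auto
        \<comment> \<open>The terms in \<open>x\<close> use
          \<open>M * \<delta> (Suc k) = \<sigma> (Suc k)\<close>; the coefficients of
          \<open>M * q\<close> add up to \<open>1 + t k\<close>.\<close>
        also have "\<dots> = D k * (x * (\<theta> * ?E k + C2 * \<sigma> (Suc k)) + (1 + t k) * (M * q))"
          by (simp add: \<theta>_def t_def \<sigma>_def M_def algebra_simps add_divide_distrib)
        also have "\<dots> \<le> D k * ((1 + t k) * (x * ?E (Suc k)) + (1 + t k) * (M * q))"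
        proof (intro mult_left_mono add_right_mono Dk0)
          have "x * (\<theta> * ?E k + C2 * \<sigma> (Suc k)) \<le> x * ?E (Suc k)"
            using x0 by (intro mult_left_mono) (auto simp: c_def algebra_simps)
          also have "\<dots> \<le> (1 + t k) * (x * ?E (Suc k))"
          proof -
            have "0 \<le> t k * (x * ?E (Suc k))" by (intro mult_nonneg_nonneg t0 x0 E0)
            then show ?thesis by (simp add: algebra_simps del: forced_decay.simps)
          qed
          finally show "x * (\<theta> * ?E k + C2 * \<sigma> (Suc k)) \<le> (1 + t k) * (x * ?E (Suc k))" .
        qed
        also have "\<dots> = D (Suc k) * (x * ?E (Suc k) + M * q)"
          by (simp add: D_def algebra_simps del: forced_decay.simps)
        finally show "M * \<bar>trs m N a e (Suc k) w \<alpha>\<bar> \<le> D (Suc k) * (x * ?E (Suc k) + M * q)" .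
      qed
    qed
  qed
  define n where "n = real (card I)"
  define CC where "CC = D0 * exp (suminf t) * (C0 * pC * c + n)"
  have n0: "n \<ge> 0" by (simp add: n_def)
  have CC0: "CC \<ge> 0" unfolding CC_def using D0 an(2) consts_nonneg c n0 by simp
  have "real m ^ (k * l) * \<bar>trs m N a e k w \<alpha>\<bar> \<le> CC * (H * forced_decay 1 \<theta> k + real m ^ (k * l) * \<tau>)"
    if e: "\<forall>j. e j \<in> digits m" and w: "supp m N 1 w" and H: "\<forall>\<beta>. \<bar>w \<beta>\<bar> \<le> H"
     and \<tau>: "\<forall>\<eta>. mabs \<eta> \<le> l \<longrightarrow> \<bar>mom \<eta> w\<bar> \<le> \<tau> * real m ^ (k * mabs \<eta>)" for k e w H \<tau> \<alpha>
  proof -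
    have H0: "H \<ge> 0" using H order_trans[OF abs_ge_zero] by blast
    have \<tau>0: "\<tau> \<ge> 0" using \<tau>[rule_format, of 0] order_trans[OF abs_ge_zero] by fastforce
    have "an (P w) \<le> C0 * nrm (P w)" using an(1) P_V[OF w] by blast
    also have "\<dots> \<le> C0 * (pC * H)" using an(2) H by (intro mult_left_mono nrm_P_bound[OF w]) auto
    finally have 1: "an (P w) \<le> C0 * (pC * H)" .
    have "Q k w \<le> (\<Sum>\<eta>\<in>I. \<tau>)" unfolding Q_def
      using \<tau> m2 by (intro sum_mono) (auto simp: divide_le_eq)
    then have 2: "Q k w \<le> n * \<tau>" by (simp add: n_def)
    have E1: "forced_decay 1 \<theta> k \<ge> 0" using \<theta> by (intro forced_decay_nonneg) auto
    have "real m ^ (k * l) * \<bar>trs m N a e k w \<alpha>\<bar> \<le> D k * (an (P w) * ?E k + real m ^ (k * l) * Q k w)"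
      using claim e w by blast
    also have "\<dots> \<le> (D0 * exp (suminf t)) * (C0 * (pC * H) * (c * forced_decay 1 \<theta> k) + real m ^ (k * l) * (n * \<tau>))"
      using Dexp 1 2 anP(2)[OF w] Q_nonneg E0 D0 H0 an(2) consts_nonneg \<theta> c
      by (intro mult_mono add_mono forced_decay_scale mult_left_mono add_nonneg_nonneg mult_nonneg_nonneg) auto
    also have "\<dots> \<le> (D0 * exp (suminf t)) * ((C0 * pC * c + n) * (H * forced_decay 1 \<theta> k + real m ^ (k * l) * \<tau>))"
    proof (intro mult_left_mono)
      have "0 \<le> n * (H * forced_decay 1 \<theta> k) + C0 * pC * c * (real m ^ (k * l) * \<tau>)"
        using n0 H0 E1 an(2) consts_nonneg c \<tau>0 by (intro add_nonneg_nonneg mult_nonneg_nonneg) auto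
      then show "C0 * (pC * H) * (c * forced_decay 1 \<theta> k) + real m ^ (k * l) * (n * \<tau>) \<le> (C0 * pC * c + n) * (H * forced_decay 1 \<theta> k + real m ^ (k * l) * \<tau>)"
        by (simp add: algebra_simps)
    qed (use D0 in simp)
    finally show ?thesis by (simp add: CC_def mult.assoc)
  qed
  then show ?thesis unfolding \<theta>_def[symmetric] using CC0 by blast
qed

text \<open>One transition step reduces the slack of the box by at least one, so the case of larger
  slack follows from the smaller one at level \<open>k - 1\<close>. The step itself is estimated
  crudely, and \<open>moment_step\<close> supplies the new \<tau>.\<close>

lemma contraction:
  assumes r: "rhoA l m N a < r" and r1: "real m ^ l * r < 1"
  shows "\<exists>C\<ge>0. \<forall>k e w H \<tau>. (\<forall>j. e j \<in> digits m) \<longrightarrow> supp m N (Suc d) w \<longrightarrow> (\<forall>\<beta>. \<bar>w \<beta>\<bar> \<le> H) \<longrightarrow>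
     (\<forall>\<eta>. mabs \<eta> \<le> l \<longrightarrow> \<bar>mom \<eta> w\<bar> \<le> \<tau> * real m ^ (k * mabs \<eta>)) \<longrightarrow>
     (\<forall>\<alpha>. real m ^ (k * l) * \<bar>trs m N a e k w \<alpha>\<bar> \<le> C * (H * forced_decay 1 (real m ^ l * r) k + real m ^ (k * l) * \<tau>))"
proof (induction d)
  case 0
  then show ?case using contraction_K[OF assms] by simp
next
  case (Suc d)
  define \<theta> where "\<theta> = real m ^ l * r"
  have r0: "r > 0" using r rhoA_nonneg by linarith
  have \<theta>: "0 < \<theta>" "\<theta> < 1" using r0 r1 m2 by (auto simp: \<theta>_def)
  obtain C where C: "C \<ge> 0" "\<forall>k e w H \<tau>. (\<forall>j. e j \<in> digits m) \<longrightarrow> supp m N (Suc d) w \<longrightarrow> (\<forall>\<beta>. \<bar>w \<beta>\<bar> \<le> H) \<longrightarrow>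
     (\<forall>\<eta>. mabs \<eta> \<le> l \<longrightarrow> \<bar>mom \<eta> w\<bar> \<le> \<tau> * real m ^ (k * mabs \<eta>)) \<longrightarrow>
     (\<forall>\<alpha>. real m ^ (k * l) * \<bar>trs m N a e k w \<alpha>\<bar> \<le> C * (H * forced_decay 1 \<theta> k + real m ^ (k * l) * \<tau>))"
    using Suc.IH unfolding \<theta>_def[symmetric] by (elim exE conjE)
  obtain C1 where C1: "C1 \<ge> 0" "\<forall>k\<ge>1. \<forall>\<epsilon>\<in>digits m. \<forall>w H \<eta>. supp m N (Suc (Suc d)) w \<longrightarrow> (\<forall>\<beta>. \<bar>w \<beta>\<bar> \<le> H) \<longrightarrow> mabs \<eta> \<le> l \<longrightarrow>
     \<bar>real m ^ mabs \<eta> * mom \<eta> (tr m N (a k) \<epsilon> w) - mom \<eta> w\<bar>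
       \<le> C1 * (lowmom (mabs \<eta>) w + real m ^ (k * mabs \<eta>) * \<delta> k * H)"
    using moment_step[of "Suc (Suc d)"] by (elim exE conjE)
  define n where "n = real (card I)"
  have n0: "n \<ge> 0" by (simp add: n_def)
  \<comment> \<open>The first summand pays for the step without contraction:
    \<open>forced_decay\<close> at \<open>k\<close> is at least \<theta> times its value at
    \<open>k - 1\<close>. The other summands come from the moments after that step.\<close>
  define C3 where "C3 = real m ^ l * b1 / \<theta> + (1 + C1 * n) + C1"
  have C30: "C3 \<ge> 0" unfolding C3_def using b1_nonneg \<theta> C1 n0 by simp
  have C31: "C3 \<ge> 1" unfolding C3_def using b1_nonneg \<theta> C1 n0 by simp
  have "real m ^ (k * l) * \<bar>trs m N a e k w \<alpha>\<bar> \<le> ((1 + C) * C3) * (H * forced_decay 1 \<theta> k + real m ^ (k * l) * \<tau>)"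
    if e: "\<forall>j. e j \<in> digits m" and w: "supp m N (Suc (Suc d)) w" and H: "\<forall>\<beta>. \<bar>w \<beta>\<bar> \<le> H"
     and \<tau>: "\<forall>\<eta>. mabs \<eta> \<le> l \<longrightarrow> \<bar>mom \<eta> w\<bar> \<le> \<tau> * real m ^ (k * mabs \<eta>)" for k e w H \<tau> \<alpha>
  proof -
    have H0: "H \<ge> 0" using H order_trans[OF abs_ge_zero] by blast
    have \<tau>0: "\<tau> \<ge> 0" using \<tau>[rule_format, of 0] order_trans[OF abs_ge_zero] by fastforce
    show ?thesis
    proof (cases k)
      case 0
      have "1 * 1 \<le> (1 + C) * C3" using C(1) C31 by (intro mult_mono) auto
      then have "H + \<tau> \<le> ((1 + C) * C3) * (H + \<tau>)" using H0 \<tau>0 by (simp add: mult_le_cancel_right1)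
      then show ?thesis using 0 H[rule_format, of \<alpha>] \<tau>0 by simp
    next
      case (Suc k')
      define w' where "w' = tr m N (a k) (e k) w"
      define D where "D = \<delta> k"
      have D0: "D \<ge> 0" by (simp add: D_def)
      have "Suc (Suc d) div m \<le> Suc d"
        using m2 div_le_mono2[of 2 m "Suc (Suc d)"] by linarith
      then have w': "supp m N (Suc d) w'"
        unfolding w'_def using supp_mono[OF supp_tr[OF m2 _ w]] e by blast
      have w'b: "\<forall>\<beta>. \<bar>w' \<beta>\<bar> \<le> b1 * H"
        unfolding w'_def b1_def using b1_step[of k w H] H Suc by simp
      have mom': "\<bar>mom \<eta> w'\<bar> \<le> ((1 + C1 * n) * \<tau> + C1 * D * H) * real m ^ (k' * mabs \<eta>)" if \<eta>: "mabs \<eta> \<le> l" for \<eta>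
      proof -
        define p where "p = real m ^ (k * mabs \<eta>)"
        have p: "p = real m ^ mabs \<eta> * real m ^ (k' * mabs \<eta>)" by (simp add: p_def Suc power_add)
        have "lowmom (mabs \<eta>) w \<le> (\<Sum>\<eta>'\<in>{\<eta>' :: nat ^ 's. mabs \<eta>' < mabs \<eta>}. \<tau> * p)"
          unfolding lowmom_def p_def
        proof (intro sum_mono)
          fix \<eta>' :: "nat ^ 's" assume "\<eta>' \<in> {\<eta>'. mabs \<eta>' < mabs \<eta>}"
          then have "\<bar>mom \<eta>' w\<bar> \<le> \<tau> * real m ^ (k * mabs \<eta>')" using \<tau> \<eta> by auto
          also have "\<dots> \<le> \<tau> * real m ^ (k * mabs \<eta>)"
            using \<open>\<eta>' \<in> _\<close> \<tau>0 m2 by (intro mult_left_mono power_increasing) auto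
          finally show "\<bar>mom \<eta>' w\<bar> \<le> \<tau> * real m ^ (k * mabs \<eta>)" .
        qed
        also have "\<dots> \<le> (\<Sum>\<eta>'\<in>I. \<tau> * p)" using \<eta> \<tau>0 by (intro sum_mono2) (auto simp: p_def)
        finally have low: "lowmom (mabs \<eta>) w \<le> n * (\<tau> * p)" by (simp add: n_def)
        have "\<bar>real m ^ mabs \<eta> * mom \<eta> w' - mom \<eta> w\<bar> \<le> C1 * (lowmom (mabs \<eta>) w + p * D * H)"
          unfolding w'_def p_def D_def by (rule C1(2)[rule_format]) (use e w H \<eta> Suc in auto)
        also have "\<dots> \<le> C1 * (n * (\<tau> * p) + p * D * H)" using low C1(1) by (intro mult_left_mono add_right_mono)
        finally have "\<bar>real m ^ mabs \<eta> * mom \<eta> w'\<bar> \<le> \<tau> * p + C1 * (n * (\<tau> * p) + p * D * H)"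
          using \<tau>[rule_format, OF \<eta>] by (simp add: p_def)
        also have "\<dots> = real m ^ mabs \<eta> * (((1 + C1 * n) * \<tau> + C1 * D * H) * real m ^ (k' * mabs \<eta>))"
          by (simp add: p algebra_simps)
        finally show ?thesis using m2 by (simp add: abs_mult)
      qed
      define E where "E = forced_decay 1 \<theta> k'"
      have E: "E \<ge> 0" unfolding E_def using \<theta> by (intro forced_decay_nonneg) auto
      have Ek: "forced_decay 1 \<theta> k = \<theta> * E + \<sigma> k" by (simp add: Suc E_def)
      define M where "M = real m ^ (k * l)"
      have M0: "M \<ge> 0" by (simp add: M_def)
      have Mk: "M = real m ^ l * real m ^ (k' * l)" by (simp add: M_def Suc power_add)
      have "real m ^ (k' * l) * \<bar>trs m N a e k' w' \<alpha>\<bar> \<le>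
         C * ((b1 * H) * E + real m ^ (k' * l) * ((1 + C1 * n) * \<tau> + C1 * D * H))"
        unfolding E_def by (rule C(2)[rule_format]) (use e w' w'b mom' in auto)
      then have "real m ^ l * (real m ^ (k' * l) * \<bar>trs m N a e k' w' \<alpha>\<bar>) \<le>
         real m ^ l * (C * ((b1 * H) * E + real m ^ (k' * l) * ((1 + C1 * n) * \<tau> + C1 * D * H)))"
        by (intro mult_left_mono) auto
      also have "\<dots> = C * (H * ((real m ^ l * b1 / \<theta>) * (\<theta> * E) + C1 * \<sigma> k) + (1 + C1 * n) * (M * \<tau>))"
        using \<theta> by (simp add: Mk \<sigma>_def[of k] D_def M_def[symmetric] algebra_simps)
      also have "\<dots> \<le> C * (H * (C3 * (\<theta> * E) + C3 * \<sigma> k) + C3 * (M * \<tau>))"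
        using C(1) H0 M0 \<tau>0 E \<theta> b1_nonneg C1(1) n0
        by (intro mult_left_mono add_mono mult_right_mono) (auto simp: C3_def)
      also have "\<dots> = C * (C3 * (H * forced_decay 1 \<theta> k + M * \<tau>))"
        unfolding Ek by (simp add: algebra_simps)
      also have "\<dots> \<le> (1 + C) * (C3 * (H * forced_decay 1 \<theta> k + M * \<tau>))"
        unfolding Ek using H0 M0 \<tau>0 E \<theta> C30
        by (intro mult_right_mono mult_nonneg_nonneg add_nonneg_nonneg) auto
      finally show ?thesis by (simp add: Suc w'_def M_def power_add mult_ac)
    qed
  qed
  then show ?case unfolding \<theta>_def[symmetric] using C(1) C30 by (intro exI[of _ "(1 + C) * C3"]) auto
qed

end

section \<open>Poisson summation\<close>

definition ee :: "real ^ 's::finite \<Rightarrow> real ^ 's \<Rightarrow> complex" where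
  "ee \<omega> x = cis (- (2 * pi * (x \<bullet> \<omega>)))"

definition gf :: "(real ^ 's::finite \<Rightarrow> complex) \<Rightarrow> real ^ 's \<Rightarrow> complex" where
  "gf g \<omega> = (LINT x|lborel. g x * ee \<omega> x)"

definition cube :: "real \<Rightarrow> (real ^ 's::finite) set" where
  "cube R = cbox (\<chi> i. - R) (\<chi> i. R)"

definition ucube :: "(real ^ 's::finite) set" where
  "ucube = {x. \<forall>i. 0 \<le> x $ i \<and> x $ i < 1}"

text \<open>The mean over the torus. The cube is half open, so that each class modulo the lattice
  has exactly one representative in it.\<close>

definition cmean :: "(real ^ 's::finite \<Rightarrow> complex) \<Rightarrow> complex" where
  "cmean F = (LINT x|lborel. indicator ucube x *\<^sub>R F x)"

lemma fourier_gf: "fourier f = gf (\<lambda>x. of_real (f x))"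
  by (auto simp: fourier_def gf_def ee_def cis_conv_exp mult_ac intro!: ext)

lemma mem_cube: "x \<in> cube R \<longleftrightarrow> (\<forall>i. \<bar>x $ i\<bar> \<le> R)"
  by (auto simp: cube_def mem_box_cart abs_le_iff) (metis minus_le_iff)+

lemma compact_cube: "compact (cube R)" by (simp add: cube_def)

lemma continuous_ee [continuous_intros]: "continuous_on S (\<lambda>x. ee \<omega> x)"
  unfolding ee_def by (intro continuous_intros)

lemma ee_add_left: "ee (\<omega> + \<nu>) x = ee \<omega> x * ee \<nu> x"
  by (simp add: ee_def cis_mult inner_add_right algebra_simps)

lemma ee_add_right: "ee \<omega> (x + y) = ee \<omega> x * ee \<omega> y"
  by (simp add: ee_def cis_mult inner_add_left algebra_simps)

lemma cis_2pi_int: "cis (2 * pi * of_int n) = 1"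
  by (simp add: complex_eq_iff)

lemma ee_lattice: "ee (rvec \<alpha>) (rvec \<beta>) = 1"
proof -
  have "rvec \<beta> \<bullet> rvec \<alpha> = of_int (\<Sum>i\<in>UNIV. \<beta> $ i * \<alpha> $ i)"
    by (simp add: inner_vec_def rvec_def)
  then have "ee (rvec \<alpha>) (rvec \<beta>) = cis (2 * pi * of_int (- (\<Sum>i\<in>UNIV. \<beta> $ i * \<alpha> $ i)))"
    by (simp add: ee_def)
  then show ?thesis by (simp only: cis_2pi_int)
qed

lemma ee_periodic: "ee (rvec \<alpha>) (x + rvec \<beta>) = ee (rvec \<alpha>) x"
  by (simp add: ee_add_right ee_lattice)

lemma integrable_compact_support:
  fixes g :: "real ^ 's::finite \<Rightarrow> complex"
  assumes "continuous_on UNIV g" "\<And>x. g x \<noteq> 0 \<Longrightarrow> x \<in> cube R"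
  shows "integrable lborel g"
proof -
  have "integrable lborel (\<lambda>x. indicator (cube R) x *\<^sub>R g x)"
    by (rule borel_integrable_compact[OF compact_cube continuous_on_subset[OF assms(1)]]) simp
  moreover have "(\<lambda>x. indicator (cube R) x *\<^sub>R g x) = g"
  proof
    show "indicator (cube R) x *\<^sub>R g x = g x" for x
      using assms(2)[of x] by (cases "x \<in> cube R") auto
  qed
  ultimately show ?thesis by simp
qed

lemma gf_integral:
  assumes c: "continuous_on UNIV g" and s: "\<And>x. g x \<noteq> 0 \<Longrightarrow> x \<in> cube R"
  shows "gf g \<omega> = integral (cube R) (\<lambda>x. g x * ee \<omega> x)"
proof -
  let ?h = "\<lambda>x. g x * ee \<omega> x"
  have "integrable lborel ?h"
    by (rule integrable_compact_support[of _ R]) (use s in \<open>auto intro!: continuous_intros c\<close>)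
  then have "gf g \<omega> = integral UNIV ?h" by (simp add: gf_def integral_lborel)
  also have "\<dots> = integral UNIV (\<lambda>x. if x \<in> cube R then ?h x else 0)"
    using s by (intro arg_cong[of _ _ "integral UNIV"] ext) auto
  also have "\<dots> = integral (cube R) ?h" by (rule integral_restrict_UNIV)
  finally show ?thesis .
qed

text \<open>Differentiation under the integral sign over the fixed cube carrying \<open>g\<close>,
  where the integrand and its derivative in the frequency are jointly continuous.\<close>

lemma has_partial_gf:
  assumes c: "continuous_on UNIV g" and s: "\<And>x. g x \<noteq> 0 \<Longrightarrow> x \<in> cube R"
  shows "has_partial i (gf g) (gf (\<lambda>x. (- 2 * pi * \<i>) * of_real (x $ i) * g x))"
  unfolding has_partial_def
proof
  fix \<omega> :: "real ^ 'a"
  let ?fx = "\<lambda>t x. (- 2 * pi * \<i>) * of_real (x $ i) * g x * ee (\<omega> + axis i t) x"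
  have e: "ee (\<omega> + axis i t) x = ee \<omega> x * cis (- (2 * pi * (x $ i * t)))" for t x
    by (simp add: ee_def cis_mult inner_add_right inner_axis distrib_left)
  have "((\<lambda>t. integral (cbox (\<chi> i. - R) (\<chi> i. R)) (\<lambda>x. g x * ee (\<omega> + axis i t) x))
     has_vector_derivative integral (cbox (\<chi> i. - R) (\<chi> i. R)) (?fx 0)) (at 0 within UNIV)"
  proof (rule leibniz_rule_vector_derivative)
    fix t and x :: "real ^ 'a"
    define K where "K = \<i> * of_real (- (2 * pi * x $ i))"
    have "((\<lambda>t. of_real t * K) has_vector_derivative 1 * K) (at t)"
      by (intro has_vector_derivative_mult_left has_vector_derivative_of_real) (auto intro!: derivative_eq_intros)
    moreover have "(exp has_field_derivative exp (of_real t * K)) (at (of_real t * K))" by (rule DERIV_exp)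
    ultimately have "(exp \<circ> (\<lambda>t. of_real t * K) has_vector_derivative 1 * K * exp (of_real t * K)) (at t)"
      by (rule field_vector_diff_chain_at)
    then have "((\<lambda>t. exp (of_real t * (\<i> * of_real (- (2 * pi * x $ i))))) has_vector_derivative
       (\<i> * of_real (- (2 * pi * x $ i))) * exp (of_real t * (\<i> * of_real (- (2 * pi * x $ i))))) (at t)"
      unfolding o_def K_def by simp
    moreover have "exp (of_real t * (\<i> * of_real (- (2 * pi * x $ i)))) = cis (- (2 * pi * (x $ i * t)))" for t
      by (simp add: cis_conv_exp mult_ac)
    ultimately have "((\<lambda>t. cis (- (2 * pi * (x $ i * t)))) has_vector_derivative
       (\<i> * of_real (- (2 * pi * x $ i))) * cis (- (2 * pi * (x $ i * t)))) (at t)" by simp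
    then have "((\<lambda>t. g x * ee \<omega> x * cis (- (2 * pi * (x $ i * t)))) has_vector_derivative
       g x * ee \<omega> x * ((\<i> * of_real (- (2 * pi * x $ i))) * cis (- (2 * pi * (x $ i * t))))) (at t)"
      by (rule has_vector_derivative_mult_right)
    then show "((\<lambda>t. g x * ee (\<omega> + axis i t) x) has_vector_derivative ?fx t x) (at t within UNIV)"
      by (simp add: e mult_ac)
  next
    show "(\<lambda>x. g x * ee (\<omega> + axis i t) x) integrable_on cbox (\<chi> i. - R) (\<chi> i. R)" for t
      by (intro integrable_continuous continuous_intros continuous_on_subset[OF c]) auto
    show "continuous_on (UNIV \<times> cbox (\<chi> i. - R) (\<chi> i. R)) (\<lambda>(t, x). ?fx t x)"
      unfolding e split_def
      by (intro continuous_intros continuous_on_compose2[OF c] continuous_on_compose2[OF continuous_ee[of UNIV]]) auto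
  qed auto
  moreover have "gf (\<lambda>x. (- 2 * pi * \<i>) * of_real (x $ i) * g x) \<omega> = integral (cube R) (?fx 0)"
    by (subst gf_integral[of _ R]) (use s in \<open>auto intro!: continuous_intros c\<close>)
  moreover have gi: "gf g \<nu> = integral (cube R) (\<lambda>x. g x * ee \<nu> x)" for \<nu>
    by (rule gf_integral[OF c]) (rule s)
  ultimately show "((\<lambda>t. gf g (\<omega> + axis i t)) has_vector_derivative gf (\<lambda>x. (- 2 * pi * \<i>) * of_real (x $ i) * g x) \<omega>) (at 0)"
    by (simp only: gi) (simp add: cube_def)
qed

lemma Dl_gf:
  assumes c: "continuous_on UNIV g" and s: "\<And>x. g x \<noteq> 0 \<Longrightarrow> x \<in> cube R"
  shows "Dl is (gf g) = gf (\<lambda>x. (- 2 * pi * \<i>) ^ length is * of_real (\<Prod>j\<leftarrow>is. x $ j) * g x)"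
proof (induction "is")
  case (Cons i js)
  have cp: "continuous_on UNIV (\<lambda>x :: real ^ 'a. \<Prod>j\<leftarrow>js. x $ j)" by (induction js) (auto intro!: continuous_intros)
  have "Dl (i # js) (gf g) = partial i (gf (\<lambda>x. (- 2 * pi * \<i>) ^ length js * of_real (\<Prod>j\<leftarrow>js. x $ j) * g x))"
    unfolding Dl_Cons Cons.IH ..
  also have "\<dots> = gf (\<lambda>x. (- 2 * pi * \<i>) * of_real (x $ i) * ((- 2 * pi * \<i>) ^ length js * of_real (\<Prod>j\<leftarrow>js. x $ j) * g x))"
    by (rule has_partial_partial[OF has_partial_gf[of _ R]])
       (use s in \<open>auto intro!: continuous_intros cp c\<close>)
  finally show ?case by (simp add: mult_ac)
qed simp

lemma mderiv_fourier:
  assumes c: "continuous_on UNIV f" and s: "\<And>x. f x \<noteq> 0 \<Longrightarrow> x \<in> cube R"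
  shows "mderiv \<mu> (fourier f) \<omega> = (- 2 * pi * \<i>) ^ mabs \<mu> * gf (\<lambda>x. of_real (rmono \<mu> x * f x)) \<omega>"
proof -
  obtain "is" where i: "mderiv \<mu> (fourier f) = Dl is (fourier f)" "length is = mabs \<mu>"
    "\<And>x :: real ^ 'a. (\<Prod>j\<leftarrow>is. x $ j) = rmono \<mu> x"
    using mderiv_Dl[of \<mu> "fourier f"] unfolding rmono_def by blast
  have "Dl is (fourier f) = gf (\<lambda>x. (- 2 * pi * \<i>) ^ length is * of_real (\<Prod>j\<leftarrow>is. x $ j) * of_real (f x))"
    unfolding fourier_gf by (rule Dl_gf[of _ R]) (use s in \<open>auto intro!: continuous_intros c\<close>)
  then show ?thesis unfolding i gf_def by (simp add: mult.assoc)
qed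

lemma integral_shift:
  fixes H :: "real ^ 's::finite \<Rightarrow> complex"
  assumes "H \<in> borel_measurable borel"
  shows "(LINT x|lborel. H (c + x)) = (LINT x|lborel. H x)"
proof -
  have "(LINT x|lborel. H x) = (LINT x|distr lborel borel ((+) c). H x)" by (simp add: lborel_distr_plus)
  also have "\<dots> = (LINT x|lborel. H (c + x))" by (rule integral_distr) (use assms in auto)
  finally show ?thesis ..
qed

lemma ucube_borel [measurable]: "(ucube :: (real ^ 's::finite) set) \<in> sets borel"
proof -
  have eq: "ucube = (\<Inter>i. {x :: real ^ 's. 0 \<le> x $ i} \<inter> {x. x $ i < 1})" by (auto simp: ucube_def)
  have "closed {x :: real ^ 's. 0 \<le> x $ i}" "open {x :: real ^ 's. x $ i < 1}" for i
    by (auto intro!: closed_Collect_le open_Collect_less continuous_intros)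
  then have "(\<Inter>i. {x :: real ^ 's. 0 \<le> x $ i} \<inter> {x. x $ i < 1}) \<in> sets borel"
    by (intro sets.finite_INT sets.Int borel_closed borel_open) auto
  then show ?thesis unfolding eq .
qed

lemma exists_floor: "\<exists>\<beta>. x - rvec \<beta> \<in> ucube"
proof
  show "x - rvec (\<chi> i. \<lfloor>x $ i\<rfloor>) \<in> ucube"
    by (auto simp: ucube_def rvec_simps floor_le_iff) linarith
qed

lemma ucube_unique: "x - rvec \<beta> \<in> ucube \<Longrightarrow> x - rvec \<beta>' \<in> ucube \<Longrightarrow> \<beta> = \<beta>'"
proof -
  assume a: "x - rvec \<beta> \<in> ucube" "x - rvec \<beta>' \<in> ucube"
  have "\<beta> $ i = \<beta>' $ i" for i
  proof -
    have "0 \<le> x $ i - of_int (\<beta> $ i)" "x $ i - of_int (\<beta> $ i) < 1" "0 \<le> x $ i - of_int (\<beta>' $ i)" "x $ i - of_int (\<beta>' $ i) < 1"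
      using a by (auto simp: ucube_def rvec_simps)
    then show ?thesis by linarith
  qed
  then show ?thesis by (simp add: vec_eq_iff)
qed

text \<open>The integer translates of \<open>ucube\<close> tile the space, and only those by
  elements of \<open>S\<close> meet the support of \<open>H\<close>.\<close>

lemma unfold_integral:
  fixes H :: "real ^ 's::finite \<Rightarrow> complex"
  assumes int: "integrable lborel H" and fin: "finite S" and s: "\<And>x \<beta>. x \<in> ucube \<Longrightarrow> \<beta> \<notin> S \<Longrightarrow> H (x + rvec \<beta>) = 0"
  shows "(LINT x|lborel. H x) = cmean (\<lambda>x. \<Sum>\<beta>\<in>S. H (x + rvec \<beta>))"
proof -
  have meas: "H \<in> borel_measurable borel" using borel_measurable_integrable[OF int] by simp
  have eq: "H x = (\<Sum>\<beta>\<in>S. indicator ucube (x - rvec \<beta>) *\<^sub>R H x)" for x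
  proof -
    obtain \<beta>0 where b: "x - rvec \<beta>0 \<in> ucube" using exists_floor by blast
    have "(indicator ucube (x - rvec \<beta>) :: real) = (if \<beta> = \<beta>0 then 1 else 0)" for \<beta>
    proof (cases "\<beta> = \<beta>0")
      case False
      then have "x - rvec \<beta> \<notin> ucube" using ucube_unique[OF b] by blast
      then show ?thesis using False by simp
    qed (use b in simp)
    then have "(\<Sum>\<beta>\<in>S. indicator ucube (x - rvec \<beta>) *\<^sub>R H x) = (if \<beta>0 \<in> S then H x else 0)"
      using fin by (simp add: if_distrib[of "\<lambda>c. c *\<^sub>R H x"] cong: if_cong)
    then show ?thesis using s[OF b, of \<beta>0] by auto
  qed
  have i1: "integrable lborel (\<lambda>x. indicator ucube (x - rvec \<beta>) *\<^sub>R H x)" for \<beta>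
  proof -
    have "indicator ucube (x - rvec \<beta>) = (indicator ((\<lambda>x. x - rvec \<beta>) -` ucube) x :: real)" for x
      by (simp add: indicator_def)
    moreover have "(\<lambda>x. x - rvec \<beta>) -` ucube \<in> sets borel"
      using measurable_sets[of "\<lambda>x. x - rvec \<beta>" borel borel ucube] by (simp add: ucube_borel)
    ultimately show ?thesis using integrable_mult_indicator[OF _ int] by simp
  qed
  have "(LINT x|lborel. H x) = (\<Sum>\<beta>\<in>S. LINT x|lborel. indicator ucube (x - rvec \<beta>) *\<^sub>R H x)"
    by (subst eq) (rule Bochner_Integration.integral_sum[OF i1])
  also have "\<dots> = (\<Sum>\<beta>\<in>S. LINT x|lborel. indicator ucube x *\<^sub>R H (x + rvec \<beta>))"
  proof (intro sum.cong refl)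
    fix \<beta>
    have "(\<lambda>x. indicator ucube (x - rvec \<beta>) *\<^sub>R H x) \<in> borel_measurable borel"
      using borel_measurable_integrable[OF i1] by simp
    from integral_shift[OF this, of "rvec \<beta>"]
    show "(LINT x|lborel. indicator ucube (x - rvec \<beta>) *\<^sub>R H x) = (LINT x|lborel. indicator ucube x *\<^sub>R H (x + rvec \<beta>))"
      by (simp add: add.commute)
  qed
  also have "\<dots> = cmean (\<lambda>x. \<Sum>\<beta>\<in>S. H (x + rvec \<beta>))"
    unfolding cmean_def scaleR_sum_right
  proof (rule Bochner_Integration.integral_sum[symmetric])
    fix \<beta>
    have "integrable (distr lborel borel ((+) (rvec \<beta>))) (\<lambda>x. indicator ucube (x - rvec \<beta>) *\<^sub>R H x)"
      using i1 by (simp add: lborel_distr_plus)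
    then show "integrable lborel (\<lambda>x. indicator ucube x *\<^sub>R H (x + rvec \<beta>))"
      by (subst (asm) integrable_distr_eq) (use borel_measurable_integrable[OF i1] in \<open>auto simp: add.commute\<close>)
  qed
  finally show ?thesis .
qed

lemma cmean_integrable:
  assumes "continuous_on UNIV F"
  shows "integrable lborel (\<lambda>x. indicator ucube x *\<^sub>R (F x :: complex))"
proof -
  have "integrable lborel (\<lambda>x. indicator (cube 1) x *\<^sub>R F x)"
    by (rule borel_integrable_compact[OF compact_cube continuous_on_subset[OF assms]]) simp
  from integrable_mult_indicator[OF _ this, of ucube]
  have "integrable lborel (\<lambda>x. indicator ucube x *\<^sub>R indicator (cube 1) x *\<^sub>R F x)" by simp
  moreover have "(\<lambda>x. indicator ucube x *\<^sub>R indicator (cube 1) x *\<^sub>R F x) = (\<lambda>x. indicator ucube x *\<^sub>R F x)"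
  proof
    fix x :: "real ^ 'a"
    have "x \<in> ucube \<Longrightarrow> x \<in> cube 1" by (simp add: ucube_def mem_cube abs_of_nonneg less_imp_le)
    then show "indicator ucube x *\<^sub>R indicator (cube 1) x *\<^sub>R F x = indicator ucube x *\<^sub>R F x"
      by (cases "x \<in> ucube") auto
  qed
  ultimately show ?thesis by (simp only:)
qed

lemma cmean_add: "continuous_on UNIV F \<Longrightarrow> continuous_on UNIV G \<Longrightarrow> cmean (\<lambda>x. F x + G x) = cmean F + cmean G"
  unfolding cmean_def scaleR_add_right
  by (rule Bochner_Integration.integral_add[OF cmean_integrable cmean_integrable])

lemma cmean_cmult: "cmean (\<lambda>x. c * F x) = c * cmean F"
proof -
  have "indicator ucube x *\<^sub>R (c * F x) = c * (indicator ucube x *\<^sub>R F x)" for x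
    by (simp add: mult_scaleR_right)
  then show ?thesis unfolding cmean_def by (simp only: integral_mult_right_zero)
qed

lemma cmean_integral:
  assumes c: "continuous_on UNIV F"
  shows "cmean F = integral (cbox 0 1) F"
proof -
  have "cmean F = (LINT x : ucube | lborel. F x)" by (simp add: cmean_def set_lebesgue_integral_def)
  also have "\<dots> = integral ucube F"
    by (rule set_borel_integral_eq_integral(2)) (simp add: set_integrable_def cmean_integrable[OF c])
  also have "\<dots> = integral (cbox 0 1) F"
  proof (rule integral_spike_set)
    have "{x \<in> ucube - cbox 0 1. F x \<noteq> 0} = {}"
      by (auto simp: ucube_def mem_box_cart less_imp_le)
    then show "negligible {x \<in> ucube - cbox 0 1. F x \<noteq> 0}" by (simp only: negligible_empty)
    have "{x \<in> cbox 0 1 - ucube. F x \<noteq> 0} \<subseteq> cbox 0 1 - box 0 1"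
      by (auto simp: ucube_def mem_box_cart less_imp_le)
    then show "negligible {x \<in> cbox 0 1 - ucube. F x \<noteq> 0}"
      using negligible_frontier_interval negligible_subset by blast
  qed
  finally show ?thesis .
qed

lemma content_unit_cube: "measure lborel (cbox 0 (1 :: real ^ 's::finite)) = 1"
proof -
  have "(0 :: real ^ 's) \<in> cbox 0 1" by (simp add: mem_box_cart)
  then have "cbox 0 (1 :: real ^ 's) \<noteq> {}" by blast
  then show ?thesis by (simp add: content_cbox_cart)
qed

lemma cmean_const: "cmean (\<lambda>x :: real ^ 's::finite. c) = c"
proof -
  have "measure lborel (cbox 0 (1 :: real ^ 's)) = 1" by (rule content_unit_cube)
  then show ?thesis by (subst cmean_integral) auto
qed

text \<open>A translate of the unit cube is again a fundamental domain: cut along the lattice, its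
  pieces return to \<open>ucube\<close> by translations that leave \<open>F\<close>
  unchanged.\<close>

lemma cmean_shift:
  fixes F :: "real ^ 's::finite \<Rightarrow> complex"
  assumes c: "continuous_on UNIV F" and p: "\<And>x \<beta>. F (x + rvec \<beta>) = F x"
  shows "cmean (\<lambda>x. F (x + t)) = cmean F"
proof -
  define H where "H x = indicator ucube (x - t) *\<^sub>R F x" for x
  have meas: "F \<in> borel_measurable borel" using c by (rule borel_measurable_continuous_onI)
  have mH: "H \<in> borel_measurable borel"
  proof -
    have "(\<lambda>x. indicator ucube (x - t)) \<in> borel_measurable borel"
      by measurable
    then show ?thesis unfolding H_def[abs_def] using meas by (intro borel_measurable_scaleR) auto
  qed
  have sh: "H (t + x) = indicator ucube x *\<^sub>R F (x + t)" for x by (simp add: H_def add.commute)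
  have ct: "continuous_on UNIV (\<lambda>x. F (x + t))" by (intro continuous_on_compose2[OF c] continuous_intros) auto
  have "integrable (distr lborel borel ((+) t)) H"
    by (subst integrable_distr_eq) (use mH cmean_integrable[OF ct] in \<open>auto simp: sh\<close>)
  then have iH: "integrable lborel H" by (simp add: lborel_distr_plus)
  have "cmean (\<lambda>x. F (x + t)) = (LINT x|lborel. H x)"
    unfolding cmean_def using integral_shift[OF mH, of t] by (simp add: sh)
  \<comment> \<open>Bounds every lattice vector that connects a point of the cube with a point of
    its translate; the 2 covers the widths of the cubes and rounding.\<close>
  define n where "n = \<lceil>norm t\<rceil> + 2"
  define S :: "(int ^ 's) set" where "S = {\<beta>. \<forall>i. \<beta> $ i \<in> {- n..n}}"
  have finS: "finite S" unfolding S_def by (rule finite_vec_set) simp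
  have inS: "\<beta> \<in> S" if "x \<in> ucube" "x + rvec \<beta> - t \<in> ucube" for x \<beta>
    unfolding S_def
  proof (intro CollectI allI)
    fix i
    have 1: "0 \<le> x $ i" "x $ i < 1" "0 \<le> x $ i + of_int (\<beta> $ i) - t $ i" "x $ i + of_int (\<beta> $ i) - t $ i < 1"
      using that by (auto simp: ucube_def rvec_simps)
    have 2: "\<bar>t $ i\<bar> \<le> of_int \<lceil>norm t\<rceil>" using component_le_norm_cart[of t i] le_of_int_ceiling[of "norm t"] by linarith
    show "\<beta> $ i \<in> {- n..n}" using 1 2 unfolding n_def by simp linarith
  qed
  have "(LINT x|lborel. H x) = cmean (\<lambda>x. \<Sum>\<beta>\<in>S. H (x + rvec \<beta>))"
    by (rule unfold_integral[OF iH finS]) (use inS in \<open>auto simp: H_def indicator_def\<close>)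
  also have "\<dots> = cmean F"
    unfolding cmean_def
  proof (intro Bochner_Integration.integral_cong refl)
    fix x
    show "indicator ucube x *\<^sub>R (\<Sum>\<beta>\<in>S. H (x + rvec \<beta>)) = indicator ucube x *\<^sub>R F x"
    proof (cases "x \<in> ucube")
      case True
      obtain \<beta>0 where "x - t - rvec \<beta>0 \<in> ucube" using exists_floor by blast
      then have b: "(x - t) - rvec \<beta>0 \<in> ucube" .
      have flip: "x + rvec \<beta> - t = (x - t) - rvec (- \<beta>)" for \<beta> by (simp add: rvec_simps)
      have "(indicator ucube (x + rvec \<beta> - t) :: real) = (if \<beta> = - \<beta>0 then 1 else 0)" for \<beta>
      proof (cases "\<beta> = - \<beta>0")
        case True
        then show ?thesis using b unfolding flip by simp
      next
        case False
        then have "(x - t) - rvec (- \<beta>) \<notin> ucube" using ucube_unique[OF b, of "- \<beta>"] by auto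
        then show ?thesis using False unfolding flip by simp
      qed
      moreover have "- \<beta>0 \<in> S" by (rule inS[OF True]) (use b in \<open>simp add: flip\<close>)
      ultimately show ?thesis using finS
        by (simp add: H_def p if_distrib[of "\<lambda>c. c *\<^sub>R F x"] cong: if_cong)
    qed simp
  qed
  finally show ?thesis using \<open>cmean (\<lambda>x. F (x + t)) = (LINT x|lborel. H x)\<close> by simp
qed

lemma cmean_ee:
  assumes "\<alpha> \<noteq> 0"
  shows "cmean (ee (rvec \<alpha>)) = 0"
proof -
  obtain i where i: "\<alpha> $ i \<noteq> 0" using assms by (auto simp: vec_eq_iff)
  \<comment> \<open>Half a period in the coordinate \<open>i\<close>: the character equals -1 there,
    so invariance of the mean under this shift forces it to vanish.\<close>
  define t where "t = axis i (1 / (2 * real_of_int (\<alpha> $ i)))"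
  have "t \<bullet> rvec \<alpha> = 1 / 2"
    using i by (simp add: t_def inner_axis' rvec_simps)
  then have "ee (rvec \<alpha>) t = cis (- (2 * pi * (1 / 2)))" by (simp only: ee_def)
  then have "ee (rvec \<alpha>) t = -1" by (simp add: complex_eq_iff)
  then have "cmean (\<lambda>x. ee (rvec \<alpha>) (x + t)) = - 1 * cmean (ee (rvec \<alpha>))"
    unfolding ee_add_right using cmean_cmult[of "-1" "ee (rvec \<alpha>)"] by (simp add: mult.commute)
  moreover have "cmean (\<lambda>x. ee (rvec \<alpha>) (x + t)) = cmean (ee (rvec \<alpha>))"
    by (rule cmean_shift[OF continuous_ee ee_periodic])
  ultimately have "cmean (ee (rvec \<alpha>)) = - cmean (ee (rvec \<alpha>))" by simp
  then have "2 * cmean (ee (rvec \<alpha>)) = 0" unfolding mult_2 by (simp only: eq_neg_iff_add_eq_0)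
  then show ?thesis by simp
qed

section \<open>Trigonometric polynomials and uniqueness of Fourier coefficients\<close>

inductive trig :: "(real ^ 's::finite \<Rightarrow> complex) \<Rightarrow> bool" where
  basis: "trig (ee (rvec \<alpha>))"
| add: "trig F \<Longrightarrow> trig G \<Longrightarrow> trig (\<lambda>x. F x + G x)"
| scale: "trig F \<Longrightarrow> trig (\<lambda>x. c * F x)"

lemma trig_mult: "trig F \<Longrightarrow> trig G \<Longrightarrow> trig (\<lambda>x. F x * G x)"
proof (induction arbitrary: G rule: trig.induct)
  case (basis \<alpha>)
  then show ?case
  proof (induction rule: trig.induct)
    case (basis \<beta>)
    have "ee (rvec (\<alpha> + \<beta>)) = (\<lambda>x. ee (rvec \<alpha>) x * ee (rvec \<beta>) x)"
      by (simp add: rvec_simps ee_add_left fun_eq_iff)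
    then show ?case using trig.basis[of "\<alpha> + \<beta>"] by simp
  next
    case (add F G)
    then show ?case using trig.add[OF add.IH] by (simp add: distrib_left)
  next
    case (scale F c)
    then show ?case using trig.scale[OF scale.IH, of c] by (simp add: mult_ac)
  qed
next
  case (add F G H)
  then show ?case using trig.add[OF add.IH(1)[OF add.prems] add.IH(2)[OF add.prems]] by (simp add: distrib_right)
next
  case (scale F c G)
  then show ?case using trig.scale[OF scale.IH[OF scale.prems], of c] by (simp add: mult_ac)
qed

lemma trig_const: "trig (\<lambda>x :: real ^ 's::finite. c)"
proof -
  have "ee (rvec (0 :: int ^ 's)) = (\<lambda>x. 1)" by (auto simp: ee_def rvec_simps)
  then show ?thesis using trig.scale[OF trig.basis[of "0 :: int ^ 's"], of c] by simp
qed

lemma trig_sum: "(\<And>i. i \<in> A \<Longrightarrow> trig (F i)) \<Longrightarrow> trig (\<lambda>x. \<Sum>i\<in>A. F i x)"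
  by (induction A rule: infinite_finite_induct) (auto intro: trig_const trig.add)

lemma trig_continuous: "trig F \<Longrightarrow> continuous_on UNIV F"
  by (induction rule: trig.induct) (auto intro!: continuous_intros)

lemma trig_cos_sin:
  "trig (\<lambda>x. of_real (Re (cis (2 * pi * x $ i))))" "trig (\<lambda>x. of_real (Im (cis (2 * pi * x $ i))))"
proof -
  have 1: "ee (rvec (axis i 1)) x = cis (- (2 * pi * x $ i))" "ee (rvec (axis i (-1))) x = cis (2 * pi * x $ i)" for x
  proof -
    have "rvec (axis i n) = axis i (real_of_int n)" for n by (simp add: rvec_def vec_eq_iff axis_def)
    then show "ee (rvec (axis i 1)) x = cis (- (2 * pi * x $ i))" "ee (rvec (axis i (-1))) x = cis (2 * pi * x $ i)"
      by (simp_all add: ee_def inner_axis)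
  qed
  have "trig (\<lambda>x. (1/2) * (ee (rvec (axis i 1)) x + ee (rvec (axis i (-1))) x))"
    by (intro trig.intros)
  then show "trig (\<lambda>x. of_real (Re (cis (2 * pi * x $ i))))"
    unfolding 1 by (rule back_subst[of trig]) (auto simp: complex_eq_iff)
  have "trig (\<lambda>x. (\<i>/2) * (ee (rvec (axis i 1)) x + (-1) * ee (rvec (axis i (-1))) x))"
    by (intro trig.intros)
  then show "trig (\<lambda>x. of_real (Im (cis (2 * pi * x $ i))))"
    unfolding 1 by (rule back_subst[of trig]) (auto simp: complex_eq_iff)
qed

definition torus_pt :: "real ^ 's::finite \<Rightarrow> complex ^ 's" where
  "torus_pt x = (\<chi> i. cis (2 * pi * x $ i))"

text \<open>Linear functionals are combinations of real and imaginary parts of the coordinates, that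
  is, of cosines and sines on the torus; the other cases are closure properties.\<close>

lemma trig_polynomial:
  "real_polynomial_function p \<Longrightarrow> trig (\<lambda>x. of_real (p (torus_pt x)))"
proof (induction rule: real_polynomial_function.induct)
  case (linear f)
  interpret bounded_linear f by fact
  have "f z = (\<Sum>i\<in>UNIV. Re (z $ i) * f (axis i 1) + Im (z $ i) * f (axis i \<i>))" for z :: "complex ^ 'a"
  proof -
    have "z = (\<Sum>i\<in>UNIV. Re (z $ i) *\<^sub>R axis i 1 + Im (z $ i) *\<^sub>R axis i \<i>)"
      by (simp add: vec_eq_iff axis_def complex_eq_iff sum.distrib if_distrib cong: if_cong)
    then have "f z = f (\<Sum>i\<in>UNIV. Re (z $ i) *\<^sub>R axis i 1 + Im (z $ i) *\<^sub>R axis i \<i>)" by simp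
    then show ?thesis by (simp add: sum add scaleR)
  qed
  note fz = this
  have "(\<lambda>x. complex_of_real (f (torus_pt x))) = (\<lambda>x. \<Sum>i\<in>UNIV. of_real (f (axis i 1)) * of_real (Re (cis (2 * pi * x $ i))) +
      of_real (f (axis i \<i>)) * of_real (Im (cis (2 * pi * x $ i))))"
    unfolding fz[of "torus_pt _"] by (simp add: torus_pt_def mult.commute)
  then show ?case by (simp only:) (intro trig_sum trig.add trig.scale trig_cos_sin)
next
  case (const c)
  then show ?case by (rule trig_const)
next
  case (add f g)
  then show ?case using trig.add[OF add.IH] by simp
next
  case (mult f g)
  then show ?case using trig_mult[OF mult.IH] by simp
qed

text \<open>A periodic function factors through the compact torus, where the Stone-Weierstrass
  theorem applies; polynomials in the torus coordinates pull back to trigonometric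
  polynomials.\<close>

lemma periodic_trig_approx:
  fixes G :: "real ^ 's::finite \<Rightarrow> real"
  assumes c: "continuous_on UNIV G" and p: "\<And>x \<beta>. G (x + rvec \<beta>) = G x" and e: "e > 0"
  shows "\<exists>p. trig (\<lambda>x. of_real (p x)) \<and> (\<forall>x. \<bar>G x - p x\<bar> < e)"
proof -
  define T where "T = {z :: complex ^ 's. \<forall>i. cmod (z $ i) = 1}"
  define lift where "lift z = G (\<chi> i. Arg (z $ i) / (2 * pi))" for z :: "complex ^ 's"
  have eqG: "G x = G y" if "torus_pt x = torus_pt y" for x y
  proof -
    have "\<exists>n::int. x $ i - y $ i = of_int n" for i
    proof -
      have "cis (2 * pi * x $ i) = cis (2 * pi * y $ i)" using that by (simp add: torus_pt_def vec_eq_iff)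
      then have "cis (2 * pi * x $ i) / cis (2 * pi * y $ i) = 1" by simp
      then have "cis (2 * pi * (x $ i - y $ i)) = 1" by (simp add: cis_divide right_diff_distrib)
      then obtain n :: int where "2 * pi * (x $ i - y $ i) = 2 * pi * of_int n" unfolding cis_eq_1_iff by blast
      then show ?thesis by auto
    qed
    then obtain n where n: "\<And>i. x $ i - y $ i = of_int (n i)" by metis
    have "x = y + rvec (\<chi> i. n i)" using n by (simp add: vec_eq_iff rvec_simps algebra_simps)
    then show ?thesis using p by simp
  qed
  have torus_arg: "torus_pt (\<chi> i. Arg (z $ i) / (2 * pi)) = z" if "z \<in> T" for z
    unfolding torus_pt_def vec_eq_iff
  proof
    fix i
    have n1: "cmod (z $ i) = 1" using that by (auto simp: T_def)
    moreover from n1 have "z $ i \<noteq> 0" by auto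
    ultimately
    show "(\<chi> i. cis (2 * pi * (\<chi> i. Arg (z $ i) / (2 * pi)) $ i)) $ i = z $ i"
      by (simp add: cis_Arg sgn_div_norm)
  qed
  have inT: "torus_pt x \<in> T" for x by (simp add: T_def torus_pt_def)
  have lift: "lift (torus_pt x) = G x" for x
    unfolding lift_def by (rule eqG[OF torus_arg[OF inT]])
  have "compact T"
  proof -
    have "T = (\<Inter>i. {z. cmod (z $ i) = 1})" by (auto simp: T_def)
    then have "closed T" by (auto intro!: closed_INT closed_Collect_eq continuous_intros)
    moreover have "bounded T"
    proof (rule boundedI)
      fix z assume "z \<in> T"
      then have "(\<Sum>i\<in>UNIV. norm (z $ i)) = real CARD('s)" by (simp add: T_def)
      moreover have "norm z \<le> (\<Sum>i\<in>UNIV. norm (z $ i))" unfolding norm_vec_def by (rule L2_set_le_sum) simp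
      ultimately show "norm z \<le> real CARD('s)" by simp
    qed
    ultimately show ?thesis by (simp add: compact_eq_bounded_closed)
  qed
  moreover have "continuous_on T lift"
    unfolding continuous_on_eq_continuous_within
  proof
    fix z0 assume z0: "z0 \<in> T"
    then have "cmod (z0 $ i) = 1" for i by (auto simp: T_def)
    then have nz: "z0 $ i \<noteq> 0" for i using norm_zero zero_neq_one by metis
    define x0 :: "real ^ 's" where "x0 = (\<chi> i. Arg (z0 $ i) / (2 * pi))"
    \<comment> \<open>\<open>Arg\<close> jumps along its cut. Near \<open>z0\<close> the angle of
      \<open>z / z0\<close>, a number close to 1, is continuous; the two choices of angle differ by
      full turns, which \<open>G\<close> does not see.\<close>
    define \<Phi> where "\<Phi> z = G (x0 + (\<chi> i. Im (Ln (z $ i / z0 $ i)) / (2 * pi)))" for z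
    have "continuous (at z0) (\<lambda>z. x0 + (\<chi> i. Im (Ln (z $ i / z0 $ i)) / (2 * pi)))"
    proof -
      have "isCont (\<lambda>z. Im (Ln (z $ i / z0 $ i)) / (2 * pi)) z0" for i
        using nz by (intro continuous_intros) auto
      then have "isCont (\<lambda>z. \<chi> i. Im (Ln (z $ i / z0 $ i)) / (2 * pi)) z0"
        unfolding isCont_def by (rule tendsto_vec_lambda)
      then show ?thesis by (intro continuous_intros)
    qed
    then have "continuous (at z0) \<Phi>" unfolding \<Phi>_def
      by (rule isCont_o2) (use c in \<open>simp add: continuous_on_eq_continuous_at\<close>)
    then have "continuous (at z0 within T) \<Phi>" by (rule continuous_at_imp_continuous_at_within)
    have eqT: "lift z = \<Phi> z" if z: "z \<in> T" for z
      unfolding lift_def \<Phi>_def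
    proof (rule eqG)
      have "torus_pt (x0 + (\<chi> i. Im (Ln (z $ i / z0 $ i)) / (2 * pi))) = z"
        unfolding vec_eq_iff
      proof
        fix i
        define w where "w = z $ i / z0 $ i"
        have w: "cmod w = 1" using z z0 by (simp add: w_def T_def norm_divide)
        then have "w \<noteq> 0" by auto
        then have "cis (Im (Ln w)) = w"
          using w exp_Ln[of w] by (simp add: exp_eq_polar)
        moreover have "cis (Arg (z0 $ i)) = z0 $ i"
          using z0 nz[of i] by (simp add: cis_Arg sgn_div_norm T_def)
        ultimately have "cis (Arg (z0 $ i)) * cis (Im (Ln w)) = z $ i" using nz[of i] by (simp add: w_def)
        then have "cis (Arg (z0 $ i) + Im (Ln w)) = z $ i" by (simp only: cis_mult)
        moreover have "2 * pi * (x0 + (\<chi> i. Im (Ln (z $ i / z0 $ i)) / (2 * pi))) $ i = Arg (z0 $ i) + Im (Ln w)"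
          by (simp add: x0_def w_def distrib_left)
        ultimately show "torus_pt (x0 + (\<chi> i. Im (Ln (z $ i / z0 $ i)) / (2 * pi))) $ i = z $ i"
          by (simp add: torus_pt_def)
      qed
      then show "torus_pt (\<chi> i. Arg (z $ i) / (2 * pi)) = torus_pt (x0 + (\<chi> i. Im (Ln (z $ i / z0 $ i)) / (2 * pi)))"
        using torus_arg[OF z] by simp
    qed
    have ev: "\<forall>\<^sub>F z in at z0 within T. \<Phi> z = lift z"
      unfolding eventually_at_filter using eqT by (auto intro: always_eventually)
    have lim: "(\<Phi> \<longlongrightarrow> lift z0) (at z0 within T)"
      using \<open>continuous (at z0 within T) \<Phi>\<close> eqT[OF z0] by (simp add: continuous_within)
    show "continuous (at z0 within T) lift"
      unfolding continuous_within by (rule Lim_transform_eventually[OF lim ev])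
  qed
  ultimately obtain q where q: "real_polynomial_function q" "\<And>z. z \<in> T \<Longrightarrow> \<bar>lift z - q z\<bar> < e"
    using Stone_Weierstrass_real_polynomial_function e by metis
  show ?thesis
    using trig_polynomial[OF q(1)] q(2)[OF inT] lift by (intro exI[of _ "\<lambda>x. q (torus_pt x)"]) auto
qed

text \<open>Subtracting the mean leaves a continuous \<open>G\<close> orthogonal to all
  trigonometric polynomials. Approximating \<open>G\<close> itself by such a \<open>p\<close>, the
  integral of \<open>G * G\<close> equals that of \<open>G * (G - p)\<close> and is arbitrarily
  small, so \<open>G\<close> vanishes.\<close>

lemma periodic_const:
  fixes F :: "real ^ 's::finite \<Rightarrow> real"
  assumes c: "continuous_on UNIV F" and p: "\<And>x \<beta>. F (x + rvec \<beta>) = F x"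
    and z: "\<And>\<alpha>. \<alpha> \<noteq> 0 \<Longrightarrow> cmean (\<lambda>x. of_real (F x) * ee (rvec \<alpha>) x) = 0"
  shows "F x = Re (cmean (\<lambda>x. of_real (F x)))"
proof -
  define c0 where "c0 = Re (cmean (\<lambda>x. of_real (F x)))"
  have "cmean (\<lambda>x. of_real (F x)) = of_real (LINT x|lborel. indicator ucube x *\<^sub>R F x)"
  proof -
    have "indicator ucube x *\<^sub>R complex_of_real (F x) = of_real (indicator ucube x *\<^sub>R F x)" for x
      by (simp add: scaleR_conv_of_real)
    then show ?thesis unfolding cmean_def by (simp only: integral_complex_of_real)
  qed
  then have c0: "cmean (\<lambda>x. of_real (F x)) = of_real c0" by (simp add: c0_def)
  define G where "G x = F x - c0" for x
  have cG: "continuous_on UNIV G" unfolding G_def by (intro continuous_intros c)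
  have pG: "G (x + rvec \<beta>) = G x" for x \<beta> by (simp add: G_def p)
  have base: "cmean (\<lambda>x. of_real (G x) * ee (rvec \<alpha>) x) = 0" for \<alpha>
  proof -
    have "cmean (\<lambda>x. of_real (G x) * ee (rvec \<alpha>) x) =
        cmean (\<lambda>x. of_real (F x) * ee (rvec \<alpha>) x + (- of_real c0) * ee (rvec \<alpha>) x)"
      by (simp add: G_def algebra_simps)
    also have "\<dots> = cmean (\<lambda>x. of_real (F x) * ee (rvec \<alpha>) x) + (- of_real c0) * cmean (ee (rvec \<alpha>))"
      by (subst cmean_add) (auto intro!: continuous_intros c simp: cmean_cmult[of "- of_real c0" "ee (rvec \<alpha>)", simplified])
    also have "\<dots> = 0"
    proof (cases "\<alpha> = 0")
      case True
      then have "ee (rvec \<alpha>) = (\<lambda>x. 1)" by (auto simp: ee_def rvec_simps)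
      then show ?thesis by (simp add: c0 cmean_const)
    qed (simp add: z cmean_ee)
    finally show ?thesis .
  qed
  have tz: "trig T \<Longrightarrow> cmean (\<lambda>x. of_real (G x) * T x) = 0" for T
  proof (induction rule: trig.induct)
    case (basis \<alpha>) then show ?case by (rule base)
  next
    case (add F1 F2)
    then show ?case
      by (simp add: distrib_left cmean_add continuous_on_mult continuous_on_of_real cG trig_continuous)
  next
    case (scale F1 c)
    then show ?case using cmean_cmult[of c "\<lambda>x. of_real (G x) * F1 x"] by (simp add: mult_ac)
  qed
  obtain M where M: "\<And>x. x \<in> cbox 0 1 \<Longrightarrow> \<bar>G x\<bar> \<le> M" "M > 0"
  proof -
    have "bounded (G ` cbox 0 1)"
      by (intro compact_imp_bounded compact_continuous_image continuous_on_subset[OF cG]) auto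
    then show ?thesis using that by (auto simp: bounded_pos)
  qed
  have ci: "integral (cbox 0 1) (\<lambda>x. complex_of_real (h x)) = of_real (integral (cbox 0 1) h)"
    if "continuous_on UNIV h" for h :: "real ^ 's \<Rightarrow> real"
    using that by (intro integral_unique has_integral_of_real integrable_integral integrable_continuous continuous_on_subset[OF that]) auto
  have I: "\<bar>integral (cbox 0 1) (\<lambda>x. G x * G x)\<bar> \<le> M * e" if e: "e > 0" for e
  proof -
    obtain p where p: "trig (\<lambda>x. of_real (p x))" "\<And>x. \<bar>G x - p x\<bar> < e"
      using periodic_trig_approx[OF cG pG e] by blast
    have cp: "continuous_on UNIV p"
      using continuous_on_Re[OF trig_continuous[OF p(1)]] by simp
    have "of_real (integral (cbox 0 1) (\<lambda>x. G x * p x)) = cmean (\<lambda>x. of_real (G x) * of_real (p x))"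
      using ci[OF continuous_on_mult[OF cG cp]]
      by (subst cmean_integral) (auto intro!: continuous_intros cG cp)
    also have "\<dots> = (0 :: complex)" by (rule tz[OF p(1)])
    finally have z: "integral (cbox 0 1) (\<lambda>x. G x * p x) = 0" by simp
    have "integral (cbox 0 1) (\<lambda>x. G x * G x) = integral (cbox 0 1) (\<lambda>x. G x * G x - G x * p x)"
      by (subst Henstock_Kurzweil_Integration.integral_diff)
         (auto intro!: integrable_continuous continuous_intros continuous_on_subset[OF cG] continuous_on_subset[OF cp] simp: z)
    moreover have "norm (integral (cbox 0 1) (\<lambda>x. G x * G x - G x * p x)) \<le> M * e * measure lborel (cbox 0 (1 :: real ^ 's))"
    proof (rule has_integral_bound[OF _ integrable_integral])
      show "(\<lambda>x. G x * G x - G x * p x) integrable_on cbox 0 1"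
        by (intro integrable_continuous continuous_intros continuous_on_subset[OF cG] continuous_on_subset[OF cp]) auto
      fix x :: "real ^ 's" assume "x \<in> cbox 0 1"
      then show "norm (G x * G x - G x * p x) \<le> M * e"
        using M p(2)[of x] unfolding right_diff_distrib[symmetric] by (auto simp: abs_mult intro!: mult_mono)
    qed (use M e in simp)
    ultimately show ?thesis by (simp add: content_unit_cube)
  qed
  have "integral (cbox 0 1) (\<lambda>x. G x * G x) = 0"
  proof (rule ccontr)
    assume "integral (cbox 0 1) (\<lambda>x. G x * G x) \<noteq> 0"
    then have "\<bar>integral (cbox 0 1) (\<lambda>x. G x * G x)\<bar> > 0" by simp
    with I[of "\<bar>integral (cbox 0 1) (\<lambda>x. G x * G x)\<bar> / (2 * M)"] M show False by simp
  qed
  moreover have "(\<lambda>x. G x * G x) integrable_on cbox 0 1"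
    by (intro integrable_continuous continuous_intros continuous_on_subset[OF cG]) auto
  ultimately have hi: "((\<lambda>x. G x * G x) has_integral 0) (cbox 0 1)" using has_integral_iff by metis
  have zero: "G x = 0" if "x \<in> cbox 0 1" for x
  proof -
    have "G x * G x = 0"
      by (rule has_integral_0_cbox_imp_0[OF _ _ hi _ that])
         (auto intro!: continuous_intros continuous_on_subset[OF cG] simp: interval_ne_empty_cart)
    then show ?thesis by simp
  qed
  obtain \<beta> where "x - rvec \<beta> \<in> ucube" using exists_floor by blast
  then have "x - rvec \<beta> \<in> cbox 0 1" by (auto simp: ucube_def mem_box_cart less_imp_le)
  then have "G (x - rvec \<beta> + rvec \<beta>) = 0" using zero pG by metis
  then show ?thesis by (simp add: G_def c0_def)
qed

section \<open>Sums of shifts and the Strang--Fix conditions\<close>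

definition lsum :: "(int ^ 's::finite \<Rightarrow> real) \<Rightarrow> (real ^ 's \<Rightarrow> real) \<Rightarrow> real ^ 's \<Rightarrow> real" where
  "lsum c h x = (\<Sum>\<^sub>\<infinity>\<alpha>. c \<alpha> * h (x - rvec \<alpha>))"

definition csupp :: "real \<Rightarrow> (real ^ 's::finite \<Rightarrow> real) \<Rightarrow> bool" where
  "csupp R h \<longleftrightarrow> (\<forall>x. h x \<noteq> 0 \<longrightarrow> (\<forall>i. \<bar>x $ i\<bar> \<le> R))"

definition nearpts :: "real \<Rightarrow> real ^ 's::finite \<Rightarrow> (int ^ 's) set" where
  "nearpts R x = {\<alpha>. \<forall>i. \<alpha> $ i \<in> {\<lceil>x $ i - R\<rceil>..\<lfloor>x $ i + R\<rfloor>}}"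

definition zbox :: "int \<Rightarrow> (int ^ 's::finite) set" where
  "zbox n = {\<alpha>. \<forall>i. \<alpha> $ i \<in> {- n..n}}"

lemma finite_nearpts [simp]: "finite (nearpts R x)"
  unfolding nearpts_def by (rule finite_vec_set) simp

lemma finite_zbox [simp]: "finite (zbox n)"
  unfolding zbox_def by (rule finite_vec_set) simp

lemma card_nearpts:
  assumes "R \<ge> 0"
  shows "real (card (nearpts R (x :: real ^ 's::finite))) \<le> (2 * R + 1) ^ CARD('s)"
proof -
  have "real (card (nearpts R x)) = (\<Prod>i\<in>UNIV. real (card {\<lceil>x $ i - R\<rceil>..\<lfloor>x $ i + R\<rfloor>}))"
    unfolding nearpts_def card_vec_set by simp
  also have "\<dots> \<le> (\<Prod>i\<in>(UNIV :: 's set). 2 * R + 1)"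
  proof (intro prod_mono conjI)
    fix i
    have "real_of_int (\<lfloor>x $ i + R\<rfloor> - \<lceil>x $ i - R\<rceil> + 1) \<le> 2 * R + 1"
      using of_int_floor_le[of "x $ i + R"] le_of_int_ceiling[of "x $ i - R"] by (simp only: of_int_add of_int_diff)
    then show "real (card {\<lceil>x $ i - R\<rceil>..\<lfloor>x $ i + R\<rfloor>}) \<le> 2 * R + 1" using assms
      by (cases "\<lfloor>x $ i + R\<rfloor> - \<lceil>x $ i - R\<rceil> + 1 \<ge> 0") auto
  qed simp
  finally show ?thesis by simp
qed

lemma nearptsI:
  assumes "csupp R h" "h (x - rvec \<alpha>) \<noteq> 0"
  shows "\<alpha> \<in> nearpts R x"
  unfolding nearpts_def
proof (intro CollectI allI)
  fix i
  have "\<bar>x $ i - of_int (\<alpha> $ i)\<bar> \<le> R" using assms by (auto simp: csupp_def rvec_simps)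
  then show "\<alpha> $ i \<in> {\<lceil>x $ i - R\<rceil>..\<lfloor>x $ i + R\<rfloor>}" by (auto simp: ceiling_le_iff le_floor_iff)
qed

lemma nearpts_zbox:
  assumes "\<And>i. \<bar>x $ i\<bar> + R \<le> of_int n"
  shows "nearpts R x \<subseteq> zbox n"
proof
  fix \<alpha> assume a: "\<alpha> \<in> nearpts R x"
  show "\<alpha> \<in> zbox n"
    unfolding zbox_def
  proof (intro CollectI allI)
    fix i
    have "x $ i - R \<le> of_int (\<alpha> $ i)" "of_int (\<alpha> $ i) \<le> x $ i + R"
      using a by (auto simp: nearpts_def ceiling_le_iff le_floor_iff)
    then have "of_int (- n) \<le> real_of_int (\<alpha> $ i)" "real_of_int (\<alpha> $ i) \<le> of_int n" using assms[of i] by auto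
    then show "\<alpha> $ i \<in> {- n..n}" by (simp only: of_int_le_iff) simp
  qed
qed

lemma lsum_finite:
  assumes "csupp R h" "finite S" "nearpts R x \<subseteq> S"
  shows "lsum c h x = (\<Sum>\<alpha>\<in>S. c \<alpha> * h (x - rvec \<alpha>))"
  unfolding lsum_def
  by (rule infsum_finite_support) (use assms nearptsI[OF assms(1)] in auto)

lemma lsum_bound:
  fixes x :: "real ^ 's::finite"
  assumes h: "csupp R h" and R: "R \<ge> 0" and c: "\<And>\<alpha>. \<bar>c \<alpha>\<bar> \<le> Cc" and H: "\<And>x. \<bar>h x\<bar> \<le> H"
  shows "\<bar>lsum c h x\<bar> \<le> (2 * R + 1) ^ CARD('s) * (Cc * H)"
proof -
  have H0: "H \<ge> 0" "Cc \<ge> 0" using order_trans[OF abs_ge_zero H] order_trans[OF abs_ge_zero c] by auto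
  have "\<bar>lsum c h x\<bar> \<le> (\<Sum>\<alpha>\<in>nearpts R x. Cc * H)"
    unfolding lsum_finite[OF h finite_nearpts order_refl]
    by (intro order_trans[OF sum_abs] sum_mono) (auto simp: abs_mult intro!: mult_mono c H H0)
  also have "\<dots> = real (card (nearpts R x)) * (Cc * H)" by simp
  also have "\<dots> \<le> (2 * R + 1) ^ CARD('s) * (Cc * H)"
    using card_nearpts[OF R] H0 by (intro mult_right_mono) auto
  finally show ?thesis .
qed

text \<open>At most the lattice points near \<open>x\<close> or near \<open>y\<close> contribute;
  the factor 2 comes from uniting the two sets.\<close>

lemma lsum_diff_bound:
  fixes x y :: "real ^ 's::finite"
  assumes h: "csupp R h" and R: "R \<ge> 0" and c: "\<And>\<alpha>. \<bar>c \<alpha>\<bar> \<le> Cc"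
    and D: "\<And>u v. u - v = x - y \<Longrightarrow> \<bar>h u - h v\<bar> \<le> D"
  shows "\<bar>lsum c h x - lsum c h y\<bar> \<le> 2 * (2 * R + 1) ^ CARD('s) * (Cc * D)"
proof -
  have D0: "D \<ge> 0" "Cc \<ge> 0" using order_trans[OF abs_ge_zero D[of x y]] order_trans[OF abs_ge_zero c] by auto
  let ?S = "nearpts R x \<union> nearpts R y"
  have "lsum c h x - lsum c h y = (\<Sum>\<alpha>\<in>?S. c \<alpha> * (h (x - rvec \<alpha>) - h (y - rvec \<alpha>)))"
    by (subst (1 2) lsum_finite[OF h, of ?S]) (auto simp: right_diff_distrib sum_subtractf)
  also have "\<bar>\<dots>\<bar> \<le> (\<Sum>\<alpha>\<in>?S. Cc * D)"
    by (intro order_trans[OF sum_abs] sum_mono) (auto simp: abs_mult intro!: mult_mono c D D0)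
  also have "\<dots> = real (card ?S) * (Cc * D)" by simp
  also have "\<dots> \<le> (2 * (2 * R + 1) ^ CARD('s)) * (Cc * D)"
  proof (intro mult_right_mono)
    have "real (card ?S) \<le> real (card (nearpts R x)) + real (card (nearpts R y))"
      using card_Un_le[of "nearpts R x" "nearpts R y"] by linarith
    then show "real (card ?S) \<le> 2 * (2 * R + 1) ^ CARD('s)"
      using card_nearpts[OF R, of x] card_nearpts[OF R, of y] by linarith
  qed (use D0 in simp)
  finally show ?thesis by simp
qed

lemma csupp_Dl: "csupp R h \<Longrightarrow> csupp R (Dl is h)"
  unfolding csupp_def using Dl_outside_support[of h R] by (meson not_le)

lemma csupp_mult: "csupp R h \<Longrightarrow> csupp R (\<lambda>x. g x * h x)"
  by (auto simp: csupp_def)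

text \<open>The margin 1 makes one finite index set valid on a whole unit ball, through which sums
  of shifts inherit continuity and derivatives from finite sums.\<close>

lemma lsum_local:
  assumes "csupp R h" "\<And>i. \<bar>x $ i\<bar> + 1 + R \<le> of_int n" "norm (y - x) < 1"
  shows "lsum c h y = (\<Sum>\<alpha>\<in>zbox n. c \<alpha> * h (y - rvec \<alpha>))"
proof (rule lsum_finite[OF assms(1) finite_zbox nearpts_zbox])
  fix i
  show "\<bar>y $ i\<bar> + R \<le> of_int n"
    using assms(2)[of i] component_le_norm_cart[of "y - x" i] assms(3) by simp
qed

lemma exists_zbox: "\<exists>n. \<forall>i. \<bar>x $ i\<bar> + 1 + R \<le> real_of_int n"
proof
  show "\<forall>i. \<bar>x $ i\<bar> + 1 + R \<le> real_of_int \<lceil>norm x + 1 + R\<rceil>"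
    using component_le_norm_cart[of x] le_of_int_ceiling[of "norm x + 1 + R"] by (auto intro: order_trans[of _ "norm x + 1 + R"])
qed

lemma continuous_lsum:
  fixes h :: "real ^ 's::finite \<Rightarrow> real"
  assumes h: "csupp R h" and c: "continuous_on UNIV h"
  shows "continuous_on UNIV (lsum c h)"
  unfolding continuous_on_eq_continuous_at[OF open_UNIV]
proof
  fix x :: "real ^ 's"
  obtain n where n: "\<And>i. \<bar>x $ i\<bar> + 1 + R \<le> real_of_int n" using exists_zbox by blast
  have "\<forall>\<^sub>F y in nhds x. y \<in> ball x 1" by (rule eventually_nhds_in_open) auto
  then have "\<forall>\<^sub>F y in nhds x. lsum c h y = (\<Sum>\<alpha>\<in>zbox n. c \<alpha> * h (y - rvec \<alpha>))"
    by eventually_elim (rule lsum_local[OF h n], simp add: dist_norm norm_minus_commute)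
  note ev = this
  have "continuous_on UNIV (\<lambda>y. \<Sum>\<alpha>\<in>zbox n. c \<alpha> * h (y - rvec \<alpha>))"
    by (intro continuous_intros continuous_on_compose2[OF c]) auto
  then have "isCont (\<lambda>y. \<Sum>\<alpha>\<in>zbox n. c \<alpha> * h (y - rvec \<alpha>)) x"
    by (simp add: continuous_on_eq_continuous_at)
  then show "isCont (lsum c h) x" using isCont_cong[OF ev] by simp
qed

lemma has_partial_lsum:
  fixes h :: "real ^ 's::finite \<Rightarrow> real"
  assumes h: "csupp R h" and h': "csupp R h'" and d: "has_partial i h h'"
  shows "has_partial i (lsum c h) (lsum c h')"
  unfolding has_partial_def
proof
  fix x :: "real ^ 's"
  obtain n where n: "\<And>i. \<bar>x $ i\<bar> + 1 + R \<le> real_of_int n" using exists_zbox by blast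
  have "has_partial i (\<lambda>y. h (y - rvec \<alpha>)) (\<lambda>y. h' (y - rvec \<alpha>))" for \<alpha>
    using has_partial_affine[OF d, of 1 "- rvec \<alpha>"] by simp
  then have "has_partial i (\<lambda>y. \<Sum>\<alpha>\<in>zbox n. c \<alpha> * h (y - rvec \<alpha>)) (\<lambda>y. \<Sum>\<alpha>\<in>zbox n. c \<alpha> * h' (y - rvec \<alpha>))"
    by (intro has_partial_sum has_partial_cmult)
  then have "((\<lambda>t. \<Sum>\<alpha>\<in>zbox n. c \<alpha> * h (x + axis i t - rvec \<alpha>)) has_vector_derivative (\<Sum>\<alpha>\<in>zbox n. c \<alpha> * h' (x - rvec \<alpha>))) (at 0)"
    by (simp add: has_partial_def)
  moreover have "(\<Sum>\<alpha>\<in>zbox n. c \<alpha> * h' (x - rvec \<alpha>)) = lsum c h' x"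
    using lsum_local[OF h' n, of x c] by simp
  ultimately have 1: "((\<lambda>t. \<Sum>\<alpha>\<in>zbox n. c \<alpha> * h (x + axis i t - rvec \<alpha>)) has_vector_derivative lsum c h' x) (at 0)" by simp
  have 2: "(\<Sum>\<alpha>\<in>zbox n. c \<alpha> * h (x + axis i t - rvec \<alpha>)) = lsum c h (x + axis i t)" if "t \<in> ball 0 1" for t
    using lsum_local[OF h n, of "x + axis i t" c] that by (simp add: norm_eq_sqrt_inner inner_axis_axis)
  show "((\<lambda>t. lsum c h (x + axis i t)) has_vector_derivative lsum c h' x) (at 0)"
    by (rule has_vector_derivative_transform_within_open[OF 1 open_ball[of 0 1] _ 2]) auto
qed

lemma
  fixes h :: "real ^ 's::finite \<Rightarrow> real"
  assumes h: "csupp R h" and c: "Cdiff n h"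
  shows Cdiff_lsum: "Cdiff n (lsum c h)"
    and Dl_lsum: "length is \<le> n \<Longrightarrow> Dl is (lsum c h) = lsum c (Dl is h)"
proof -
  have 1: "continuous_on UNIV (lsum c (Dl is h))" if "length is \<le> n" for "is"
    by (rule continuous_lsum[OF csupp_Dl[OF h]]) (use c that in \<open>simp add: Cdiff_iff_Dl\<close>)
  have 2: "has_partial i (lsum c (Dl is h)) (lsum c (Dl (i # is) h))" if "length is < n" for "is" i
    by (rule has_partial_lsum[OF csupp_Dl[OF h] csupp_Dl[OF h] Dl_has_partial[OF c that]])
  show "Cdiff n (lsum c h)" using Cdiff_DlI(1)[of n "\<lambda>is. lsum c (Dl is h)", OF 1 2] by simp
  show "length is \<le> n \<Longrightarrow> Dl is (lsum c h) = lsum c (Dl is h)"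
    using Cdiff_DlI(2)[of n "\<lambda>is. lsum c (Dl is h)", OF 1 2] by simp
qed

lemma lsum_shift: "lsum c h (x + rvec \<beta>) = lsum (\<lambda>\<alpha>. c (\<alpha> + \<beta>)) h x"
proof -
  have "(\<Sum>\<^sub>\<infinity>\<alpha>. c (\<alpha> + \<beta>) * h (x + rvec \<beta> - rvec (\<alpha> + \<beta>))) = (\<Sum>\<^sub>\<infinity>\<alpha>. c \<alpha> * h (x + rvec \<beta> - rvec \<alpha>))"
    by (rule infsum_reindex_bij_betw) (rule bij_betw_byWitness[of _ "\<lambda>\<alpha>. \<alpha> - \<beta>"], auto)
  then show ?thesis by (simp add: lsum_def rvec_simps)
qed

lemma zbox_uminus: "- \<alpha> \<in> zbox n \<longleftrightarrow> \<alpha> \<in> zbox n"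
  by (auto simp: zbox_def) (smt (verit))+

text \<open>Poisson summation in coefficient form: a character at a lattice frequency is periodic,
  so it passes through the unfolding of the integral and multiplies the periodization of
  \<open>h\<close>.\<close>

lemma gf_lsum:
  fixes h :: "real ^ 's::finite \<Rightarrow> real"
  assumes h: "csupp R h" and c: "continuous_on UNIV h"
  shows "gf (\<lambda>x. of_real (h x)) (rvec \<alpha>) = cmean (\<lambda>x. of_real (lsum (\<lambda>_. 1) h x) * ee (rvec \<alpha>) x)"
proof -
  define n where "n = \<lceil>1 + R\<rceil>"
  have near: "nearpts R x \<subseteq> zbox n" if "x \<in> ucube" for x :: "real ^ 's"
  proof (rule nearpts_zbox)
    fix i
    show "\<bar>x $ i\<bar> + R \<le> of_int n"
    proof -
      have "0 \<le> x $ i" "x $ i < 1" using that by (auto simp: ucube_def)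
      then show ?thesis using le_of_int_ceiling[of "1 + R"] unfolding n_def by linarith
    qed
  qed
  have "gf (\<lambda>x. of_real (h x)) (rvec \<alpha>) = (LINT x|lborel. of_real (h x) * ee (rvec \<alpha>) x)"
    by (simp add: gf_def)
  also have "\<dots> = cmean (\<lambda>x. \<Sum>\<beta>\<in>zbox n. of_real (h (x + rvec \<beta>)) * ee (rvec \<alpha>) (x + rvec \<beta>))"
  proof (rule unfold_integral)
    show "integrable lborel (\<lambda>x. of_real (h x) * ee (rvec \<alpha>) x)"
      by (rule integrable_compact_support[of _ R])
         (use h in \<open>auto intro!: continuous_intros c simp: mem_cube csupp_def\<close>)
    fix x :: "real ^ 's" and \<beta> :: "int ^ 's" assume "x \<in> ucube" "\<beta> \<notin> zbox n"
    then have "- \<beta> \<notin> nearpts R x" using near zbox_uminus by blast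
    then show "complex_of_real (h (x + rvec \<beta>)) * ee (rvec \<alpha>) (x + rvec \<beta>) = 0"
      using nearptsI[OF h, of x "- \<beta>"] by (auto simp: rvec_simps)
  qed simp
  also have "\<dots> = cmean (\<lambda>x. of_real (lsum (\<lambda>_. 1) h x) * ee (rvec \<alpha>) x)"
    unfolding cmean_def
  proof (intro Bochner_Integration.integral_cong refl)
    fix x :: "real ^ 's"
    show "indicator ucube x *\<^sub>R (\<Sum>\<beta>\<in>zbox n. complex_of_real (h (x + rvec \<beta>)) * ee (rvec \<alpha>) (x + rvec \<beta>)) =
      indicator ucube x *\<^sub>R (of_real (lsum (\<lambda>_. 1) h x) * ee (rvec \<alpha>) x)"
    proof (cases "x \<in> ucube")
      case True
      have "lsum (\<lambda>_. 1) h x = (\<Sum>\<beta>\<in>zbox n. h (x - rvec \<beta>))"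
        using lsum_finite[OF h finite_zbox near[OF True], of "\<lambda>_. 1"] by simp
      also have "\<dots> = (\<Sum>\<beta>\<in>zbox n. h (x + rvec \<beta>))"
        by (rule sum.reindex_bij_witness[of _ uminus uminus]) (auto simp: zbox_uminus rvec_simps)
      finally show ?thesis by (simp add: ee_periodic sum_distrib_right)
    qed simp
  qed
  finally show ?thesis .
qed

lemma continuous_rmono [continuous_intros]: "continuous_on S (rmono \<eta>)"
  unfolding rmono_def[abs_def] by (intro continuous_intros)

text \<open>By Poisson summation, the Strang--Fix conditions say that the periodizations
  \<open>\<Sum>\<^sub>\<alpha> (x - \<alpha>)\<^sup>\<eta> f(x - \<alpha>)\<close> are constant.\<close>

lemma strang_fix_iff:
  fixes f :: "real ^ 's::finite \<Rightarrow> real"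
  assumes f: "csupp R f" and c: "continuous_on UNIV f"
  shows "strang_fix (l + 1) f \<longleftrightarrow>
     (\<forall>x. lsum (\<lambda>_. 1) f x = 1) \<and> (\<forall>\<eta>. mabs \<eta> \<le> l \<longrightarrow> (\<exists>C. \<forall>x. lsum (\<lambda>_. 1) (\<lambda>u. rmono \<eta> u * f u) x = C))"
proof -
  let ?h = "\<lambda>\<eta> u. rmono \<eta> u * f u"
  have sh: "csupp R (?h \<eta>)" for \<eta> using f by (rule csupp_mult)
  have ch: "continuous_on UNIV (?h \<eta>)" for \<eta> by (intro continuous_intros c)
  have four0: "fourier f 0 = cmean (\<lambda>x. of_real (lsum (\<lambda>_. 1) f x))"
  proof -
    have "ee (rvec (0 :: int ^ 's)) = (\<lambda>x. 1)" by (auto simp: ee_def rvec_simps)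
    then show ?thesis using gf_lsum[OF f c, of 0] by (simp add: fourier_gf rvec_simps)
  qed
  have md: "mderiv \<mu> (fourier f) (rvec \<alpha>) =
      (- 2 * pi * \<i>) ^ mabs \<mu> * cmean (\<lambda>x. of_real (lsum (\<lambda>_. 1) (?h \<mu>) x) * ee (rvec \<alpha>) x)" for \<mu> \<alpha>
    using mderiv_fourier[OF c, of R \<mu> "rvec \<alpha>"] f gf_lsum[OF sh ch, of \<mu> \<alpha>] by (simp add: csupp_def mem_cube)
  show ?thesis
  proof
    assume sf: "strang_fix (l + 1) f"
    have const: "lsum (\<lambda>_. 1) (?h \<eta>) x = Re (cmean (\<lambda>x. of_real (lsum (\<lambda>_. 1) (?h \<eta>) x)))" if \<eta>: "mabs \<eta> \<le> l" for \<eta> x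
    proof (rule periodic_const)
      show "continuous_on UNIV (lsum (\<lambda>_. 1) (?h \<eta>))" by (rule continuous_lsum[OF sh ch])
      show "lsum (\<lambda>_. 1) (?h \<eta>) (x + rvec \<beta>) = lsum (\<lambda>_. 1) (?h \<eta>) x" for x \<beta> by (rule lsum_shift)
      fix \<alpha> :: "int ^ 's" assume "\<alpha> \<noteq> 0"
      then have "mderiv \<eta> (fourier f) (rvec \<alpha>) = 0" using sf \<eta> by (simp add: strang_fix_def)
      then show "cmean (\<lambda>x. of_real (lsum (\<lambda>_. 1) (?h \<eta>) x) * ee (rvec \<alpha>) x) = 0"
        unfolding md by simp
    qed
    have "lsum (\<lambda>_. 1) f x = 1" for x
      using const[of 0 x] four0 sf by (simp add: strang_fix_def)
    then show "(\<forall>x. lsum (\<lambda>_. 1) f x = 1) \<and> (\<forall>\<eta>. mabs \<eta> \<le> l \<longrightarrow> (\<exists>C. \<forall>x. lsum (\<lambda>_. 1) (?h \<eta>) x = C))"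
      using const by blast
  next
    assume R: "(\<forall>x. lsum (\<lambda>_. 1) f x = 1) \<and> (\<forall>\<eta>. mabs \<eta> \<le> l \<longrightarrow> (\<exists>C. \<forall>x. lsum (\<lambda>_. 1) (?h \<eta>) x = C))"
    show "strang_fix (l + 1) f"
      unfolding strang_fix_def
    proof (intro conjI allI impI)
      show "fourier f 0 = 1" using R by (simp add: four0 cmean_const)
      fix \<alpha> :: "int ^ 's" and \<mu> :: "nat ^ 's" assume a: "\<alpha> \<noteq> 0" "mabs \<mu> < l + 1"
      then have "mabs \<mu> \<le> l" by simp
      then obtain C where "\<And>x. lsum (\<lambda>_. 1) (?h \<mu>) x = C" using R by blast
      then show "mderiv \<mu> (fourier f) (rvec \<alpha>) = 0"
        unfolding md by (simp add: cmean_cmult cmean_ee[OF a(1)])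
    qed
  qed
qed

section \<open>A test function\<close>

text \<open>The truncated power, which for positive exponent \<open>n\<close> has continuous
  derivatives up to order \<open>n - 1\<close>.\<close>

definition pospow :: "nat \<Rightarrow> real \<Rightarrow> real" where
  "pospow n t = max 0 t ^ n"

lemma pospow_deriv: "(pospow (Suc (Suc n)) has_real_derivative real (Suc (Suc n)) * pospow (Suc n) t) (at t)"
proof -
  consider "t > 0" | "t < 0" | "t = 0" by linarith
  then show ?thesis
  proof cases
    case 1
    have "((\<lambda>t. t ^ Suc (Suc n)) has_real_derivative real (Suc (Suc n)) * pospow (Suc n) t) (at t)"
      using DERIV_pow[of "Suc (Suc n)" t UNIV] 1 by (simp add: pospow_def del: power_Suc)
    then show ?thesis
      by (rule has_field_derivative_transform_within_open[where S = "{0<..}"]) (use 1 in \<open>auto simp: pospow_def\<close>)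
  next
    case 2
    have "((\<lambda>t. 0) has_real_derivative real (Suc (Suc n)) * pospow (Suc n) t) (at t)"
      using 2 by (simp add: pospow_def)
    then show ?thesis
      by (rule has_field_derivative_transform_within_open[where S = "{..<0}"]) (use 2 in \<open>auto simp: pospow_def\<close>)
  next
    case 3
    have "((\<lambda>h. max 0 h ^ Suc n) \<longlongrightarrow> max 0 0 ^ Suc n) (at (0::real))"
      by (intro tendsto_intros)
    moreover have "\<forall>\<^sub>F h in at (0::real). max 0 h ^ Suc n = (pospow (Suc (Suc n)) (0 + h) - pospow (Suc (Suc n)) 0) / h"
      unfolding eventually_at_filter by (intro always_eventually) (auto simp: pospow_def max_def)
    ultimately have "((\<lambda>h. (pospow (Suc (Suc n)) (0 + h) - pospow (Suc (Suc n)) 0) / h) \<longlongrightarrow> 0) (at (0::real))"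
      by (simp add: tendsto_cong)
    then show ?thesis using 3 by (simp add: DERIV_def pospow_def)
  qed
qed

lemma has_partial_coord:
  fixes u :: "real \<Rightarrow> real"
  assumes "\<And>t. (u has_real_derivative u' t) (at t)"
  shows "has_partial j (\<lambda>x. u (x $ i)) (\<lambda>x. if j = i then u' (x $ i) else 0)"
  unfolding has_partial_def
proof
  fix x :: "real ^ 'a"
  show "((\<lambda>t. u ((x + axis j t) $ i)) has_vector_derivative (if j = i then u' (x $ i) else 0)) (at 0)"
  proof (cases "j = i")
    case True
    have "((\<lambda>t. u (t + x $ i)) has_real_derivative u' (x $ i)) (at 0)"
      using DERIV_shift[of u "u' (x $ i)" 0 "x $ i"] assms by simp
    then show ?thesis using True
      by (simp add: has_real_derivative_iff_has_vector_derivative add.commute)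
  qed (simp add: axis_def)
qed

lemma Cdiff_if: "Cdiff n f \<Longrightarrow> Cdiff n (\<lambda>x. if P then f x else 0)"
  by (cases P) (auto simp: Cdiff_const)

lemma Cdiff_pospow: "Cdiff n (\<lambda>x. pospow (Suc n) (x $ i))"
proof (induction n)
  case 0
  show ?case by (auto simp: pospow_def intro!: continuous_intros)
next
  case (Suc n)
  show ?case
  proof (rule Cdiff_SucI)
    show "continuous_on UNIV (\<lambda>x :: real ^ 'a. pospow (Suc (Suc n)) (x $ i))"
      unfolding pospow_def by (intro continuous_intros)
    show "has_partial j (\<lambda>x. pospow (Suc (Suc n)) (x $ i)) (\<lambda>x. if j = i then real (Suc (Suc n)) * pospow (Suc n) (x $ i) else 0)" for j
      by (rule has_partial_coord) (rule pospow_deriv)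
    show "Cdiff n (\<lambda>x. if j = i then real (Suc (Suc n)) * pospow (Suc n) (x $ i) else 0)" for j
      by (intro Cdiff_if Cdiff_cmult Suc.IH)
  qed
qed

lemma Cdiff_coord: "Cdiff n (\<lambda>x. x $ i)"
proof (cases n)
  case (Suc k)
  show ?thesis unfolding Suc
  proof (rule Cdiff_SucI)
    show "has_partial j (\<lambda>x. x $ i) (\<lambda>x. if j = i then 1 else 0)" for j
      using has_partial_coord[of "\<lambda>t. t" "\<lambda>t. 1" j i] by simp
    show "Cdiff k (\<lambda>x. if j = i then 1 else 0)" for j by (rule Cdiff_if[OF Cdiff_const])
  qed (intro continuous_intros)
qed (auto intro!: continuous_intros)

lemma Cdiff_inverse:
  assumes "\<And>x. q x \<noteq> 0"
  shows "Cdiff n q \<Longrightarrow> Cdiff n (\<lambda>x. inverse (q x))"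
proof (induction n)
  case 0
  then show ?case using assms by (auto intro!: continuous_intros)
next
  case (Suc n)
  note q = Cdiff_SucD[OF Suc.prems]
  have IH: "Cdiff n (\<lambda>x. inverse (q x))" by (rule Suc.IH[OF Cdiff_Suc_imp[OF Suc.prems]])
  show ?case
  proof (rule Cdiff_SucI)
    show "continuous_on UNIV (\<lambda>x. inverse (q x))" using q(1) assms by (intro continuous_intros) auto
    show "has_partial i (\<lambda>x. inverse (q x)) (\<lambda>x. (-1) * (inverse (q x) * partial i q x * inverse (q x)))" for i
      unfolding has_partial_def
    proof
      fix x
      have "((\<lambda>t. q (x + axis i t)) has_real_derivative partial i q x) (at 0)"
        using q(2)[of i] by (simp add: has_partial_def has_real_derivative_iff_has_vector_derivative)
      from DERIV_inverse'[OF this] assms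
      show "((\<lambda>t. inverse (q (x + axis i t))) has_vector_derivative (-1) * (inverse (q x) * partial i q x * inverse (q x))) (at 0)"
        by (simp add: has_real_derivative_iff_has_vector_derivative)
    qed
    show "Cdiff n (\<lambda>x. (-1) * (inverse (q x) * partial i q x * inverse (q x)))" for i
      by (intro Cdiff_cmult Cdiff_mult IH q(3))
  qed
qed

text \<open>A step from 0 to 1 across the unit interval. Since \<open>t\<close> and
  \<open>1 - t\<close> are never both nonpositive, the denominator has no zero and the quotient
  keeps the smoothness of the truncated powers.\<close>

definition smoothstep :: "nat \<Rightarrow> real \<Rightarrow> real" where
  "smoothstep l t = pospow (Suc l) t * inverse (pospow (Suc l) t + pospow (Suc l) (1 - t))"

text \<open>A difference of two steps shifted by one, so that the integer translates telescope to
  1.\<close>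

definition bump :: "nat \<Rightarrow> real \<Rightarrow> real" where
  "bump l t = smoothstep l (t + 1) - smoothstep l t"

definition lagrange :: "nat \<Rightarrow> nat \<Rightarrow> real \<Rightarrow> real" where
  "lagrange l i t = (\<Prod>k\<in>{..l} - {i}. (t - real k) * inverse (real i - real k))"

text \<open>The fundamental function of the quasi-interpolant that blends, by the partition of unity
  \<open>bump l (t - r)\<close>, the polynomials of degree at most \<open>l\<close> interpolating at
  \<open>r, \<dots>, r + l\<close>. It interpolates on the integers and reproduces polynomials
  of degree at most \<open>l\<close>.\<close>

definition kernel1 :: "nat \<Rightarrow> real \<Rightarrow> real" where
  "kernel1 l t = (\<Sum>i\<le>l. bump l (t + real i) * lagrange l i (t + real i))"

definition test_fn :: "nat \<Rightarrow> real ^ 's::finite \<Rightarrow> real" where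
  "test_fn l x = (\<Prod>i\<in>UNIV. kernel1 l (x $ i))"

lemma smoothstep_0: "t \<le> 0 \<Longrightarrow> smoothstep l t = 0"
  by (simp add: smoothstep_def pospow_def)

lemma smoothstep_1:
  assumes "t \<ge> 1"
  shows "smoothstep l t = 1"
proof -
  have "pospow (Suc l) (1 - t) = 0" "pospow (Suc l) t \<noteq> 0" using assms by (auto simp: pospow_def)
  then show ?thesis by (simp add: smoothstep_def)
qed

lemma bump_outside: "\<bar>t\<bar> \<ge> 1 \<Longrightarrow> bump l t = 0"
  by (cases "t \<ge> 0") (auto simp: bump_def smoothstep_0 smoothstep_1)

lemma bump_int: "bump l (of_int n) = (if n = 0 then 1 else 0)"
proof (cases "n = 0")
  case True then show ?thesis by (simp add: bump_def smoothstep_0 smoothstep_1)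
next
  case False
  then have "\<bar>real_of_int n\<bar> \<ge> 1" by linarith
  then show ?thesis using False by (simp add: bump_outside)
qed

lemma Cdiff_smoothstep: "Cdiff l (\<lambda>x. smoothstep l (x $ i))"
  unfolding smoothstep_def
proof (intro Cdiff_mult Cdiff_pospow Cdiff_inverse Cdiff_add)
  have "Cdiff l (\<lambda>x. (\<lambda>x. pospow (Suc l) (x $ i)) ((- 1) *\<^sub>R x + 1))"
    by (rule Cdiff_affine[OF Cdiff_pospow])
  then show "Cdiff l (\<lambda>x. pospow (Suc l) (1 - x $ i))" by simp
  fix x :: "real ^ 'a"
  show "pospow (Suc l) (x $ i) + pospow (Suc l) (1 - x $ i) \<noteq> 0"
  proof (cases "x $ i > 0")
    case True
    then have "pospow (Suc l) (x $ i) > 0" unfolding pospow_def by simp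
    moreover have "pospow (Suc l) (1 - x $ i) \<ge> 0" by (simp add: pospow_def)
    ultimately show ?thesis by linarith
  next
    case False
    then have "pospow (Suc l) (1 - x $ i) > 0" unfolding pospow_def by simp
    moreover have "pospow (Suc l) (x $ i) \<ge> 0" by (simp add: pospow_def)
    ultimately show ?thesis by linarith
  qed
qed

lemma Cdiff_shift:
  assumes "Cdiff n (\<lambda>x :: real ^ 's::finite. u (x $ i))"
  shows "Cdiff n (\<lambda>x :: real ^ 's. u (x $ i + c))"
  using Cdiff_affine[OF assms, of 1 "\<chi> i. c"] by simp

lemma Cdiff_lagrange: "Cdiff n (\<lambda>x. lagrange l j (x $ i))"
  unfolding lagrange_def
proof (intro Cdiff_prod)
  fix k
  have "Cdiff n (\<lambda>x. inverse (real j - real k) * (x $ i - real k))"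
    by (intro Cdiff_cmult Cdiff_diff Cdiff_coord Cdiff_const)
  then show "Cdiff n (\<lambda>x. (x $ i - real k) * inverse (real j - real k))" by (simp add: mult.commute)
qed

lemma Cdiff_test_fn: "Cdiff l (test_fn l)"
  unfolding test_fn_def[abs_def] kernel1_def bump_def
  by (intro Cdiff_prod Cdiff_sum Cdiff_mult Cdiff_diff Cdiff_shift[where u = "smoothstep l"]
     Cdiff_shift[where u = "lagrange l _"] Cdiff_lagrange Cdiff_smoothstep
     Cdiff_shift[where u = "\<lambda>t. smoothstep l (t + 1)"])

lemma kernel1_outside: "\<bar>t\<bar> > real l + 1 \<Longrightarrow> kernel1 l t = 0"
  unfolding kernel1_def by (intro sum.neutral ballI) (auto intro!: bump_outside)

lemma lagrange_node: "i \<le> l \<Longrightarrow> j \<le> l \<Longrightarrow> lagrange l i (real j) = (if i = j then 1 else 0)"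
proof (cases "i = j")
  case True
  then show ?thesis unfolding lagrange_def by (auto intro!: prod.neutral)
next
  case False
  assume "j \<le> l"
  then have "j \<in> {..l} - {i}" using False by auto
  then show ?thesis unfolding lagrange_def using False by (auto intro!: prod_zero bexI[of _ j])
qed

lemma kernel1_int: "kernel1 l (of_int n) = (if n = 0 then 1 else 0)"
proof -
  have "kernel1 l (of_int n) = (\<Sum>i\<le>l. if int i = - n then lagrange l i (real 0) else 0)"
    unfolding kernel1_def
  proof (intro sum.cong refl)
    fix i
    have "bump l (of_int n + real i) = (if n + int i = 0 then 1 else 0)"
      using bump_int[of l "n + int i"] by simp
    note b = this
    show "bump l (of_int n + real i) * lagrange l i (of_int n + real i) = (if int i = - n then lagrange l i (real 0) else 0)"
    proof (cases "n + int i = 0")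
      case True
      then have z: "of_int n + real i = 0" using arg_cong[OF True, of real_of_int] by simp
      show ?thesis using True b unfolding z by simp
    next
      case False
      then show ?thesis using b by auto
    qed
  qed
  also have "\<dots> = (\<Sum>i\<le>l. if i = 0 then (if n = 0 then 1 else 0) else 0)"
    by (intro sum.cong refl) (auto simp: lagrange_node[of _ l 0, simplified])
  finally show ?thesis by simp
qed

text \<open>Interpolation at \<open>l + 1\<close> nodes reproduces the polynomial
  \<open>(u - X) ^ j\<close>, whose value at \<open>u\<close> is \<open>0 ^ j\<close>. Interpolant
  minus polynomial has degree at most \<open>l\<close> and \<open>l + 1\<close> zeros.\<close>

lemma lagrange_power:
  assumes j: "j \<le> l"
  shows "(\<Sum>i\<le>l. (u - real i) ^ j * lagrange l i u) = (if j = 0 then 1 else 0)"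
proof -
  define L :: "nat \<Rightarrow> real poly" where "L i = (\<Prod>k\<in>{..l} - {i}. [: - real k, 1 :] * [: inverse (real i - real k) :])" for i
  have L: "poly (L i) t = lagrange l i t" for i t
    unfolding L_def lagrange_def poly_prod by (intro prod.cong refl) (simp add: algebra_simps)
  have degL: "degree (L i) \<le> l" if "i \<le> l" for i
  proof -
    have "degree (L i) \<le> (\<Sum>k\<in>{..l} - {i}. degree ([: - real k, 1 :] * [: inverse (real i - real k) :]))"
      unfolding L_def by (rule degree_prod_sum_le[unfolded o_def]) auto
    also have "\<dots> \<le> (\<Sum>k\<in>{..l} - {i}. 1)" by (intro sum_mono) (auto simp: degree_mult_le)
    also have "\<dots> = l" using that by simp
    finally show ?thesis .
  qed
  define q where "q = (\<Sum>i\<le>l. smult ((u - real i) ^ j) (L i)) - [: u, -1 :] ^ j"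
  have "degree q \<le> l"
  proof -
    have "degree (\<Sum>i\<le>l. smult ((u - real i) ^ j) (L i)) \<le> l"
      by (rule degree_sum_le) (auto intro: order_trans[OF degree_smult_le degL] degL)
    moreover have "degree ([: u, -1 :] ^ j) \<le> l"
      using degree_power_le[of "[: u, -1 :]" j] j by simp
    ultimately show ?thesis unfolding q_def using degree_diff_le by blast
  qed
  moreover have "poly q (real i) = 0" if "i \<le> l" for i
  proof -
    have "poly q (real i) = (\<Sum>k\<le>l. (u - real k) ^ j * lagrange l k (real i)) - (u - real i) ^ j"
      by (simp add: q_def poly_sum poly_power L)
    also have "(\<Sum>k\<le>l. (u - real k) ^ j * lagrange l k (real i)) = (\<Sum>k\<le>l. if k = i then (u - real k) ^ j else 0)"
      using that by (intro sum.cong) (auto simp: lagrange_node)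
    finally show ?thesis using that by simp
  qed
  ultimately have "q = 0"
  proof -
    assume dq: "degree q \<le> l" and r: "\<And>i. i \<le> l \<Longrightarrow> poly q (real i) = 0"
    show "q = 0"
    proof (rule ccontr)
      assume "q \<noteq> 0"
      have "real ` {..l} \<subseteq> {x. poly q x = 0}" using r by auto
      then have "card (real ` {..l}) \<le> card {x. poly q x = 0}"
        using poly_roots_finite[OF \<open>q \<noteq> 0\<close>] by (intro card_mono)
      also have "\<dots> \<le> degree q" by (rule card_poly_roots_bound[OF \<open>q \<noteq> 0\<close>])
      finally have "Suc l \<le> degree q" by (simp add: card_image)
      then show False using dq by simp
    qed
  qed
  then have "poly q u = 0" by simp
  then have "(\<Sum>i\<le>l. (u - real i) ^ j * lagrange l i u) = 0 ^ j" by (simp add: q_def poly_sum poly_power L)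
  then show ?thesis by (simp add: power_0_left)
qed

lemma bump_sum:
  assumes "finite A" and A: "{\<lfloor>t\<rfloor>, \<lfloor>t\<rfloor> + 1} \<subseteq> A"
  shows "(\<Sum>r\<in>A. bump l (t - of_int r) * g r) = bump l (t - of_int \<lfloor>t\<rfloor>) * g \<lfloor>t\<rfloor> + bump l (t - of_int \<lfloor>t\<rfloor> - 1) * g (\<lfloor>t\<rfloor> + 1)"
proof -
  have "(\<Sum>r\<in>A. bump l (t - of_int r) * g r) = (\<Sum>r\<in>{\<lfloor>t\<rfloor>, \<lfloor>t\<rfloor> + 1}. bump l (t - of_int r) * g r)"
  proof (rule sum.mono_neutral_right[OF assms], intro ballI)
    fix r assume "r \<in> A - {\<lfloor>t\<rfloor>, \<lfloor>t\<rfloor> + 1}"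
    then have "\<bar>t - of_int r\<bar> \<ge> 1" by (auto simp: abs_if) linarith+
    then show "bump l (t - of_int r) * g r = 0" by (simp add: bump_outside)
  qed
  then show ?thesis by (simp add: algebra_simps)
qed

lemma bump_unity: "bump l (t - of_int \<lfloor>t\<rfloor>) + bump l (t - of_int \<lfloor>t\<rfloor> - 1) = 1"
proof -
  have "0 \<le> t - of_int \<lfloor>t\<rfloor>" "t - of_int \<lfloor>t\<rfloor> < 1" by linarith+
  then show ?thesis by (simp add: bump_def smoothstep_0 smoothstep_1)
qed

text \<open>Reindexing by \<open>r = n - i\<close> groups the terms by interpolation window. Within
  one window the Lagrange identity gives \<open>0 ^ j\<close>, and the bumps of the two active
  windows sum to 1. The bound on \<open>M\<close> ensures that every shifted index range contains
  both windows.\<close>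

lemma kernel1_moment:
  assumes j: "j \<le> l" and M: "real_of_int M \<ge> \<bar>t\<bar> + real l + 2"
  shows "(\<Sum>n\<in>{- M..M}. (t - of_int n) ^ j * kernel1 l (t - of_int n)) = (if j = 0 then 1 else 0)"
proof -
  let ?g = "\<lambda>i r. (t - of_int r - real i) ^ j * lagrange l i (t - of_int r)"
  let ?f = "\<lfloor>t\<rfloor>"
  have fl: "of_int ?f \<le> t" "t < of_int ?f + 1" by linarith+
  have "(\<Sum>n\<in>{- M..M}. (t - of_int n) ^ j * kernel1 l (t - of_int n)) =
     (\<Sum>i\<le>l. \<Sum>n\<in>{- M..M}. bump l (t - of_int (n - int i)) * ?g i (n - int i))"
    unfolding kernel1_def sum_distrib_left by (subst sum.swap) (simp add: algebra_simps)
  also have "\<dots> = (\<Sum>i\<le>l. \<Sum>r\<in>{- M - int i..M - int i}. bump l (t - of_int r) * ?g i r)"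
  proof (rule sum.cong[OF refl])
    fix i
    show "(\<Sum>n\<in>{- M..M}. bump l (t - of_int (n - int i)) * ?g i (n - int i)) =
        (\<Sum>r\<in>{- M - int i..M - int i}. bump l (t - of_int r) * ?g i r)"
      by (rule sum.reindex_bij_witness[of _ "\<lambda>r. r + int i" "\<lambda>n. n - int i"]) auto
  qed
  also have "\<dots> = (\<Sum>i\<le>l. bump l (t - of_int ?f) * ?g i ?f + bump l (t - of_int ?f - 1) * ?g i (?f + 1))"
  proof (intro sum.cong refl bump_sum)
    fix i assume "i \<in> {..l}"
    then have i: "real i \<le> real l" by simp
    have "real_of_int (- M - int i) \<le> of_int ?f" "real_of_int (?f + 1) \<le> of_int (M - int i)"
      using fl M i by (simp_all, linarith+)
    then have "- M - int i \<le> ?f" "?f + 1 \<le> M - int i" by (simp_all only: of_int_le_iff)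
    then show "{?f, ?f + 1} \<subseteq> {- M - int i..M - int i}" by auto
  qed simp
  also have "\<dots> = bump l (t - of_int ?f) * (\<Sum>i\<le>l. ?g i ?f) + bump l (t - of_int ?f - 1) * (\<Sum>i\<le>l. ?g i (?f + 1))"
    by (simp add: sum.distrib sum_distrib_left)
  also have "\<dots> = (bump l (t - of_int ?f) + bump l (t - of_int ?f - 1)) * (if j = 0 then 1 else 0)"
    unfolding lagrange_power[OF j] by (simp add: distrib_right)
  finally show ?thesis unfolding bump_unity by simp
qed

lemma csupp_test_fn: "csupp (real l + 1) (test_fn l)"
  unfolding csupp_def
proof (intro allI impI)
  fix x :: "real ^ 'a" and i assume "test_fn l x \<noteq> 0"
  then have "kernel1 l (x $ i) \<noteq> 0" by (auto simp: test_fn_def)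
  then show "\<bar>x $ i\<bar> \<le> real l + 1" using kernel1_outside[of l "x $ i"] by linarith
qed

lemma test_fn_lattice: "test_fn l (rvec \<alpha>) = (if \<alpha> = 0 then 1 else 0)"
proof (cases "\<alpha> = 0")
  case False
  then obtain i where "\<alpha> $ i \<noteq> 0" by (auto simp: vec_eq_iff)
  then have "(\<Prod>i\<in>UNIV. kernel1 l (real_of_int (\<alpha> $ i))) = 0"
    by (intro prod_zero) (auto simp: kernel1_int)
  then show ?thesis using False by (simp add: test_fn_def rvec_simps)
qed (simp add: test_fn_def rvec_simps kernel1_int[of l 0, simplified])

lemma test_fn_moment:
  assumes "mabs \<eta> \<le> l"
  shows "lsum (\<lambda>_. 1) (\<lambda>u. rmono \<eta> u * test_fn l u) x = (if \<eta> = 0 then 1 else 0)"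
proof -
  obtain M where M: "\<And>i. \<bar>x $ i\<bar> + 1 + (real l + 1) \<le> real_of_int M" using exists_zbox by blast
  have le: "\<eta> $ i \<le> l" for i
    using member_le_sum[of i UNIV "\<lambda>i. \<eta> $ i"] assms by (simp add: mabs_def)
  have "lsum (\<lambda>_. 1) (\<lambda>u. rmono \<eta> u * test_fn l u) x = (\<Sum>\<alpha>\<in>zbox M. rmono \<eta> (x - rvec \<alpha>) * test_fn l (x - rvec \<alpha>))"
    using lsum_local[OF csupp_mult[OF csupp_test_fn] M, of x "\<lambda>_. 1"] by simp
  also have "\<dots> = (\<Sum>\<alpha>\<in>zbox M. \<Prod>i\<in>UNIV. (\<lambda>i n. (x $ i - of_int n) ^ (\<eta> $ i) * kernel1 l (x $ i - of_int n)) i (\<alpha> $ i))"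
    by (simp add: rmono_def test_fn_def prod.distrib rvec_simps)
  also have "\<dots> = (\<Prod>i\<in>UNIV. \<Sum>n\<in>{- M..M}. (x $ i - of_int n) ^ (\<eta> $ i) * kernel1 l (x $ i - of_int n))"
    unfolding zbox_def by (rule sum_vec_set_prod) simp
  also have "\<dots> = (\<Prod>i\<in>UNIV. if \<eta> $ i = 0 then 1 else 0)"
  proof (intro prod.cong refl kernel1_moment le)
    fix i show "\<bar>x $ i\<bar> + real l + 2 \<le> real_of_int M" using M[of i] by linarith
  qed
  also have "\<dots> = (if \<eta> = 0 then 1 else 0)" by (auto simp: vec_eq_iff intro!: prod_zero)
  finally show ?thesis .
qed

lemma lsum_test_fn_lattice: "lsum c (test_fn l) (rvec \<alpha>) = c \<alpha>"
proof -
  have "lsum c (test_fn l) (rvec \<alpha>) = (\<Sum>\<beta>\<in>nearpts (real l + 1) (rvec \<alpha>) \<union> {\<alpha>}. c \<beta> * test_fn l (rvec \<alpha> - rvec \<beta>))"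
    by (rule lsum_finite[OF csupp_test_fn]) auto
  also have "\<dots> = (\<Sum>\<beta>\<in>nearpts (real l + 1) (rvec \<alpha>) \<union> {\<alpha>}. if \<beta> = \<alpha> then c \<beta> else 0)"
  proof (intro sum.cong refl)
    fix \<beta>
    show "c \<beta> * test_fn l (rvec \<alpha> - rvec \<beta>) = (if \<beta> = \<alpha> then c \<beta> else 0)"
      using test_fn_lattice[of l "\<alpha> - \<beta>"] by (auto simp: rvec_simps)
  qed
  finally show ?thesis by simp
qed

lemma csupp_bounded:
  assumes "csupp R h" "continuous_on UNIV h"
  shows "\<exists>H. \<forall>x. \<bar>h x\<bar> \<le> H"
proof -
  have "bounded (h ` cube R)"
    by (intro compact_imp_bounded compact_continuous_image compact_cube continuous_on_subset[OF assms(2)]) auto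
  then obtain H where H: "H > 0" "\<And>x. x \<in> cube R \<Longrightarrow> \<bar>h x\<bar> \<le> H" by (auto simp: bounded_pos)
  have "\<bar>h x\<bar> \<le> H" for x
  proof (cases "x \<in> cube R")
    case False
    then have "h x = 0" using assms(1) unfolding csupp_def mem_cube by blast
    then show ?thesis using H(1) by simp
  qed (rule H(2))
  then show ?thesis by blast
qed

lemma supnorm_le: "(\<And>x. \<bar>f x\<bar> \<le> C) \<Longrightarrow> supnorm f \<le> ereal C"
  unfolding supnorm_def by (rule SUP_least) simp

lemma le_supnorm: "ereal \<bar>f x\<bar> \<le> supnorm f"
  unfolding supnorm_def by (rule SUP_upper) simp

text \<open>Interpolation on the lattice recovers the coefficients as values and gives the lower
  constant 1; the upper one counts the shifts overlapping at a point.\<close>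

lemma stable_test_fn: "stable (test_fn l :: real ^ 'a::finite \<Rightarrow> real)"
proof -
  have cont: "continuous_on UNIV (test_fn l :: real ^ 'a \<Rightarrow> real)" by (rule Cdiff_continuous[OF Cdiff_test_fn])
  obtain H where H: "\<And>x :: real ^ 'a. \<bar>test_fn l x\<bar> \<le> H" using csupp_bounded[OF csupp_test_fn cont] by blast
  define C2 where "C2 = max 1 ((2 * (real l + 1) + 1) ^ CARD('a) * H)"
  show ?thesis
    unfolding stable_def lsum_def[symmetric]
  proof (rule exI[of _ 1], rule exI[of _ C2], intro conjI allI impI)
    fix c :: "int ^ 'a \<Rightarrow> real" assume b: "bounded (range c)"
    have "supnorm c \<le> supnorm (lsum c (test_fn l))"
      unfolding supnorm_def[of c] by (rule SUP_least) (metis le_supnorm lsum_test_fn_lattice)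
    then show "ereal 1 * supnorm c \<le> supnorm (lsum c (test_fn l))" by (simp add: one_ereal_def[symmetric])
    obtain B where B: "\<And>\<alpha>. \<bar>c \<alpha>\<bar> \<le> B" using b by (auto simp: bounded_iff)
    have "supnorm c \<le> ereal B" by (rule supnorm_le[OF B])
    moreover have "supnorm c \<ge> ereal \<bar>c 0\<bar>" by (rule le_supnorm)
    ultimately obtain Cc where Cc: "supnorm c = ereal Cc" by (cases "supnorm c") auto
    have c: "\<bar>c \<alpha>\<bar> \<le> Cc" for \<alpha> using le_supnorm[of c \<alpha>] by (simp add: Cc)
    have Cc0: "Cc \<ge> 0" using order_trans[OF abs_ge_zero c] .
    have "\<bar>lsum c (test_fn l) x\<bar> \<le> C2 * Cc" for x
    proof -
      have "\<bar>lsum c (test_fn l) x\<bar> \<le> (2 * (real l + 1) + 1) ^ CARD('a) * (Cc * H)"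
        by (rule lsum_bound[OF csupp_test_fn]) (use c H in auto)
      also have "\<dots> = ((2 * (real l + 1) + 1) ^ CARD('a) * H) * Cc" by simp
      also have "\<dots> \<le> C2 * Cc" unfolding C2_def using Cc0 by (intro mult_right_mono) auto
      finally show ?thesis .
    qed
    then show "supnorm (lsum c (test_fn l)) \<le> ereal C2 * supnorm c"
      unfolding Cc by (simp add: supnorm_le)
  qed (auto simp: C2_def)
qed

lemma test_function_test_fn: "test_function l (test_fn l)"
  unfolding test_function_def
proof (intro conjI Cdiff_test_fn stable_test_fn)
  have "{x :: real ^ 'a. test_fn l x \<noteq> 0} \<subseteq> cube (real l + 1)"
    using csupp_test_fn[of l] by (auto simp: csupp_def mem_cube)
  then have "bounded {x :: real ^ 'a. test_fn l x \<noteq> 0}"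
    using bounded_subset compact_imp_bounded[OF compact_cube] by blast
  then show "compact (closure {x :: real ^ 'a. test_fn l x \<noteq> 0})" by simp
  show "strang_fix (l + 1) (test_fn l :: real ^ 'a \<Rightarrow> real)"
    unfolding strang_fix_iff[OF csupp_test_fn Cdiff_continuous[OF Cdiff_test_fn]]
    using test_fn_moment[of 0 l] test_fn_moment by (simp, blast)
qed

lemma test_functionD:
  assumes "test_function l f"
  shows "\<exists>R\<ge>0. csupp R f" "Cdiff l f"
    "lsum (\<lambda>_. 1) f x = 1" "mabs \<eta> \<le> l \<Longrightarrow> \<exists>C. \<forall>x. lsum (\<lambda>_. 1) (\<lambda>u. rmono \<eta> u * f u) x = C"
proof -
  have "bounded {x. f x \<noteq> 0}"
    using assms bounded_subset[OF compact_imp_bounded closure_subset] by (auto simp: test_function_def)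
  then obtain R where R: "R > 0" "\<And>x. f x \<noteq> 0 \<Longrightarrow> norm x \<le> R" by (auto simp: bounded_pos)
  have cs: "csupp R f" unfolding csupp_def using R(2) component_le_norm_cart order_trans by blast
  then show "\<exists>R\<ge>0. csupp R f" using R(1) by (auto intro: less_imp_le)
  show cd: "Cdiff l f" using assms by (simp add: test_function_def)
  have "strang_fix (l + 1) f" using assms by (simp add: test_function_def)
  then show "lsum (\<lambda>_. 1) f x = 1" "mabs \<eta> \<le> l \<Longrightarrow> \<exists>C. \<forall>x. lsum (\<lambda>_. 1) (\<lambda>u. rmono \<eta> u * f u) x = C"
    unfolding strang_fix_iff[OF cs Cdiff_continuous[OF cd]] by auto
qed

section \<open>The cascade iteration\<close>

lemma const_if_partials_zero:
  fixes f :: "real ^ 's::finite \<Rightarrow> real"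
  assumes "\<And>i. has_partial i f (\<lambda>x. 0)"
  shows "f x = f y"
proof -
  have step: "f (z + axis i t) = f z" for z i t
    using has_partial_bound[OF assms, of 0 z i t] by simp
  have "f (y + (\<chi> i. if i \<in> S then (x - y) $ i else 0)) = f y" for S :: "'s set"
  proof (induction S rule: infinite_finite_induct)
    case empty
    have "y + (\<chi> i. if i \<in> {} then (x - y) $ i else 0) = y" by (simp add: vec_eq_iff)
    then show ?case by simp
  next
    case (insert j S)
    have eq: "y + (\<chi> i. if i \<in> insert j S then (x - y) $ i else 0) =
        (y + (\<chi> i. if i \<in> S then (x - y) $ i else 0)) + axis j ((x - y) $ j)"
      using insert.hyps by (auto simp: vec_eq_iff axis_def)
    show ?case unfolding eq step by (rule insert.IH)
  qed simp
  moreover have "y + (\<chi> i. if i \<in> UNIV then (x - y) $ i else 0) = x" by (simp add: vec_eq_iff)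
  ultimately show ?thesis by metis
qed

text \<open>Polynomials of degree at most \<open>n\<close>, described by what is applied to them
  later: derivatives of order above the degree vanish, so those of order equal to it are
  constant.\<close>

definition poln :: "nat \<Rightarrow> (real ^ 's::finite \<Rightarrow> real) \<Rightarrow> bool" where
  "poln n p \<longleftrightarrow> (\<forall>k. Cdiff k p) \<and> (\<forall>is. length is > n \<longrightarrow> Dl is p = (\<lambda>x. 0))"

lemma Dl_zero: "Dl is (\<lambda>x. 0) = (\<lambda>x. 0 :: real)"
  by (induction "is") (auto simp: Dl_Cons has_partial_partial[OF has_partial_const])

lemma poln_zero: "poln n (\<lambda>x. 0)"
  by (simp add: poln_def Cdiff_const Dl_zero)

lemma poln_const: "poln n (\<lambda>x. c)"
proof -
  have "Dl is (\<lambda>x. c) = (\<lambda>x. 0 :: real)" if "length is > n" for "is" :: "'a list"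
  proof (cases "is" rule: rev_cases)
    case (snoc ys y)
    then show ?thesis by (simp add: Dl_snoc has_partial_partial[OF has_partial_const] Dl_zero)
  qed (use that in simp)
  then show ?thesis by (auto simp: poln_def Cdiff_const)
qed

lemma poln_partial: "poln (Suc n) p \<Longrightarrow> poln n (partial i p)"
  unfolding poln_def by (auto simp: Dl_snoc[symmetric] intro: Cdiff_SucD(3))

lemma poln_mono: "poln n p \<Longrightarrow> n \<le> k \<Longrightarrow> poln k p"
  by (auto simp: poln_def)

lemma poln_add: "poln n p \<Longrightarrow> poln n q \<Longrightarrow> poln n (\<lambda>x. p x + q x)"
  unfolding poln_def by (auto intro: Cdiff_add simp: Dl_add[OF _ _ order_refl])

lemma poln_cmult: "poln n p \<Longrightarrow> poln n (\<lambda>x. c * p x)"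
  unfolding poln_def by (auto intro: Cdiff_cmult simp: Dl_cmult[OF _ order_refl])

lemma poln_coord_mult: "poln n p \<Longrightarrow> poln (Suc n) (\<lambda>x. x $ i * p x)"
proof (induction n arbitrary: p)
  case (0 p)
  have C: "Cdiff k (\<lambda>x. x $ i * p x)" for k
    using 0 by (intro Cdiff_mult Cdiff_coord) (simp add: poln_def)
  have pp: "partial j p = (\<lambda>x. 0)" for j
    using 0 unfolding poln_def by (metis Dl_Cons Dl_Nil length_Cons zero_less_Suc)
  have "partial j (\<lambda>x. x $ i * p x) = (\<lambda>x. (if j = i then 1 else 0) * p x)" for j
  proof -
    have "Cdiff (Suc 0) p" using 0 by (simp add: poln_def)
    from has_partial_mult[OF has_partial_coord[of "\<lambda>t. t" "\<lambda>_. 1" j i] Cdiff_SucD(2)[OF this, of j]]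
    have "has_partial j (\<lambda>x. x $ i * p x) (\<lambda>x. x $ i * partial j p x + (if j = i then 1 else 0) * p x)" by simp
    then show ?thesis using has_partial_partial pp by force
  qed
  moreover have "poln 0 (\<lambda>x. (if j = i then 1 else 0) * p x)" for j by (rule poln_cmult[OF 0])
  ultimately have P: "poln 0 (partial j (\<lambda>x. x $ i * p x))" for j by metis
  have "Dl is (\<lambda>x. x $ i * p x) = (\<lambda>x. 0)" if "length is > Suc 0" for "is"
    using that P by (cases "is" rule: rev_cases) (auto simp: Dl_snoc poln_def)
  then show ?case using C by (simp add: poln_def)
next
  case (Suc n p)
  have C: "Cdiff k (\<lambda>x. x $ i * p x)" for k
    using Suc by (intro Cdiff_mult Cdiff_coord) (simp add: poln_def)
  have "poln (Suc n) (partial j (\<lambda>x. x $ i * p x))" for j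
  proof -
    have "Cdiff (Suc 0) p" using Suc by (simp add: poln_def)
    from has_partial_mult[OF has_partial_coord[of "\<lambda>t. t" "\<lambda>_. 1" j i] Cdiff_SucD(2)[OF this, of j]]
    have "has_partial j (\<lambda>x. x $ i * p x) (\<lambda>x. x $ i * partial j p x + (if j = i then 1 else 0) * p x)" by simp
    then have "partial j (\<lambda>x. x $ i * p x) = (\<lambda>x. x $ i * partial j p x + (if j = i then 1 else 0) * p x)"
      by (rule has_partial_partial)
    moreover have "poln (Suc n) (\<lambda>x. x $ i * partial j p x + (if j = i then 1 else 0) * p x)"
      by (intro poln_add poln_cmult Suc.IH poln_partial Suc.prems)
    ultimately show ?thesis by simp
  qed
  then have "Dl is (\<lambda>x. x $ i * p x) = (\<lambda>x. 0)" if "length is > Suc (Suc n)" for "is"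
    using that by (cases "is" rule: rev_cases) (auto simp: Dl_snoc poln_def)
  then show ?case using C by (simp add: poln_def)
qed

lemma poln_rmono: "poln (mabs \<eta>) (\<lambda>y. rmono \<eta> (- y))"
proof (induction "mabs \<eta>" arbitrary: \<eta>)
  case 0
  then show ?case using poln_const[of 0 1] by (simp add: eq_commute[of 0])
next
  case (Suc n)
  obtain \<eta>' i where \<eta>: "\<eta> = \<eta>' + axis i 1" "mabs \<eta>' = n" using mabs_SucE[OF Suc.hyps(2)[symmetric]] .
  have "poln (Suc n) (\<lambda>y. (- 1) * (y $ i * rmono \<eta>' (- y)))"
    by (intro poln_cmult poln_coord_mult) (use Suc.hyps(1)[of \<eta>'] \<eta> in simp)
  then show ?case unfolding Suc.hyps(2)[symmetric] unfolding \<eta>(1) rmono_Suc by simp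
qed

lemma poln_Dl_const:
  assumes "poln n p" "length is = n"
  shows "Dl is p x = Dl is p y"
proof (rule const_if_partials_zero)
  fix i
  have "has_partial i (Dl is p) (Dl (i # is) p)"
    by (rule Dl_has_partial[of "Suc n"]) (use assms in \<open>auto simp: poln_def\<close>)
  moreover have "Dl (i # is) p = (\<lambda>x. 0)" using assms by (simp add: poln_def)
  ultimately show "has_partial i (Dl is p) (\<lambda>x. 0)" by simp
qed

lemma lsum_add_coeff:
  "csupp R h \<Longrightarrow> lsum (\<lambda>\<alpha>. c \<alpha> + d \<alpha>) h x = lsum c h x + lsum d h x"
  by (simp add: lsum_finite[OF _ finite_nearpts order_refl] distrib_right sum.distrib)

lemma lsum_scale_coeff:
  "csupp R h \<Longrightarrow> lsum (\<lambda>\<alpha>. r * c \<alpha>) h x = r * lsum c h x"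
  by (simp add: lsum_finite[OF _ finite_nearpts order_refl] sum_distrib_left mult.assoc)

lemma lsum_diff:
  "csupp R h \<Longrightarrow> csupp R g \<Longrightarrow> lsum c (\<lambda>x. h x - g x) x = lsum c h x - lsum c g x"
proof -
  assume a: "csupp R h" "csupp R g"
  then have "csupp R (\<lambda>x. h x - g x)" by (auto simp: csupp_def) (metis diff_0_right)
  then show ?thesis using a
    by (simp add: lsum_finite[OF _ finite_nearpts order_refl] right_diff_distrib sum_subtractf)
qed

text \<open>Reversing the sign of the index turns moments of samples into a sum of shifts with
  polynomial coefficients, which can be differentiated term by term.\<close>

lemma mom_lsum: "mom \<eta> (\<lambda>\<beta>. h (y + rvec \<beta>)) = lsum (\<lambda>\<alpha>. rmono \<eta> (rvec (- \<alpha>))) h y"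
proof -
  have "(\<Sum>\<^sub>\<infinity>\<alpha>. rmono \<eta> (rvec (- \<alpha>)) * h (y + rvec (- \<alpha>))) = (\<Sum>\<^sub>\<infinity>\<beta>. rmono \<eta> (rvec \<beta>) * h (y + rvec \<beta>))"
    by (rule infsum_reindex_bij_betw) (rule bij_betw_byWitness[of _ uminus], auto)
  then show ?thesis by (simp add: mom_def lsum_def rvec_simps)
qed

text \<open>The moments of a test function are those of the point evaluation up to terms of lower
  degree, which disappear after \<open>l\<close> differentiations.\<close>

lemma lowmix_psum:
  fixes f :: "real ^ 's::finite \<Rightarrow> real"
  assumes f: "test_function l f" and G: "lowmix rmono n G" and n: "n \<le> l"
  shows "poln (n - 1) (\<lambda>y. lsum (\<lambda>\<alpha>. G (y - rvec \<alpha>) (- y)) f y) \<and>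
     (n = 0 \<longrightarrow> (\<forall>y. lsum (\<lambda>\<alpha>. G (y - rvec \<alpha>) (- y)) f y = 0))"
  using G
proof (induction rule: lowmix.induct)
  case zero
  have "lsum (\<lambda>\<alpha>. 0) f y = 0" for y by (simp add: lsum_def)
  then show ?case by (simp add: poln_zero)
next
  case (basis \<kappa> \<eta>)
  obtain R where R: "csupp R f" using test_functionD(1)[OF f] by blast
  obtain C where C: "\<And>x. lsum (\<lambda>_. 1) (\<lambda>u. rmono \<kappa> u * f u) x = C"
    using test_functionD(4)[OF f, of \<kappa>] basis n by auto
  have "lsum (\<lambda>\<alpha>. rmono \<kappa> (y - rvec \<alpha>) * rmono \<eta> (- y)) f y = C * rmono \<eta> (- y)" for y
  proof -
    have "lsum (\<lambda>\<alpha>. rmono \<kappa> (y - rvec \<alpha>) * rmono \<eta> (- y)) f y = rmono \<eta> (- y) * lsum (\<lambda>\<alpha>. rmono \<kappa> (y - rvec \<alpha>)) f y"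
      using lsum_scale_coeff[OF R, of "rmono \<eta> (- y)" "\<lambda>\<alpha>. rmono \<kappa> (y - rvec \<alpha>)" y] by (simp add: mult.commute)
    also have "lsum (\<lambda>\<alpha>. rmono \<kappa> (y - rvec \<alpha>)) f y = lsum (\<lambda>_. 1) (\<lambda>u. rmono \<kappa> u * f u) y" by (simp add: lsum_def)
    finally show ?thesis by (simp add: C)
  qed
  moreover have "poln (n - 1) (\<lambda>y. C * rmono \<eta> (- y))"
    by (rule poln_cmult[OF poln_mono[OF poln_rmono]]) (use basis in simp)
  ultimately show ?case using basis by simp
next
  case (add F G)
  obtain R where R: "csupp R f" using test_functionD(1)[OF f] by blast
  show ?case using add.IH by (auto simp: lsum_add_coeff[OF R] intro: poln_add)
next
  case (scale F c)
  obtain R where R: "csupp R f" using test_functionD(1)[OF f] by blast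
  show ?case using scale.IH by (auto simp: lsum_scale_coeff[OF R] intro: poln_cmult)
qed

text \<open>Writing \<open>-\<alpha> = (y - \<alpha>) + (-y)\<close> separates the monomial at
  \<open>-y\<close>, times the partition of unity, from polynomials of degree below
  \<open>mabs \<eta>\<close>. After \<open>l\<close> differentiations only a constant is left; it
  depends neither on \<open>y\<close> nor on \<open>f\<close>, and it is 0 below order
  \<open>l\<close>.\<close>

lemma mom_test_function:
  fixes f :: "real ^ 's::finite \<Rightarrow> real"
  assumes f: "test_function l f" and len: "length is = l" and \<eta>: "mabs \<eta> \<le> l"
  shows "mom \<eta> (\<lambda>\<beta>. Dl is f (y + rvec \<beta>)) = Dl is (\<lambda>y. rmono \<eta> (- y)) 0"
    and "mabs \<eta> < l \<Longrightarrow> mom \<eta> (\<lambda>\<beta>. Dl is f (y + rvec \<beta>)) = 0"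
proof -
  obtain R where R: "csupp R f" using test_functionD(1)[OF f] by blast
  have cf: "Cdiff l f" by (rule test_functionD(2)[OF f])
  define G where "G = (\<lambda>x y. rmono \<eta> (x + y - 0) - rmono \<eta> y)"
  have "lowmix rmono (mabs \<eta>) G"
    unfolding G_def by (rule lowmix_expand[where c = "\<lambda>_ _. 0"]) (auto simp: rmono_Suc simp del: One_nat_def)
  note low = lowmix_psum[OF f this \<eta>]
  define p where "p = (\<lambda>y. rmono \<eta> (- y) :: real)"
  define q where "q = (\<lambda>y. lsum (\<lambda>\<alpha>. G (y - rvec \<alpha>) (- y)) f y)"
  have pp: "poln (mabs \<eta>) p" unfolding p_def by (rule poln_rmono)
  have eq: "lsum (\<lambda>\<alpha>. rmono \<eta> (rvec (- \<alpha>))) f = (\<lambda>y. p y + q y)"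
  proof
    fix y
    have "lsum (\<lambda>\<alpha>. rmono \<eta> (rvec (- \<alpha>))) f y = lsum (\<lambda>\<alpha>. rmono \<eta> (- y) * 1 + G (y - rvec \<alpha>) (- y)) f y"
      by (simp add: G_def rvec_simps)
    also have "\<dots> = p y * lsum (\<lambda>_. 1) f y + q y"
      unfolding lsum_add_coeff[OF R] lsum_scale_coeff[OF R] p_def q_def ..
    finally show "lsum (\<lambda>\<alpha>. rmono \<eta> (rvec (- \<alpha>))) f y = p y + q y" by (simp add: test_functionD(3)[OF f])
  qed
  have qz: "Dl is q = (\<lambda>x. 0)"
  \<comment> \<open>Order 0 is separate because \<open>mabs \<eta> - 1\<close> truncates to 0, which
    would still admit a constant remainder; there the remainder is zero.\<close>
  proof (cases "mabs \<eta> = 0")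
    case True
    then have "q = (\<lambda>x. 0)" using low by (auto simp: q_def)
    then show ?thesis by (simp add: Dl_zero)
  next
    case False
    then have "length is > mabs \<eta> - 1" using len \<eta> by linarith
    then show ?thesis using low by (simp add: poln_def q_def)
  qed
  have Cq: "Cdiff l q" using low by (simp add: poln_def q_def)
  have Cp: "Cdiff l p" using pp by (simp add: poln_def)
  have main: "mom \<eta> (\<lambda>\<beta>. Dl is f (y + rvec \<beta>)) = Dl is p y"
  proof -
    have "mom \<eta> (\<lambda>\<beta>. Dl is f (y + rvec \<beta>)) = Dl is (lsum (\<lambda>\<alpha>. rmono \<eta> (rvec (- \<alpha>))) f) y"
      unfolding mom_lsum using Dl_lsum[OF R cf] len by simp
    also have "\<dots> = Dl is p y" unfolding eq using Dl_add[OF Cp Cq, of "is"] len qz by simp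
    finally show ?thesis .
  qed
  show "mabs \<eta> < l \<Longrightarrow> mom \<eta> (\<lambda>\<beta>. Dl is f (y + rvec \<beta>)) = 0"
    unfolding main using pp len by (simp add: poln_def)
  have "poln l p" by (rule poln_mono[OF pp \<eta>])
  then show "mom \<eta> (\<lambda>\<beta>. Dl is f (y + rvec \<beta>)) = Dl is (\<lambda>y. rmono \<eta> (- y)) 0"
    unfolding main p_def[symmetric] using len by (rule poln_Dl_const)
qed

section \<open>The cascade operator and base \<open>m\<close> digits\<close>

definition casc :: "nat \<Rightarrow> nat \<Rightarrow> (int ^ 's::finite \<Rightarrow> real) \<Rightarrow> (real ^ 's \<Rightarrow> real) \<Rightarrow> real ^ 's \<Rightarrow> real" where
  "casc m N a f x = (\<Sum>\<gamma>\<in>mbox N. a \<gamma> * f (real m *\<^sub>R x - rvec \<gamma>))"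

primrec cascn :: "nat \<Rightarrow> nat \<Rightarrow> (nat \<Rightarrow> int ^ 's::finite \<Rightarrow> real) \<Rightarrow> nat \<Rightarrow> (real ^ 's \<Rightarrow> real) \<Rightarrow> real ^ 's \<Rightarrow> real" where
  "cascn m N a 0 f = f"
| "cascn m N a (Suc k) f = cascn m N a k (casc m N (a (Suc k)) f)"

text \<open>The expanding dynamics whose inverse branches are
  \<open>x \<mapsto> (x + \<epsilon>) / m\<close>. With the digits of \<open>x\<close> it yields the
  point of the unit cube at which the initial function is sampled at level \<open>k\<close>.\<close>

primrec orbit :: "nat \<Rightarrow> (nat \<Rightarrow> int ^ 's::finite) \<Rightarrow> real ^ 's \<Rightarrow> nat \<Rightarrow> real ^ 's" where
  "orbit m e x 0 = x"
| "orbit m e x (Suc k) = real m *\<^sub>R orbit m e x k - rvec (e (Suc k))"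

lemma casc_tr: "casc m N a f (x + rvec \<alpha>) = tr m N a \<epsilon> (\<lambda>\<beta>. f (real m *\<^sub>R x - rvec \<epsilon> + rvec \<beta>)) \<alpha>"
  unfolding casc_def tr_def by (intro sum.cong refl arg_cong[of _ _ "\<lambda>u. _ * f u"]) (simp add: rvec_simps scaleR_add_right)

text \<open>Any sequence of lattice vectors \<open>e\<close> is allowed, since changing it only
  relabels the lattice of sampling points; digits of \<open>x\<close> are chosen later to keep these
  points bounded.\<close>

lemma cascn_trs:
  "cascn m N a k f (x + rvec \<alpha>) = trs m N a e k (\<lambda>\<beta>. f (orbit m e x k + rvec \<beta>)) \<alpha>"
proof (induction k arbitrary: f)
  case (Suc k)
  have "(\<lambda>\<beta>. casc m N (a (Suc k)) f (orbit m e x k + rvec \<beta>)) =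
      tr m N (a (Suc k)) (e (Suc k)) (\<lambda>\<beta>. f (orbit m e x (Suc k) + rvec \<beta>))"
    by (rule ext) (simp only: casc_tr[of _ _ _ _ _ _ "e (Suc k)"] orbit.simps)
  then show ?case using Suc.IH[of "casc m N (a (Suc k)) f"] by simp
qed simp

lemma orbit_diff: "orbit m e x k - orbit m e y k = real m ^ k *\<^sub>R (x - y)"
proof (induction k)
  case (Suc k)
  have "orbit m e x (Suc k) - orbit m e y (Suc k) = real m *\<^sub>R (orbit m e x k - orbit m e y k)"
    by (simp add: scaleR_diff_right)
  then show ?case using Suc by simp
qed simp

text \<open>Base \<open>m\<close> expansion in each coordinate. The value of \<open>e\<close> at 0
  is a default, as \<open>orbit\<close> reads the digits from index 1 on.\<close>

lemma digit_expansion: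
  fixes x :: "real ^ 's::finite"
  assumes m: "m \<ge> 2" and x: "x \<in> ucube"
  shows "\<exists>e. (\<forall>j. e j \<in> digits m) \<and> (\<forall>k. orbit m e x k \<in> ucube)"
proof -
  define fl where "fl y = (\<chi> i. \<lfloor>y $ i\<rfloor>)" for y :: "real ^ 's"
  have fl: "y - rvec (fl y) \<in> ucube" for y
    by (auto simp: ucube_def rvec_simps fl_def) linarith
  define Y where "Y = rec_nat x (\<lambda>k y. real m *\<^sub>R y - rvec (fl (real m *\<^sub>R y)))"
  define e where "e k = (case k of 0 \<Rightarrow> 0 | Suc j \<Rightarrow> fl (real m *\<^sub>R Y j))" for k
  have Y: "Y 0 = x" "Y (Suc k) = real m *\<^sub>R Y k - rvec (fl (real m *\<^sub>R Y k))" for k by (simp_all add: Y_def)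
  have YU: "Y k \<in> ucube" for k by (cases k) (auto simp: Y x fl)
  have "orbit m e x k = Y k" for k by (induction k) (auto simp: Y e_def)
  then have "orbit m e x k \<in> ucube" for k using YU by simp
  moreover have "e j \<in> digits m" for j
  proof (cases j)
    case 0 then show ?thesis using m by (simp add: e_def digits_def)
  next
    case (Suc k)
    have "fl (real m *\<^sub>R Y k) $ i \<in> {0..<int m}" for i
    proof -
      have "0 \<le> Y k $ i" "Y k $ i < 1" using YU[of k] by (auto simp: ucube_def)
      then have "0 \<le> real m * Y k $ i" "real m * Y k $ i < real m" using m by auto
      then have "0 \<le> \<lfloor>real m * Y k $ i\<rfloor>" "\<lfloor>real m * Y k $ i\<rfloor> < int m" by (simp_all add: floor_less_iff)
      then show ?thesis by (simp add: fl_def)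
    qed
    then show ?thesis by (simp add: Suc e_def digits_def)
  qed
  ultimately show ?thesis by blast
qed

text \<open>On the support of the new function
  \<open>m * \<bar>x $ i\<bar> \<le> R + N \<le> 2 * R \<le> m * R\<close>; hence the condition that
  \<open>R\<close> be at least \<open>N\<close>.\<close>

lemma csupp_casc:
  assumes m: "m \<ge> 2" and h: "csupp R h" and R: "R \<ge> real N"
  shows "csupp R (casc m N a h)"
  unfolding csupp_def
proof (intro allI impI)
  fix x :: "real ^ 'a" and i assume "casc m N a h x \<noteq> 0"
  then obtain \<gamma> where g: "\<gamma> \<in> mbox N" "h (real m *\<^sub>R x - rvec \<gamma>) \<noteq> 0"
    unfolding casc_def by (metis (mono_tags, lifting) mult_zero_right sum.neutral)
  have "\<bar>real m * x $ i - of_int (\<gamma> $ i)\<bar> \<le> R" using h g(2) by (auto simp: csupp_def rvec_simps)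
  moreover have "0 \<le> real_of_int (\<gamma> $ i)" "real_of_int (\<gamma> $ i) \<le> real N"
    using g(1) of_int_le_iff[of "\<gamma> $ i" "int N", where 'a = real] by (auto simp: mbox_def)
  ultimately have "\<bar>real m * x $ i\<bar> \<le> 2 * R" using R by linarith
  moreover have "2 * \<bar>x $ i\<bar> \<le> real m * \<bar>x $ i\<bar>" using m by (intro mult_right_mono) auto
  ultimately show "\<bar>x $ i\<bar> \<le> R" by (simp add: abs_mult)
qed

lemma csupp_cascn:
  assumes m: "m \<ge> 2" and R: "R \<ge> real N"
  shows "csupp R h \<Longrightarrow> csupp R (cascn m N a k h)"
  by (induction k arbitrary: h) (auto intro: csupp_casc[OF m _ R])

lemma casc_affine: "casc m N a f x = (\<Sum>\<gamma>\<in>mbox N. a \<gamma> * f (real m *\<^sub>R x + (- rvec \<gamma>)))"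
  by (simp add: casc_def)

lemma Cdiff_casc: "Cdiff n f \<Longrightarrow> Cdiff n (casc m N a f)"
  unfolding casc_affine[abs_def] by (intro Cdiff_sum Cdiff_cmult Cdiff_affine)

lemma Dl_casc:
  assumes "Cdiff n f" "length is \<le> n"
  shows "Dl is (casc m N a f) = (\<lambda>x. real m ^ length is * casc m N a (Dl is f) x)"
proof -
  have each: "Dl is (\<lambda>x. a \<gamma> * f (real m *\<^sub>R x + (- rvec \<gamma>))) =
      (\<lambda>x. a \<gamma> * (real m ^ length is * Dl is f (real m *\<^sub>R x + (- rvec \<gamma>))))" for \<gamma>
    unfolding Dl_cmult[OF Cdiff_affine[OF assms(1)] assms(2)] Dl_affine[OF assms] ..
  have "Dl is (casc m N a f) = (\<lambda>x. \<Sum>\<gamma>\<in>mbox N. Dl is (\<lambda>x. a \<gamma> * f (real m *\<^sub>R x + (- rvec \<gamma>))) x)"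
    unfolding casc_affine[abs_def]
    by (rule Dl_sum[OF _ assms(2)]) (intro Cdiff_cmult Cdiff_affine assms(1))
  then show ?thesis unfolding each casc_affine sum_distrib_left by (simp only: mult.left_commute)
qed

lemma casc_cmult: "casc m N a (\<lambda>x. c * f x) = (\<lambda>x. c * casc m N a f x)"
  by (auto simp: casc_def sum_distrib_left mult_ac)

lemma casc_diff: "casc m N a (\<lambda>x. f x - g x) = (\<lambda>x. casc m N a f x - casc m N a g x)"
  by (auto simp: casc_def sum_subtractf right_diff_distrib)

lemma cascn_cmult: "cascn m N a k (\<lambda>x. c * f x) = (\<lambda>x. c * cascn m N a k f x)"
  by (induction k arbitrary: f) (auto simp: casc_cmult)

lemma cascn_diff: "cascn m N a k (\<lambda>x. f x - g x) = (\<lambda>x. cascn m N a k f x - cascn m N a k g x)"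
  by (induction k arbitrary: f g) (auto simp: casc_diff)

lemma trs_diff: "trs m N a e k (\<lambda>x. f x - g x) = (\<lambda>x. trs m N a e k f x - trs m N a e k g x)"
  by (induction k arbitrary: f g) (auto simp: tr_def right_diff_distrib sum_subtractf)

lemma Cdiff_cascn: "Cdiff n f \<Longrightarrow> Cdiff n (cascn m N a k f)"
  by (induction k arbitrary: f) (auto intro: Cdiff_casc)

lemma Dl_cascn:
  "Cdiff n f \<Longrightarrow> length is \<le> n \<Longrightarrow> Dl is (cascn m N a k f) = (\<lambda>x. (real m ^ length is) ^ k * cascn m N a k (Dl is f) x)"
proof (induction k arbitrary: f)
  case (Suc k)
  then show ?case
    using Suc.IH[OF Cdiff_casc[OF Suc.prems(1), of m N "a (Suc k)"] Suc.prems(2)]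
    by (simp add: Dl_casc[OF Suc.prems] cascn_cmult mult_ac)
qed simp

text \<open>Exchanging the two sums moves the mask from the coefficients to the generator.
  Convergence for all data thereby reduces to the cascade iteration on one function.\<close>

lemma lsum_subdiv:
  fixes c :: "int ^ 's::finite \<Rightarrow> real"
  assumes m: "m \<ge> 2" and a: "is_mask N a" and h: "csupp R h"
  shows "lsum (subdiv m a c) h (real m *\<^sub>R x) = lsum c (casc m N a h) x"
proof -
  define S where "S = nearpts R (real m *\<^sub>R x)"
  \<comment> \<open>A finite set containing every \<beta> for which
    \<open>\<alpha> - m\<beta>\<close> can lie in the support of the mask for some \<alpha> in
    \<open>S\<close>.\<close>
  define T where "T = (\<lambda>(\<alpha> :: int ^ 's, \<gamma> :: int ^ 's). (\<chi> i. (\<alpha> $ i - \<gamma> $ i) div int m)) ` (S \<times> mbox N)"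
  have fin: "finite S" "finite T" by (auto simp: S_def T_def)
  have T: "\<beta> \<in> T" if "\<alpha> \<in> S" "\<alpha> - int m *s \<beta> \<in> mbox N" for \<alpha> \<beta>
    unfolding T_def
  proof (rule image_eqI[of _ _ "(\<alpha>, \<alpha> - int m *s \<beta>)"])
    show "\<beta> = (case (\<alpha>, \<alpha> - int m *s \<beta>) of (\<alpha>, \<gamma>) \<Rightarrow> \<chi> i. (\<alpha> $ i - \<gamma> $ i) div int m)"
      using m by (simp add: vec_eq_iff)
  qed (use that in auto)
  have inner: "(\<Sum>\<alpha>\<in>S. a (\<alpha> - int m *s \<beta>) * h (real m *\<^sub>R x - rvec \<alpha>)) = casc m N a h (x - rvec \<beta>)" for \<beta>
    unfolding casc_def
  proof (rule sum.reindex_bij_witness_not_neutral[of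
        "{\<alpha>\<in>S. a (\<alpha> - int m *s \<beta>) * h (real m *\<^sub>R x - rvec \<alpha>) = 0}"
        "{\<gamma>\<in>mbox N. a \<gamma> * h (real m *\<^sub>R (x - rvec \<beta>) - rvec \<gamma>) = 0}" _
        "\<lambda>\<gamma>. \<gamma> + int m *s \<beta>" "\<lambda>\<alpha>. \<alpha> - int m *s \<beta>"])
    have e: "real m *\<^sub>R (x - rvec \<beta>) - rvec (\<alpha> - int m *s \<beta>) = real m *\<^sub>R x - rvec \<alpha>" for \<alpha>
      by (simp add: rvec_simps scaleR_diff_right)
    have e': "real m *\<^sub>R x - rvec (\<gamma> + int m *s \<beta>) = real m *\<^sub>R (x - rvec \<beta>) - rvec \<gamma>" for \<gamma>
      by (simp add: rvec_simps scaleR_diff_right)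
    show "finite {\<alpha>\<in>S. a (\<alpha> - int m *s \<beta>) * h (real m *\<^sub>R x - rvec \<alpha>) = 0}" using fin by simp
    show "finite {\<gamma>\<in>mbox N. a \<gamma> * h (real m *\<^sub>R (x - rvec \<beta>) - rvec \<gamma>) = 0}" by simp
    show "\<alpha> - int m *s \<beta> \<in> mbox N - {\<gamma>\<in>mbox N. a \<gamma> * h (real m *\<^sub>R (x - rvec \<beta>) - rvec \<gamma>) = 0}"
      if "\<alpha> \<in> S - {\<alpha>\<in>S. a (\<alpha> - int m *s \<beta>) * h (real m *\<^sub>R x - rvec \<alpha>) = 0}" for \<alpha>
      using that is_mask_outside[OF a, of "\<alpha> - int m *s \<beta>"] by (auto simp: e)
    show "\<gamma> + int m *s \<beta> \<in> S - {\<alpha>\<in>S. a (\<alpha> - int m *s \<beta>) * h (real m *\<^sub>R x - rvec \<alpha>) = 0}"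
      if "\<gamma> \<in> mbox N - {\<gamma>\<in>mbox N. a \<gamma> * h (real m *\<^sub>R (x - rvec \<beta>) - rvec \<gamma>) = 0}" for \<gamma>
      using that nearptsI[OF h, of "real m *\<^sub>R x" "\<gamma> + int m *s \<beta>"] by (auto simp: e' S_def)
    show "a (\<alpha> - int m *s \<beta>) * h (real m *\<^sub>R (x - rvec \<beta>) - rvec (\<alpha> - int m *s \<beta>)) = a (\<alpha> - int m *s \<beta>) * h (real m *\<^sub>R x - rvec \<alpha>)" for \<alpha>
      by (simp add: e)
  qed auto
  have "lsum (subdiv m a c) h (real m *\<^sub>R x) = (\<Sum>\<alpha>\<in>S. subdiv m a c \<alpha> * h (real m *\<^sub>R x - rvec \<alpha>))"
    by (rule lsum_finite[OF h]) (auto simp: S_def)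
  also have "\<dots> = (\<Sum>\<alpha>\<in>S. (\<Sum>\<beta>\<in>T. a (\<alpha> - int m *s \<beta>) * c \<beta>) * h (real m *\<^sub>R x - rvec \<alpha>))"
  proof (intro sum.cong refl)
    fix \<alpha> assume "\<alpha> \<in> S"
    then have "subdiv m a c \<alpha> = (\<Sum>\<beta>\<in>T. a (\<alpha> - int m *s \<beta>) * c \<beta>)"
      unfolding subdiv_def using T is_mask_outside[OF a] by (intro infsum_finite_support fin) auto
    then show "subdiv m a c \<alpha> * h (real m *\<^sub>R x - rvec \<alpha>) = (\<Sum>\<beta>\<in>T. a (\<alpha> - int m *s \<beta>) * c \<beta>) * h (real m *\<^sub>R x - rvec \<alpha>)"
      by simp
  qed
  also have "\<dots> = (\<Sum>\<alpha>\<in>S. \<Sum>\<beta>\<in>T. c \<beta> * (a (\<alpha> - int m *s \<beta>) * h (real m *\<^sub>R x - rvec \<alpha>)))"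
    unfolding sum_distrib_right by (intro sum.cong refl) (simp only: mult_ac)
  also have "\<dots> = (\<Sum>\<beta>\<in>T. \<Sum>\<alpha>\<in>S. c \<beta> * (a (\<alpha> - int m *s \<beta>) * h (real m *\<^sub>R x - rvec \<alpha>)))"
    by (rule sum.swap)
  also have "\<dots> = (\<Sum>\<beta>\<in>T. c \<beta> * casc m N a h (x - rvec \<beta>))"
    unfolding sum_distrib_left[symmetric] inner ..
  also have "\<dots> = lsum c (casc m N a h) x"
    unfolding lsum_def
  proof (rule infsum_finite_support[symmetric, OF fin(2)])
    fix \<beta> assume "\<beta> \<notin> T"
    then have "a (\<alpha> - int m *s \<beta>) = 0" if "\<alpha> \<in> S" for \<alpha> using T that is_mask_outside[OF a] by blast
    then have "casc m N a h (x - rvec \<beta>) = 0" unfolding inner[symmetric] by (intro sum.neutral) auto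
    then show "c \<beta> * casc m N a h (x - rvec \<beta>) = 0" by simp
  qed
  finally show ?thesis .
qed

lemma telescoping_bound:
  fixes u :: "nat \<Rightarrow> real"
  assumes "u \<longlonglongrightarrow> L" "\<And>k. \<bar>u (Suc k) - u k\<bar> \<le> e k" "summable e"
  shows "\<bar>L - u k\<bar> \<le> (\<Sum>i. e (i + k))"
proof (rule tendsto_upperbound[OF tendsto_rabs[OF tendsto_diff[OF LIMSEQ_ignore_initial_segment[OF assms(1), of k] tendsto_const]]])
  have se: "summable (\<lambda>i. e (i + k))" by (rule summable_ignore_initial_segment[OF assms(3)])
  have e0: "e k \<ge> 0" for k using order_trans[OF abs_ge_zero assms(2)] .
  have "\<bar>u (n + k) - u k\<bar> \<le> (\<Sum>i<n. e (i + k))" for n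
  proof (induction n)
    case (Suc n)
    then show ?case using assms(2)[of "n + k"] by simp
  qed simp
  also have "(\<Sum>i<n. e (i + k)) \<le> (\<Sum>i. e (i + k))" for n
    by (rule sum_le_suminf[OF se]) (auto simp: e0)
  finally show "\<forall>\<^sub>F n in sequentially. \<bar>u (n + k) - u k\<bar> \<le> (\<Sum>i. e (i + k))" by simp
qed simp

lemma telescoping_convergent:
  fixes u :: "nat \<Rightarrow> real"
  assumes "\<And>k. \<bar>u (Suc k) - u k\<bar> \<le> e k" "summable e"
  shows "\<exists>L. u \<longlonglongrightarrow> L"
proof -
  have "summable (\<lambda>k. u (Suc k) - u k)"
    by (rule summable_comparison_test'[OF assms(2), of 0]) (use assms(1) in auto)
  then have "(\<lambda>n. \<Sum>k<n. u (Suc k) - u k) \<longlonglongrightarrow> (\<Sum>k. u (Suc k) - u k)" by (rule summable_LIMSEQ)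
  then have "(\<lambda>n. u n - u 0) \<longlonglongrightarrow> (\<Sum>k. u (Suc k) - u k)" by (simp add: sum_lessThan_telescope)
  then have "(\<lambda>n. (u n - u 0) + u 0) \<longlonglongrightarrow> (\<Sum>k. u (Suc k) - u k) + u 0" by (intro tendsto_intros)
  then show ?thesis by auto
qed

lemma summable_tail_tendsto_0:
  fixes e :: "nat \<Rightarrow> real"
  assumes "summable e"
  shows "(\<lambda>k. \<Sum>i. e (i + k)) \<longlonglongrightarrow> 0"
proof -
  have "(\<lambda>k. suminf e - (\<Sum>i<k. e i)) \<longlonglongrightarrow> suminf e - suminf e"
    by (intro tendsto_intros summable_LIMSEQ assms)
  moreover have "suminf e - (\<Sum>i<k. e i) = (\<Sum>i. e (i + k))" for k
    using suminf_split_initial_segment[OF assms, of k] by simp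
  ultimately show ?thesis by simp
qed

lemma Dl_bounded:
  fixes f :: "real ^ 's::finite \<Rightarrow> real"
  assumes "csupp R f" "Cdiff n f"
  shows "\<exists>H\<ge>0. \<forall>is x. length is = n \<longrightarrow> \<bar>Dl is f x\<bar> \<le> H"
proof -
  have "\<exists>H. \<forall>x. \<bar>Dl is f x\<bar> \<le> H" if "length is = n" for "is"
    using csupp_bounded[OF csupp_Dl[OF assms(1)]] assms(2) that by (simp add: Cdiff_iff_Dl)
  then obtain H where H: "\<And>is x. length is = n \<Longrightarrow> \<bar>Dl is f x\<bar> \<le> H is" by metis
  have fin: "finite {is :: 's list. length is = n}"
    using finite_lists_length_eq[OF finite, of "UNIV :: 's set" n] by simp
  have H0: "H is \<ge> 0" if "length is = n" for "is" using order_trans[OF abs_ge_zero H[OF that]] .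
  have "\<bar>Dl is f x\<bar> \<le> (\<Sum>is | length is = n. H is)" if "length is = n" for "is" x
    using H[OF that, of x] member_le_sum[OF _ _ fin, of "is" H] that H0 by force
  moreover have "(\<Sum>is | length is = n. H is) \<ge> 0" using H0 by (auto intro: sum_nonneg)
  ultimately show ?thesis by blast
qed

lemma csupp_mono: "csupp R f \<Longrightarrow> R \<le> R' \<Longrightarrow> csupp R' f"
  unfolding csupp_def by (meson order_trans)

lemma supp_shift:
  assumes m: "m \<ge> 2" and h: "csupp R h" and y: "\<And>i. \<bar>y $ i\<bar> \<le> Y" and d: "real d \<ge> real m * (R + Y)"
  shows "supp m N d (\<lambda>\<beta>. h (y + rvec \<beta>))"
  unfolding supp_def
proof (intro allI impI, rule ccontr)
  fix \<beta> :: "int ^ 'a" assume b: "\<beta> \<notin> lbox m N d" and nz: "h (y + rvec \<beta>) \<noteq> 0"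
  have "- (int m - 1) - int d \<le> (int m - 1) * \<beta> $ i \<and> (int m - 1) * \<beta> $ i \<le> int N + int d" for i
  proof -
    have "\<bar>y $ i + of_int (\<beta> $ i)\<bar> \<le> R" using h nz by (auto simp: csupp_def rvec_simps)
    then have "\<bar>real_of_int (\<beta> $ i)\<bar> \<le> R + Y" using y[of i] by linarith
    then have "(real m - 1) * \<bar>real_of_int (\<beta> $ i)\<bar> \<le> real m * (R + Y)"
      using m by (intro mult_mono) auto
    then have "\<bar>(real m - 1) * real_of_int (\<beta> $ i)\<bar> \<le> real d" using d m by (simp add: abs_mult)
    then have "\<bar>real_of_int ((int m - 1) * \<beta> $ i)\<bar> \<le> real_of_int (int d)" using m by simp
    then have "\<bar>(int m - 1) * \<beta> $ i\<bar> \<le> int d" by (simp only: of_int_abs[symmetric] of_int_le_iff)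
    then show ?thesis using m by linarith
  qed
  then show False using b by (simp add: lbox_def)
qed

section \<open>Uniform estimates for cascade iterates\<close>

context contractive_scheme
begin

definition rate :: "real \<Rightarrow> nat \<Rightarrow> real" where
  "rate r k = forced_decay 1 (real m ^ l * r) k"

text \<open>The first term is the decay in \<open>V\<close>, the second the moments of the
  difference of two consecutive iterates.\<close>

definition step_err :: "real \<Rightarrow> nat \<Rightarrow> real" where
  "step_err r k = rate r k + \<sigma> (Suc k)"

definition admissible :: "real \<Rightarrow> bool" where
  "admissible r \<longleftrightarrow> rhoA l m N a < r \<and> real m ^ l * r < 1"

lemma admissibleD:
  assumes "admissible r"
  shows "0 \<le> real m ^ l * r" "real m ^ l * r < 1"
  using assms rhoA_nonneg by (auto simp: admissible_def)

lemma rate_nonneg: "admissible r \<Longrightarrow> rate r k \<ge> 0"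
  unfolding rate_def by (rule forced_decay_nonneg) (auto dest: admissibleD)

lemma rate_summable: "admissible r \<Longrightarrow> summable (rate r)"
  unfolding rate_def[abs_def] by (rule forced_decay_summable) (auto dest: admissibleD)

lemma step_err_nonneg: "admissible r \<Longrightarrow> step_err r k \<ge> 0"
  using rate_nonneg by (simp add: step_err_def)

lemma step_err_summable: "admissible r \<Longrightarrow> summable (step_err r)"
  unfolding step_err_def[abs_def]
  by (intro summable_add rate_summable iffD2[OF summable_Suc_iff] sigma_summable)

lemma exists_admissible: "\<exists>r. admissible r"
proof -
  have "rhoA l m N a < (rhoA l m N a + 1 / real m ^ l) / 2" "(rhoA l m N a + 1 / real m ^ l) / 2 < 1 / real m ^ l"
    using rho by auto
  moreover have "real m ^ l * r < 1" if "r < 1 / real m ^ l" for r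
    using that m2 by (simp add: field_simps)
  ultimately show ?thesis unfolding admissible_def by blast
qed

lemma contraction_box:
  assumes "admissible r"
  shows "\<exists>C\<ge>0. \<forall>k e w H \<tau>. (\<forall>j. e j \<in> digits m) \<longrightarrow> supp m N d w \<longrightarrow> (\<forall>\<beta>. \<bar>w \<beta>\<bar> \<le> H) \<longrightarrow>
     (\<forall>\<eta>. mabs \<eta> \<le> l \<longrightarrow> \<bar>mom \<eta> w\<bar> \<le> \<tau> * real m ^ (k * mabs \<eta>)) \<longrightarrow>
     (\<forall>\<alpha>. real m ^ (k * l) * \<bar>trs m N a e k w \<alpha>\<bar> \<le> C * (H * rate r k + real m ^ (k * l) * \<tau>))"
  using contraction[of r d] assms supp_mono[of m N d _ "Suc d"] unfolding admissible_def rate_def by (meson lessI less_imp_le)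

lemma ucube_abs: "y \<in> ucube \<Longrightarrow> \<bar>y $ i\<bar> \<le> 1"
  by (auto simp: ucube_def abs_le_iff intro: order_trans[of _ 0] less_imp_le)

text \<open>After translation into the unit cube the digits of the point keep all sampling points in
  that cube, so the samples live in one fixed box and \<open>contraction_box\<close> applies
  uniformly in \<open>x\<close>.\<close>

lemma casc_contraction:
  assumes r: "admissible r"
  shows "\<exists>C\<ge>0. \<forall>k h H \<tau>. csupp R h \<longrightarrow> (\<forall>x. \<bar>h x\<bar> \<le> H) \<longrightarrow>
     (\<forall>y\<in>ucube. \<forall>\<eta>. mabs \<eta> \<le> l \<longrightarrow> \<bar>mom \<eta> (\<lambda>\<beta>. h (y + rvec \<beta>))\<bar> \<le> \<tau> * real m ^ (k * mabs \<eta>)) \<longrightarrow>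
     (\<forall>x. real m ^ (k * l) * \<bar>cascn m N a k h x\<bar> \<le> C * (H * rate r k + real m ^ (k * l) * \<tau>))"
proof -
  define d where "d = nat \<lceil>real m * (R + 1)\<rceil>"
  have d: "real d \<ge> real m * (R + 1)" unfolding d_def by linarith
  obtain C where C: "C \<ge> 0" "\<forall>k e w H \<tau>. (\<forall>j. e j \<in> digits m) \<longrightarrow> supp m N d w \<longrightarrow> (\<forall>\<beta>. \<bar>w \<beta>\<bar> \<le> H) \<longrightarrow>
     (\<forall>\<eta>. mabs \<eta> \<le> l \<longrightarrow> \<bar>mom \<eta> w\<bar> \<le> \<tau> * real m ^ (k * mabs \<eta>)) \<longrightarrow>
     (\<forall>\<alpha>. real m ^ (k * l) * \<bar>trs m N a e k w \<alpha>\<bar> \<le> C * (H * rate r k + real m ^ (k * l) * \<tau>))"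
    using contraction_box[OF r, of d] by (elim exE conjE)
  have "real m ^ (k * l) * \<bar>cascn m N a k h x\<bar> \<le> C * (H * rate r k + real m ^ (k * l) * \<tau>)"
    if h: "csupp R h" "\<forall>x. \<bar>h x\<bar> \<le> H"
      "\<forall>y\<in>ucube. \<forall>\<eta>. mabs \<eta> \<le> l \<longrightarrow> \<bar>mom \<eta> (\<lambda>\<beta>. h (y + rvec \<beta>))\<bar> \<le> \<tau> * real m ^ (k * mabs \<eta>)" for k h H \<tau> x
  proof -
    obtain \<alpha> where x: "x - rvec \<alpha> \<in> ucube" using exists_floor by blast
    obtain e where e: "\<forall>j. e j \<in> digits m" "\<forall>k. orbit m e (x - rvec \<alpha>) k \<in> ucube"
      using digit_expansion[OF m2 x] by blast
    define y where "y = orbit m e (x - rvec \<alpha>) k"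
    have y: "y \<in> ucube" using e(2) by (simp add: y_def)
    have "cascn m N a k h x = trs m N a e k (\<lambda>\<beta>. h (y + rvec \<beta>)) \<alpha>"
      using cascn_trs[of m N a k h "x - rvec \<alpha>" \<alpha> e] by (simp add: y_def)
    moreover have "supp m N d (\<lambda>\<beta>. h (y + rvec \<beta>))"
      by (rule supp_shift[OF m2 h(1) ucube_abs[OF y] d])
    then have "real m ^ (k * l) * \<bar>trs m N a e k (\<lambda>\<beta>. h (y + rvec \<beta>)) \<alpha>\<bar> \<le> C * (H * rate r k + real m ^ (k * l) * \<tau>)"
      by (intro C(2)[rule_format]) (use e h y in auto)
    ultimately show ?thesis by simp
  qed
  then show ?thesis using C(1) by blast
qed

text \<open>Both points follow the digits of the first, so their sampling points differ by at most 1
  in each coordinate; the radius \<open>R + 2\<close> accounts for this. The difference of the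
  samples has no moments and only decays.\<close>

lemma casc_two_point:
  assumes r: "admissible r"
  shows "\<exists>C\<ge>0. \<forall>k h H x x'. csupp R h \<longrightarrow> (\<forall>x. \<bar>h x\<bar> \<le> H) \<longrightarrow>
     (\<forall>y y' \<eta>. mabs \<eta> \<le> l \<longrightarrow> mom \<eta> (\<lambda>\<beta>. h (y + rvec \<beta>)) = mom \<eta> (\<lambda>\<beta>. h (y' + rvec \<beta>))) \<longrightarrow>
     (\<forall>i. real m ^ k * \<bar>(x - x') $ i\<bar> \<le> 1) \<longrightarrow>
     real m ^ (k * l) * \<bar>cascn m N a k h x - cascn m N a k h x'\<bar> \<le> C * (H * rate r k)"
proof -
  define d where "d = nat \<lceil>real m * (R + 2)\<rceil>"
  have d: "real d \<ge> real m * (R + 2)" unfolding d_def by linarith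
  obtain C where C: "C \<ge> 0" "\<forall>k e w H \<tau>. (\<forall>j. e j \<in> digits m) \<longrightarrow> supp m N d w \<longrightarrow> (\<forall>\<beta>. \<bar>w \<beta>\<bar> \<le> H) \<longrightarrow>
     (\<forall>\<eta>. mabs \<eta> \<le> l \<longrightarrow> \<bar>mom \<eta> w\<bar> \<le> \<tau> * real m ^ (k * mabs \<eta>)) \<longrightarrow>
     (\<forall>\<alpha>. real m ^ (k * l) * \<bar>trs m N a e k w \<alpha>\<bar> \<le> C * (H * rate r k + real m ^ (k * l) * \<tau>))"
    using contraction_box[OF r, of d] by (elim exE conjE)
  have "real m ^ (k * l) * \<bar>cascn m N a k h x - cascn m N a k h x'\<bar> \<le> (C * 2) * (H * rate r k)"
    if h: "csupp R h" "\<forall>x. \<bar>h x\<bar> \<le> H"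
      "\<forall>y y' \<eta>. mabs \<eta> \<le> l \<longrightarrow> mom \<eta> (\<lambda>\<beta>. h (y + rvec \<beta>)) = mom \<eta> (\<lambda>\<beta>. h (y' + rvec \<beta>))"
      and close: "\<forall>i. real m ^ k * \<bar>(x - x') $ i\<bar> \<le> 1" for k h H x x'
  proof -
    obtain \<alpha> where x: "x - rvec \<alpha> \<in> ucube" using exists_floor by blast
    obtain e where e: "\<forall>j. e j \<in> digits m" "\<forall>k. orbit m e (x - rvec \<alpha>) k \<in> ucube"
      using digit_expansion[OF m2 x] by blast
    define y where "y = orbit m e (x - rvec \<alpha>) k"
    define y' where "y' = orbit m e (x' - rvec \<alpha>) k"
    have y: "y \<in> ucube" using e(2) by (simp add: y_def)
    have y1: "\<bar>y $ i\<bar> \<le> 2" for i using ucube_abs[OF y, of i] by linarith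
    have y2: "\<bar>y' $ i\<bar> \<le> 2" for i
    proof -
      have "y - y' = real m ^ k *\<^sub>R (x - x')" unfolding y_def y'_def orbit_diff by simp
      from arg_cong[OF this, of "\<lambda>v. v $ i"] have "y $ i - y' $ i = real m ^ k * (x - x') $ i" by simp
      then have "\<bar>y $ i - y' $ i\<bar> \<le> 1" using close by (simp add: abs_mult)
      then show ?thesis using ucube_abs[OF y, of i] by linarith
    qed
    have s1: "supp m N d (\<lambda>\<beta>. h (y + rvec \<beta>))" by (rule supp_shift[OF m2 h(1) y1 d])
    have s2: "supp m N d (\<lambda>\<beta>. h (y' + rvec \<beta>))" by (rule supp_shift[OF m2 h(1) y2 d])
    define w where "w = (\<lambda>\<beta>. h (y + rvec \<beta>) - 1 * h (y' + rvec \<beta>))"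
    have sw: "supp m N d w" using s1 s2 by (auto simp: supp_def w_def)
    have wb: "\<bar>w \<beta>\<bar> \<le> 2 * H" for \<beta>
      using h(2)[rule_format, of "y + rvec \<beta>"] h(2)[rule_format, of "y' + rvec \<beta>"] by (simp add: w_def)
    have mw: "mom \<eta> w = 0" if "mabs \<eta> \<le> l" for \<eta>
      unfolding w_def mom_lincomb[OF m2 s1 s2] using h(3) that by simp
    have "cascn m N a k h x - cascn m N a k h x' = trs m N a e k w \<alpha>"
      using cascn_trs[of m N a k h "x - rvec \<alpha>" \<alpha> e] cascn_trs[of m N a k h "x' - rvec \<alpha>" \<alpha> e]
      by (simp add: y_def y'_def w_def trs_diff)
    moreover have "real m ^ (k * l) * \<bar>trs m N a e k w \<alpha>\<bar> \<le> C * (2 * H * rate r k + real m ^ (k * l) * 0)"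
      by (intro C(2)[rule_format]) (use e sw wb mw in auto)
    ultimately show ?thesis by (simp add: mult_ac)
  qed
  then show ?thesis using C(1) by (intro exI[of _ "C * 2"]) auto
qed

lemma casc_bound:
  assumes "k \<ge> 1" "\<And>x. \<bar>h x\<bar> \<le> H"
  shows "\<bar>casc m N (a k) h x\<bar> \<le> b1 * H"
proof -
  have "casc m N (a k) h x = tr m N (a k) 0 (\<lambda>\<beta>. h (real m *\<^sub>R x - rvec 0 + rvec \<beta>)) 0"
    using casc_tr[of m N "a k" h x 0 0] by (simp add: rvec_simps)
  also have "\<bar>\<dots>\<bar> \<le> b1 * H" unfolding b1_def by (rule b1_step[OF assms(1)]) (rule assms(2))
  finally show ?thesis .
qed

lemma test_function_csupp:
  assumes "test_function l f"
  shows "\<exists>R\<ge>real N. csupp R f"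
proof -
  obtain R where "csupp R f" using test_functionD(1)[OF assms] by blast
  then have "csupp (max R (real N)) f" by (rule csupp_mono) simp
  then show ?thesis by (intro exI[of _ "max R (real N)"]) auto
qed

text \<open>The derivatives of consecutive iterates differ by \<open>k\<close> cascade steps applied
  to \<open>h = g - m ^ l * casc g\<close> with \<open>g\<close> a derivative of order
  \<open>l\<close> of \<open>f\<close>. As the moments of \<open>g\<close> are constant in order
  \<open>l\<close> and vanish below, the factor \<open>m ^ l\<close> cancels them against those of
  \<open>casc g\<close>, up to the defect of level \<open>Suc k\<close>.\<close>

lemma cauchy_step:
  assumes r: "admissible r" and f: "test_function l f"
  shows "\<exists>C\<ge>0. \<forall>k is x. length is = l \<longrightarrow>
     \<bar>Dl is (cascn m N a (Suc k) f) x - Dl is (cascn m N a k f) x\<bar> \<le> C * step_err r k"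
proof -
  obtain R where R: "R \<ge> real N" "csupp R f" using test_function_csupp[OF f] by blast
  have cf: "Cdiff l f" by (rule test_functionD(2)[OF f])
  obtain H0 where H0: "H0 \<ge> 0" "\<And>is x. length is = l \<Longrightarrow> \<bar>Dl is f x\<bar> \<le> H0"
    using Dl_bounded[OF R(2) cf] by blast
  obtain C1 where C1: "C1 \<ge> 0" "\<forall>k h H \<tau>. csupp R h \<longrightarrow> (\<forall>x. \<bar>h x\<bar> \<le> H) \<longrightarrow>
     (\<forall>y\<in>ucube. \<forall>\<eta>. mabs \<eta> \<le> l \<longrightarrow> \<bar>mom \<eta> (\<lambda>\<beta>. h (y + rvec \<beta>))\<bar> \<le> \<tau> * real m ^ (k * mabs \<eta>)) \<longrightarrow>
     (\<forall>x. real m ^ (k * l) * \<bar>cascn m N a k h x\<bar> \<le> C1 * (H * rate r k + real m ^ (k * l) * \<tau>))"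
    using casc_contraction[OF r, of R] by (elim exE conjE)
  \<comment> \<open>Chosen for samples at \<open>m y\<close> with \<open>y\<close> in the unit cube,
    whose coordinates reach \<open>m\<close>.\<close>
  define d where "d = nat \<lceil>real m * (R + real m)\<rceil>"
  have d: "real d \<ge> real m * (R + real m)" unfolding d_def by linarith
  obtain C2 where C2: "C2 \<ge> 0" "\<forall>k\<ge>1. \<forall>\<epsilon>\<in>digits m. \<forall>w H \<eta>. supp m N d w \<longrightarrow> (\<forall>\<beta>. \<bar>w \<beta>\<bar> \<le> H) \<longrightarrow> mabs \<eta> \<le> l \<longrightarrow>
     \<bar>real m ^ mabs \<eta> * mom \<eta> (tr m N (a k) \<epsilon> w) - mom \<eta> w\<bar>
       \<le> C2 * (lowmom (mabs \<eta>) w + real m ^ (k * mabs \<eta>) * \<delta> k * H)"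
    using moment_step[of d] by (elim exE conjE)
  define H where "H = H0 + real m ^ l * (b1 * H0)"
  have H: "H \<ge> 0" using H0(1) b1_nonneg by (simp add: H_def)
  have z: "(0 :: int ^ 's) \<in> digits m" using m2 by (simp add: digits_def)
  have "\<bar>Dl is (cascn m N a (Suc k) f) x - Dl is (cascn m N a k f) x\<bar> \<le> C1 * (H + C2 * H0) * step_err r k"
    if len: "length is = l" for k "is" x
  proof -
    define g where "g = Dl is f"
    define h where "h = (\<lambda>x. g x - real m ^ l * casc m N (a (Suc k)) g x)"
    have sg: "csupp R g" unfolding g_def by (rule csupp_Dl[OF R(2)])
    have gb: "\<bar>g x\<bar> \<le> H0" for x unfolding g_def by (rule H0(2)[OF len])
    have sc: "csupp R (casc m N (a (Suc k)) g)" by (rule csupp_casc[OF m2 sg R(1)])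
    have sh: "csupp R h" unfolding csupp_def
    proof (intro allI impI, rule ccontr)
      fix x i assume "h x \<noteq> 0" "\<not> \<bar>x $ i\<bar> \<le> R"
      then have "g x = 0" "casc m N (a (Suc k)) g x = 0" using sg sc unfolding csupp_def by blast+
      then show False using \<open>h x \<noteq> 0\<close> by (simp add: h_def)
    qed
    have hb: "\<bar>h x\<bar> \<le> H" for x
    proof -
      have "\<bar>h x\<bar> \<le> \<bar>g x\<bar> + real m ^ l * \<bar>casc m N (a (Suc k)) g x\<bar>"
        unfolding h_def using abs_triangle_ineq4[of "g x" "real m ^ l * casc m N (a (Suc k)) g x"] by (simp add: abs_mult)
      also have "\<dots> \<le> H" unfolding H_def
        by (intro add_mono gb mult_left_mono casc_bound) auto
      finally show ?thesis .
    qed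
    have hm: "\<bar>mom \<eta> (\<lambda>\<beta>. h (y + rvec \<beta>))\<bar> \<le> (C2 * H0 * real m ^ l * \<delta> (Suc k)) * real m ^ (k * mabs \<eta>)"
      if y: "y \<in> ucube" and \<eta>: "mabs \<eta> \<le> l" for y \<eta>
    proof -
      define w where "w = (\<lambda>\<beta>. g (real m *\<^sub>R y - rvec 0 + rvec \<beta>))"
      define T where "T = tr m N (a (Suc k)) 0 w"
      have cT: "casc m N (a (Suc k)) g (y + rvec \<beta>) = T \<beta>" for \<beta>
        unfolding T_def w_def by (rule casc_tr)
      have ym: "\<bar>(real m *\<^sub>R y - rvec 0) $ i\<bar> \<le> real m" for i
        using ucube_abs[OF y, of i] by (simp add: rvec_simps abs_mult mult_left_le)
      have sw: "supp m N d w" unfolding w_def by (rule supp_shift[OF m2 sg ym d])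
      have sT: "supp m N d T" unfolding T_def by (rule supp_mono[OF supp_tr[OF m2 z sw]]) simp
      have d1: "real d \<ge> real m * (R + 1)"
        using d m2 mult_left_mono[of "R + 1" "R + real m" "real m"] by linarith
      have sy: "supp m N d (\<lambda>\<beta>. g (y + rvec \<beta>))" by (rule supp_shift[OF m2 sg ucube_abs[OF y] d1])
      define K where "K = mom \<eta> w"
      have Keq: "mom \<eta> (\<lambda>\<beta>. g (y + rvec \<beta>)) = K"
        unfolding K_def w_def g_def using mom_test_function(1)[OF f len \<eta>] by metis
      have low: "lowmom (mabs \<eta>) w = 0" unfolding lowmom_def w_def g_def
        using mom_test_function(2)[OF f len] \<eta> by (intro sum.neutral) auto
      define p where "p = real m ^ (l - mabs \<eta>)"
      have p0: "p \<ge> 0" by (simp add: p_def)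
      have pl: "real m ^ l = p * real m ^ mabs \<eta>" using \<eta> by (simp add: p_def power_add[symmetric])
      \<comment> \<open>The moment \<open>K\<close> is nonzero in top order only, and there
        \<open>p = 1\<close>.\<close>
      have Kp: "K = p * K"
      proof (cases "mabs \<eta> = l")
        case False
        then have "K = 0" unfolding K_def w_def g_def using mom_test_function(2)[OF f len \<eta>] \<eta> by simp
        then show ?thesis by simp
      qed (simp add: p_def)
      have "mom \<eta> (\<lambda>\<beta>. h (y + rvec \<beta>)) = K - real m ^ l * mom \<eta> T"
        unfolding h_def cT mom_lincomb[OF m2 sy sT] Keq ..
      also have "\<dots> = p * (K - real m ^ mabs \<eta> * mom \<eta> T)"
        using Kp pl by (simp add: right_diff_distrib)
      finally have "\<bar>mom \<eta> (\<lambda>\<beta>. h (y + rvec \<beta>))\<bar> = p * \<bar>real m ^ mabs \<eta> * mom \<eta> T - K\<bar>"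
        using p0 by (simp add: abs_mult abs_minus_commute)
      also have "\<dots> \<le> p * (C2 * (lowmom (mabs \<eta>) w + real m ^ (Suc k * mabs \<eta>) * \<delta> (Suc k) * H0))"
        unfolding T_def K_def
        by (intro mult_left_mono p0 C2(2)[rule_format]) (use z sw gb \<eta> in \<open>auto simp: w_def\<close>)
      also have "\<dots> = (C2 * H0 * real m ^ l * \<delta> (Suc k)) * real m ^ (k * mabs \<eta>)"
        unfolding low pl by (simp add: power_add mult_ac)
      finally show ?thesis .
    qed
    have "Dl is (cascn m N a (Suc k) f) x - Dl is (cascn m N a k f) x = - ((real m ^ l) ^ k * cascn m N a k h x)"
    proof -
      have "Dl is (cascn m N a (Suc k) f) x = (real m ^ l) ^ k * cascn m N a k (\<lambda>x. real m ^ l * casc m N (a (Suc k)) g x) x"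
        using Dl_cascn[OF Cdiff_casc[OF cf], of "is" m N a k m N "a (Suc k)"] Dl_casc[OF cf, of "is" m N "a (Suc k)"] len
        by (simp add: g_def)
      moreover have "Dl is (cascn m N a k f) x = (real m ^ l) ^ k * cascn m N a k g x"
        using Dl_cascn[OF cf, of "is" m N a k] len by (simp add: g_def)
      ultimately show ?thesis unfolding h_def cascn_diff by (simp add: right_diff_distrib)
    qed
    then have "\<bar>Dl is (cascn m N a (Suc k) f) x - Dl is (cascn m N a k f) x\<bar> = real m ^ (k * l) * \<bar>cascn m N a k h x\<bar>"
      by (simp add: abs_mult power_mult[symmetric] mult.commute)
    also have "\<dots> \<le> C1 * (H * rate r k + real m ^ (k * l) * (C2 * H0 * real m ^ l * \<delta> (Suc k)))"
      by (rule C1(2)[rule_format]) (use sh hb hm in auto)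
    also have "\<dots> = C1 * (H * rate r k + C2 * H0 * \<sigma> (Suc k))"
      by (simp add: \<sigma>_def power_add mult_ac)
    also have "\<dots> \<le> C1 * ((H + C2 * H0) * step_err r k)"
    proof (intro mult_left_mono C1(1))
      have "0 \<le> H * \<sigma> (Suc k) + C2 * H0 * rate r k" using H C2(1) H0(1) rate_nonneg[OF r] by simp
      then show "H * rate r k + C2 * H0 * \<sigma> (Suc k) \<le> (H + C2 * H0) * step_err r k"
        by (simp add: step_err_def algebra_simps)
    qed
    finally show ?thesis by simp
  qed
  then show ?thesis using C1(1) H C2(1) H0(1) by (intro exI[of _ "C1 * (H + C2 * H0)"]) auto
qed

text \<open>Derivatives of order \<open>l\<close> of two test functions have equal moments, so the
  samples of their difference contribute nothing but their part in \<open>V\<close>.\<close>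

lemma test_compare:
  assumes r: "admissible r" and f: "test_function l f" and f': "test_function l f'"
  shows "\<exists>C\<ge>0. \<forall>k is x. length is = l \<longrightarrow>
     \<bar>Dl is (cascn m N a k f) x - Dl is (cascn m N a k f') x\<bar> \<le> C * rate r k"
proof -
  obtain R1 where R1: "R1 \<ge> real N" "csupp R1 f" using test_function_csupp[OF f] by blast
  obtain R2 where R2: "R2 \<ge> real N" "csupp R2 f'" using test_function_csupp[OF f'] by blast
  define R where "R = max R1 R2"
  have R: "csupp R f" "csupp R f'" unfolding R_def by (rule csupp_mono[OF R1(2)] csupp_mono[OF R2(2)], simp)+
  have cf: "Cdiff l f" "Cdiff l f'" using test_functionD(2)[OF f] test_functionD(2)[OF f'] by auto
  obtain H1 where H1: "H1 \<ge> 0" "\<And>is x. length is = l \<Longrightarrow> \<bar>Dl is f x\<bar> \<le> H1"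
    using Dl_bounded[OF R(1) cf(1)] by blast
  obtain H2 where H2: "H2 \<ge> 0" "\<And>is x. length is = l \<Longrightarrow> \<bar>Dl is f' x\<bar> \<le> H2"
    using Dl_bounded[OF R(2) cf(2)] by blast
  obtain C1 where C1: "C1 \<ge> 0" "\<forall>k h H \<tau>. csupp R h \<longrightarrow> (\<forall>x. \<bar>h x\<bar> \<le> H) \<longrightarrow>
     (\<forall>y\<in>ucube. \<forall>\<eta>. mabs \<eta> \<le> l \<longrightarrow> \<bar>mom \<eta> (\<lambda>\<beta>. h (y + rvec \<beta>))\<bar> \<le> \<tau> * real m ^ (k * mabs \<eta>)) \<longrightarrow>
     (\<forall>x. real m ^ (k * l) * \<bar>cascn m N a k h x\<bar> \<le> C1 * (H * rate r k + real m ^ (k * l) * \<tau>))"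
    using casc_contraction[OF r, of R] by (elim exE conjE)
  have "\<bar>Dl is (cascn m N a k f) x - Dl is (cascn m N a k f') x\<bar> \<le> C1 * (H1 + H2) * rate r k"
    if len: "length is = l" for k "is" x
  proof -
    define h where "h = (\<lambda>x. Dl is f x - Dl is f' x)"
    have sh: "csupp R h" unfolding csupp_def
    proof (intro allI impI, rule ccontr)
      fix x i assume "h x \<noteq> 0" "\<not> \<bar>x $ i\<bar> \<le> R"
      then have "Dl is f x = 0" "Dl is f' x = 0"
        using csupp_Dl[OF R(1), of "is"] csupp_Dl[OF R(2), of "is"] unfolding csupp_def by blast+
      then show False using \<open>h x \<noteq> 0\<close> by (simp add: h_def)
    qed
    have hb: "\<bar>h x\<bar> \<le> H1 + H2" for x
      using H1(2)[OF len, of x] H2(2)[OF len, of x] by (simp add: h_def)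
    have hm: "mom \<eta> (\<lambda>\<beta>. h (y + rvec \<beta>)) = 0" if \<eta>: "mabs \<eta> \<le> l" for y \<eta>
    proof -
      have "mom \<eta> (\<lambda>\<beta>. h (y + rvec \<beta>)) = lsum (\<lambda>\<alpha>. rmono \<eta> (rvec (- \<alpha>))) h y" by (rule mom_lsum)
      also have "\<dots> = lsum (\<lambda>\<alpha>. rmono \<eta> (rvec (- \<alpha>))) (Dl is f) y - lsum (\<lambda>\<alpha>. rmono \<eta> (rvec (- \<alpha>))) (Dl is f') y"
        unfolding h_def by (rule lsum_diff[OF csupp_Dl[OF R(1)] csupp_Dl[OF R(2)]])
      also have "\<dots> = 0"
        unfolding mom_lsum[symmetric] mom_test_function(1)[OF f len \<eta>] mom_test_function(1)[OF f' len \<eta>] by simp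
      finally show ?thesis .
    qed
    have "Dl is (cascn m N a k f) x - Dl is (cascn m N a k f') x = (real m ^ l) ^ k * cascn m N a k h x"
      using Dl_cascn[OF cf(1), of "is" m N a k] Dl_cascn[OF cf(2), of "is" m N a k] len
      unfolding h_def cascn_diff by (simp add: right_diff_distrib)
    then have "\<bar>Dl is (cascn m N a k f) x - Dl is (cascn m N a k f') x\<bar> = real m ^ (k * l) * \<bar>cascn m N a k h x\<bar>"
      by (simp add: abs_mult power_mult[symmetric] mult.commute)
    also have "\<dots> \<le> C1 * ((H1 + H2) * rate r k + real m ^ (k * l) * 0)"
      by (rule C1(2)[rule_format]) (use sh hb hm in auto)
    finally show ?thesis by simp
  qed
  then show ?thesis using C1(1) H1(1) H2(1) by (intro exI[of _ "C1 * (H1 + H2)"]) auto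
qed

text \<open>Derivatives of order \<open>l\<close> have summable increments; the common compact
  support carries this to lower orders, and uniform limits may be differentiated.\<close>

lemma refinable_limit:
  assumes r: "admissible r" and f: "test_function l f"
  shows "\<exists>\<phi> R C. R \<ge> 0 \<and> csupp R \<phi> \<and> Cdiff l \<phi> \<and> C \<ge> 0 \<and>
    (\<forall>k is x. length is \<le> l \<longrightarrow> \<bar>Dl is \<phi> x - Dl is (cascn m N a k f) x\<bar> \<le> C * (\<Sum>i. step_err r (i + k)))"
proof -
  obtain R where R: "R \<ge> real N" "csupp R f" using test_function_csupp[OF f] by blast
  have R0: "R \<ge> 0" using R(1) by linarith
  have cf: "Cdiff l f" by (rule test_functionD(2)[OF f])
  obtain C0 where C0: "C0 \<ge> 0" "\<And>k is x. length is = l \<Longrightarrow>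
     \<bar>Dl is (cascn m N a (Suc k) f) x - Dl is (cascn m N a k f) x\<bar> \<le> C0 * step_err r k"
    using cauchy_step[OF r f] by blast
  define C where "C = C0 * (2 * R + 2) ^ l"
  have C: "C \<ge> 0" using C0(1) R0 by (simp add: C_def)
  define u where "u js k = Dl js (cascn m N a k f)" for js k
  have cc: "Cdiff l (cascn m N a k f)" for k by (rule Cdiff_cascn[OF cf])
  have cs: "csupp R (cascn m N a k f)" for k by (rule csupp_cascn[OF m2 R])
  have step: "\<bar>u js (Suc k) x - u js k x\<bar> \<le> C * step_err r k" if len: "length js \<le> l" for js k x
  proof -
    define D where "D = (\<lambda>x. cascn m N a (Suc k) f x - cascn m N a k f x)"
    have cD: "Cdiff l D" unfolding D_def by (rule Cdiff_diff[OF cc cc])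
    have eq: "Dl js D = (\<lambda>x. u js (Suc k) x - u js k x)" if "length js \<le> l" for js
      unfolding D_def u_def by (rule Dl_diff[OF cc cc that])
    have "\<bar>Dl js D x\<bar> \<le> (C0 * step_err r k) * (2 * R + 2) ^ l"
    proof (rule compact_support_Dl_bound[OF cD R0 _ _ len])
      show "\<forall>i. \<bar>x $ i\<bar> \<le> R" if "D x \<noteq> 0" for x
        using that cs[of "Suc k"] cs[of k] unfolding D_def csupp_def by (metis diff_0_right)
      show "\<bar>Dl is D x\<bar> \<le> C0 * step_err r k" if "length is = l" for "is" x
        using C0(2)[OF that] that by (simp add: eq u_def)
      show "0 \<le> C0 * step_err r k" using C0(1) step_err_nonneg[OF r] by simp
    qed
    then show ?thesis using len by (simp add: eq C_def mult_ac)
  qed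
  have se: "summable (\<lambda>k. C * step_err r k)" by (intro summable_mult step_err_summable[OF r])
  have ex: "\<exists>L. (\<lambda>k. u js k x) \<longlonglongrightarrow> L" if "length js \<le> l" for js x
    by (rule telescoping_convergent[OF step[OF that] se])
  define F where "F js x = lim (\<lambda>k. u js k x)" for js x
  have F: "(\<lambda>k. u js k x) \<longlonglongrightarrow> F js x" if "length js \<le> l" for js x
    using ex[OF that, of x] unfolding F_def convergent_LIMSEQ_iff[symmetric] convergent_def by blast
  have bound: "\<bar>F js x - u js k x\<bar> \<le> C * (\<Sum>i. step_err r (i + k))" if "length js \<le> l" for js k x
  proof -
    have "\<bar>F js x - u js k x\<bar> \<le> (\<Sum>i. C * step_err r (i + k))"
      by (rule telescoping_bound[OF F[OF that] step[OF that] se])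
    also have "\<dots> = C * (\<Sum>i. step_err r (i + k))"
      by (rule suminf_mult) (rule summable_ignore_initial_segment[OF step_err_summable[OF r]])
    finally show ?thesis .
  qed
  have unif: "uniform_limit UNIV (\<lambda>k. u js k) (F js) sequentially" if "length js \<le> l" for js
  proof (rule uniform_limitI)
    fix e :: real assume "e > 0"
    have "(\<lambda>k. C * (\<Sum>i. step_err r (i + k))) \<longlonglongrightarrow> C * 0"
      by (intro tendsto_mult_left summable_tail_tendsto_0 step_err_summable[OF r])
    then have "\<forall>\<^sub>F k in sequentially. C * (\<Sum>i. step_err r (i + k)) < e"
      using \<open>e > 0\<close> by (intro order_tendstoD(2)) auto
    then show "\<forall>\<^sub>F k in sequentially. \<forall>x\<in>UNIV. dist (u js k x) (F js x) < e"
    proof eventually_elim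
      case (elim k)
      then show ?case using bound[OF that, of _ k] by (auto simp: dist_real_def abs_minus_commute intro: le_less_trans)
    qed
  qed
  have cont: "continuous_on UNIV (F js)" if "length js \<le> l" for js
  proof (rule uniform_limit_theorem[OF _ unif[OF that]])
    show "\<forall>\<^sub>F k in sequentially. continuous_on UNIV (u js k)"
      using cc that unfolding u_def by (simp add: Cdiff_iff_Dl)
  qed simp
  have part: "has_partial i (F js) (F (i # js))" if "length js < l" for js i
  proof (rule has_partial_uniform_limit)
    show "has_partial i (u js k) (u (i # js) k)" for k unfolding u_def by (rule Dl_has_partial[OF cc that])
    show "uniform_limit UNIV (u (i # js)) (F (i # js)) sequentially" by (rule unif) (use that in simp)
    show "(\<lambda>k. u js k x) \<longlonglongrightarrow> F js x" for x by (rule F) (use that in simp)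
  qed
  note CD = Cdiff_DlI[of l F, OF cont part]
  have "csupp R (F [])" unfolding csupp_def
  proof (intro allI impI, rule ccontr)
    fix x i assume "F [] x \<noteq> 0" "\<not> \<bar>x $ i\<bar> \<le> R"
    then have "u [] k x = 0" for k using cs[of k] unfolding u_def csupp_def by auto
    then have "F [] x = 0" using F[of "[]" x] LIMSEQ_unique[OF tendsto_const] by fastforce
    then show False using \<open>F [] x \<noteq> 0\<close> by simp
  qed
  moreover have "\<bar>Dl is (F []) x - Dl is (cascn m N a k f) x\<bar> \<le> C * (\<Sum>i. step_err r (i + k))" if "length is \<le> l" for k "is" x
    using bound[OF that, of x k] CD(2)[OF _ _ that] by (simp add: u_def)
  ultimately show ?thesis using R0 CD(1) C by (intro exI[of _ "F []"] exI[of _ R] exI[of _ C]) auto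
qed

end

section \<open>Limit functions\<close>

lemma Cnorm_le:
  assumes "\<And>is x. length is \<le> l \<Longrightarrow> \<bar>Dl is f x\<bar> \<le> B"
  shows "Cnorm l f \<le> ereal B"
  unfolding Cnorm_def
proof (rule SUP_least)
  fix \<mu> :: "nat ^ 'a" assume "\<mu> \<in> {\<mu>. mabs \<mu> \<le> l}"
  moreover obtain "is" where "mderiv \<mu> f = Dl is f" "length is = mabs \<mu>" using mderiv_Dl[of \<mu> f] by blast
  ultimately show "supnorm (mderiv \<mu> f) \<le> ereal B" using assms by (auto intro!: supnorm_le)
qed

lemma le_Cnorm: "ereal \<bar>f x\<bar> \<le> Cnorm l f"
proof -
  obtain "is" where "mderiv 0 f = Dl is f" "length is = mabs (0 :: nat ^ 'a)" using mderiv_Dl[of 0 f] by blast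
  then have "mderiv 0 f = f" by simp
  then have "ereal \<bar>f x\<bar> \<le> supnorm (mderiv 0 f)" using le_supnorm[of f x] by simp
  also have "\<dots> \<le> Cnorm l f" unfolding Cnorm_def by (rule SUP_upper) simp
  finally show ?thesis .
qed

lemma csupp_diff: "csupp R f \<Longrightarrow> csupp R g \<Longrightarrow> csupp R (\<lambda>x. f x - g x)"
  unfolding csupp_def by (metis diff_0_right)

text \<open>The largest coordinate in the support of the iterated masks, starting from a unit
  impulse.\<close>

primrec reach :: "nat \<Rightarrow> nat \<Rightarrow> nat \<Rightarrow> nat" where
  "reach m N 0 = 0"
| "reach m N (Suc k) = m * reach m N k + N"

lemma reach_bound: "m \<ge> 2 \<Longrightarrow> reach m N k + N \<le> N * m ^ k"
proof (induction k)
  case (Suc k)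
  have "reach m N (Suc k) + N = m * reach m N k + 2 * N" by simp
  also have "\<dots> \<le> m * (reach m N k + N)" using Suc.prems by (simp add: distrib_left)
  also have "\<dots> \<le> m * (N * m ^ k)" using Suc by (intro mult_left_mono) auto
  finally show ?case by (simp add: mult_ac)
qed simp

context subdivision_scheme
begin

lemma lsum_subdiv_iter:
  assumes "R \<ge> real N"
  shows "csupp R h \<Longrightarrow> lsum (subdiv_iter m a k c) h (real m ^ k *\<^sub>R x) = lsum c (cascn m N a k h) x"
proof (induction k arbitrary: h)
  case (Suc k)
  have "lsum (subdiv_iter m a (Suc k) c) h (real m ^ Suc k *\<^sub>R x) =
      lsum (subdiv m (a (Suc k)) (subdiv_iter m a k c)) h (real m *\<^sub>R (real m ^ k *\<^sub>R x))" by simp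
  also have "\<dots> = lsum (subdiv_iter m a k c) (casc m N (a (Suc k)) h) (real m ^ k *\<^sub>R x)"
    by (rule lsum_subdiv[OF m2 mask Suc.prems]) simp
  also have "\<dots> = lsum c (cascn m N a (Suc k) h) x"
    using Suc.IH[OF csupp_casc[OF m2 Suc.prems assms]] by simp
  finally show ?case .
qed simp

abbreviation dirac :: "int ^ 's \<Rightarrow> real" where "dirac \<equiv> \<lambda>\<alpha>. if \<alpha> = 0 then 1 else 0"

lemma lsum_dirac: "lsum dirac h x = h x"
proof -
  have "lsum dirac h x = (\<Sum>\<alpha>\<in>{0}. dirac \<alpha> * h (x - rvec \<alpha>))"
    unfolding lsum_def by (rule infsum_finite_support) auto
  then show ?thesis by (simp add: rvec_simps)
qed

text \<open>Each step multiplies the sum of the coefficients by the sum of the mask, which the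
  normalization at 1 fixes.\<close>

lemma subdiv_iter_dirac:
  "(\<forall>\<alpha>. \<alpha> \<notin> mbox (reach m N k) \<longrightarrow> subdiv_iter m a k dirac \<alpha> = 0) \<and>
   (\<Sum>\<alpha>\<in>mbox (reach m N k). subdiv_iter m a k dirac \<alpha>) = (real m ^ CARD('s)) ^ k"
proof (induction k)
  case 0
  have "mbox 0 = {0 :: int ^ 's}" by (auto simp: mbox_def vec_eq_iff)
  then show ?case by auto
next
  case (Suc k)
  define A where "A = subdiv_iter m a k dirac"
  define B where "B = reach m N k"
  have A: "\<And>\<beta>. \<beta> \<notin> mbox B \<Longrightarrow> A \<beta> = 0" "(\<Sum>\<beta>\<in>mbox B. A \<beta>) = (real m ^ CARD('s)) ^ k"
    using Suc.IH by (auto simp: A_def B_def)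
  have mk: "is_mask N (a (Suc k))" by (rule mask) simp
  have sub: "subdiv m (a (Suc k)) A \<alpha> = (\<Sum>\<beta>\<in>mbox B. a (Suc k) (\<alpha> - int m *s \<beta>) * A \<beta>)" for \<alpha>
    unfolding subdiv_def by (rule infsum_finite_support) (use A in auto)
  have inb: "\<gamma> + int m *s \<beta> \<in> mbox (m * B + N)" if "\<gamma> \<in> mbox N" "\<beta> \<in> mbox B" for \<gamma> \<beta> :: "int ^ 's"
    unfolding mbox_def
  proof (intro CollectI allI)
    fix i
    have "0 \<le> \<gamma> $ i" "\<gamma> $ i \<le> int N" "0 \<le> \<beta> $ i" "\<beta> $ i \<le> int B" using that by (auto simp: mbox_def)
    moreover from this have "int m * \<beta> $ i \<le> int m * int B" by (intro mult_left_mono) auto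
    ultimately show "(\<gamma> + int m *s \<beta>) $ i \<in> {0..int (m * B + N)}" by simp
  qed
  have "subdiv m (a (Suc k)) A \<alpha> = 0" if "\<alpha> \<notin> mbox (m * B + N)" for \<alpha>
    unfolding sub
  proof (intro sum.neutral ballI)
    fix \<beta> :: "int ^ 's" assume "\<beta> \<in> mbox B"
    then have "\<alpha> - int m *s \<beta> \<notin> mbox N" using inb[of "\<alpha> - int m *s \<beta>" \<beta>] that by auto
    then show "a (Suc k) (\<alpha> - int m *s \<beta>) * A \<beta> = 0" using is_mask_outside[OF mk] by simp
  qed
  moreover have "(\<Sum>\<alpha>\<in>mbox (m * B + N). subdiv m (a (Suc k)) A \<alpha>) = (real m ^ CARD('s)) ^ Suc k"
  proof -
    have inner: "(\<Sum>\<alpha>\<in>mbox (m * B + N). a (Suc k) (\<alpha> - int m *s \<beta>)) = real m ^ CARD('s)" if b: "\<beta> \<in> mbox B" for \<beta> :: "int ^ 's"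
    proof -
      have "(\<Sum>\<alpha>\<in>mbox (m * B + N). a (Suc k) (\<alpha> - int m *s \<beta>)) = (\<Sum>\<gamma>\<in>mbox N. a (Suc k) \<gamma>)"
      proof (rule sum.reindex_bij_witness_not_neutral[of "{\<alpha>\<in>mbox (m * B + N). a (Suc k) (\<alpha> - int m *s \<beta>) = 0}"
            "{\<gamma>\<in>mbox N. a (Suc k) \<gamma> = 0}" _ "\<lambda>\<gamma>. \<gamma> + int m *s \<beta>" "\<lambda>\<alpha>. \<alpha> - int m *s \<beta>"])
      qed (use inb[OF _ b] is_mask_outside[OF mk] in auto)
      then show ?thesis using sum_mask[of "Suc k"] by simp
    qed
    have "(\<Sum>\<alpha>\<in>mbox (m * B + N). subdiv m (a (Suc k)) A \<alpha>) =
        (\<Sum>\<beta>\<in>mbox B. \<Sum>\<alpha>\<in>mbox (m * B + N). a (Suc k) (\<alpha> - int m *s \<beta>) * A \<beta>)"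
      unfolding sub by (rule sum.swap)
    also have "\<dots> = (\<Sum>\<beta>\<in>mbox B. real m ^ CARD('s) * A \<beta>)"
      unfolding sum_distrib_right[symmetric] using inner by (intro sum.cong) auto
    also have "\<dots> = (real m ^ CARD('s)) ^ Suc k" unfolding sum_distrib_left[symmetric] A(2) by simp
    finally show ?thesis .
  qed
  ultimately show ?case by (simp add: A_def B_def)
qed

end

section \<open>The basic limit function and its regularity\<close>

context contractive_scheme
begin

text \<open>The basic limit function: it attracts the cascade from every test function, with one
  error sequence for all derivatives up to order \<open>l\<close>. Radii from \<open>N\<close> on
  are preserved by the cascade.\<close>

definition refinable :: "(real ^ 's \<Rightarrow> real) \<Rightarrow> real \<Rightarrow> bool" where
  "refinable \<phi> R \<longleftrightarrow> R \<ge> real N \<and> csupp R \<phi> \<and> Cdiff l \<phi> \<and>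
     (\<forall>f. test_function l f \<longrightarrow> (\<exists>\<epsilon>. \<epsilon> \<longlonglongrightarrow> 0 \<and>
       (\<forall>k is x. length is \<le> l \<longrightarrow> \<bar>Dl is \<phi> x - Dl is (cascn m N a k f) x\<bar> \<le> \<epsilon> k)))"

text \<open>The limit is built from one concrete test function; \<open>test_compare\<close> and the
  common support transfer the convergence to every other one.\<close>

lemma exists_refinable: "\<exists>\<phi> R. refinable \<phi> R"
proof -
  obtain r where r: "admissible r" using exists_admissible by blast
  define f0 :: "real ^ 's \<Rightarrow> real" where "f0 = test_fn l"
  have f0: "test_function l f0" unfolding f0_def by (rule test_function_test_fn)
  obtain \<phi> R C where \<phi>: "R \<ge> 0" "csupp R \<phi>" "Cdiff l \<phi>" "C \<ge> 0"
    "\<And>k is x. length is \<le> l \<Longrightarrow> \<bar>Dl is \<phi> x - Dl is (cascn m N a k f0) x\<bar> \<le> C * (\<Sum>i. step_err r (i + k))"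
    using refinable_limit[OF r f0] by blast
  have "\<exists>\<epsilon>. \<epsilon> \<longlonglongrightarrow> 0 \<and> (\<forall>k is x. length is \<le> l \<longrightarrow> \<bar>Dl is \<phi> x - Dl is (cascn m N a k f) x\<bar> \<le> \<epsilon> k)"
    if f: "test_function l f" for f
  proof -
    obtain R1 where R1: "R1 \<ge> real N" "csupp R1 f" using test_function_csupp[OF f] by blast
    obtain R2 where R2: "R2 \<ge> real N" "csupp R2 f0" using test_function_csupp[OF f0] by blast
    define R' where "R' = max R1 R2"
    have R': "R' \<ge> real N" "csupp R' f" "csupp R' f0"
      using R1(1) csupp_mono[OF R1(2), of R'] csupp_mono[OF R2(2), of R'] by (auto simp: R'_def)
    have R'0: "R' \<ge> 0" using R'(1) by linarith
    have c: "Cdiff l (cascn m N a k f0)" "Cdiff l (cascn m N a k f)" for k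
      using Cdiff_cascn test_functionD(2)[OF f] test_functionD(2)[OF f0] by blast+
    obtain C' where C': "C' \<ge> 0" "\<And>k is x. length is = l \<Longrightarrow>
        \<bar>Dl is (cascn m N a k f0) x - Dl is (cascn m N a k f) x\<bar> \<le> C' * rate r k"
      using test_compare[OF r f0 f] by blast
    have cmp: "\<bar>Dl is (cascn m N a k f0) x - Dl is (cascn m N a k f) x\<bar> \<le> C' * rate r k * (2 * R' + 2) ^ l"
      if len: "length is \<le> l" for k "is" x
    proof -
      define D where "D = (\<lambda>x. cascn m N a k f0 x - cascn m N a k f x)"
      have D: "Dl js D = (\<lambda>x. Dl js (cascn m N a k f0) x - Dl js (cascn m N a k f) x)" if "length js \<le> l" for js
        unfolding D_def by (rule Dl_diff[OF c that])
      have sD: "csupp R' D" unfolding D_def by (intro csupp_diff csupp_cascn[OF m2 R'(1)] R')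
      have "\<bar>Dl is D x\<bar> \<le> (C' * rate r k) * (2 * R' + 2) ^ l"
      proof (rule compact_support_Dl_bound[OF _ R'0 _ _ len])
        show "Cdiff l D" unfolding D_def by (rule Cdiff_diff[OF c])
        show "\<forall>i. \<bar>x $ i\<bar> \<le> R'" if "D x \<noteq> 0" for x using sD that by (auto simp: csupp_def)
        show "\<bar>Dl is D x\<bar> \<le> C' * rate r k" if "length is = l" for "is" x
          using C'(2)[OF that] that by (simp add: D)
        show "0 \<le> C' * rate r k" using C'(1) rate_nonneg[OF r] by simp
      qed
      then show ?thesis using len by (simp add: D)
    qed
    define \<epsilon> where "\<epsilon> k = C * (\<Sum>i. step_err r (i + k)) + C' * rate r k * (2 * R' + 2) ^ l" for k
    have "\<epsilon> \<longlonglongrightarrow> C * 0 + C' * 0 * (2 * R' + 2) ^ l"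
      unfolding \<epsilon>_def
      by (intro tendsto_intros summable_tail_tendsto_0 step_err_summable[OF r] summable_LIMSEQ_zero rate_summable[OF r])
    moreover have "\<bar>Dl is \<phi> x - Dl is (cascn m N a k f) x\<bar> \<le> \<epsilon> k" if "length is \<le> l" for k "is" x
      using \<phi>(5)[OF that, of x k] cmp[OF that, of k x] unfolding \<epsilon>_def by linarith
    ultimately show ?thesis by (intro exI[of _ \<epsilon>]) auto
  qed
  moreover have "csupp (max R (real N)) \<phi>" by (rule csupp_mono[OF \<phi>(2)]) simp
  ultimately have "refinable \<phi> (max R (real N))" using \<phi>(3) unfolding refinable_def by auto
  then show ?thesis by blast
qed

lemma bounded_rangeD: "bounded (range c) \<Longrightarrow> \<exists>B\<ge>0. \<forall>\<alpha>. \<bar>c \<alpha> :: real\<bar> \<le> B"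
  by (metis bounded_iff order_trans abs_ge_zero range_eqI real_norm_def)

lemma limit_function_lsum:
  assumes \<phi>: "refinable \<phi> R" and c: "bounded (range c)"
  shows "is_limit_function l m a c (lsum c \<phi>)"
  unfolding is_limit_function_def lsum_def[symmetric]
proof (intro conjI allI impI)
  have R: "R \<ge> real N" "csupp R \<phi>" "Cdiff l \<phi>" using \<phi> by (auto simp: refinable_def)
  show "Cdiff l (lsum c \<phi>)" by (rule Cdiff_lsum[OF R(2,3)])
  fix f :: "real ^ 's \<Rightarrow> real" assume f: "test_function l f"
  obtain R1 where R1: "R1 \<ge> real N" "csupp R1 f" using test_function_csupp[OF f] by blast
  define R' where "R' = max R R1"
  have R': "R' \<ge> real N" "csupp R' f" "csupp R' \<phi>"
    using R1(1) csupp_mono[OF R1(2), of R'] csupp_mono[OF R(2), of R'] by (auto simp: R'_def)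
  have R'0: "R' \<ge> 0" using R'(1) by linarith
  obtain B where B: "B \<ge> 0" "\<And>\<alpha>. \<bar>c \<alpha>\<bar> \<le> B" using bounded_rangeD[OF c] by blast
  obtain \<epsilon> where \<epsilon>: "\<epsilon> \<longlonglongrightarrow> 0" "\<And>k is x. length is \<le> l \<Longrightarrow> \<bar>Dl is \<phi> x - Dl is (cascn m N a k f) x\<bar> \<le> \<epsilon> k"
    using \<phi> f unfolding refinable_def by blast
  have bound: "Cnorm l (\<lambda>x. lsum c \<phi> x - lsum (subdiv_iter m a k c) f (real m ^ k *\<^sub>R x)) \<le>
     ereal ((2 * R' + 1) ^ CARD('s) * (B * \<epsilon> k))" for k
  proof (rule Cnorm_le)
    fix "is" :: "'s list" and x assume len: "length is \<le> l"
    define D where "D = (\<lambda>x. \<phi> x - cascn m N a k f x)"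
    have cf: "Cdiff l (cascn m N a k f)" by (rule Cdiff_cascn[OF test_functionD(2)[OF f]])
    have sf: "csupp R' (cascn m N a k f)" by (rule csupp_cascn[OF m2 R'(1,2)])
    have sD: "csupp R' D" unfolding D_def by (rule csupp_diff[OF R'(3) sf])
    have cD: "Cdiff l D" unfolding D_def by (rule Cdiff_diff[OF R(3) cf])
    have "(\<lambda>x. lsum c \<phi> x - lsum (subdiv_iter m a k c) f (real m ^ k *\<^sub>R x)) = lsum c D"
      unfolding lsum_subdiv_iter[OF R'(1,2)] D_def by (rule ext) (rule lsum_diff[OF R'(3) sf, symmetric])
    then have "Dl is (\<lambda>x. lsum c \<phi> x - lsum (subdiv_iter m a k c) f (real m ^ k *\<^sub>R x)) x = lsum c (Dl is D) x"
      using Dl_lsum[OF sD cD len] by simp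
    also have "\<bar>\<dots>\<bar> \<le> (2 * R' + 1) ^ CARD('s) * (B * \<epsilon> k)"
    proof (rule lsum_bound[OF csupp_Dl[OF sD] R'0])
      show "\<bar>c \<alpha>\<bar> \<le> B" for \<alpha> by (rule B(2))
      show "\<bar>Dl is D x\<bar> \<le> \<epsilon> k" for x
        unfolding D_def Dl_diff[OF R(3) cf len] by (rule \<epsilon>(2)[OF len])
    qed
    finally show "\<bar>Dl is (\<lambda>x. lsum c \<phi> x - lsum (subdiv_iter m a k c) f (real m ^ k *\<^sub>R x)) x\<bar>
       \<le> (2 * R' + 1) ^ CARD('s) * (B * \<epsilon> k)" .
  qed
  have "(\<lambda>k. (2 * R' + 1) ^ CARD('s) * (B * \<epsilon> k)) \<longlonglongrightarrow> (2 * R' + 1) ^ CARD('s) * (B * 0)"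
    by (intro tendsto_mult_left \<epsilon>(1))
  then have up: "(\<lambda>k. ereal ((2 * R' + 1) ^ CARD('s) * (B * \<epsilon> k))) \<longlonglongrightarrow> 0"
    by (simp add: zero_ereal_def)
  have low: "0 \<le> Cnorm l g" for g :: "real ^ 's \<Rightarrow> real"
    by (rule order_trans[OF _ le_Cnorm[of g 0]]) simp
  show "(\<lambda>k. Cnorm l (\<lambda>x. lsum c \<phi> x - lsum (subdiv_iter m a k c) f (real m ^ k *\<^sub>R x))) \<longlonglongrightarrow> 0"
    by (rule tendsto_sandwich[OF _ _ tendsto_const up]) (auto simp: low bound)
qed

text \<open>\<open>Cnorm\<close> dominates point values, so convergence for the single test function
  \<open>test_fn l\<close> already determines \<open>g\<close>.\<close>

lemma limit_function_unique:
  assumes "is_limit_function l m a c g" "is_limit_function l m a c g'"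
  shows "g = g'"
proof
  fix x
  define S where "S k = lsum (subdiv_iter m a k c) (test_fn l) (real m ^ k *\<^sub>R x)" for k
  have "S \<longlonglongrightarrow> g x" if "is_limit_function l m a c g" for g
  proof -
    have "(\<lambda>k. Cnorm l (\<lambda>x. g x - lsum (subdiv_iter m a k c) (test_fn l) (real m ^ k *\<^sub>R x))) \<longlonglongrightarrow> 0"
      using that test_function_test_fn unfolding is_limit_function_def lsum_def by blast
    note lim = this
    have "ereal \<bar>g x - S k\<bar> \<le> Cnorm l (\<lambda>x. g x - lsum (subdiv_iter m a k c) (test_fn l) (real m ^ k *\<^sub>R x))" for k
      unfolding S_def by (rule le_Cnorm)
    then have "(\<lambda>k. ereal \<bar>g x - S k\<bar>) \<longlonglongrightarrow> 0"
      by (intro tendsto_sandwich[OF _ _ tendsto_const lim] always_eventually allI) simp_all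
    then have "(\<lambda>k. \<bar>g x - S k\<bar>) \<longlonglongrightarrow> 0" by (simp add: zero_ereal_def)
    then have "(\<lambda>k. g x - S k) \<longlonglongrightarrow> 0" by (rule tendsto_rabs_zero_cancel)
    then have "(\<lambda>k. g x - (g x - S k)) \<longlonglongrightarrow> g x - 0" by (intro tendsto_intros)
    then show ?thesis by simp
  qed
  from this[OF assms(1)] this[OF assms(2)] show "g x = g' x" by (rule LIMSEQ_unique)
qed

lemma limit_functions_eq:
  assumes \<phi>: "refinable \<phi> R"
  shows "limit_functions l m a = {lsum c \<phi> | c. bounded (range c)}"
  unfolding limit_functions_def using limit_function_lsum[OF \<phi>] limit_function_unique by blast

text \<open>If \<open>\<phi>\<close> vanished, evaluating the interpolating \<open>test_fn l\<close>
  at scaled lattice points would force the coefficients generated by \<open>dirac\<close> to 0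
  uniformly. But level \<open>k\<close> has total mass \<open>m ^ (k * CARD('s))\<close> on at most
  \<open>((N + 1) * m ^ k) ^ CARD('s)\<close> indices.\<close>

lemma refinable_nonzero:
  assumes \<phi>: "refinable \<phi> R"
  shows "\<exists>x. \<phi> x \<noteq> 0"
proof (rule ccontr)
  assume "\<not> ?thesis"
  then have z: "\<phi> x = 0" for x by simp
  define f0 :: "real ^ 's \<Rightarrow> real" where "f0 = test_fn l"
  have f0: "test_function l f0" unfolding f0_def by (rule test_function_test_fn)
  obtain R1 where R1: "R1 \<ge> real N" "csupp R1 f0" using test_function_csupp[OF f0] by blast
  obtain \<epsilon> where \<epsilon>: "\<epsilon> \<longlonglongrightarrow> 0" "\<And>k is x. length is \<le> l \<Longrightarrow> \<bar>Dl is \<phi> x - Dl is (cascn m N a k f0) x\<bar> \<le> \<epsilon> k"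
    using \<phi> f0 unfolding refinable_def by blast
  have small: "\<bar>subdiv_iter m a k dirac \<alpha>\<bar> \<le> \<epsilon> k" for k \<alpha>
  proof -
    define x where "x = (1 / real m ^ k) *\<^sub>R rvec \<alpha>"
    have "real m ^ k *\<^sub>R x = rvec \<alpha>" using m2 by (simp add: x_def)
    then have "subdiv_iter m a k dirac \<alpha> = lsum (subdiv_iter m a k dirac) f0 (real m ^ k *\<^sub>R x)"
      by (simp add: f0_def lsum_test_fn_lattice)
    also have "\<dots> = cascn m N a k f0 x" by (simp add: lsum_subdiv_iter[OF R1] lsum_dirac)
    finally show ?thesis using \<epsilon>(2)[of "[]" x k] z by simp
  qed
  have "1 \<le> (real N + 1) ^ CARD('s) * \<epsilon> k" for k
  proof -
    have e0: "\<epsilon> k \<ge> 0" using order_trans[OF abs_ge_zero small] .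
    have card: "real (card (mbox n :: (int ^ 's) set)) = (real n + 1) ^ CARD('s)" for n
      unfolding mbox_def by (subst card_vec_set) (simp add: nat_add_distrib add.commute)
    have "(real m ^ CARD('s)) ^ k = \<bar>\<Sum>\<alpha>\<in>mbox (reach m N k). subdiv_iter m a k dirac \<alpha>\<bar>"
      using subdiv_iter_dirac[of k] by simp
    also have "\<dots> \<le> (\<Sum>\<alpha>\<in>(mbox (reach m N k) :: (int ^ 's) set). \<epsilon> k)"
      by (rule order_trans[OF sum_abs sum_mono]) (rule small)
    also have "\<dots> = (real (reach m N k) + 1) ^ CARD('s) * \<epsilon> k" by (simp add: card)
    also have "\<dots> \<le> ((real N + 1) * real m ^ k) ^ CARD('s) * \<epsilon> k"
    proof (intro mult_right_mono power_mono e0)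
      have "real (reach m N k) \<le> real N * real m ^ k"
        using reach_bound[OF m2, of N k] by (metis add_leD1 of_nat_le_iff of_nat_mult of_nat_power)
      moreover have "1 \<le> real m ^ k" using m2 by (intro one_le_power) auto
      ultimately show "real (reach m N k) + 1 \<le> (real N + 1) * real m ^ k" by (simp add: distrib_right)
    qed simp
    also have "\<dots> = (real m ^ CARD('s)) ^ k * ((real N + 1) ^ CARD('s) * \<epsilon> k)"
      by (simp add: power_mult_distrib power_mult[symmetric] mult.commute)
    finally show ?thesis using m2 by (simp add: mult_le_cancel_left1)
  qed
  note ge = this
  have "(\<lambda>k. (real N + 1) ^ CARD('s) * \<epsilon> k) \<longlonglongrightarrow> (real N + 1) ^ CARD('s) * 0"
    by (intro tendsto_mult_left \<epsilon>(1))
  from LIMSEQ_le_const[OF this] ge have "1 \<le> (real N + 1) ^ CARD('s) * (0::real)" by blast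
  then show False by simp
qed

text \<open>Points at distance about \<open>1 / m ^ k\<close> are compared through the iterate of
  level \<open>k\<close>: approximation at either point and the two-point estimate each cost a
  multiple of \<open>q ^ k\<close>, which is comparable to the distance to the power \<nu>.\<close>

lemma refinable_hoelder:
  assumes \<phi>: "refinable \<phi> R" and \<nu>: "\<nu> > 0"
    and q: "q = (1 / real m) powr \<nu>" and rho': "real m ^ l * rhoA l m N a < q"
    and D: "D \<ge> 0" "\<And>k. \<sigma> k \<le> D * q ^ k"
  shows "\<exists>C\<ge>0. \<forall>is x y. length is = l \<longrightarrow> norm (x - y) \<le> 1 \<longrightarrow> \<bar>Dl is \<phi> x - Dl is \<phi> y\<bar> \<le> C * norm (x - y) powr \<nu>"
proof -
  have q01: "0 < q" "q < 1" unfolding q using m2 \<nu> powr_less_mono2[of \<nu> "1 / real m" 1] by auto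
  \<comment> \<open>The midpoint puts \<open>\<theta> = m ^ l * r\<close> strictly below
    \<open>q\<close>, so that forcing of size \<open>q ^ k\<close> dominates the homogeneous
    decay.\<close>
  define r where "r = (rhoA l m N a + q / real m ^ l) / 2"
  have ml: "real m ^ l > 0" using m2 by simp
  have rr: "rhoA l m N a < q / real m ^ l" using rho' ml by (simp add: less_divide_eq mult.commute)
  define \<theta> where "\<theta> = real m ^ l * r"
  have th: "\<theta> < q" unfolding \<theta>_def r_def using rho' ml by (simp add: field_simps)
  have r: "admissible r" unfolding admissible_def \<theta>_def[symmetric] using rr th q01 by (simp add: r_def)
  have \<theta>0: "\<theta> \<ge> 0" unfolding \<theta>_def by (rule admissibleD(1)[OF r])
  \<comment> \<open>Solves the inequality \<open>\<theta> * C3 + D * q \<le> q * C3\<close> of the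
    induction step.\<close>
  define C3 where "C3 = 1 + D * q / (q - \<theta>)"
  have C3: "C3 \<ge> 1" using D(1) q01 th by (simp add: C3_def)
  have C3': "\<theta> * C3 + D * q \<le> q * C3"
  proof -
    have "(q - \<theta>) * C3 = (q - \<theta>) + D * q" using th by (simp add: C3_def distrib_left)
    then have "(q - \<theta>) * C3 \<ge> D * q" using th by simp
    then show ?thesis by (simp add: left_diff_distrib)
  qed
  have rate: "rate r k \<le> C3 * q ^ k" for k
  proof (induction k)
    case 0 then show ?case using C3 by (simp add: rate_def)
  next
    case (Suc k)
    have "rate r (Suc k) = \<theta> * rate r k + \<sigma> (Suc k)" by (simp add: rate_def \<theta>_def)
    also have "\<dots> \<le> \<theta> * (C3 * q ^ k) + D * q ^ Suc k" by (intro add_mono mult_left_mono Suc D \<theta>0)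
    also have "\<dots> = (\<theta> * C3 + D * q) * q ^ k" by (simp add: algebra_simps)
    also have "\<dots> \<le> (q * C3) * q ^ k" using C3' q01 by (intro mult_right_mono) auto
    finally show ?case by (simp add: mult_ac)
  qed
  have se: "step_err r k \<le> (C3 + D) * q ^ k" for k
  proof -
    have "D * q ^ Suc k \<le> D * q ^ k" using D(1) q01 by (intro mult_left_mono power_decreasing) auto
    then show ?thesis using rate[of k] D(2)[of "Suc k"] by (simp add: step_err_def distrib_right)
  qed
  define f0 :: "real ^ 's \<Rightarrow> real" where "f0 = test_fn l"
  have f0: "test_function l f0" unfolding f0_def by (rule test_function_test_fn)
  have cf: "Cdiff l f0" by (rule test_functionD(2)[OF f0])
  obtain R1 where R1: "R1 \<ge> real N" "csupp R1 f0" using test_function_csupp[OF f0] by blast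
  obtain \<epsilon> where \<epsilon>: "\<epsilon> \<longlonglongrightarrow> 0" "\<And>k is x. length is \<le> l \<Longrightarrow> \<bar>Dl is \<phi> x - Dl is (cascn m N a k f0) x\<bar> \<le> \<epsilon> k"
    using \<phi> f0 unfolding refinable_def by blast
  obtain C0 where C0: "C0 \<ge> 0" "\<And>k is x. length is = l \<Longrightarrow>
     \<bar>Dl is (cascn m N a (Suc k) f0) x - Dl is (cascn m N a k f0) x\<bar> \<le> C0 * step_err r k"
    using cauchy_step[OF r f0] by blast
  define C4 where "C4 = C0 * (C3 + D) / (1 - q)"
  have C4: "C4 \<ge> 0" using C0(1) C3 D(1) q01 by (simp add: C4_def)
  have approx: "\<bar>Dl is \<phi> x - Dl is (cascn m N a k f0) x\<bar> \<le> C4 * q ^ k" if len: "length is = l" for "is" x k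
  proof -
    have lim: "(\<lambda>k. Dl is (cascn m N a k f0) x) \<longlonglongrightarrow> Dl is \<phi> x"
    proof (rule LIM_zero_cancel, rule Lim_null_comparison[OF _ \<epsilon>(1)])
      show "\<forall>\<^sub>F k in sequentially. norm (Dl is (cascn m N a k f0) x - Dl is \<phi> x) \<le> \<epsilon> k"
        using \<epsilon>(2)[of "is" x] len by (intro always_eventually) (simp add: abs_minus_commute)
    qed
    have "summable (\<lambda>k. C0 * (C3 + D) * q ^ k)" using q01 by (intro summable_mult summable_geometric) auto
    note sm = this
    have "\<bar>Dl is (cascn m N a (Suc k) f0) x - Dl is (cascn m N a k f0) x\<bar> \<le> C0 * (C3 + D) * q ^ k" for k
      using order_trans[OF C0(2)[OF len, of k x] mult_left_mono[OF se[of k] C0(1)]] by (simp add: mult.assoc)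
    from telescoping_bound[OF lim this sm, of k]
    have "\<bar>Dl is \<phi> x - Dl is (cascn m N a k f0) x\<bar> \<le> (\<Sum>i. C0 * (C3 + D) * q ^ (i + k))" .
    also have "\<dots> = (\<Sum>i. (C0 * (C3 + D) * q ^ k) * q ^ i)" by (simp add: power_add mult_ac)
    also have "\<dots> = (C0 * (C3 + D) * q ^ k) * (1 / (1 - q))"
      using q01 by (subst suminf_mult) (auto simp: suminf_geometric summable_geometric)
    finally show ?thesis by (simp add: C4_def)
  qed
  obtain H0 where H0: "H0 \<ge> 0" "\<And>is x. length is = l \<Longrightarrow> \<bar>Dl is f0 x\<bar> \<le> H0"
    using Dl_bounded[OF R1(2) cf] by blast
  obtain C5 where C5: "C5 \<ge> 0" "\<forall>k h H x x'. csupp R1 h \<longrightarrow> (\<forall>x. \<bar>h x\<bar> \<le> H) \<longrightarrow>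
     (\<forall>y y' \<eta>. mabs \<eta> \<le> l \<longrightarrow> mom \<eta> (\<lambda>\<beta>. h (y + rvec \<beta>)) = mom \<eta> (\<lambda>\<beta>. h (y' + rvec \<beta>))) \<longrightarrow>
     (\<forall>i. real m ^ k * \<bar>(x - x') $ i\<bar> \<le> 1) \<longrightarrow>
     real m ^ (k * l) * \<bar>cascn m N a k h x - cascn m N a k h x'\<bar> \<le> C5 * (H * rate r k)"
    using casc_two_point[OF r, of R1] by (elim exE conjE)
  define C6 where "C6 = C5 * H0 * C3"
  have C6: "C6 \<ge> 0" using C5(1) H0(1) C3 by (simp add: C6_def)
  have two: "\<bar>Dl is (cascn m N a k f0) x - Dl is (cascn m N a k f0) y\<bar> \<le> C6 * q ^ k"
    if len: "length is = l" and close: "\<forall>i. real m ^ k * \<bar>(x - y) $ i\<bar> \<le> 1" for "is" k x y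
  proof -
    have "Dl is (cascn m N a k f0) x - Dl is (cascn m N a k f0) y =
        (real m ^ l) ^ k * (cascn m N a k (Dl is f0) x - cascn m N a k (Dl is f0) y)"
      using Dl_cascn[OF cf, of "is" m N a k] len by (simp add: right_diff_distrib)
    then have "\<bar>Dl is (cascn m N a k f0) x - Dl is (cascn m N a k f0) y\<bar> =
        real m ^ (k * l) * \<bar>cascn m N a k (Dl is f0) x - cascn m N a k (Dl is f0) y\<bar>"
      by (simp add: abs_mult power_mult[symmetric] mult.commute)
    also have "\<dots> \<le> C5 * (H0 * rate r k)"
    proof (rule C5(2)[rule_format])
      show "csupp R1 (Dl is f0)" by (rule csupp_Dl[OF R1(2)])
      show "\<bar>Dl is f0 x\<bar> \<le> H0" for x by (rule H0(2)[OF len])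
      show "mom \<eta> (\<lambda>\<beta>. Dl is f0 (y + rvec \<beta>)) = mom \<eta> (\<lambda>\<beta>. Dl is f0 (y' + rvec \<beta>))" if "mabs \<eta> \<le> l" for y y' \<eta>
        by (simp add: mom_test_function(1)[OF f0 len that])
      show "real m ^ k * \<bar>(x - y) $ i\<bar> \<le> 1" for i using close by blast
    qed
    also have "\<dots> \<le> C5 * (H0 * (C3 * q ^ k))" using C5(1) H0(1) rate by (intro mult_left_mono) auto
    finally show ?thesis by (simp add: C6_def mult_ac)
  qed
  have "\<bar>Dl is \<phi> x - Dl is \<phi> y\<bar> \<le> ((2 * C4 + C6) / q) * norm (x - y) powr \<nu>"
    if len: "length is = l" and n1: "norm (x - y) \<le> 1" for "is" x y
  proof (cases "x = y")
    case False
    define t where "t = norm (x - y)"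
    have t: "0 < t" "t \<le> 1" using False n1 by (auto simp: t_def)
    have i1: "0 < 1 / real m" "1 / real m < 1" using m2 by auto
    obtain n0 where "(1 / real m) ^ n0 < t" using real_arch_pow_inv[OF t(1) i1(2)] by blast
    \<comment> \<open>With \<open>n = Suc k\<close> minimal, the distance lies between
      \<open>1 / m ^ Suc k\<close> and \<open>1 / m ^ k\<close>; the lower end costs the factor
      \<open>1 / q\<close> in the constant.\<close>
    define n where "n = (LEAST n. (1 / real m) ^ n < t)"
    have n: "(1 / real m) ^ n < t" unfolding n_def by (rule LeastI[of "\<lambda>n. (1 / real m) ^ n < t", OF \<open>(1 / real m) ^ n0 < t\<close>])
    have "n \<noteq> 0" using n t by (intro notI) simp
    then obtain k where k: "n = Suc k" by (cases n) auto
    have tk: "t \<le> (1 / real m) ^ k"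
      using not_less_Least[of k "\<lambda>n. (1 / real m) ^ n < t"] k unfolding n_def[symmetric] by simp
    have close: "\<forall>i. real m ^ k * \<bar>(x - y) $ i\<bar> \<le> 1"
    proof
      fix i
      have "real m ^ k * \<bar>(x - y) $ i\<bar> \<le> real m ^ k * (1 / real m) ^ k"
        using component_le_norm_cart[of "x - y" i] tk by (intro mult_left_mono) (auto simp: t_def)
      also have "\<dots> = 1" using m2 by (simp add: power_divide)
      finally show "real m ^ k * \<bar>(x - y) $ i\<bar> \<le> 1" .
    qed
    have "q ^ Suc k = ((1 / real m) ^ n) powr \<nu>"
      unfolding q k using i1(1) by (simp only: powr_realpow[symmetric] powr_gt_zero powr_powr mult.commute)
    also have "\<dots> \<le> t powr \<nu>" using n \<nu> i1(1) by (intro powr_mono2) auto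
    finally have qk: "q ^ k \<le> t powr \<nu> / q" using q01 by (simp add: le_divide_eq mult.commute)
    have "\<bar>Dl is \<phi> x - Dl is \<phi> y\<bar> \<le> (2 * C4 + C6) * q ^ k"
      using approx[OF len, of x k] approx[OF len, of y k] two[OF len close] by (simp add: distrib_right)
    also have "\<dots> \<le> (2 * C4 + C6) * (t powr \<nu> / q)" using qk C4 C6 by (intro mult_left_mono) auto
    finally show ?thesis by (simp add: t_def)
  qed simp
  moreover have "(2 * C4 + C6) / q \<ge> 0" using C4 C6 q01 by simp
  ultimately show ?thesis by blast
qed

text \<open>An exponent above 1 would make the derivatives of order \<open>l\<close> constant, hence zero.\<close>

lemma refinable_hoelder_le_1:
  assumes \<phi>: "refinable \<phi> R" and \<nu>: "\<nu> > 1"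
  shows "\<not> (\<exists>C. \<forall>is x y. length is = l \<longrightarrow> norm (x - y) \<le> 1 \<longrightarrow> \<bar>Dl is \<phi> x - Dl is \<phi> y\<bar> \<le> C * norm (x - y) powr \<nu>)"
proof
  assume "\<exists>C. \<forall>is x y. length is = l \<longrightarrow> norm (x - y) \<le> 1 \<longrightarrow> \<bar>Dl is \<phi> x - Dl is \<phi> y\<bar> \<le> C * norm (x - y) powr \<nu>"
  then obtain C where C: "\<And>is x y. length is = l \<Longrightarrow> norm (x - y) \<le> 1 \<Longrightarrow> \<bar>Dl is \<phi> x - Dl is \<phi> y\<bar> \<le> C * norm (x - y) powr \<nu>"
    by blast
  have R: "R \<ge> 0" "csupp R \<phi>" "Cdiff l \<phi>" using \<phi> by (auto simp: refinable_def intro: order_trans[OF of_nat_0_le_iff])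
  have zero: "Dl is \<phi> x = 0" if len: "length is = l" for "is" x
  proof -
    have "has_partial i (Dl is \<phi>) (\<lambda>x. 0)" for i
      unfolding has_partial_def has_real_derivative_iff_has_vector_derivative[symmetric] DERIV_def
    proof
      fix x
      show "((\<lambda>h. (Dl is \<phi> (x + axis i (0 + h)) - Dl is \<phi> (x + axis i 0)) / h) \<longlongrightarrow> 0) (at 0)"
      proof (rule Lim_null_comparison)
        have "\<forall>\<^sub>F h in at (0::real). h \<in> ball 0 1 \<and> h \<noteq> 0"
          unfolding eventually_at_filter using eventually_nhds_in_open[OF open_ball, of 0 0 1] by (auto elim: eventually_mono)
        then show "\<forall>\<^sub>F h in at 0. norm ((Dl is \<phi> (x + axis i (0 + h)) - Dl is \<phi> (x + axis i 0)) / h) \<le> C * \<bar>h\<bar> powr (\<nu> - 1)"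
        proof eventually_elim
          case (elim h)
          have nh: "norm (axis i h :: real ^ 's) = \<bar>h\<bar>" by (simp add: norm_eq_sqrt_inner inner_axis_axis)
          have "\<bar>Dl is \<phi> (x + axis i h) - Dl is \<phi> x\<bar> \<le> C * \<bar>h\<bar> powr \<nu>"
            using C[OF len, of "x + axis i h" x] elim nh by simp
          then have "\<bar>Dl is \<phi> (x + axis i h) - Dl is \<phi> x\<bar> / \<bar>h\<bar> \<le> C * \<bar>h\<bar> powr \<nu> / \<bar>h\<bar>"
            by (rule divide_right_mono) simp
          also have "\<dots> = C * \<bar>h\<bar> powr (\<nu> - 1)" using elim by (simp add: powr_diff)
          finally show ?case by (simp add: abs_divide)
        qed
        have "((\<lambda>h::real. \<bar>h\<bar> powr (\<nu> - 1)) \<longlongrightarrow> \<bar>0\<bar> powr (\<nu> - 1)) (at 0)"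
          using \<nu> by (intro tendsto_powr' tendsto_intros) auto
        then have "((\<lambda>h::real. C * \<bar>h\<bar> powr (\<nu> - 1)) \<longlongrightarrow> C * 0) (at 0)" by (intro tendsto_mult_left) simp
        then show "((\<lambda>h::real. C * \<bar>h\<bar> powr (\<nu> - 1)) \<longlongrightarrow> 0) (at 0)" by simp
      qed
    qed
    \<comment> \<open>The point with all coordinates \<open>R + 1\<close> lies outside the support,
      so the constant value of the derivative is 0.\<close>
    from const_if_partials_zero[OF this, of x "\<chi> i. R + 1"]
    have "Dl is \<phi> x = Dl is \<phi> (\<chi> i. R + 1)" .
    moreover have "Dl is \<phi> (\<chi> i. R + 1) = 0"
      using csupp_Dl[OF R(2), of "is"] R(1) unfolding csupp_def by force
    ultimately show ?thesis by simp
  qed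
  have "\<bar>Dl [] \<phi> x\<bar> \<le> 0 * (2 * R + 2) ^ l" for x
    by (rule compact_support_Dl_bound[OF R(3,1)]) (use R(2) zero in \<open>auto simp: csupp_def\<close>)
  then show False using refinable_nonzero[OF \<phi>] by auto
qed

text \<open>The strict inequality for the upper limit bounds the defects by
  \<open>m powr (- (l + \<nu>) * k)\<close> from some index on, and \<sigma> carries the factor
  \<open>m ^ (k * l)\<close>. A defect 0, where \<open>elog\<close> is infinite, is immediate; the
  earlier indices go into \<open>D\<close>.\<close>

lemma sigma_decay:
  assumes \<nu>: "ereal (real l + \<nu>) < - limsup (\<lambda>k. elog m (\<delta> k) / ereal (real k))"
    and q: "q = (1 / real m) powr \<nu>"
  shows "\<exists>D\<ge>0. \<forall>k. \<sigma> k \<le> D * q ^ k"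
proof -
  have q0: "q > 0" using m2 by (simp add: q)
  have "limsup (\<lambda>k. elog m (\<delta> k) / ereal (real k)) < - ereal (real l + \<nu>)"
    using \<nu> ereal_less_uminus_reorder by blast
  then have "\<forall>\<^sub>F k in sequentially. elog m (\<delta> k) / ereal (real k) < - ereal (real l + \<nu>)"
    by (rule Limsup_lessD)
  then obtain k0 where k0: "\<And>k. k \<ge> k0 \<Longrightarrow> elog m (\<delta> k) / ereal (real k) < - ereal (real l + \<nu>)"
    by (auto simp: eventually_sequentially)
  have big: "\<sigma> k \<le> q ^ k" if "k \<ge> k0" "k \<ge> 1" for k
  proof (cases "\<delta> k = 0")
    case True then show ?thesis using q0 by (simp add: \<sigma>_def)
  next
    case False
    then have d: "\<delta> k > 0" using delta_nonneg[of k] by linarith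
    have "log (real m) (\<delta> k) / real k < - (real l + \<nu>)"
      using k0[OF that(1)] False that(2) by (simp add: elog_def)
    then have "log (real m) (\<delta> k) < - (real l + \<nu>) * real k" using that(2) by (simp add: divide_less_eq)
    then have "\<delta> k < real m powr (- (real l + \<nu>) * real k)"
      using d m2 by (simp add: log_less_iff)
    then have "\<sigma> k \<le> real m ^ (k * l) * real m powr (- (real l + \<nu>) * real k)"
      unfolding \<sigma>_def by (intro mult_left_mono) auto
    also have "\<dots> = real m powr (real (k * l) + - (real l + \<nu>) * real k)"
      unfolding powr_add using m2 by (simp add: powr_realpow[symmetric])
    also have "\<dots> = real m powr (- \<nu> * real k)" by (simp add: algebra_simps)
    also have "\<dots> = q ^ k"
      unfolding q using m2 by (simp add: powr_realpow[symmetric] powr_powr powr_minus_divide powr_divide)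
    finally show ?thesis .
  qed
  define D where "D = 1 + (\<Sum>k\<le>k0. \<sigma> k / q ^ k)"
  have nn: "\<sigma> k / q ^ k \<ge> 0" for k using q0 by simp
  have D1: "D \<ge> 1" unfolding D_def using nn by (simp add: sum_nonneg)
  have "\<sigma> k \<le> D * q ^ k" for k
  proof (cases "k \<le> k0")
    case True
    have "\<sigma> k / q ^ k \<le> (\<Sum>k\<le>k0. \<sigma> k / q ^ k)" using True nn by (intro member_le_sum) auto
    then have "\<sigma> k / q ^ k \<le> D" by (simp add: D_def)
    then show ?thesis using q0 by (simp add: divide_le_eq)
  next
    case False
    then have "\<sigma> k \<le> 1 * q ^ k" using big[of k] by simp
    also have "\<dots> \<le> D * q ^ k" using D1 q0 by (intro mult_right_mono) auto
    finally show ?thesis .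
  qed
  then show ?thesis using D1 by (intro exI[of _ D]) auto
qed

lemma rho_bound:
  assumes \<nu>: "ereal (real l + \<nu>) < - elog m (rhoA l m N a)" and q: "q = (1 / real m) powr \<nu>"
  shows "real m ^ l * rhoA l m N a < q"
proof (cases "rhoA l m N a = 0")
  case True then show ?thesis using m2 by (simp add: q)
next
  case False
  then have p: "rhoA l m N a > 0" using rhoA_nonneg by linarith
  have "log (real m) (rhoA l m N a) < - (real l + \<nu>)" using \<nu> False by (simp add: elog_def)
  then have "rhoA l m N a < real m powr (- (real l + \<nu>))" using p m2 by (simp add: log_less_iff)
  then have "real m ^ l * rhoA l m N a < real m ^ l * real m powr (- (real l + \<nu>))" using m2 by simp
  also have "\<dots> = real m powr (real l + - (real l + \<nu>))"
    unfolding powr_add using m2 by (simp add: powr_realpow)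
  also have "\<dots> = real m powr (- \<nu>)" by simp
  also have "\<dots> = q" unfolding q using m2 by (simp add: powr_minus_divide powr_divide)
  finally show ?thesis .
qed

definition hoelder_bound :: ereal where
  "hoelder_bound = min (- elog m (rhoA l m N a)) (- limsup (\<lambda>k. elog m (\<delta> k) / ereal (real k)))"

lemma refinable_hoelder':
  assumes \<phi>: "refinable \<phi> R" and \<nu>: "\<nu> > 0" "ereal (real l + \<nu>) < hoelder_bound"
  shows "\<exists>C\<ge>0. \<forall>is x y. length is = l \<longrightarrow> norm (x - y) \<le> 1 \<longrightarrow> \<bar>Dl is \<phi> x - Dl is \<phi> y\<bar> \<le> C * norm (x - y) powr \<nu>"
proof -
  define q where "q = (1 / real m) powr \<nu>"
  have 1: "real m ^ l * rhoA l m N a < q"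
    by (rule rho_bound[OF _ q_def]) (use \<nu>(2) in \<open>simp add: hoelder_bound_def\<close>)
  obtain D where D: "D \<ge> 0" "\<And>k. \<sigma> k \<le> D * q ^ k"
    using sigma_decay[OF _ q_def] \<nu>(2) by (auto simp: hoelder_bound_def)
  show ?thesis by (rule refinable_hoelder[OF \<phi> \<nu>(1) q_def 1 D])
qed

text \<open>Also shows that the asserted bound is finite from above, so that exceeding it can be
  tested with real exponents.\<close>

lemma hoelder_bound_le: "hoelder_bound \<le> ereal (real l + 1)"
proof (rule ccontr)
  assume "\<not> ?thesis"
  then have "ereal (real l + 1) < hoelder_bound" by simp
  then obtain z where z: "ereal (real l + 1) < ereal z" "ereal z < hoelder_bound"
    using ereal_dense2 by blast
  define \<nu> where "\<nu> = z - real l"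
  have \<nu>: "\<nu> > 1" "ereal (real l + \<nu>) < hoelder_bound" using z by (auto simp: \<nu>_def)
  obtain \<phi> R where \<phi>: "refinable \<phi> R" using exists_refinable by blast
  show False using refinable_hoelder_le_1[OF \<phi> \<nu>(1)] refinable_hoelder'[OF \<phi> _ \<nu>(2)] \<nu>(1) by force
qed

text \<open>The estimate for \<open>\<phi>\<close> covers distances up to 1. For larger ones
  boundedness of the derivatives suffices, since the power of the distance is then at least
  1.\<close>

lemma limit_functions_hoelder:
  assumes \<phi>: "refinable \<phi> R" and \<nu>: "\<nu> > 0" "ereal (real l + \<nu>) < hoelder_bound"
    and c: "bounded (range c)"
  shows "\<exists>C. \<forall>x y is. length is = l \<longrightarrow> \<bar>Dl is (lsum c \<phi>) x - Dl is (lsum c \<phi>) y\<bar> \<le> C * norm (x - y) powr \<nu>"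
proof -
  have R: "R \<ge> 0" "csupp R \<phi>" "Cdiff l \<phi>" using \<phi> by (auto simp: refinable_def intro: order_trans[OF of_nat_0_le_iff])
  obtain B where B: "B \<ge> 0" "\<And>\<alpha>. \<bar>c \<alpha>\<bar> \<le> B" using bounded_rangeD[OF c] by blast
  obtain C where C: "C \<ge> 0" "\<And>is x y. length is = l \<Longrightarrow> norm (x - y) \<le> 1 \<Longrightarrow> \<bar>Dl is \<phi> x - Dl is \<phi> y\<bar> \<le> C * norm (x - y) powr \<nu>"
    using refinable_hoelder'[OF \<phi> \<nu>] by blast
  obtain H where H: "H \<ge> 0" "\<And>is x. length is = l \<Longrightarrow> \<bar>Dl is \<phi> x\<bar> \<le> H" using Dl_bounded[OF R(2,3)] by blast
  define K where "K = 2 * (2 * R + 1) ^ CARD('s) * B"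
  have K: "K \<ge> 0" using R(1) B(1) by (simp add: K_def)
  have "\<bar>Dl is (lsum c \<phi>) x - Dl is (lsum c \<phi>) y\<bar> \<le> (K * (C + H)) * norm (x - y) powr \<nu>" if len: "length is = l" for x y "is"
  proof -
    have eq: "Dl is (lsum c \<phi>) = lsum c (Dl is \<phi>)" using Dl_lsum[OF R(2,3)] len by simp
    show ?thesis
    proof (cases "norm (x - y) \<le> 1")
      case True
      have "\<bar>lsum c (Dl is \<phi>) x - lsum c (Dl is \<phi>) y\<bar> \<le> 2 * (2 * R + 1) ^ CARD('s) * (B * (C * norm (x - y) powr \<nu>))"
        by (rule lsum_diff_bound[OF csupp_Dl[OF R(2)] R(1) B(2)]) (use C(2)[OF len] True in metis)
      also have "\<dots> = K * (C * norm (x - y) powr \<nu>)" by (simp add: K_def)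
      also have "\<dots> \<le> K * ((C + H) * norm (x - y) powr \<nu>)"
        using K H(1) by (intro mult_left_mono mult_right_mono) auto
      finally show ?thesis by (simp add: eq)
    next
      case False
      have b: "\<bar>lsum c (Dl is \<phi>) x\<bar> \<le> (2 * R + 1) ^ CARD('s) * (B * H)" for x
        by (rule lsum_bound[OF csupp_Dl[OF R(2)] R(1) B(2)]) (rule H(2)[OF len])
      have "\<bar>lsum c (Dl is \<phi>) x - lsum c (Dl is \<phi>) y\<bar> \<le> K * H"
        using b[of x] b[of y] by (simp add: K_def)
      also have "\<dots> \<le> (K * (C + H)) * 1" using K C(1) by (simp add: distrib_left)
      also have "\<dots> \<le> (K * (C + H)) * norm (x - y) powr \<nu>"
        using K C(1) H(1) False \<nu>(1) by (intro mult_left_mono ge_one_powr_ge_zero) auto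
      finally show ?thesis by (simp add: eq)
    qed
  qed
  then show ?thesis by blast
qed

lemma C_convergent_and_hoelder:
  "C_convergent l m a \<and> holder_exponent (limit_functions l m a) \<ge> hoelder_bound"
proof
  obtain \<phi> R where \<phi>: "refinable \<phi> R" using exists_refinable by blast
  show "C_convergent l m a" unfolding C_convergent_def using limit_function_lsum[OF \<phi>] by blast
  have R: "R \<ge> 0" "csupp R \<phi>" using \<phi> by (auto simp: refinable_def intro: order_trans[OF of_nat_0_le_iff])
  define G where "G = limit_functions l m a"
  have G: "G = {lsum c \<phi> | c. bounded (range c)}" unfolding G_def by (rule limit_functions_eq[OF \<phi>])
  have \<phi>G: "\<phi> \<in> G"
  proof -
    have "bounded (range dirac)" by (rule boundedI[of _ 1]) auto
    moreover have "lsum dirac \<phi> = \<phi>" by (rule ext) (rule lsum_dirac)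
    ultimately show ?thesis unfolding G by (intro CollectI exI[of _ dirac]) simp
  qed
  have Gl: "\<forall>g\<in>G. Cdiff l g" by (auto simp: G_def limit_functions_def is_limit_function_def)
  show "hoelder_bound \<le> holder_exponent (limit_functions l m a)"
  proof (cases "\<forall>n. \<forall>g\<in>G. Cdiff n g")
    case True
    then show ?thesis by (simp add: holder_exponent_def G_def)
  next
    case False
    then obtain n0 where n0: "\<not> (\<forall>g\<in>G. Cdiff n0 g)" by blast
    have le: "n \<le> n0" if "\<forall>g\<in>G. Cdiff n g" for n
      using n0 that Cdiff_mono by (metis nat_le_linear)
    define n where "n = (GREATEST n. \<forall>g\<in>G. Cdiff n g)"
    have nG: "\<forall>g\<in>G. Cdiff n g" unfolding n_def by (rule GreatestI_nat[of "\<lambda>n. \<forall>g\<in>G. Cdiff n g" l n0]) (use Gl le in auto)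
    have nl: "l \<le> n" unfolding n_def by (rule Greatest_le_nat[of "\<lambda>n. \<forall>g\<in>G. Cdiff n g" l n0]) (use Gl le in auto)
    define S where "S = {\<nu>\<in>{0..1}. \<forall>g\<in>G. \<exists>C. \<forall>x y \<mu>. mabs \<mu> = n \<longrightarrow>
       \<bar>mderiv \<mu> g x - mderiv \<mu> g y\<bar> \<le> C * norm (x - y) powr \<nu>}"
    define \<zeta> where "\<zeta> = Sup S"
    have he: "holder_exponent (limit_functions l m a) = ereal (real n + \<zeta>)"
      using False unfolding holder_exponent_def G_def[symmetric] by (simp add: n_def \<zeta>_def S_def Let_def)
    have SI: "\<nu> \<in> S" if SI_prems: "0 \<le> \<nu>" "\<nu> \<le> 1"
      "\<And>c. bounded (range c) \<Longrightarrow> \<exists>C. \<forall>x y is. length is = n \<longrightarrow>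
         \<bar>Dl is (lsum c \<phi>) x - Dl is (lsum c \<phi>) y\<bar> \<le> C * norm (x - y) powr \<nu>" for \<nu>
      unfolding S_def
    proof (intro CollectI conjI ballI)
      fix g assume "g \<in> G"
      then obtain c where c: "g = lsum c \<phi>" "bounded (range c)" by (auto simp: G)
      obtain C where C: "\<And>x y is. length is = n \<Longrightarrow> \<bar>Dl is g x - Dl is g y\<bar> \<le> C * norm (x - y) powr \<nu>"
        using SI_prems(3)[OF c(2)] unfolding c(1) by blast
      have "\<bar>mderiv \<mu> g x - mderiv \<mu> g y\<bar> \<le> C * norm (x - y) powr \<nu>" if "mabs \<mu> = n" for x y \<mu>
        using mderiv_Dl[of \<mu> g] C that by metis
      then show "\<exists>C. \<forall>x y \<mu>. mabs \<mu> = n \<longrightarrow> \<bar>mderiv \<mu> g x - mderiv \<mu> g y\<bar> \<le> C * norm (x - y) powr \<nu>" by blast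
    qed (use SI_prems in auto)
    have bdd: "bdd_above S" unfolding S_def by (rule bdd_aboveI[of _ 1]) auto
    \<comment> \<open>Makes \<open>S\<close> nonempty and \<zeta> nonnegative, as bounded
      derivatives satisfy the condition with exponent 0. The case \<open>x = y\<close> is separate
      because \<open>0 powr 0\<close> is 0.\<close>
    have "0 \<in> S"
    proof (rule SI)
      fix c :: "int ^ 's \<Rightarrow> real" assume c: "bounded (range c)"
      obtain B where B: "B \<ge> 0" "\<And>\<alpha>. \<bar>c \<alpha>\<bar> \<le> B" using bounded_rangeD[OF c] by blast
      have cn: "Cdiff n \<phi>" using nG \<phi>G by blast
      obtain H where H: "H \<ge> 0" "\<And>is x. length is = n \<Longrightarrow> \<bar>Dl is \<phi> x\<bar> \<le> H" using Dl_bounded[OF R(2) cn] by blast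
      have b: "\<bar>Dl is (lsum c \<phi>) x\<bar> \<le> (2 * R + 1) ^ CARD('s) * (B * H)" if len: "length is = n" for "is" x
      proof -
        have "Dl is (lsum c \<phi>) = lsum c (Dl is \<phi>)" using Dl_lsum[OF R(2) cn] len by simp
        moreover have "\<bar>lsum c (Dl is \<phi>) x\<bar> \<le> (2 * R + 1) ^ CARD('s) * (B * H)"
          by (rule lsum_bound[OF csupp_Dl[OF R(2)] R(1) B(2)]) (rule H(2)[OF len])
        ultimately show ?thesis by simp
      qed
      have "\<bar>Dl is (lsum c \<phi>) x - Dl is (lsum c \<phi>) y\<bar> \<le> (2 * ((2 * R + 1) ^ CARD('s) * (B * H))) * norm (x - y) powr 0"
        if "length is = n" for x y "is"
        using b[OF that, of x] b[OF that, of y] by (cases "x = y") auto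
      then show "\<exists>C. \<forall>x y is. length is = n \<longrightarrow> \<bar>Dl is (lsum c \<phi>) x - Dl is (lsum c \<phi>) y\<bar> \<le> C * norm (x - y) powr 0" by blast
    qed auto
    then have \<zeta>0: "\<zeta> \<ge> 0" unfolding \<zeta>_def by (rule cSup_upper[OF _ bdd])
    show ?thesis
    proof (cases "n = l")
      \<comment> \<open>All limit functions are smoother than order \<open>l\<close>. The exponent
        is then at least \<open>l + 1\<close>, which the asserted bound does not exceed.\<close>
      case False
      then have "real l + 1 \<le> real n" using nl by linarith
      then have "ereal (real l + 1) \<le> ereal (real n + \<zeta>)" using \<zeta>0 by simp
      from order_trans[OF hoelder_bound_le this] show ?thesis unfolding he .
    next
      case True
      show ?thesis
      proof (rule ccontr)
        assume "\<not> ?thesis"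
        then have lt: "ereal (real l + \<zeta>) < hoelder_bound" using True he by simp
        then obtain z where z: "ereal (real l + \<zeta>) < ereal z" "ereal z < hoelder_bound"
          using ereal_dense2 by blast
        define \<nu> where "\<nu> = z - real l"
        have \<nu>: "\<zeta> < \<nu>" "ereal (real l + \<nu>) < hoelder_bound" using z by (auto simp: \<nu>_def)
        have "ereal (real l + \<nu>) \<le> ereal (real l + 1)" using \<nu>(2) hoelder_bound_le by (meson less_imp_le order_trans)
        then have \<nu>1: "\<nu> \<le> 1" by simp
        have \<nu>0: "\<nu> > 0" using \<nu>(1) \<zeta>0 by linarith
        have "\<nu> \<in> S" by (rule SI) (use \<nu>0 \<nu>1 limit_functions_hoelder[OF \<phi> \<nu>0 \<nu>(2)] True in auto)
        then have "\<nu> \<le> \<zeta>" unfolding \<zeta>_def by (rule cSup_upper[OF _ bdd])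
        then show False using \<nu>(1) by simp
      qed
    qed
  qed
qed

end

theorem theorem2:
  fixes a :: "nat \<Rightarrow> int ^ 's::finite \<Rightarrow> real" and l m N :: nat
  assumes "m \<ge> 2"
    and "\<And>k. k \<ge> 1 \<Longrightarrow> is_mask N (a k)"
    and "\<And>k. k \<ge> 1 \<Longrightarrow> symbol (a k) 1 = of_nat m ^ CARD('s)"
    and "\<exists>B. \<forall>k\<ge>1. \<forall>\<alpha>. \<bar>a k \<alpha>\<bar> \<le> B"
    and "approx_sum_rules l m a"
    and "rhoA l m N a < 1 / real m ^ l"
  shows "C_convergent l m a \<and>
    holder_exponent (limit_functions l m a)
      \<ge> min (- elog m (rhoA l m N a)) (- limsup (\<lambda>k. elog m (delta l m a k) / ereal (real k)))"
proof -
  obtain B where "\<forall>k\<ge>1. \<forall>\<alpha>. \<bar>a k \<alpha>\<bar> \<le> B" using assms(4) by blast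
  then interpret contractive_scheme a l m N B
    using assms by unfold_locales auto
  show ?thesis using C_convergent_and_hoelder unfolding hoelder_bound_def .
qed

end
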